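(* Let $\mathbb{F}$ be a field and let $\Lambda$ be a finite-dimensional hereditary $\mathbb{F}$-algebra. If $\Lambda$ is basic and of finite representation type, then the preprojective algebra $\Pi$ of $\Lambda$ is Frobenius, i.e. there exists an isomorphism $\Pi\cong\Pi^*$ of left $\Pi$-modules.
   Context: Modules are finitely generated left modules unless stated otherwise. $\Lambda$ is hereditary if every submodule of a projective module is projective; basic if the regular module $\Lambda$ is a direct sum of pairwise non-isomorphic indecomposable projectives; and of finite representation type (representation finite) if it has only finitely many isomorphism classes of indecomposable modules. Write $(-)^*=\operatorname{Hom}_{\mathbb{F}}(-,\mathbb{F})$, which interchanges left and right modules; $\Pi^*$ is the left $\Pi$-module dual to the regular right module $\Pi$. Let $E=\operatorname{Ext}^1_\Lambda(\Lambda^*,\Lambda)$, a $\Lambda$-$\Lambda$-bimodule. The Auslander-Reiten translations $\tau,\tau^-$ of the hereditary algebra $\Lambda$ are regarded as endofunctors of the category of finitely generated left $\Lambda$-modules (with $\tau\Lambda=0$ and $\tau^-\Lambda^*=0$); concretely $\tau^-\cong E\otimes_\Lambda-$ and $\tau\cong\operatorname{Hom}_\Lambda(E,-)$. Write $\tau^{-r}=(\tau^-)^r$ for $r\ge 0$. The preprojective algebra of $\Lambda$ is $\Pi=\bigoplus_{r\ge0}\operatorname{Hom}_\Lambda(\Lambda,\tau^{-r}\Lambda)$, where the product of $f:\Lambda\to\tau^{-r}\Lambda$ and $g:\Lambda\to\tau^{-s}\Lambda$ is $gf=\tau^{-r}(g)\circ f:\Lambda\to\tau^{-r-s}\Lambda$.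 *)

theory Defs
  imports "HOL-Algebra.Module" "HOL-Algebra.IntRing"
begin

section \<open>Left modules over a ring that need not be commutative\<close>

text \<open>
  Left modules are records of type \<^typ>\<open>('a, 'b) module\<close> from HOL-Algebra, whose locale \<open>module\<close> covers
  commutative base rings only.  The fields \<open>mult\<close> and \<open>one\<close> of such a record play no role for a
  module and are \<^const>\<open>undefined\<close> below.
\<close>

locale left_module = R?: ring R + M?: abelian_group M
  for R :: "('a, 'r) ring_scheme" (structure) and M :: "('a, 'b, 'm) module_scheme" (structure) +
  assumes smult_closed:
      "\<lbrakk>a \<in> carrier R; x \<in> carrier M\<rbrakk> \<Longrightarrow> a \<odot>\<^bsub>M\<^esub> x \<in> carrier M"
    and smult_l_distr:
      "\<lbrakk>a \<in> carrier R; b \<in> carrier R; x \<in> carrier M\<rbrakk> \<Longrightarrow>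
        (a \<oplus> b) \<odot>\<^bsub>M\<^esub> x = a \<odot>\<^bsub>M\<^esub> x \<oplus>\<^bsub>M\<^esub> b \<odot>\<^bsub>M\<^esub> x"
    and smult_r_distr:
      "\<lbrakk>a \<in> carrier R; x \<in> carrier M; y \<in> carrier M\<rbrakk> \<Longrightarrow>
        a \<odot>\<^bsub>M\<^esub> (x \<oplus>\<^bsub>M\<^esub> y) = a \<odot>\<^bsub>M\<^esub> x \<oplus>\<^bsub>M\<^esub> a \<odot>\<^bsub>M\<^esub> y"
    and smult_assoc1:
      "\<lbrakk>a \<in> carrier R; b \<in> carrier R; x \<in> carrier M\<rbrakk> \<Longrightarrow>
        (a \<otimes> b) \<odot>\<^bsub>M\<^esub> x = a \<odot>\<^bsub>M\<^esub> (b \<odot>\<^bsub>M\<^esub> x)"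
    and smult_one:
      "x \<in> carrier M \<Longrightarrow> \<one> \<odot>\<^bsub>M\<^esub> x = x"

text \<open>
  Homomorphisms are extensional functions, so that equality in a Hom set is equality on the source
  and Hom sets are genuine abelian groups.
\<close>

definition mod_hom ::
    "('a, 'r) ring_scheme \<Rightarrow> ('a, 'b, 'm) module_scheme \<Rightarrow> ('a, 'c, 'n) module_scheme \<Rightarrow> ('b \<Rightarrow> 'c) set"
  where "mod_hom R M N =
    {h \<in> carrier M \<rightarrow>\<^sub>E carrier N.
      (\<forall>x \<in> carrier M. \<forall>y \<in> carrier M. h (x \<oplus>\<^bsub>M\<^esub> y) = h x \<oplus>\<^bsub>N\<^esub> h y) \<and>
      (\<forall>a \<in> carrier R. \<forall>x \<in> carrier M. h (a \<odot>\<^bsub>M\<^esub> x) = a \<odot>\<^bsub>N\<^esub> h x)}"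

definition mod_iso ::
    "('a, 'r) ring_scheme \<Rightarrow> ('a, 'b, 'm) module_scheme \<Rightarrow> ('a, 'c, 'n) module_scheme \<Rightarrow> ('b \<Rightarrow> 'c) set"
  where "mod_iso R M N = {h \<in> mod_hom R M N. bij_betw h (carrier M) (carrier N)}"

definition isomorphic ::
    "('a, 'r) ring_scheme \<Rightarrow> ('a, 'b, 'm) module_scheme \<Rightarrow> ('a, 'c, 'n) module_scheme \<Rightarrow> bool"
  where "isomorphic R M N \<longleftrightarrow> mod_iso R M N \<noteq> {}"

definition hom_group ::
    "('a, 'r) ring_scheme \<Rightarrow> ('a, 'b, 'm) module_scheme \<Rightarrow> ('a, 'c, 'n) module_scheme \<Rightarrow> ('b \<Rightarrow> 'c) ring"
  where "hom_group R M N =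
    \<lparr>carrier = mod_hom R M N, monoid.mult = undefined, one = undefined,
     zero = (\<lambda>x \<in> carrier M. \<zero>\<^bsub>N\<^esub>),
     add = (\<lambda>f g. \<lambda>x \<in> carrier M. f x \<oplus>\<^bsub>N\<^esub> g x)\<rparr>"

definition regular_module :: "('a, 'r) ring_scheme \<Rightarrow> ('a, 'a) module"
  where "regular_module R =
    \<lparr>carrier = carrier R, monoid.mult = monoid.mult R, one = one R, zero = zero R, add = add R,
     smult = monoid.mult R\<rparr>"

definition gen_submodule :: "('a, 'r) ring_scheme \<Rightarrow> ('a, 'b, 'm) module_scheme \<Rightarrow> 'b set \<Rightarrow> 'b set"
  where "gen_submodule R M S = \<Inter> {N. submodule N R M \<and> S \<subseteq> N}"

definition fin_gen :: "('a, 'r) ring_scheme \<Rightarrow> ('a, 'b, 'm) module_scheme \<Rightarrow> bool"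
  where "fin_gen R M \<longleftrightarrow> (\<exists>S. finite S \<and> S \<subseteq> carrier M \<and> gen_submodule R M S = carrier M)"

definition fg_module :: "('a, 'r) ring_scheme \<Rightarrow> ('a, 'b, 'm) module_scheme \<Rightarrow> bool"
  where "fg_module R M \<longleftrightarrow> left_module R M \<and> fin_gen R M"

text \<open>
  A universe of finitely generated modules: such a module is a quotient of some \<open>R\<^sup>n\<close>, hence is
  isomorphic to one whose elements are cosets of functions \<^typ>\<open>nat \<Rightarrow> 'a\<close>.  So quantifying over
  this type is quantifying over all finitely generated \<open>R\<close>-modules up to isomorphism, for every ring
  \<open>R\<close> with elements in \<^typ>\<open>'a\<close>.
\<close>

type_synonym 'a fgmod = "('a, (nat \<Rightarrow> 'a) set) module"

definition fg_projective :: "('a, 'r) ring_scheme \<Rightarrow> ('a, 'b, 'm) module_scheme \<Rightarrow> bool"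
  where "fg_projective R P \<longleftrightarrow> fg_module R P \<and>
    (\<forall>(M :: 'a fgmod) (N :: 'a fgmod). fg_module R M \<longrightarrow> fg_module R N \<longrightarrow>
      (\<forall>g \<in> mod_hom R M N. g ` carrier M = carrier N \<longrightarrow>
        (\<forall>f \<in> mod_hom R P N. \<exists>h \<in> mod_hom R P M. compose (carrier P) g h = f)))"

definition hereditary :: "('a, 'r) ring_scheme \<Rightarrow> bool"
  where "hereditary R \<longleftrightarrow>
    (\<forall>P :: 'a fgmod. fg_projective R P \<longrightarrow>
      (\<forall>N. submodule N R P \<longrightarrow> fg_projective R (P\<lparr>carrier := N\<rparr>)))"

definition indecomposable :: "('a, 'r) ring_scheme \<Rightarrow> ('a, 'b, 'm) module_scheme \<Rightarrow> bool"
  where "indecomposable R M \<longleftrightarrow> carrier M \<noteq> {\<zero>\<^bsub>M\<^esub>} \<and>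
    (\<forall>U V. submodule U R M \<longrightarrow> submodule V R M \<longrightarrow>
      U <+>\<^bsub>M\<^esub> V = carrier M \<longrightarrow> U \<inter> V = {\<zero>\<^bsub>M\<^esub>} \<longrightarrow> U = {\<zero>\<^bsub>M\<^esub>} \<or> V = {\<zero>\<^bsub>M\<^esub>})"

definition internal_direct_sum ::
    "('a, 'r) ring_scheme \<Rightarrow> ('a, 'b, 'm) module_scheme \<Rightarrow> 'i set \<Rightarrow> ('i \<Rightarrow> 'b set) \<Rightarrow> bool"
  where "internal_direct_sum R M I N \<longleftrightarrow>
    finite I \<and> (\<forall>i \<in> I. submodule (N i) R M) \<and>
    (\<forall>x \<in> carrier M. \<exists>!p. p \<in> (\<Pi>\<^sub>E i \<in> I. N i) \<and> x = (\<Oplus>\<^bsub>M\<^esub>i \<in> I. p i))"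

definition basic_ring :: "('a, 'r) ring_scheme \<Rightarrow> bool"
  where "basic_ring R \<longleftrightarrow>
    (\<exists>(n :: nat) P. internal_direct_sum R (regular_module R) {..<n} P \<and>
      (\<forall>i < n. indecomposable R ((regular_module R)\<lparr>carrier := P i\<rparr>) \<and>
               fg_projective R ((regular_module R)\<lparr>carrier := P i\<rparr>)) \<and>
      (\<forall>i < n. \<forall>j < n. i \<noteq> j \<longrightarrow>
        \<not> isomorphic R ((regular_module R)\<lparr>carrier := P i\<rparr>) ((regular_module R)\<lparr>carrier := P j\<rparr>)))"

definition indecomposables :: "('a, 'r) ring_scheme \<Rightarrow> 'a fgmod set"
  where "indecomposables R = {M. fg_module R M \<and> indecomposable R M}"

definition rep_finite :: "('a, 'r) ring_scheme \<Rightarrow> bool"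
  where "rep_finite R \<longleftrightarrow>
    finite (indecomposables R //
      {(M, N). M \<in> indecomposables R \<and> N \<in> indecomposables R \<and> isomorphic R M N})"


section \<open>Finite-dimensional algebras and duality\<close>

text \<open>
  An \<open>F\<close>-algebra is a record of type \<^typ>\<open>('f, 'a) module\<close>, now with meaningful \<open>mult\<close> and \<open>one\<close>; its
  \<open>smult\<close> is the action of the field.  The zero algebra is allowed.
\<close>

locale fin_dim_algebra = field F + module F A + A?: ring A
  for F :: "('f, 'p) ring_scheme" (structure) and A :: "('f, 'a, 'm) module_scheme" (structure) +
  assumes smult_mult_left:
      "\<lbrakk>c \<in> carrier F; x \<in> carrier A; y \<in> carrier A\<rbrakk> \<Longrightarrow>
        (c \<odot>\<^bsub>A\<^esub> x) \<otimes>\<^bsub>A\<^esub> y = c \<odot>\<^bsub>A\<^esub> (x \<otimes>\<^bsub>A\<^esub> y)"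
    and smult_mult_right:
      "\<lbrakk>c \<in> carrier F; x \<in> carrier A; y \<in> carrier A\<rbrakk> \<Longrightarrow>
        x \<otimes>\<^bsub>A\<^esub> (c \<odot>\<^bsub>A\<^esub> y) = c \<odot>\<^bsub>A\<^esub> (x \<otimes>\<^bsub>A\<^esub> y)"
    and fin_dim: "fin_gen F A"

text \<open>
  \<open>A\<^sup>* = Hom\<^sub>F(A, F)\<close> as the left module dual to the regular right module: \<open>(a\<phi>)(x) = \<phi>(xa)\<close>.
\<close>

definition dual_module :: "('f, 'p) ring_scheme \<Rightarrow> ('f, 'a, 'm) module_scheme \<Rightarrow> ('a, 'a \<Rightarrow> 'f) module"
  where "dual_module F A =
    \<lparr>carrier = mod_hom F A (regular_module F), monoid.mult = undefined, one = undefined,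
     zero = (\<lambda>x \<in> carrier A. \<zero>\<^bsub>F\<^esub>),
     add = (\<lambda>\<phi> \<psi>. \<lambda>x \<in> carrier A. \<phi> x \<oplus>\<^bsub>F\<^esub> \<psi> x),
     smult = (\<lambda>a \<phi>. \<lambda>x \<in> carrier A. \<phi> (x \<otimes>\<^bsub>A\<^esub> a))\<rparr>"

definition dual_rmult :: "('f, 'a, 'm) module_scheme \<Rightarrow> ('a \<Rightarrow> 'f) \<Rightarrow> 'a \<Rightarrow> ('a \<Rightarrow> 'f)"
  where "dual_rmult A \<phi> b = (\<lambda>x \<in> carrier A. \<phi> (b \<otimes>\<^bsub>A\<^esub> x))"

definition frobenius_algebra :: "('f, 'p) ring_scheme \<Rightarrow> ('f, 'a, 'm) module_scheme \<Rightarrow> bool"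
  where "frobenius_algebra F A \<longleftrightarrow> isomorphic A (regular_module A) (dual_module F A)"


section \<open>Free modules and quotients\<close>

definition free_module :: "('a, 'r) ring_scheme \<Rightarrow> 's set \<Rightarrow> ('a, 's \<Rightarrow> 'a) module"
  where "free_module R S =
    \<lparr>carrier = {c. (\<forall>s \<in> S. c s \<in> carrier R) \<and> (\<forall>s. s \<notin> S \<longrightarrow> c s = \<zero>\<^bsub>R\<^esub>) \<and>
                   finite {s \<in> S. c s \<noteq> \<zero>\<^bsub>R\<^esub>}},
     monoid.mult = undefined, one = undefined,
     zero = (\<lambda>s. \<zero>\<^bsub>R\<^esub>),
     add = (\<lambda>c d s. c s \<oplus>\<^bsub>R\<^esub> d s),
     smult = (\<lambda>a c s. a \<otimes>\<^bsub>R\<^esub> c s)\<rparr>"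

definition free_gen :: "('a, 'r) ring_scheme \<Rightarrow> 's \<Rightarrow> ('s \<Rightarrow> 'a)"
  where "free_gen R s = (\<lambda>t. if t = s then \<one>\<^bsub>R\<^esub> else \<zero>\<^bsub>R\<^esub>)"

text \<open>The homomorphism of free modules \<open>R\<^sup>(\<^sup>S\<^sup>) \<rightarrow> R\<^sup>(\<^sup>T\<^sup>)\<close> induced by a map \<open>g : S \<rightarrow> T\<close> of basis sets.\<close>

definition free_map :: "('a, 'r) ring_scheme \<Rightarrow> 's set \<Rightarrow> ('s \<Rightarrow> 't) \<Rightarrow> ('s \<Rightarrow> 'a) \<Rightarrow> ('t \<Rightarrow> 'a)"
  where "free_map R S g c = (\<lambda>t. \<Oplus>\<^bsub>R\<^esub>s \<in> {s \<in> S. g s = t \<and> c s \<noteq> \<zero>\<^bsub>R\<^esub>}. c s)"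

definition quot_group :: "('b, 'r) ring_scheme \<Rightarrow> 'b set \<Rightarrow> 'b set ring"
  where "quot_group G H =
    \<lparr>carrier = a_rcosets\<^bsub>G\<^esub> H, monoid.mult = undefined, one = undefined, zero = H,
     add = set_add G\<rparr>"


section \<open>The functor \<open>Ext\<^sup>1\<close>\<close>

text \<open>
  \<open>Ext\<^sup>1\<^sub>R(X, Y)\<close> is the cokernel of \<open>Hom(P, Y) \<rightarrow> Hom(K, Y)\<close> for the projective presentation
  \<open>0 \<rightarrow> K \<rightarrow> P \<rightarrow> X \<rightarrow> 0\<close> where \<open>P\<close> is the free module on the underlying set of \<open>X\<close>.  This \<open>P\<close> is
  in general not finitely generated, but it is functorial in \<open>X\<close>: a homomorphism \<open>X' \<rightarrow> X\<close> lifts to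
  the induced map of free modules, and no choice of lifts is needed.
\<close>

definition free_cover :: "('a, 'r) ring_scheme \<Rightarrow> ('a, 'x, 'm) module_scheme \<Rightarrow> ('a, 'x \<Rightarrow> 'a) module"
  where "free_cover R X = free_module R (carrier X)"

definition syzygy :: "('a, 'r) ring_scheme \<Rightarrow> ('a, 'x, 'm) module_scheme \<Rightarrow> ('a, 'x \<Rightarrow> 'a) module"
  where "syzygy R X = (free_cover R X)
    \<lparr>carrier := {c \<in> carrier (free_cover R X).
       (\<Oplus>\<^bsub>X\<^esub>x \<in> {x \<in> carrier X. c x \<noteq> \<zero>\<^bsub>R\<^esub>}. c x \<odot>\<^bsub>X\<^esub> x) = \<zero>\<^bsub>X\<^esub>}\<rparr>"

definition ext_null ::
    "('a, 'r) ring_scheme \<Rightarrow> ('a, 'x, 'm) module_scheme \<Rightarrow> ('a, 'y, 'n) module_scheme \<Rightarrow>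
     (('x \<Rightarrow> 'a) \<Rightarrow> 'y) set"
  where "ext_null R X Y = (\<lambda>h. restrict h (carrier (syzygy R X))) ` mod_hom R (free_cover R X) Y"

definition Ext1 ::
    "('a, 'r) ring_scheme \<Rightarrow> ('a, 'x, 'm) module_scheme \<Rightarrow> ('a, 'y, 'n) module_scheme \<Rightarrow>
     (('x \<Rightarrow> 'a) \<Rightarrow> 'y) set ring"
  where "Ext1 R X Y = quot_group (hom_group R (syzygy R X) Y) (ext_null R X Y)"

text \<open>
  The maps \<open>Ext\<^sup>1(X, Y) \<rightarrow> Ext\<^sup>1(X', Y)\<close> for \<open>g : X' \<rightarrow> X\<close> and \<open>Ext\<^sup>1(X, Y) \<rightarrow> Ext\<^sup>1(X, Y')\<close> for
  \<open>k : Y \<rightarrow> Y'\<close>.  Here and below, the union over the representatives of a coset is a union of equal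
  cosets.
\<close>

definition Ext1_pull ::
    "('a, 'r) ring_scheme \<Rightarrow> ('a, 'w, 'm) module_scheme \<Rightarrow> ('a, 'y, 'n) module_scheme \<Rightarrow>
     ('w \<Rightarrow> 'x) \<Rightarrow> (('x \<Rightarrow> 'a) \<Rightarrow> 'y) set \<Rightarrow> (('w \<Rightarrow> 'a) \<Rightarrow> 'y) set"
  where "Ext1_pull R X' Y g e =
    (\<Union>h \<in> e. ext_null R X' Y +>\<^bsub>hom_group R (syzygy R X') Y\<^esub>
       compose (carrier (syzygy R X')) h (free_map R (carrier X') g))"

definition Ext1_push ::
    "('a, 'r) ring_scheme \<Rightarrow> ('a, 'x, 'm) module_scheme \<Rightarrow> ('a, 'z, 'n) module_scheme \<Rightarrow>
     ('y \<Rightarrow> 'z) \<Rightarrow> (('x \<Rightarrow> 'a) \<Rightarrow> 'y) set \<Rightarrow> (('x \<Rightarrow> 'a) \<Rightarrow> 'z) set"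
  where "Ext1_push R X Y' k e =
    (\<Union>h \<in> e. ext_null R X Y' +>\<^bsub>hom_group R (syzygy R X) Y'\<^esub>
       compose (carrier (syzygy R X)) k h)"

record ('a, 'b) bimodule = "('a, 'b) module" +
  rsmult :: "['b, 'a] \<Rightarrow> 'b"

text \<open>
  The bimodule \<open>E = Ext\<^sup>1\<^sub>A(A\<^sup>*, A)\<close>.  Its left action comes, by contravariance, from the right action
  on \<open>A\<^sup>*\<close>; its right action comes from the right action on \<open>A\<close>.
\<close>

definition AR_bimodule ::
    "('f, 'p) ring_scheme \<Rightarrow> ('f, 'a, 'm) module_scheme \<Rightarrow>
     ('a, ((('a \<Rightarrow> 'f) \<Rightarrow> 'a) \<Rightarrow> 'a) set) bimodule"
  where "AR_bimodule F A =
    (let D = dual_module F A; L = regular_module A; E = Ext1 A D L in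
     \<lparr>carrier = carrier E, monoid.mult = undefined, one = undefined, zero = zero E, add = add E,
      smult = (\<lambda>b. Ext1_pull A D L (\<lambda>\<phi> \<in> carrier D. dual_rmult A \<phi> b)),
      rsmult = (\<lambda>e b. Ext1_push A D L (\<lambda>x \<in> carrier A. x \<otimes>\<^bsub>A\<^esub> b) e)\<rparr>)"


section \<open>Tensor products\<close>

definition tensor_rels ::
    "('a, 'r) ring_scheme \<Rightarrow> ('a, 'e, 'l) bimodule_scheme \<Rightarrow> ('a, 'b, 'm) module_scheme \<Rightarrow>
     ('e \<times> 'b \<Rightarrow> int) set"
  where "tensor_rels R E M =
    (let G = free_module \<Z> (carrier E \<times> carrier M); \<delta> = free_gen \<Z> in
     {\<delta> (e \<oplus>\<^bsub>E\<^esub> e', x) \<ominus>\<^bsub>G\<^esub> (\<delta> (e, x) \<oplus>\<^bsub>G\<^esub> \<delta> (e', x)) | e e' x.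
        e \<in> carrier E \<and> e' \<in> carrier E \<and> x \<in> carrier M} \<union>
     {\<delta> (e, x \<oplus>\<^bsub>M\<^esub> x') \<ominus>\<^bsub>G\<^esub> (\<delta> (e, x) \<oplus>\<^bsub>G\<^esub> \<delta> (e, x')) | e x x'.
        e \<in> carrier E \<and> x \<in> carrier M \<and> x' \<in> carrier M} \<union>
     {\<delta> (rsmult E e a, x) \<ominus>\<^bsub>G\<^esub> \<delta> (e, a \<odot>\<^bsub>M\<^esub> x) | e a x.
        e \<in> carrier E \<and> a \<in> carrier R \<and> x \<in> carrier M})"

definition tensor_null ::
    "('a, 'r) ring_scheme \<Rightarrow> ('a, 'e, 'l) bimodule_scheme \<Rightarrow> ('a, 'b, 'm) module_scheme \<Rightarrow>
     ('e \<times> 'b \<Rightarrow> int) set"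
  where "tensor_null R E M =
    gen_submodule \<Z> (free_module \<Z> (carrier E \<times> carrier M)) (tensor_rels R E M)"

text \<open>\<open>E \<otimes>\<^sub>R M\<close> as a left \<open>R\<close>-module, and \<open>id \<otimes> f : E \<otimes>\<^sub>R M \<rightarrow> E \<otimes>\<^sub>R N\<close> for \<open>f : M \<rightarrow> N\<close>.\<close>

definition tensor ::
    "('a, 'r) ring_scheme \<Rightarrow> ('a, 'e, 'l) bimodule_scheme \<Rightarrow> ('a, 'b, 'm) module_scheme \<Rightarrow>
     ('a, ('e \<times> 'b \<Rightarrow> int) set) module"
  where "tensor R E M =
    (let G = free_module \<Z> (carrier E \<times> carrier M);
         Q = quot_group G (tensor_null R E M) in
     \<lparr>carrier = carrier Q, monoid.mult = undefined, one = undefined, zero = zero Q, add = add Q,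
      smult = (\<lambda>a t. \<Union>c \<in> t. tensor_null R E M +>\<^bsub>G\<^esub>
        free_map \<Z> (carrier E \<times> carrier M) (\<lambda>(e, x). (a \<odot>\<^bsub>E\<^esub> e, x)) c)\<rparr>)"

definition tensor_map ::
    "('a, 'r) ring_scheme \<Rightarrow> ('a, 'e, 'l) bimodule_scheme \<Rightarrow> ('a, 'b, 'm) module_scheme \<Rightarrow>
     ('a, 'c, 'n) module_scheme \<Rightarrow> ('b \<Rightarrow> 'c) \<Rightarrow> ('e \<times> 'b \<Rightarrow> int) set \<Rightarrow> ('e \<times> 'c \<Rightarrow> int) set"
  where "tensor_map R E M N f = (\<lambda>t \<in> carrier (tensor R E M).
    \<Union>c \<in> t. tensor_null R E N +>\<^bsub>free_module \<Z> (carrier E \<times> carrier N)\<^esub>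
      free_map \<Z> (carrier E \<times> carrier M) (\<lambda>(e, x). (e, f x)) c)"


section \<open>The functor \<open>\<tau>\<^sup>-\<close>\<close>

text \<open>
  To be iterated, \<open>\<tau>\<^sup>- = E \<otimes>\<^sub>A -\<close> has to be an endofunctor of a category whose objects have one HOL
  type.  Every finitely generated module \<open>M\<close>, of whatever type, is therefore assigned an isomorphic
  copy in the universe \<^typ>\<open>'a fgmod\<close> and an isomorphism onto it, and \<open>\<tau>\<^sup>-\<close> is transported along these
  isomorphisms.  Different choices give naturally isomorphic functors.
\<close>

definition fg_copy :: "('a, 'r) ring_scheme \<Rightarrow> ('a, 'b, 'm) module_scheme \<Rightarrow> 'a fgmod"
  where "fg_copy R M = (SOME N. fg_module R N \<and> isomorphic R M N)"

definition fg_copy_iso ::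
    "('a, 'r) ring_scheme \<Rightarrow> ('a, 'b, 'm) module_scheme \<Rightarrow> 'b \<Rightarrow> (nat \<Rightarrow> 'a) set"
  where "fg_copy_iso R M = (SOME h. h \<in> mod_iso R M (fg_copy R M))"

definition tau_inv :: "('f, 'p) ring_scheme \<Rightarrow> ('f, 'a, 'm) module_scheme \<Rightarrow> 'a fgmod \<Rightarrow> 'a fgmod"
  where "tau_inv F A M = fg_copy A (tensor A (AR_bimodule F A) M)"

definition tau_inv_map ::
    "('f, 'p) ring_scheme \<Rightarrow> ('f, 'a, 'm) module_scheme \<Rightarrow> 'a fgmod \<Rightarrow> 'a fgmod \<Rightarrow>
     ((nat \<Rightarrow> 'a) set \<Rightarrow> (nat \<Rightarrow> 'a) set) \<Rightarrow> ((nat \<Rightarrow> 'a) set \<Rightarrow> (nat \<Rightarrow> 'a) set)"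
  where "tau_inv_map F A M N f =
    (let E = AR_bimodule F A in
     (\<lambda>x \<in> carrier (tau_inv F A M).
       fg_copy_iso A (tensor A E N)
         (tensor_map A E M N f
           (inv_into (carrier (tensor A E M)) (fg_copy_iso A (tensor A E M)) x))))"

primrec tau_inv_pow ::
    "('f, 'p) ring_scheme \<Rightarrow> ('f, 'a, 'm) module_scheme \<Rightarrow> nat \<Rightarrow> 'a fgmod \<Rightarrow> 'a fgmod"
  where
    "tau_inv_pow F A 0 M = M"
  | "tau_inv_pow F A (Suc r) M = tau_inv F A (tau_inv_pow F A r M)"

primrec tau_inv_pow_map ::
    "('f, 'p) ring_scheme \<Rightarrow> ('f, 'a, 'm) module_scheme \<Rightarrow> nat \<Rightarrow> 'a fgmod \<Rightarrow> 'a fgmod \<Rightarrow>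
     ((nat \<Rightarrow> 'a) set \<Rightarrow> (nat \<Rightarrow> 'a) set) \<Rightarrow> ((nat \<Rightarrow> 'a) set \<Rightarrow> (nat \<Rightarrow> 'a) set)"
  where
    "tau_inv_pow_map F A 0 M N f = f"
  | "tau_inv_pow_map F A (Suc r) M N f =
       tau_inv_map F A (tau_inv_pow F A r M) (tau_inv_pow F A r N) (tau_inv_pow_map F A r M N f)"


section \<open>The preprojective algebra\<close>

text \<open>
  An element of \<open>\<Oplus>\<^sub>r Hom\<^sub>A(A, \<tau>\<^sup>-\<^sup>r A)\<close> is the family \<open>p\<close> of its components.  The regular module is
  represented by its copy \<open>L\<close> in the universe.  The product of \<open>f\<close> in degree \<open>r\<close> and \<open>g\<close> in degree \<open>s\<close>,
  written \<open>g f\<close>, is \<open>\<tau>\<^sup>-\<^sup>r(g) \<circ> f\<close>; its target \<open>\<tau>\<^sup>-\<^sup>r(\<tau>\<^sup>-\<^sup>s L)\<close> is equal to \<open>\<tau>\<^sup>-\<^sup>(\<^sup>r\<^sup>+\<^sup>s\<^sup>) L\<close>.  The field acts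
  on an \<open>A\<close>-module through the multiples of the unit of \<open>A\<close>.
\<close>

definition preprojective_algebra ::
    "('f, 'p) ring_scheme \<Rightarrow> ('f, 'a, 'm) module_scheme \<Rightarrow>
     ('f, nat \<Rightarrow> (nat \<Rightarrow> 'a) set \<Rightarrow> (nat \<Rightarrow> 'a) set) module"
  where "preprojective_algebra F A =
    (let L = fg_copy A (regular_module A);
         T = (\<lambda>r. tau_inv_pow F A r L);
         H = (\<lambda>r. hom_group A L (T r)) in
     \<lparr>carrier = {p. (\<forall>r. p r \<in> carrier (H r)) \<and> finite {r. p r \<noteq> zero (H r)}},
      monoid.mult = (\<lambda>g f n. \<lambda>x \<in> carrier L.
        \<Oplus>\<^bsub>T n\<^esub>r \<in> {..n}. tau_inv_pow_map F A r L (T (n - r)) (g (n - r)) (f r x)),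
      one = (\<lambda>r. if r = 0 then (\<lambda>x \<in> carrier L. x) else zero (H r)),
      zero = (\<lambda>r. zero (H r)),
      add = (\<lambda>p q r. add (H r) (p r) (q r)),
      smult = (\<lambda>c p r. \<lambda>x \<in> carrier L. (c \<odot>\<^bsub>A\<^esub> \<one>\<^bsub>A\<^esub>) \<odot>\<^bsub>T r\<^esub> p r x)\<rparr>)"

end

theory Submission
  imports Defs
begin

text \<open>
  Write \<open>D = A\<^sup>*\<close>, \<open>L\<close> for the regular module, \<open>E = Ext\<^sup>1(D, L)\<close> and \<open>T = \<tau>\<^sup>- = E \<otimes> -\<close>.  The proof exhibits
  a linear form \<open>\<Phi>\<close> on the preprojective algebra \<open>\<Pi>\<close> such that \<open>\<Phi>(gf) = 0\<close> for all \<open>f\<close> forces \<open>g = 0\<close>.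
  Since \<open>\<Pi>\<close> is finite-dimensional, the bilinear form \<open>\<Phi>(xy)\<close> is then nondegenerate on both sides, and
  \<open>y \<mapsto> (x \<mapsto> \<Phi>(xy))\<close> is an isomorphism \<open>\<Pi> \<cong> \<Pi>\<^sup>*\<close>; it is \<open>\<Pi>\<close>-linear by associativity.

  The form comes from Auslander-Reiten theory, of which four facts about \<open>T\<close> are enough.  They follow
  from the comparison \<open>E \<otimes> Y \<rightarrow> Ext\<^sup>1(D, Y)\<close>, which is injective (\<open>tensor_to_ext\<close>), and from injective
  copresentations of \<open>L\<close> and \<open>Y\<close>.
  (1) If \<open>e \<otimes> x = 0\<close> for every \<open>e \<in> E\<close>, then \<open>x\<close> is in the image of a map from an injective module
  (\<open>pure_zero_imp_injective_image\<close>); an indecomposable module with such an \<open>x \<noteq> 0\<close> is injective.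
  (2) \<open>T\<close> kills injectives (\<open>T_injective_zero\<close>).
  (3) Every map \<open>T X \<rightarrow> T Y\<close> with \<open>Y\<close> indecomposable is \<open>T f\<close> for some \<open>f\<close> (\<open>T_full\<close>).
  (4) There is no nonzero map \<open>T X \<rightarrow> L\<close> (\<open>T_hom_regular_zero\<close>).
  With Fitting's lemma they show: if \<open>Q\<^sub>i\<close> are the indecomposable summands of \<open>L\<close>, the nonzero modules among
  the \<open>T\<^sup>r Q\<^sub>i\<close> are indecomposable and pairwise non-isomorphic.  Finite representation type therefore
  leaves only finitely many of them, so \<open>T\<^sup>r L = 0\<close> for large \<open>r\<close> and \<open>\<Pi>\<close> is finite-dimensional.

  An element \<open>g\<close> of \<open>\<Pi>\<close> is determined by its values \<open>g\<^sub>r(1) \<in> T\<^sup>r L\<close>, hence by their components in the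
  \<open>T\<^sup>r Q\<^sub>i\<close>.  An indecomposable injective has a simple socle, so it carries a form that does not vanish on any
  nonzero submodule (\<open>socle_functional\<close>); \<open>\<Phi>\<close> sums these forms over the injective \<open>T\<^sup>r Q\<^sub>i\<close>.
  If \<open>g \<noteq> 0\<close> were in the radical, then right multiplication by \<open>\<Pi>\<^sub>1\<close>, which raises degrees, would
  lead to a \<open>g \<noteq> 0\<close> in the radical with \<open>g \<Pi>\<^sub>1 = 0\<close>.  By (1) all components of this \<open>g\<close> lie in
  injective modules.  Right multiplication by \<open>\<Pi>\<^sub>0 = A\<close> reduces to a \<open>g\<close> with as few nonzero components as
  possible; these have equal annihilators, so two of them would embed the same cyclic module into two non-isomorphic
  indecomposable injectives.  Hence there is just one, and \<open>\<Phi>(ga) \<noteq> 0\<close> for some \<open>a \<in> A\<close> (\<open>Rad_zero\<close>).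
\<close>

section \<open>Notation\<close>

text \<open>
  Subscripts name the module or ring in which an operation is taken, \<open>el M\<close> is the underlying set
  of \<open>M\<close>, \<open>x .: M\<close> says that \<open>x\<close> is an element of \<open>M\<close>, and \<open>M .| U\<close> is the submodule of \<open>M\<close> with
  underlying set \<open>U\<close>.
\<close>

abbreviation (input) el :: "('b, 'z) partial_object_scheme => 'b set"
  where "el M \<equiv> carrier M"
abbreviation (input) in_carrier :: "'b => ('b, 'z) partial_object_scheme => bool" (infix ".:" 50)
  where "x .: M \<equiv> x \<in> carrier M"
abbreviation (input) add_in ("(_ \<oplus>\<^sub>_ _)" [65, 1000, 66] 65)
  where "x \<oplus>\<^sub>M y \<equiv> x \<oplus>\<^bsub>M\<^esub> y"
abbreviation (input) diff_in ("(_ \<ominus>\<^sub>_ _)" [65, 1000, 66] 65)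
  where "x \<ominus>\<^sub>M y \<equiv> x \<ominus>\<^bsub>M\<^esub> y"
abbreviation (input) neg_in ("(\<ominus>\<^sub>_ _)" [1000, 81] 80)
  where "\<ominus>\<^sub>M x \<equiv> \<ominus>\<^bsub>M\<^esub> x"
abbreviation (input) mult_in ("(_ \<otimes>\<^sub>_ _)" [70, 1000, 71] 70)
  where "x \<otimes>\<^sub>M y \<equiv> x \<otimes>\<^bsub>M\<^esub> y"
abbreviation (input) smult_in ("(_ \<odot>\<^sub>_ _)" [71, 1000, 70] 70)
  where "a \<odot>\<^sub>M x \<equiv> a \<odot>\<^bsub>M\<^esub> x"
abbreviation (input) zero_in ("\<zero>\<^sub>_" [1000] 1000)
  where "\<zero>\<^sub>M \<equiv> \<zero>\<^bsub>M\<^esub>"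
abbreviation (input) one_in ("\<one>\<^sub>_" [1000] 1000)
  where "\<one>\<^sub>M \<equiv> \<one>\<^bsub>M\<^esub>"

abbreviation (input) submod :: "('a, 'b, 'm) module_scheme => 'b set => ('a, 'b, 'm) module_scheme"  (infixl ".|" 900)
  where "M .| U \<equiv> M\<lparr>carrier := U\<rparr>"

lemmas (in left_module) ag = M.abelian_group_axioms

notation (input) iff (infixr "<->" 25)
notation (input) funcset (infixr "->" 60)

abbreviation (input) lmod :: "('a, 'r) ring_scheme => ('a, 'b, 'm) module_scheme => bool"
  where "lmod R M \<equiv> left_module R M"
type_synonym ('a, 'b, 'm) ms = "('a, 'b, 'm) module_scheme"

section \<open>Linear maps and submodules\<close>

text \<open>Homomorphisms without the extensionality that \<open>mod_hom\<close> demands, so that they are closed under plain composition.\<close>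

definition lin ::
  "('a, 'r) ring_scheme => ('a, 'b, 'm) ms => ('a, 'c, 'n) ms => ('b => 'c) => bool"
 where "lin R M N f <->
  (\<forall>x \<in> el M. f x .: N) &
  (\<forall>x \<in> el M. \<forall>y \<in> el M. f (x \<oplus>\<^sub>M y) = f x \<oplus>\<^sub>N f y) &
  (\<forall>a \<in> el R. \<forall>x \<in> el M. f (a \<odot>\<^sub>M x) = a \<odot>\<^sub>N f x)"

lemma linI:
 assumes "!!x. x .: M ==> f x .: N"
  and "!!x y. x .: M ==> y .: M ==> f (x \<oplus>\<^sub>M y) = f x \<oplus>\<^sub>N f y"
  and "!!a x. a .: R ==> x .: M ==> f (a \<odot>\<^sub>M x) = a \<odot>\<^sub>N f x"
 shows "lin R M N f"
 using assms by (auto simp: lin_def)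

lemma lin_cl: "lin R M N f ==> x .: M ==> f x .: N"
 and lin_add: "lin R M N f ==> x .: M ==> y .: M ==> f (x \<oplus>\<^sub>M y) = f x \<oplus>\<^sub>N f y"
 and lin_smult: "lin R M N f ==> a .: R ==> x .: M ==> f (a \<odot>\<^sub>M x) = a \<odot>\<^sub>N f x"
 by (auto simp: lin_def)

lemma lin_cong:
 assumes "lmod R M" "!!x. x .: M ==> f x = g x"
 shows "lin R M N f <-> lin R M N g"
proof -
 interpret M: left_module R M by fact
 show ?thesis using assms(2) M.smult_closed by (auto simp: lin_def)
qed

lemma lin_comp: "lin R M N f ==> lin R N K g ==> lin R M K (%x. g (f x))"
 by (auto simp: lin_def)

lemma lin_id: "lin R M M (%x. x)"
 by (auto simp: lin_def)

lemma mod_hom_iff: "h \<in> mod_hom R M N <-> lin R M N h & h \<in> extensional (el M)"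
 by (auto simp: mod_hom_def lin_def PiE_def)

lemma mod_hom_lin: "h \<in> mod_hom R M N ==> lin R M N h"
 by (simp add: mod_hom_iff)

lemma restrict_mod_hom:
 assumes "lmod R M" "lin R M N h"
 shows "restrict h (el M) \<in> mod_hom R M N"
 using lin_cong[OF assms(1), of "restrict h (el M)" h N] assms(2) by (simp add: mod_hom_iff)

declare (in left_module) smult_closed [simp, intro] smult_one [simp]

lemma (in left_module) smult_l_null [simp]: "x .: M ==> \<zero> \<odot>\<^sub>M x = \<zero>\<^sub>M"
 using smult_l_distr[of \<zero> \<zero> x] by (metis M.add.l_cancel_one' R.l_zero R.zero_closed smult_closed)

lemma (in left_module) smult_r_null [simp]: "a .: R ==> a \<odot>\<^sub>M \<zero>\<^sub>M = \<zero>\<^sub>M"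
 using smult_r_distr[of a "\<zero>\<^sub>M" "\<zero>\<^sub>M"] by (metis M.add.l_cancel_one' M.l_zero M.zero_closed smult_closed)

lemma (in left_module) smult_l_minus:
 "a .: R ==> x .: M ==> (\<ominus> a) \<odot>\<^sub>M x = \<ominus>\<^sub>M (a \<odot>\<^sub>M x)"
 using smult_l_distr[of "\<ominus> a" a x] R.l_neg[of a] M.minus_equality[of "(\<ominus> a) \<odot>\<^sub>M x" "a \<odot>\<^sub>M x"] by simp

lemma (in left_module) smult_r_minus:
 "a .: R ==> x .: M ==> a \<odot>\<^sub>M (\<ominus>\<^sub>M x) = \<ominus>\<^sub>M (a \<odot>\<^sub>M x)"
 using smult_r_distr[of a "\<ominus>\<^sub>M x" x] M.l_neg[of x] M.minus_equality[of "a \<odot>\<^sub>M (\<ominus>\<^sub>M x)" "a \<odot>\<^sub>M x"] by simp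

lemma (in left_module) smult_finsum:
 assumes "a .: R" "f \<in> I -> el M"
 shows "a \<odot>\<^sub>M (\<Oplus>\<^bsub>M\<^esub>i \<in> I. f i) = (\<Oplus>\<^bsub>M\<^esub>i \<in> I. a \<odot>\<^sub>M f i)"
 using assms(2)
proof (induction I rule: infinite_finite_induct)
 case (insert x I)
 then show ?case using assms(1) by (simp add: Pi_def smult_r_distr)
qed (use assms in simp_all)

lemma lin_zero:
 assumes "abelian_group M" "abelian_group N" "lin R M N f"
 shows "f \<zero>\<^sub>M = \<zero>\<^sub>N"
proof -
 interpret M: abelian_group M by fact
 interpret N: abelian_group N by fact
 show ?thesis
  using lin_add[OF assms(3), of "\<zero>\<^sub>M" "\<zero>\<^sub>M"] lin_cl[OF assms(3), of "\<zero>\<^sub>M"]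
  by (metis M.l_zero M.zero_closed N.add.l_cancel_one')
qed

lemma lin_minus:
 assumes "abelian_group M" "abelian_group N" "lin R M N f" "x .: M"
 shows "f (\<ominus>\<^sub>M x) = \<ominus>\<^sub>N f x"
proof -
 interpret M: abelian_group M by fact
 interpret N: abelian_group N by fact
 show ?thesis
  using lin_add[OF assms(3), of "\<ominus>\<^sub>M x" x] lin_cl[OF assms(3)] assms(4) lin_zero[OF assms(1-3)]
   N.minus_equality[of "f (\<ominus>\<^sub>M x)" "f x"] by (simp add: M.l_neg)
qed

lemma lin_diff:
 assumes "abelian_group M" "abelian_group N" "lin R M N f" "x .: M" "y .: M"
 shows "f (x \<ominus>\<^sub>M y) = f x \<ominus>\<^sub>N f y"
 using lin_minus[OF assms(1-3) assms(5)] lin_add[OF assms(3) assms(4), of "\<ominus>\<^sub>M y"] assms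
 by (simp add: a_minus_def abelian_group.a_inv_closed)

lemma lin_finsum:
 assumes "abelian_group M" "abelian_group N" "lin R M N f" "g \<in> I -> el M"
 shows "f (\<Oplus>\<^bsub>M\<^esub>i \<in> I. g i) = (\<Oplus>\<^bsub>N\<^esub>i \<in> I. f (g i))"
proof -
 interpret M: abelian_group M by fact
 interpret N: abelian_group N by fact
 show ?thesis
  using assms(4)
 proof (induction I rule: infinite_finite_induct)
  case (insert x I)
  then show ?case
   using lin_cl[OF assms(3)] by (simp add: Pi_def lin_add[OF assms(3)])
 qed (use lin_zero[OF assms(1-3)] in simp_all)
qed

lemma (in abelian_group) diff_eq_zero: "x .: G ==> y .: G ==> x \<ominus> y = \<zero> <-> x = y"
 using minus_equality[of x "\<ominus> y"] r_neg[of y] by (auto simp: a_minus_def)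

lemma (in abelian_group) diff_add: "x .: G ==> y .: G ==> (x \<ominus> y) \<oplus> y = x"
 by (simp add: a_minus_def a_assoc l_neg)

lemma lin_inj_iff:
 assumes "abelian_group M" "abelian_group N" "lin R M N f"
 shows "inj_on f (el M) <-> (\<forall>x \<in> el M. f x = \<zero>\<^sub>N --> x = \<zero>\<^sub>M)"
proof -
 interpret M: abelian_group M by fact
 interpret N: abelian_group N by fact
 show ?thesis
 proof
  assume "inj_on f (el M)"
  then show "\<forall>x \<in> el M. f x = \<zero>\<^sub>N --> x = \<zero>\<^sub>M"
   using lin_zero[OF assms] by (metis inj_onD M.zero_closed)
 next
  assume k: "\<forall>x \<in> el M. f x = \<zero>\<^sub>N --> x = \<zero>\<^sub>M"
  show "inj_on f (el M)"
  proof (rule inj_onI)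
   fix x y assume xy: "x .: M" "y .: M" "f x = f y"
   have "f (x \<ominus>\<^sub>M y) = \<zero>\<^sub>N"
    using lin_diff[OF assms xy(1,2)] xy lin_cl[OF assms(3)] N.diff_eq_zero by simp
   then have "x \<ominus>\<^sub>M y = \<zero>\<^sub>M" using k[rule_format, of "x \<ominus>\<^sub>M y"] xy by simp
   then show "x = y" using xy M.diff_eq_zero by simp
  qed
 qed
qed

lemma lin_add_pt:
 assumes "lmod R N" "lin R M N f" "lin R M N g"
 shows "lin R M N (%x. f x \<oplus>\<^sub>N g x)"
proof -
 interpret N: left_module R N by fact
 show ?thesis
  using assms(2,3) by (auto simp: lin_def N.M.a_ac N.smult_r_distr)
qed

lemma lin_minus_pt:
 assumes "lmod R N" "lin R M N f"
 shows "lin R M N (%x. \<ominus>\<^sub>N f x)"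
proof -
 interpret N: left_module R N by fact
 show ?thesis
  using assms(2) by (auto simp: lin_def N.M.minus_add N.smult_r_minus)
qed

lemma lin_diff_pt:
 assumes "lmod R N" "lin R M N f" "lin R M N g"
 shows "lin R M N (%x. f x \<ominus>\<^sub>N g x)"
 unfolding a_minus_def using assms by (intro lin_add_pt lin_minus_pt)

lemma lin_zero_pt:
 assumes "lmod R N"
 shows "lin R M N (%x. \<zero>\<^sub>N)"
proof -
 interpret N: left_module R N by fact
 show ?thesis by (auto simp: lin_def)
qed

lemma lin_finsum_pt:
 assumes "lmod R M" "lmod R N" "!!i. i \<in> I ==> lin R M N (f i)" "finite I"
 shows "lin R M N (%x. \<Oplus>\<^bsub>N\<^esub>i \<in> I. f i x)"
proof -
 interpret M: left_module R M by fact
 interpret N: left_module R N by fact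
 show ?thesis
  using assms(4,3)
 proof (induction I)
  case empty
  then show ?case using lin_zero_pt[OF assms(2)] by simp
 next
  case (insert j I)
  have *: "lin R M N (%x. f j x \<oplus>\<^sub>N (\<Oplus>\<^bsub>N\<^esub>i \<in> I. f i x))"
   using insert by (intro lin_add_pt[OF assms(2)]) auto
  have "(\<Oplus>\<^bsub>N\<^esub>i \<in> insert j I. f i x) = f j x \<oplus>\<^sub>N (\<Oplus>\<^bsub>N\<^esub>i \<in> I. f i x)" if "x .: M" for x
   using insert that by (intro N.M.finsum_insert) (auto simp: lin_def)
  then show ?case using lin_cong[OF assms(1), THEN iffD2, OF _ *] by simp
 qed
qed

lemma lin_inv_into:
 assumes "lmod R M" "lin R M N f" "bij_betw f (el M) (el N)"
 shows "lin R N M (inv_into (el M) f)"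
proof -
 interpret M: left_module R M by fact
 have im: "el N = f ` el M" using assms(3) by (simp add: bij_betw_def)
 have inv: "inv_into (el M) f (f x) = x" if "x .: M" for x
  using assms(3) that by (simp add: bij_betw_def)
 have "inv_into (el M) f (f x \<oplus>\<^sub>N f y) = x \<oplus>\<^sub>M y" if "x .: M" "y .: M" for x y
  using that inv[of "x \<oplus>\<^sub>M y"] lin_add[OF assms(2)] by simp
 moreover have "inv_into (el M) f (a \<odot>\<^sub>N f x) = a \<odot>\<^sub>M x" if "a .: R" "x .: M" for a x
  using that inv[of "a \<odot>\<^sub>M x"] lin_smult[OF assms(2)] by simp
 ultimately show ?thesis
  unfolding lin_def im by (auto simp: inv)
qed

lemma abelian_group_image:
 assumes "abelian_group G" "p ` el G = el Q" "p \<zero>\<^sub>G = \<zero>\<^sub>Q"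
  and add: "!!x y. x .: G ==> y .: G ==> p (x \<oplus>\<^sub>G y) = p x \<oplus>\<^sub>Q p y"
 shows "abelian_group Q"
proof -
 interpret G: abelian_group G by fact
 have ex: "\<exists>x' \<in> el G. x = p x'" if "x .: Q" for x using that assms(2) by auto
 have cl: "p x .: Q" if "x .: G" for x using that assms(2) by auto
 show ?thesis
 proof (rule abelian_groupI)
  show "x \<oplus>\<^sub>Q y .: Q" if "x .: Q" "y .: Q" for x y
   using ex[OF that(1)] ex[OF that(2)] cl add by (metis G.a_closed)
  show "\<zero>\<^sub>Q .: Q" using cl assms(3) by (metis G.zero_closed)
  show "x \<oplus>\<^sub>Q y \<oplus>\<^sub>Q z = x \<oplus>\<^sub>Q (y \<oplus>\<^sub>Q z)"
   if "x .: Q" "y .: Q" "z .: Q" for x y z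
   using ex[OF that(1)] ex[OF that(2)] ex[OF that(3)]
   by (auto simp: add[symmetric] G.a_assoc)
  show "x \<oplus>\<^sub>Q y = y \<oplus>\<^sub>Q x" if "x .: Q" "y .: Q" for x y
   using ex[OF that(1)] ex[OF that(2)] by (auto simp: add[symmetric] G.a_comm)
  show "\<zero>\<^sub>Q \<oplus>\<^sub>Q x = x" if "x .: Q" for x
   using ex[OF that(1)] by (auto simp: add[symmetric] assms(3)[symmetric])
  show "\<exists>y \<in> el Q. y \<oplus>\<^sub>Q x = \<zero>\<^sub>Q" if "x .: Q" for x
  proof -
   obtain x' where x': "x' .: G" "x = p x'" using ex[OF \<open>x .: Q\<close>] by blast
   then have "p (\<ominus>\<^sub>G x') \<oplus>\<^sub>Q x = \<zero>\<^sub>Q"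
    using add[of "\<ominus>\<^sub>G x'" x'] assms(3) by (simp add: G.l_neg)
   then show ?thesis using cl x' by (meson G.a_inv_closed)
  qed
 qed
qed

lemma left_moduleI:
 assumes "ring R" "abelian_group M"
  and "!!a x. [|a .: R; x .: M|] ==> a \<odot>\<^sub>M x .: M"
  and "!!a b x. [|a .: R; b .: R; x .: M|] ==>
    (a \<oplus>\<^sub>R b) \<odot>\<^sub>M x = a \<odot>\<^sub>M x \<oplus>\<^sub>M b \<odot>\<^sub>M x"
  and "!!a x y. [|a .: R; x .: M; y .: M|] ==>
    a \<odot>\<^sub>M (x \<oplus>\<^sub>M y) = a \<odot>\<^sub>M x \<oplus>\<^sub>M a \<odot>\<^sub>M y"
  and "!!a b x. [|a .: R; b .: R; x .: M|] ==>
    (a \<otimes>\<^sub>R b) \<odot>\<^sub>M x = a \<odot>\<^sub>M (b \<odot>\<^sub>M x)"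
  and "!!x. x .: M ==> \<one>\<^sub>R \<odot>\<^sub>M x = x"
 shows "lmod R M"
 using assms by (intro left_module.intro left_module_axioms.intro)

text \<open>An algebraic structure passes to the image under a surjection that respects the operations; this transfers the axioms to quotients.\<close>

lemma lm_image:
 assumes "lmod R M" "p ` el M = el Q" "p \<zero>\<^sub>M = \<zero>\<^sub>Q"
  and add: "!!x y. x .: M ==> y .: M ==> p (x \<oplus>\<^sub>M y) = p x \<oplus>\<^sub>Q p y"
  and smult: "!!a x. a .: R ==> x .: M ==> p (a \<odot>\<^sub>M x) = a \<odot>\<^sub>Q p x"
 shows "lmod R Q"
proof -
 interpret M: left_module R M by fact
 interpret Q: abelian_group Q
  by (rule abelian_group_image[where p = p and G = M]) (use assms M.ag in auto)
 have ex: "\<exists>x' \<in> el M. x = p x'" if "x .: Q" for x using that assms(2) by auto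
 have cl: "p x .: Q" if "x .: M" for x using that assms(2) by auto
 show ?thesis
 proof (rule left_moduleI)
  show "ring R" by (rule M.R.ring_axioms)
  show "abelian_group Q" by (rule Q.abelian_group_axioms)
  show "a \<odot>\<^sub>Q x .: Q" if "a .: R" "x .: Q" for a x
   using ex[OF that(2)] that by (auto simp: smult[symmetric] cl)
  show "(a \<oplus>\<^sub>R b) \<odot>\<^sub>Q x = a \<odot>\<^sub>Q x \<oplus>\<^sub>Q b \<odot>\<^sub>Q x"
   if "a .: R" "b .: R" "x .: Q" for a b x
   using ex[OF that(3)] that by (auto simp: smult[symmetric] add[symmetric] M.smult_l_distr)
  show "a \<odot>\<^sub>Q (x \<oplus>\<^sub>Q y) = a \<odot>\<^sub>Q x \<oplus>\<^sub>Q a \<odot>\<^sub>Q y"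
   if "a .: R" "x .: Q" "y .: Q" for a x y
   using ex[OF that(2)] ex[OF that(3)] that
   by (auto simp: smult[symmetric] add[symmetric] M.smult_r_distr)
  show "(a \<otimes>\<^sub>R b) \<odot>\<^sub>Q x = a \<odot>\<^sub>Q (b \<odot>\<^sub>Q x)"
   if "a .: R" "b .: R" "x .: Q" for a b x
   using ex[OF that(3)] that by (auto simp: smult[symmetric] M.smult_assoc1)
  show "\<one>\<^sub>R \<odot>\<^sub>Q x = x" if "x .: Q" for x
   using ex[OF that] by (auto simp: smult[symmetric])
 qed
qed

lemma (in left_module) submodule_iff:
 "submodule N R M <-> N <= el M & \<zero>\<^sub>M \<in> N & (\<forall>x \<in> N. \<forall>y \<in> N. x \<oplus>\<^sub>M y \<in> N) &
  (\<forall>a \<in> el R. \<forall>x \<in> N. a \<odot>\<^sub>M x \<in> N)" (is "?l <-> ?r")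
proof
 assume ?l
 then interpret N: submodule N R M .
 show ?r using N.subset N.one_closed N.m_closed N.smult_closed by auto
next
 assume r: ?r
 have "\<ominus>\<^sub>M x \<in> N" if "x \<in> N" for x
 proof -
  have "\<ominus>\<^sub>M x = (\<ominus> \<one>) \<odot>\<^sub>M x" using r that by (simp add: smult_l_minus subset_iff)
  then show ?thesis using r that by simp
 qed
 then show ?l using r
  by (intro submodule.intro subgroup.intro submodule_axioms.intro) (auto simp: a_inv_def)
qed

lemma submodule_minus:
 assumes "submodule N R M" "x \<in> N" shows "\<ominus>\<^sub>M x \<in> N"
proof -
 interpret N: submodule N R M by fact
 show ?thesis using N.m_inv_closed[OF assms(2)] by (simp add: a_inv_def)
qed

lemma submod_sub: "submodule N R M ==> N <= el M"
 using subgroup.subset submodule.axioms(1) by fastforce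

lemma submodule_add: "submodule N R M ==> x \<in> N ==> y \<in> N ==> x \<oplus>\<^sub>M y \<in> N"
 using subgroup.m_closed submodule.axioms(1) by fastforce

lemma submodule_diff: "submodule N R M ==> x \<in> N ==> y \<in> N ==> x \<ominus>\<^sub>M y \<in> N"
 by (simp add: a_minus_def submodule_add submodule_minus)

lemma submodule_zero: "submodule N R M ==> \<zero>\<^sub>M \<in> N"
 using subgroup.one_closed submodule.axioms(1) by fastforce

lemma submodule_smult: "submodule N R M ==> a .: R ==> x \<in> N ==> a \<odot>\<^sub>M x \<in> N"
 by (rule submodule.smult_closed)

lemma submodule_left_module:
 assumes "lmod R M" "submodule N R M"
 shows "lmod R (M .| N)"
proof -
 interpret M: left_module R M by fact
 have sub: "!!x. x \<in> N ==> x .: M" using submod_sub[OF assms(2)] by auto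
 show ?thesis
 proof (rule left_moduleI)
  show "ring R" by (rule M.R.ring_axioms)
  show "abelian_group (M .| N)"
  proof (rule abelian_groupI)
   show "\<exists>y \<in> el (M .| N). y \<oplus>\<^bsub>M .| N\<^esub> x = \<zero>\<^bsub>M .| N\<^esub>"
    if "x .: (M .| N)" for x
    using that submodule_minus[OF assms(2), of x] sub[of x] M.M.l_neg[of x] by auto
  qed (use sub assms(2) in "auto simp: submodule_add submodule_zero M.M.a_ac")
 qed (use sub assms(2) in "auto simp: submodule_smult M.smult_l_distr M.smult_r_distr M.smult_assoc1")
qed

lemma lin_incl: "N <= el M ==> lin R (M .| N) M (%x. x)"
 by (auto simp: lin_def)

lemma lin_restrict_dom: "lin R M K f ==> N <= el M ==> lin R (M .| N) K f"
 by (auto simp: lin_def subset_iff)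

lemma lin_corestrict: "lin R K M f ==> f ` el K <= N ==> lin R K (M .| N) f"
 by (auto simp: lin_def)

lemma submodule_carrier: "lmod R M ==> submodule (el M) R M"
proof -
 assume "lmod R M"
 then interpret M: left_module R M .
 show ?thesis by (simp add: M.submodule_iff)
qed

lemma submodule_zero_set: "lmod R M ==> submodule {\<zero>\<^sub>M} R M"
proof -
 assume "lmod R M"
 then interpret M: left_module R M .
 show ?thesis by (simp add: M.submodule_iff)
qed

lemma submodule_kernel:
 assumes "lmod R M" "lmod R N" "lin R M N f"
 shows "submodule {x \<in> el M. f x = \<zero>\<^sub>N} R M"
proof -
 interpret M: left_module R M by fact
 interpret N: left_module R N by fact
 show ?thesis
  using lin_zero[OF M.ag N.ag assms(3)] assms(3)
  by (auto simp: M.submodule_iff lin_add lin_smult)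
qed

lemma submodule_vimage:
 assumes "lmod R M" "lmod R N" "lin R M N f" "submodule U R N"
 shows "submodule {x \<in> el M. f x \<in> U} R M"
proof -
 interpret M: left_module R M by fact
 interpret N: left_module R N by fact
 show ?thesis
  using lin_zero[OF M.ag N.ag assms(3)] assms(3) assms(4)
  by (auto simp: M.submodule_iff lin_add lin_smult submodule_zero submodule_add submodule_smult)
qed

lemma submodule_image:
 assumes "lmod R M" "lmod R N" "lin R M N f" "submodule U R M"
 shows "submodule (f ` U) R N"
proof -
 interpret M: left_module R M by fact
 interpret N: left_module R N by fact
 have sub: "!!x. x \<in> U ==> x .: M" using submod_sub[OF assms(4)] by auto
 have "\<zero>\<^sub>N \<in> f ` U"
  using lin_zero[OF M.ag N.ag assms(3)] submodule_zero[OF assms(4)]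
  by (metis image_eqI)
 moreover have "f x \<oplus>\<^sub>N f y \<in> f ` U" if "x \<in> U" "y \<in> U" for x y
  using that sub submodule_add[OF assms(4)] lin_add[OF assms(3)] by (metis image_eqI)
 moreover have "a \<odot>\<^sub>N f x \<in> f ` U" if "a .: R" "x \<in> U" for a x
  using that sub submodule_smult[OF assms(4)] lin_smult[OF assms(3)] by (metis image_eqI)
 ultimately show ?thesis using lin_cl[OF assms(3)] sub by (auto simp: N.submodule_iff)
qed

lemma submodule_Int:
 assumes "lmod R M" "submodule U R M" "submodule V R M"
 shows "submodule (U \<inter> V) R M"
proof -
 interpret M: left_module R M by fact
 show ?thesis using assms(2,3) by (auto simp: M.submodule_iff)
qed

lemma submodule_submodule:
 assumes "lmod R M" "submodule N R M"
 shows "submodule U R (M .| N) <-> submodule U R M & U <= N"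
proof -
 interpret M: left_module R M by fact
 interpret N: left_module R "M .| N" by (rule submodule_left_module[OF assms])
 show ?thesis
  using submod_sub[OF assms(2)] by (auto simp: N.submodule_iff M.submodule_iff)
qed

lemma finsum_submodule:
 assumes "lmod R M" "submodule N R M" "f \<in> I -> N"
 shows "finsum (M .| N) f I = finsum M f I" "finsum M f I \<in> N"
proof -
 interpret M: left_module R M by fact
 interpret N: left_module R "M .| N" by (rule submodule_left_module[OF assms(1,2)])
 show "finsum (M .| N) f I = finsum M f I"
  using lin_finsum[OF N.ag M.ag
    lin_incl[OF submod_sub[OF assms(2)]], of f I] assms(3) by simp
 then show "finsum M f I \<in> N" using N.M.finsum_closed[of f I] assms(3) by simp
qed

lemma gen_submod:
 assumes "lmod R M" "S <= el M"
 shows "submodule (gen_submodule R M S) R M" "S <= gen_submodule R M S"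
  "!!N. submodule N R M ==> S <= N ==> gen_submodule R M S <= N"
proof -
 interpret M: left_module R M by fact
 show "submodule (gen_submodule R M S) R M"
  using submodule_carrier[OF assms(1)] assms(2)
  unfolding M.submodule_iff gen_submodule_def
  by (intro conjI ballI) (auto simp: M.submodule_iff)
qed (auto simp: gen_submodule_def)

section \<open>Quotients and free modules\<close>

lemma lin_congI:
 assumes "lmod R M" "lin R M N g" "!!x. x .: M ==> f x = g x"
 shows "lin R M N f"
 using lin_cong[OF assms(1), of f g N] assms(2,3) by simp

lemma add_finsum:
 assumes "abelian_group G" "abelian_group H"
  and "!!x. x .: G ==> f x .: H"
  and "!!x y. x .: G ==> y .: G ==> f (x \<oplus>\<^sub>G y) = f x \<oplus>\<^sub>H f y"
  and "g \<in> I -> el G"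
 shows "f (\<Oplus>\<^bsub>G\<^esub>i \<in> I. g i) = (\<Oplus>\<^bsub>H\<^esub>i \<in> I. f (g i))"
proof -
 interpret G: abelian_group G by fact
 interpret H: abelian_group H by fact
 have z: "f \<zero>\<^sub>G = \<zero>\<^sub>H"
  using assms(4)[of "\<zero>\<^sub>G" "\<zero>\<^sub>G"] assms(3)[of "\<zero>\<^sub>G"]
  by (metis G.l_zero G.zero_closed H.add.l_cancel_one')
 show ?thesis
  using assms(5)
 proof (induction I rule: infinite_finite_induct)
  case (insert x I)
  then show ?case using assms(3,4) by (simp add: Pi_def)
 qed (use z in simp_all)
qed

lemma regular_module_simps [simp]:
 "el (regular_module R) = el R" "add (regular_module R) = add R"
 "zero (regular_module R) = zero R" "smult (regular_module R) = monoid.mult R"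
 by (simp_all add: regular_module_def)

lemma lm_regular:
 assumes "ring R" shows "lmod R (regular_module R)"
proof -
 interpret R: ring R by fact
 show ?thesis
 proof (rule left_moduleI)
  show "abelian_group (regular_module R)"
   by (rule abelian_group_image[where G = R and p = "%x. x"])
    (simp_all add: R.abelian_group_axioms)
 qed (simp_all add: R.ring_axioms R.l_distr R.r_distr R.m_assoc)
qed

lemma finsum_regular_module:
 assumes "ring R" "f \<in> I -> el R"
 shows "finsum (regular_module R) f I = finsum R f I"
proof -
 interpret R: ring R by fact
 interpret M: left_module R "regular_module R" by (rule lm_regular[OF assms(1)])
 show ?thesis
  using add_finsum[OF M.ag R.abelian_group_axioms, of "%x. x" f I] assms(2)
  by simp
qed

context
 fixes G :: "('b, 'm) ring_scheme" (structure) and N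
 assumes G: "abelian_group G" and N: "subgroup N (add_monoid G)"
begin

lemma abelian_subgroup_of: "abelian_subgroup N G"
 using G N by (intro abelian_subgroupI3 additive_subgroupI)

lemma quot_group_carrier: "el (quot_group G N) = (%x. N +> x) ` el G"
 by (auto simp: quot_group_def A_RCOSETS_def')

lemma coset_zero: "N +> \<zero> = N"
proof -
 interpret abelian_subgroup N G by (rule abelian_subgroup_of)
 show ?thesis using a_rcos_const[OF additive_subgroup.zero_closed] additive_subgroup_axioms by blast
qed

lemma coset_add:
 "x .: G ==> y .: G ==> add (quot_group G N) (N +> x) (N +> y) = N +> (x \<oplus> y)"
proof -
 interpret abelian_subgroup N G by (rule abelian_subgroup_of)
 show "x .: G ==> y .: G ==> add (quot_group G N) (N +> x) (N +> y) = N +> (x \<oplus> y)"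
  by (simp add: quot_group_def a_rcos_sum)
qed

lemma quot_group_zero: "zero (quot_group G N) = N +> \<zero>"
 by (simp add: coset_zero) (simp add: quot_group_def)

lemma coset_self: "x .: G ==> x \<in> N +> x"
proof -
 interpret abelian_subgroup N G by (rule abelian_subgroup_of)
 show "x .: G ==> x \<in> N +> x" by (rule a_rcos_self)
qed

lemma coset_mem:
 assumes "x .: G" "y \<in> N +> x"
 shows "y .: G" "N +> y = N +> x"
proof -
 interpret abelian_subgroup N G by (rule abelian_subgroup_of)
 show "y .: G" using assms a_elemrcos_carrier by blast
 show "N +> y = N +> x" using assms a_repr_independence' by blast
qed

lemma coset_eq_iff:
 assumes "x .: G" "y .: G"
 shows "N +> x = N +> y <-> x \<ominus> y \<in> N"
proof -
 interpret abelian_subgroup N G by (rule abelian_subgroup_of)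
 show ?thesis
  using assms a_repr_independence'[of x y] coset_self[OF assms(1)] a_rcos_module[of y x]
  by (auto simp: a_minus_def)
qed

lemma coset_eq_zero_iff: "x .: G ==> N +> x = N <-> x \<in> N"
proof -
 interpret G: abelian_group G by (rule G)
 show "x .: G ==> N +> x = N <-> x \<in> N"
  using coset_eq_iff[of x "\<zero>"] G.minus_equality[of "\<zero>" "\<zero>"]
  unfolding coset_zero by (simp add: a_minus_def)
qed

lemma coset_Union:
 assumes "x .: G" "!!y. y \<in> N +> x ==> f y = f x"
 shows "(\<Union>y \<in> N +> x. f y) = f x"
proof -
 have "(\<Union>y \<in> N +> x. f y) = (\<Union>y \<in> N +> x. f x)" by (intro SUP_cong refl assms(2))
 then show ?thesis using coset_self[OF assms(1)] by auto
qed

lemma abelian_group_quot: "abelian_group (quot_group G N)"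
 by (rule abelian_group_image[where G = G and p = "%x. N +> x"])
  (simp_all add: G quot_group_carrier coset_add quot_group_zero)

end

lemma submodule_subgroup: "submodule N R M ==> subgroup N (add_monoid M)"
 by (rule submodule.axioms)

definition quot_mod :: "('a, 'b, 'm) ms => 'b set => ('a, 'b set) module"
 where "quot_mod M N =
  \<lparr>carrier = el (quot_group M N), monoid.mult = undefined, one = undefined,
  zero = zero (quot_group M N), add = add (quot_group M N),
  smult = (%a t. \<Union>x \<in> t. N +>\<^bsub>M\<^esub> (a \<odot>\<^sub>M x))\<rparr>"

lemma quot_mod:
 assumes "lmod R M" "submodule N R M"
 shows lm_quot: "lmod R (quot_mod M N)"
  and lin_quot: "lin R M (quot_mod M N) (%x. N +>\<^bsub>M\<^esub> x)"
  and quot_mod_carrier: "el (quot_mod M N) = (%x. N +>\<^bsub>M\<^esub> x) ` el M"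
  and quot_mod_zero_iff: "!!x. x .: M ==> N +>\<^bsub>M\<^esub> x = \<zero>\<^sub>(quot_mod M N) <-> x \<in> N"
proof -
 interpret M: left_module R M by fact
 note q = M.ag submodule_subgroup[OF assms(2)]
 have sm: "a \<odot>\<^sub>(quot_mod M N) (N +>\<^bsub>M\<^esub> x) = N +>\<^bsub>M\<^esub> (a \<odot>\<^sub>M x)"
  if ax: "a .: R" "x .: M" for a x
 proof -
  have "N +>\<^bsub>M\<^esub> (a \<odot>\<^sub>M y) = N +>\<^bsub>M\<^esub> (a \<odot>\<^sub>M x)" if "y \<in> N +>\<^bsub>M\<^esub> x" for y
  proof -
   have y: "y .: M" "y \<ominus>\<^sub>M x \<in> N"
    using coset_mem[OF q ax(2) that] coset_eq_iff[OF q] ax by auto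
   have "(a \<odot>\<^sub>M y) \<ominus>\<^sub>M (a \<odot>\<^sub>M x) = a \<odot>\<^sub>M (y \<ominus>\<^sub>M x)"
    using ax y by (simp add: a_minus_def M.smult_r_distr M.smult_r_minus)
   then show ?thesis
    using coset_eq_iff[OF q] ax y submodule_smult[OF assms(2) ax(1) y(2)] by simp
  qed
  then show ?thesis
   using coset_Union[OF q ax(2), of "%y. N +>\<^bsub>M\<^esub> (a \<odot>\<^sub>M y)"] by (simp add: quot_mod_def)
 qed
 show c: "el (quot_mod M N) = (%x. N +>\<^bsub>M\<^esub> x) ` el M"
  by (simp add: quot_mod_def quot_group_carrier[OF q])
 show l: "lin R M (quot_mod M N) (%x. N +>\<^bsub>M\<^esub> x)"
  using sm by (intro linI) (simp_all add: c, simp add: quot_mod_def coset_add[OF q])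
 show "lmod R (quot_mod M N)"
  by (rule lm_image[where M = M and p = "%x. N +>\<^bsub>M\<^esub> x", OF assms(1) c[symmetric]])
   (simp_all add: sm, simp_all add: quot_mod_def quot_group_zero[OF q] coset_add[OF q])
 show "!!x. x .: M ==> N +>\<^bsub>M\<^esub> x = \<zero>\<^sub>(quot_mod M N) <-> x \<in> N"
  using coset_eq_zero_iff[OF q] by (simp add: quot_mod_def quot_group_zero[OF q] coset_zero[OF q])
qed

lemma free_simps:
 "c .: (free_module R S) <->
  (\<forall>s \<in> S. c s .: R) & (\<forall>s. s \<notin> S --> c s = \<zero>\<^sub>R) & finite {s \<in> S. c s ~= \<zero>\<^sub>R}"
 "add (free_module R S) c d = (%s. c s \<oplus>\<^sub>R d s)"
 "zero (free_module R S) = (%s. \<zero>\<^sub>R)"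
 "a \<odot>\<^sub>(free_module R S) c = (%s. a \<otimes>\<^sub>R c s)"
 by (simp_all add: free_module_def)

lemma free_coeff:
 assumes "ring R" "c .: (free_module R S)" shows "c s .: R"
proof -
 interpret R: ring R by fact
 show ?thesis using assms(2) by (cases "s \<in> S") (auto simp: free_simps)
qed

lemma lm_free:
 assumes "ring R" shows "lmod R (free_module R S)"
proof -
 interpret R: ring R by fact
 have add: "(%s. c s \<oplus>\<^sub>R d s) .: (free_module R S)"
  if "c .: (free_module R S)" "d .: (free_module R S)" for c d
 proof -
  have "{s \<in> S. c s \<oplus>\<^sub>R d s ~= \<zero>\<^sub>R} <= {s \<in> S. c s ~= \<zero>\<^sub>R} \<union> {s \<in> S. d s ~= \<zero>\<^sub>R}" by auto
  then show ?thesis using that finite_subset by (auto simp: free_simps)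
 qed
 have sm: "(%s. a \<otimes>\<^sub>R c s) .: (free_module R S)"
  if "a .: R" "c .: (free_module R S)" for a c
 proof -
  have "{s \<in> S. a \<otimes>\<^sub>R c s ~= \<zero>\<^sub>R} <= {s \<in> S. c s ~= \<zero>\<^sub>R}" using that(1) by auto
  then show ?thesis using that finite_subset by (auto simp: free_simps)
 qed
 note cl = free_coeff[where S = S, OF assms]
 show ?thesis
 proof (rule left_moduleI)
  show "abelian_group (free_module R S)"
  proof (rule abelian_groupI)
   show "\<exists>y \<in> el (free_module R S). y \<oplus>\<^sub>(free_module R S) x = \<zero>\<^sub>(free_module R S)"
    if x: "x .: (free_module R S)" for x
   proof (rule bexI)
    show "(%s. (\<ominus>\<^sub>R \<one>\<^sub>R) \<otimes>\<^sub>R x s) \<oplus>\<^sub>(free_module R S) x = \<zero>\<^sub>(free_module R S)"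
     using cl[OF x] by (auto simp: free_simps(2-) R.l_minus R.l_neg)
   qed (use sm x in auto)
  qed (use add cl in \<open>auto simp: free_simps(2-) R.a_ac\<close>, auto simp: free_simps(1))
 qed (use add sm cl in "auto simp: assms free_simps(2-) R.l_distr R.r_distr R.m_assoc")
qed

lemma free_gen_cl: "ring R ==> s \<in> S ==> free_gen R s .: (free_module R S)"
proof -
 assume "ring R" "s \<in> S"
 interpret R: ring R by fact
 have "{t \<in> S. free_gen R s t ~= \<zero>\<^sub>R} <= {s}" by (auto simp: free_gen_def)
 then show ?thesis using finite_subset \<open>s \<in> S\<close> by (auto simp: free_gen_def free_simps)
qed

text \<open>The sum runs over the support of \<open>c\<close>, so that \<open>S\<close> may be infinite: the covers that define \<open>Ext\<^sup>1\<close> are free on whole modules.\<close>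

definition lcomb ::
  "('a, 'r) ring_scheme => ('a, 'b, 'm) ms => 's set => ('s => 'a) => ('s => 'b) => 'b"
 where "lcomb R M S c g = (\<Oplus>\<^bsub>M\<^esub>s \<in> {s \<in> S. c s ~= \<zero>\<^sub>R}. c s \<odot>\<^sub>M g s)"

context left_module
begin

lemma lcomb_super:
 assumes "c .: (free_module R S)" "g \<in> S -> el M" "finite T" "T <= S"
  "{s \<in> S. c s ~= \<zero>} <= T"
 shows "lcomb R M S c g = (\<Oplus>\<^bsub>M\<^esub>s \<in> T. c s \<odot>\<^sub>M g s)"
 unfolding lcomb_def
 using assms by (intro M.add.finprod_mono_neutral_cong_left) (auto simp: free_simps Pi_def)

lemma lcomb_closed:
 "c .: (free_module R S) ==> g \<in> S -> el M ==> lcomb R M S c g .: M"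
 unfolding lcomb_def by (rule M.finsum_closed) (auto simp: free_simps)

lemma lin_lcomb:
 assumes "g \<in> S -> el M"
 shows "lin R (free_module R S) M (%c. lcomb R M S c g)"
proof (rule linI)
 fix c d assume cd: "c .: (free_module R S)" "d .: (free_module R S)"
 interpret P: left_module R "free_module R S" by (rule lm_free[OF R.ring_axioms])
 note cl = free_coeff[where S = S, OF R.ring_axioms]
 let ?T = "{s \<in> S. c s ~= \<zero>} \<union> {s \<in> S. d s ~= \<zero>}"
 have T: "finite ?T" "?T <= S" using cd by (auto simp: free_simps)
 have gc: "s \<in> ?T ==> g s .: M" for s using assms by auto
 have "lcomb R M S (c \<oplus>\<^sub>(free_module R S) d) g =
   (\<Oplus>\<^bsub>M\<^esub>s \<in> ?T. (c \<oplus>\<^sub>(free_module R S) d) s \<odot>\<^sub>M g s)"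
  using cd T assms P.M.a_closed[OF cd]
  by (intro lcomb_super) (auto simp: free_simps(2))
 also have "... = (\<Oplus>\<^bsub>M\<^esub>s \<in> ?T. (c s \<odot>\<^sub>M g s) \<oplus>\<^sub>M (d s \<odot>\<^sub>M g s))"
  using cd gc cl by (intro M.finsum_cong') (auto simp: free_simps(2) smult_l_distr)
 also have "... = (\<Oplus>\<^bsub>M\<^esub>s \<in> ?T. c s \<odot>\<^sub>M g s) \<oplus>\<^sub>M (\<Oplus>\<^bsub>M\<^esub>s \<in> ?T. d s \<odot>\<^sub>M g s)"
  using cd gc cl by (intro M.finsum_addf) auto
 also have "... = lcomb R M S c g \<oplus>\<^sub>M lcomb R M S d g"
  using lcomb_super[OF cd(1) assms T] lcomb_super[OF cd(2) assms T] by simp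
 finally show "lcomb R M S (c \<oplus>\<^sub>(free_module R S) d) g = lcomb R M S c g \<oplus>\<^sub>M lcomb R M S d g" .
next
 fix a c assume ac: "a .: R" "c .: (free_module R S)"
 interpret P: left_module R "free_module R S" by (rule lm_free[OF R.ring_axioms])
 note cl = free_coeff[where S = S, OF R.ring_axioms]
 let ?T = "{s \<in> S. c s ~= \<zero>}"
 have T: "finite ?T" "?T <= S" using ac by (auto simp: free_simps)
 have gc: "s \<in> ?T ==> g s .: M" for s using assms by auto
 have "lcomb R M S (a \<odot>\<^sub>(free_module R S) c) g = (\<Oplus>\<^bsub>M\<^esub>s \<in> ?T. (a \<odot>\<^sub>(free_module R S) c) s \<odot>\<^sub>M g s)"
  using ac T assms P.smult_closed[OF ac] by (intro lcomb_super) (auto simp: free_simps(4))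
 also have "... = (\<Oplus>\<^bsub>M\<^esub>s \<in> ?T. a \<odot>\<^sub>M (c s \<odot>\<^sub>M g s))"
  using ac gc cl by (intro M.finsum_cong') (auto simp: free_simps(4) smult_assoc1)
 also have "... = a \<odot>\<^sub>M lcomb R M S c g"
  unfolding lcomb_def using ac gc cl by (subst smult_finsum) auto
 finally show "lcomb R M S (a \<odot>\<^sub>(free_module R S) c) g = a \<odot>\<^sub>M lcomb R M S c g" .
qed (use lcomb_closed assms in blast)

lemma lcomb_free_gen:
 assumes "g \<in> S -> el M" "s \<in> S"
 shows "lcomb R M S (free_gen R s) g = g s"
proof -
 have "lcomb R M S (free_gen R s) g = (\<Oplus>\<^bsub>M\<^esub>t \<in> {s}. free_gen R s t \<odot>\<^sub>M g t)"
  using assms by (intro lcomb_super free_gen_cl R.ring_axioms) (auto simp: free_gen_def)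
 also have "... = g s" using assms by (simp add: free_gen_def Pi_def)
 finally show ?thesis .
qed

lemma lcomb_cong:
 assumes "!!s. s \<in> S ==> g s = g' s" "g' \<in> S -> el M" "c .: (free_module R S)"
 shows "lcomb R M S c g = lcomb R M S c g'"
 unfolding lcomb_def using assms by (intro M.finsum_cong') (auto simp: free_simps)

lemma lcomb_add:
 assumes "g \<in> S -> el M" "g' \<in> S -> el M" "c .: (free_module R S)"
 shows "lcomb R M S c (%s. g s \<oplus>\<^sub>M g' s) = lcomb R M S c g \<oplus>\<^sub>M lcomb R M S c g'"
proof -
 have cl: "s \<in> {s \<in> S. c s ~= \<zero>} ==> c s .: R & g s .: M & g' s .: M" for s
  using assms by (auto simp: free_simps)
 have "lcomb R M S c (%s. g s \<oplus>\<^sub>M g' s) =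
   (\<Oplus>\<^bsub>M\<^esub>s \<in> {s \<in> S. c s ~= \<zero>}. (c s \<odot>\<^sub>M g s) \<oplus>\<^sub>M (c s \<odot>\<^sub>M g' s))"
  unfolding lcomb_def using cl by (intro M.finsum_cong') (auto simp: smult_r_distr)
 also have "... = lcomb R M S c g \<oplus>\<^sub>M lcomb R M S c g'"
  unfolding lcomb_def using cl by (intro M.finsum_addf) auto
 finally show ?thesis .
qed

lemma lin_lcomb_comp:
 assumes "lmod R N" "lin R N M f" "g \<in> S -> el N" "c .: (free_module R S)"
 shows "f (lcomb R N S c g) = lcomb R M S c (%s. f (g s))"
proof -
 interpret N: left_module R N by fact
 have cl: "s \<in> {s \<in> S. c s ~= \<zero>} ==> c s .: R & g s .: N" for s
  using assms by (auto simp: free_simps)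
 show ?thesis unfolding lcomb_def
  using cl lin_cl[OF assms(2)]
  by (subst lin_finsum[OF N.ag ag assms(2)])
   (auto intro!: M.finsum_cong' simp: lin_smult[OF assms(2)])
qed

end

lemma finsum_free_module:
 assumes "ring R" "f \<in> I -> el (free_module R S)"
 shows "finsum (free_module R S) f I t = (\<Oplus>\<^bsub>R\<^esub>i \<in> I. f i t)"
proof -
 interpret R: ring R by fact
 interpret P: left_module R "free_module R S" by (rule lm_free[OF R.ring_axioms])
 show ?thesis
  using assms(2) free_coeff[OF assms(1), where S = S]
  by (intro add_finsum[OF P.ag R.abelian_group_axioms])
   (auto simp: free_simps(2))
qed

lemma free_module_expand:
 assumes "ring R" "c .: (free_module R S)"
 shows "lcomb R (free_module R S) S c (free_gen R) = c"
proof
 interpret R: ring R by fact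
 interpret P: left_module R "free_module R S" by (rule lm_free[OF R.ring_axioms])
 fix t
 let ?T = "{s \<in> S. c s ~= \<zero>\<^sub>R}"
 have cl: "c s .: R" for s by (rule free_coeff[OF assms])
 have fin: "finite ?T" using assms(2) by (simp add: free_simps)
 have "lcomb R (free_module R S) S c (free_gen R) t = (\<Oplus>\<^bsub>R\<^esub>s \<in> ?T. c s \<otimes>\<^sub>R free_gen R s t)"
  unfolding lcomb_def
  using cl P.smult_closed[OF cl free_gen_cl[OF assms(1)]]
  by (subst finsum_free_module[OF assms(1)]) (auto simp: free_simps(4))
 also have "... = (\<Oplus>\<^bsub>R\<^esub>s \<in> ?T. if s = t then c s else \<zero>\<^sub>R)"
  using cl by (intro R.finsum_cong') (auto simp: free_gen_def)
 also have "... = (\<Oplus>\<^bsub>R\<^esub>s \<in> ?T \<inter> {t}. c s)"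
  using cl fin by (intro R.add.finprod_mono_neutral_cong_right) auto
 also have "... = c t"
 proof (cases "t \<in> ?T")
  case True
  then have "?T \<inter> {t} = {t}" by auto
  then show ?thesis using cl by simp
 next
  case False
  then have "?T \<inter> {t} = {}" "c t = \<zero>\<^sub>R" using assms(2) by (auto simp: free_simps)
  then show ?thesis by simp
 qed
 finally show "lcomb R (free_module R S) S c (free_gen R) t = c t" .
qed

lemma lin_free_expand:
 assumes "lmod R M" "lin R (free_module R S) M f" "c .: (free_module R S)"
 shows "f c = lcomb R M S c (%s. f (free_gen R s))"
proof -
 interpret M: left_module R M by fact
 show ?thesis
  using M.lin_lcomb_comp[OF lm_free[OF M.R.ring_axioms] assms(2) _ assms(3), of "free_gen R"]
   free_module_expand[OF M.R.ring_axioms assms(3)] free_gen_cl[OF M.R.ring_axioms, of _ S]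
  by (auto simp: Pi_def)
qed

lemma free_map_lcomb:
 assumes "ring R" "c .: (free_module R S)" "k \<in> S -> T"
 shows "free_map R S k c = lcomb R (free_module R T) S c (%s. free_gen R (k s))"
proof
 interpret R: ring R by fact
 interpret P: left_module R "free_module R T" by (rule lm_free[OF R.ring_axioms])
 fix t
 let ?T = "{s \<in> S. c s ~= \<zero>\<^sub>R}"
 have cl: "c s .: R" for s by (rule free_coeff[OF assms(1,2)])
 have fin: "finite ?T" using assms(2) by (simp add: free_simps)
 have "lcomb R (free_module R T) S c (%s. free_gen R (k s)) t =
   (\<Oplus>\<^bsub>R\<^esub>s \<in> ?T. c s \<otimes>\<^sub>R free_gen R (k s) t)"
  unfolding lcomb_def
  using cl P.smult_closed[OF cl free_gen_cl[OF assms(1) funcset_mem[OF assms(3)]]]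
  by (subst finsum_free_module[OF assms(1)]) (auto simp: free_simps(4))
 also have "... = (\<Oplus>\<^bsub>R\<^esub>s \<in> {s \<in> S. k s = t & c s ~= \<zero>\<^sub>R}. c s)"
  using cl fin by (intro R.add.finprod_mono_neutral_cong_right) (auto simp: free_gen_def)
 finally show "free_map R S k c t = lcomb R (free_module R T) S c (%s. free_gen R (k s)) t"
  by (simp add: free_map_def)
qed

lemma lin_free_map:
 assumes "ring R" "k \<in> S -> T"
 shows "lin R (free_module R S) (free_module R T) (free_map R S k)"
proof -
 interpret R: ring R by fact
 interpret P: left_module R "free_module R T" by (rule lm_free[OF R.ring_axioms])
 have "lin R (free_module R S) (free_module R T)
   (%c. lcomb R (free_module R T) S c (%s. free_gen R (k s)))"
  using free_gen_cl[OF assms(1) funcset_mem[OF assms(2)]] by (intro P.lin_lcomb) auto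
 then show ?thesis
  by (rule lin_congI[OF lm_free[OF assms(1)]]) (rule free_map_lcomb[OF assms(1) _ assms(2)])
qed

lemma free_map_free_gen:
 assumes "ring R" "k \<in> S -> T" "s \<in> S"
 shows "free_map R S k (free_gen R s) = free_gen R (k s)"
proof -
 interpret R: ring R by fact
 interpret P: left_module R "free_module R T" by (rule lm_free[OF R.ring_axioms])
 show ?thesis
  using free_map_lcomb[OF assms(1) free_gen_cl[OF assms(1,3)] assms(2)]
   P.lcomb_free_gen[of "%s. free_gen R (k s)" S s]
   free_gen_cl[OF assms(1) funcset_mem[OF assms(2)]] assms by auto
qed

lemma (in left_module) lcomb_free_map:
 assumes "c .: (free_module R S)" "k \<in> S -> T" "g \<in> T -> el M"
 shows "lcomb R M T (free_map R S k c) g = lcomb R M S c (%s. g (k s))"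
proof -
 have "lin R (free_module R S) M (%c. lcomb R M T (free_map R S k c) g)"
  using lin_comp[OF lin_free_map[OF R.ring_axioms assms(2)] lin_lcomb[OF assms(3)]] .
 from lin_free_expand[OF left_module_axioms this assms(1)]
 have "lcomb R M T (free_map R S k c) g = lcomb R M S c (%s. lcomb R M T (free_map R S k (free_gen R s)) g)" .
 also have "... = lcomb R M S c (%s. g (k s))"
  using assms by (intro lcomb_cong)
   (auto simp: free_map_free_gen[OF R.ring_axioms assms(2)] Pi_def lcomb_free_gen)
 finally show ?thesis .
qed

section \<open>Finitely generated modules and hereditary rings\<close>

lemma isomorphicI:
 assumes "lmod R M" "lin R M N f" "bij_betw f (el M) (el N)"
 shows "isomorphic R M N"
proof -
 have "bij_betw (restrict f (el M)) (el M) (el N)"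
  using assms(3) bij_betw_cong[of "el M" "restrict f (el M)" f] by simp
 then show ?thesis
  using restrict_mod_hom[OF assms(1,2)] by (auto simp: isomorphic_def mod_iso_def)
qed

lemma isomorphicE:
 assumes "isomorphic R M N"
 obtains f where "lin R M N f" "bij_betw f (el M) (el N)"
 using assms by (auto simp: isomorphic_def mod_iso_def mod_hom_iff)

lemma isomorphic_sym: "lmod R M ==> lmod R N ==> isomorphic R M N ==> isomorphic R N M"
 by (meson bij_betw_inv_into isomorphicE isomorphicI lin_inv_into)

lemma isomorphic_trans:
 assumes "lmod R M" "isomorphic R M N" "isomorphic R N K"
 shows "isomorphic R M K"
proof -
 obtain f where f: "lin R M N f" "bij_betw f (el M) (el N)" using assms(2) by (rule isomorphicE)
 obtain g where g: "lin R N K g" "bij_betw g (el N) (el K)" using assms(3) by (rule isomorphicE)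
 show ?thesis
  using isomorphicI[OF assms(1) lin_comp[OF f(1) g(1)]] bij_betw_trans[OF f(2) g(2)] by (simp add: comp_def)
qed

lemma isomorphic_refl: "lmod R M ==> isomorphic R M M"
 by (rule isomorphicI[OF _ lin_id]) (auto simp: bij_betw_def inj_on_def)

lemma fin_gen_image:
 assumes "lmod R M" "lmod R N" "lin R M N f" "f ` el M = el N" "fin_gen R M"
 shows "fin_gen R N"
proof -
 interpret M: left_module R M by fact
 interpret N: left_module R N by fact
 obtain S where S: "finite S" "S <= el M" "gen_submodule R M S = el M"
  using assms(5) by (auto simp: fin_gen_def)
 have fS: "f ` S <= el N" using S(2) assms(4) by auto
 note g = gen_submod[OF assms(2) fS]
 have "gen_submodule R M S <= {x \<in> el M. f x \<in> gen_submodule R N (f ` S)}"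
  using g(2) S(2)
  by (intro gen_submod(3)[OF assms(1) S(2)] submodule_vimage[OF assms(1-3)] g(1)) auto
 then have "f ` el M <= gen_submodule R N (f ` S)" using S(3) by auto
 then have "el N <= gen_submodule R N (f ` S)" using assms(4) by simp
 then have "gen_submodule R N (f ` S) = el N" using submod_sub[OF g(1)] by blast
 then show ?thesis using S(1) fS unfolding fin_gen_def by blast
qed

lemma fin_gen_free:
 assumes "ring R"
 shows "fin_gen R (free_module R {..<d::nat})"
proof -
 let ?P = "free_module R {..<d}" let ?S = "free_gen R ` {..<d}"
 note P = lm_free[OF assms, of "{..<d}"]
 interpret P: left_module R ?P by (rule P)
 have S: "?S <= el ?P" using free_gen_cl[OF assms, where S = "{..<d}"] by auto
 note g = gen_submod[OF P S]
 have "c \<in> gen_submodule R ?P ?S" if c: "c .: ?P" for c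
 proof -
  have "lcomb R ?P {..<d} c (free_gen R) \<in> gen_submodule R ?P ?S"
   unfolding lcomb_def using g(2) free_coeff[OF assms c]
   by (intro finsum_submodule(2)[OF P g(1)]) (auto intro!: submodule_smult[OF g(1)])
  then show ?thesis by (simp add: free_module_expand[OF assms c])
 qed
 then have "gen_submodule R ?P ?S = el ?P" using submod_sub[OF g(1)] by blast
 then show ?thesis using S unfolding fin_gen_def by blast
qed

lemma fin_gen_lcomb:
 assumes "lmod R M" "fin_gen R M"
 obtains d g where "g \<in> {..<d::nat} -> el M"
  "(%c. lcomb R M {..<d} c g) ` el (free_module R {..<d}) = el M"
proof -
 interpret M: left_module R M by fact
 obtain S where S: "finite S" "S <= el M" "gen_submodule R M S = el M"
  using assms(2) by (auto simp: fin_gen_def)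
 obtain d :: nat and g where dg: "S = g ` {i. i < d}"
  using finite_imp_nat_seg_image_inj_on[OF S(1)] by blast
 have g: "g \<in> {..<d} -> el M" using dg S(2) by auto
 note l = M.lin_lcomb[OF g] and P = lm_free[OF M.R.ring_axioms, of "{..<d}"]
 have sub: "submodule ((%c. lcomb R M {..<d} c g) ` el (free_module R {..<d})) R M"
  by (rule submodule_image[OF P assms(1) l submodule_carrier[OF P]])
 have "S <= (%c. lcomb R M {..<d} c g) ` el (free_module R {..<d})"
 proof
  fix x assume "x \<in> S"
  then obtain i where i: "x = g i" "i \<in> {..<d}" using dg by auto
  show "x \<in> (%c. lcomb R M {..<d} c g) ` el (free_module R {..<d})"
   using M.lcomb_free_gen[OF g i(2)] free_gen_cl[OF M.R.ring_axioms i(2)] i(1) by (metis image_eqI)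
 qed
 then have "(%c. lcomb R M {..<d} c g) ` el (free_module R {..<d}) = el M"
  using gen_submod(3)[OF assms(1) S(2) sub] S(3) submod_sub[OF sub] by auto
 then show ?thesis using that g by blast
qed

lemma fgD: "fg_module R M ==> lmod R M" "fg_module R M ==> fin_gen R M"
 by (simp_all add: fg_module_def)

lemma fg_module_image:
 "fg_module R M ==> lmod R N ==> lin R M N f ==> f ` el M = el N ==> fg_module R N"
 by (auto simp: fg_module_def intro: fin_gen_image)

lemma fg_module_free: "ring R ==> fg_module R (free_module R {..<d::nat})"
 by (simp add: fg_module_def lm_free fin_gen_free)

lemma fg_module_quot: "fg_module R M ==> submodule N R M ==> fg_module R (quot_mod M N)"
proof -
 assume M: "fg_module R M" and N: "submodule N R M"
 note q = fgD(1)[OF M] N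
 show ?thesis
  by (rule fg_module_image[OF M lm_quot[OF q] lin_quot[OF q]]) (simp add: quot_mod_carrier[OF q])
qed

text \<open>\<open>M\<close> is the image of some \<open>R\<^sup>d\<close>, hence isomorphic to a set of cosets of functions on \<open>nat\<close>.\<close>

lemma ex_fgmod:
 fixes R :: "('a, 'r) ring_scheme" and M :: "('a, 'b, 'm) ms"
 assumes "fg_module R M"
 shows "\<exists>N :: 'a fgmod. fg_module R N & isomorphic R M N"
proof -
 note M = fgD[OF assms]
 interpret M: left_module R M by (rule M)
 obtain d g where g: "g \<in> {..<d::nat} -> el M"
  and im: "(%c. lcomb R M {..<d} c g) ` el (free_module R {..<d}) = el M"
  by (rule fin_gen_lcomb[OF M])
 let ?P = "free_module R {..<d}" let ?f = "%c. lcomb R M {..<d} c g"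
 note l = M.lin_lcomb[OF g] and P = lm_free[OF M.R.ring_axioms, of "{..<d}"]
 interpret P: left_module R ?P by (rule P)
 define K where "K = {c \<in> el ?P. ?f c = \<zero>\<^sub>M}"
 have K: "submodule K R ?P" unfolding K_def by (rule submodule_kernel[OF P M(1) l])
 let ?N = "quot_mod ?P K"
 note N = lm_quot[OF P K] lin_quot[OF P K] quot_mod_carrier[OF P K]
 have eq: "K +>\<^bsub>?P\<^esub> c = K +>\<^bsub>?P\<^esub> c' <-> ?f c = ?f c'" if "c .: ?P" "c' .: ?P" for c c'
 proof -
  have "K +>\<^bsub>?P\<^esub> c = K +>\<^bsub>?P\<^esub> c' <-> ?f (c \<ominus>\<^sub>?P c') = \<zero>\<^sub>M"
   using coset_eq_iff[OF P.ag submodule_subgroup[OF K] that] that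
   by (simp add: K_def)
  also have "... <-> ?f c = ?f c'"
   using lin_diff[OF P.ag M.ag l that]
    M.diff_eq_zero lin_cl[OF l] that by simp
  finally show ?thesis .
 qed
 define r where "r x = (SOME c. c .: ?P & ?f c = x)" for x
 have r: "r x .: ?P" "?f (r x) = x" if "x .: M" for x
 proof -
  have "x \<in> ?f ` el ?P" using im that by simp
  then have "\<exists>c. c .: ?P & ?f c = x" by auto
  from someI_ex[OF this] show "r x .: ?P" "?f (r x) = x" unfolding r_def by auto
 qed
 define h where "h x = K +>\<^bsub>?P\<^esub> r x" for x
 have hf: "h (?f c) = K +>\<^bsub>?P\<^esub> c" if "c .: ?P" for c
  unfolding h_def using r[OF lin_cl[OF l that]] that by (simp add: eq)
 have "lin R M ?N h"
 proof (rule linI)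
  fix x assume "x .: M" then show "h x .: ?N" unfolding h_def N(3) using r by auto
 next
  fix x y assume "x .: M" "y .: M"
  then show "h (x \<oplus>\<^sub>M y) = h x \<oplus>\<^sub>?N h y"
   using hf[of "r x \<oplus>\<^sub>?P r y"] r lin_add[OF l, of "r x" "r y"] lin_add[OF N(2), of "r x" "r y"]
   by (simp add: h_def)
 next
  fix a x assume "a .: R" "x .: M"
  then show "h (a \<odot>\<^sub>M x) = a \<odot>\<^sub>?N h x"
   using hf[of "a \<odot>\<^sub>?P r x"] r lin_smult[OF l, of a "r x"] lin_smult[OF N(2), of a "r x"]
   by (simp add: h_def)
 qed
 moreover have "bij_betw h (el M) (el ?N)"
 proof -
  have "inj_on h (el M)" by (rule inj_onI) (metis h_def eq r)
  moreover have "h ` el M = el ?N"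
   unfolding N(3) im[symmetric] image_image using hf by simp
  ultimately show ?thesis by (simp add: bij_betw_def)
 qed
 ultimately have "isomorphic R M ?N" by (rule isomorphicI[OF M(1)])
 moreover have "fg_module R ?N" by (rule fg_module_quot[OF fg_module_free[OF M.R.ring_axioms] K])
 ultimately show ?thesis by blast
qed

lemma fg_copy:
 assumes "fg_module R M"
 shows "fg_module R (fg_copy R M)" "isomorphic R M (fg_copy R M)"
  "lin R M (fg_copy R M) (fg_copy_iso R M)"
  "bij_betw (fg_copy_iso R M) (el M) (el (fg_copy R M))"
proof -
 have *: "fg_module R (fg_copy R M) & isomorphic R M (fg_copy R M)"
  unfolding fg_copy_def by (rule someI_ex[OF ex_fgmod[OF assms]])
 then show "fg_module R (fg_copy R M)" "isomorphic R M (fg_copy R M)" by auto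
 have "fg_copy_iso R M \<in> mod_iso R M (fg_copy R M)"
  unfolding fg_copy_iso_def some_in_eq using * by (auto simp: isomorphic_def)
 then show "lin R M (fg_copy R M) (fg_copy_iso R M)"
  "bij_betw (fg_copy_iso R M) (el M) (el (fg_copy R M))"
  by (auto simp: mod_iso_def mod_hom_lin)
qed

lemma fg_projective_free_copy:
 fixes P :: "'a fgmod" and R :: "('a, 'r) ring_scheme"
 assumes "fg_module R P" "lin R (free_module R {..<d::nat}) P t"
  "bij_betw t (el (free_module R {..<d})) (el P)"
 shows "fg_projective R P"
 unfolding fg_projective_def
proof (intro conjI allI impI ballI)
 show "fg_module R P" by fact
 interpret P: left_module R P using assms(1) by (rule fgD)
 fix M N :: "'a fgmod" and g f
 assume MN: "fg_module R M" "fg_module R N" and g: "g \<in> mod_hom R M N" "g ` el M = el N"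
  and f: "f \<in> mod_hom R P N"
 interpret M: left_module R M using MN(1) by (rule fgD)
 interpret N: left_module R N using MN(2) by (rule fgD)
 let ?F = "free_module R {..<d}"
 note F = lm_free[OF P.R.ring_axioms, of "{..<d}"]
 have gc: "free_gen R i .: ?F" if "i < d" for i using that by (auto intro: free_gen_cl[OF P.R.ring_axioms])
 define m where "m i = (SOME x. x .: M & g x = f (t (free_gen R i)))" for i
 have m: "m i .: M" "g (m i) = f (t (free_gen R i))" if "i < d" for i
 proof -
  have "f (t (free_gen R i)) \<in> g ` el M"
   using g(2) lin_cl[OF mod_hom_lin[OF f]] lin_cl[OF assms(2) gc[OF that]] by auto
  then have "\<exists>x. x .: M & g x = f (t (free_gen R i))" by auto
  then show "m i .: M" "g (m i) = f (t (free_gen R i))"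
   using someI_ex[of "%x. x .: M & g x = f (t (free_gen R i))"] unfolding m_def by blast+
 qed
 define h where "h = restrict (%x. lcomb R M {..<d} (inv_into (el ?F) t x) m) (el P)"
 have mc: "m \<in> {..<d} -> el M" using m by auto
 have h: "h \<in> mod_hom R P M"
  unfolding h_def
  by (rule restrict_mod_hom[OF P.left_module_axioms
    lin_comp[OF lin_inv_into[OF F assms(2,3)] M.lin_lcomb[OF mc]]])
 have "g (h x) = f x" if "x .: P" for x
 proof -
  let ?c = "inv_into (el ?F) t x"
  have c: "?c .: ?F" "t ?c = x"
   using assms(3) that by (auto simp: bij_betw_def inv_into_into f_inv_into_f)
  have "g (h x) = lcomb R N {..<d} ?c (%i. g (m i))"
   using that N.lin_lcomb_comp[OF M.left_module_axioms mod_hom_lin[OF g(1)] mc c(1)] by (simp add: h_def)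
  also have "... = lcomb R N {..<d} ?c (%i. f (t (free_gen R i)))"
   using m gc lin_cl[OF mod_hom_lin[OF f]] lin_cl[OF assms(2)]
   by (intro N.lcomb_cong c) auto
  also have "... = f x"
   using lin_free_expand[OF N.left_module_axioms lin_comp[OF assms(2) mod_hom_lin[OF f]] c(1)] c(2) by simp
  finally show ?thesis .
 qed
 then have "compose (el P) g h = f"
  using f by (auto simp: mod_hom_iff compose_def fun_eq_iff extensional_def)
 then show "\<exists>h \<in> mod_hom R P M. compose (el P) g h = f" using h by blast
qed

lemma bij_inv: 
 assumes "bij_betw f A B"
 shows "x \<in> A ==> inv_into A f (f x) = x" "y \<in> B ==> f (inv_into A f y) = y" "y \<in> B ==> inv_into A f y \<in> A"
 using assms by (auto simp: bij_betw_def f_inv_into_f inv_into_into)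

lemma fg_projective_lift:
 fixes R :: "('a, 'r) ring_scheme"
 assumes "fg_projective R P" "fg_module R M" "fg_module R N" "lin R M N g" "g ` el M = el N"
  "lin R P N f"
 shows "\<exists>h. lin R P M h & (\<forall>x \<in> el P. g (h x) = f x)"
proof -
 have P: "lmod R P" using assms(1) by (simp add: fg_projective_def fg_module_def)
 note M = fg_copy[OF assms(2)] and N = fg_copy[OF assms(3)]
 let ?M = "fg_copy R M" let ?N = "fg_copy R N" let ?a = "fg_copy_iso R M" let ?b = "fg_copy_iso R N"
 let ?a' = "inv_into (el M) ?a"
 have a': "lin R ?M M ?a'" by (rule lin_inv_into[OF fgD(1)[OF assms(2)] M(3,4)])
 let ?g = "restrict (%x. ?b (g (?a' x))) (el ?M)"
 let ?f = "restrict (%x. ?b (f x)) (el P)"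
 have g: "?g \<in> mod_hom R ?M ?N"
  by (intro restrict_mod_hom fgD(1)[OF M(1)] lin_comp[OF lin_comp[OF a' assms(4)] N(3)])
 have f: "?f \<in> mod_hom R P ?N"
  by (intro restrict_mod_hom P lin_comp[OF assms(6) N(3)])
 have "?g ` el ?M = el ?N"
 proof -
  have "?a' ` el ?M = el M"
   using bij_betw_inv_into[OF M(4)] by (simp add: bij_betw_def)
  then have "(%x. ?b (g (?a' x))) ` el ?M = ?b ` g ` el M" by (metis image_image)
  then show ?thesis using assms(5) N(4) by (simp add: bij_betw_def)
 qed
 then obtain h where h: "h \<in> mod_hom R P ?M" "compose (el P) ?g h = ?f"
  using assms(1) M(1) N(1) g f unfolding fg_projective_def by blast
 have hc: "h x .: ?M" if "x .: P" for x using lin_cl[OF mod_hom_lin[OF h(1)] that] .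
 have "g (?a' (h x)) = f x" if x: "x .: P" for x
 proof -
  have "?b (g (?a' (h x))) = ?b (f x)" using fun_cong[OF h(2), of x] x hc[OF x] by (simp add: compose_def)
  moreover have "g (?a' (h x)) .: N" "f x .: N"
   using x lin_cl[OF assms(4)] lin_cl[OF a'] hc[OF x] lin_cl[OF assms(6)] by auto
  ultimately show ?thesis using N(4) by (auto simp: bij_betw_def dest: inj_onD)
 qed
 then show ?thesis using lin_comp[OF mod_hom_lin[OF h(1)] a'] by blast
qed

text \<open>A submodule of \<open>R\<^sup>d\<close> is projective, but heredity is only about modules in the universe; so it is applied to the copy of \<open>R\<^sup>d\<close> and the conclusion is transported back.\<close>

lemma hereditary_free:
 fixes R :: "('a, 'r) ring_scheme"
 assumes "hereditary R" "ring R" "submodule S R (free_module R {..<d::nat})"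
 shows hereditary_fg: "fg_module R ((free_module R {..<d})\<lparr>carrier := S\<rparr>)"
  and hereditary_lift: "!!(M :: ('a, 'b, 'm) ms) (N :: ('a, 'c, 'n) ms) g f.
   fg_module R M ==> fg_module R N ==> lin R M N g ==> g ` el M = el N ==>
   lin R ((free_module R {..<d})\<lparr>carrier := S\<rparr>) N f ==>
   \<exists>h. lin R ((free_module R {..<d})\<lparr>carrier := S\<rparr>) M h & (\<forall>x \<in> S. g (h x) = f x)"
proof -
 let ?F = "free_module R {..<d}"
 note fgF = fg_module_free[OF assms(2), of d] and F = lm_free[OF assms(2), of "{..<d}"]
 note P = fg_copy[OF fgF]
 let ?P = "fg_copy R ?F" let ?t = "fg_copy_iso R ?F" let ?t' = "inv_into (el ?F) ?t"
 have t': "lin R ?P ?F ?t'" by (rule lin_inv_into[OF F P(3,4)])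
 have SF: "S <= el ?F" by (rule submod_sub[OF assms(3)])
 have S': "submodule (?t ` S) R ?P" by (rule submodule_image[OF F fgD(1)[OF P(1)] P(3) assms(3)])
 have pr: "fg_projective R (?P .| (?t ` S))"
  using assms(1) fg_projective_free_copy[OF P(1,3,4)] S' unfolding hereditary_def by blast
 have t'S: "?t' (?t x) = x" if "x \<in> S" for x using bij_inv(1)[OF P(4)] SF that by auto
 have t'im: "?t' ` ?t ` S = S" using t'S by (auto simp: image_image intro!: rev_image_eqI)
 have l: "lin R (?P .| (?t ` S)) (?F .| S) ?t'"
  using t'im by (intro lin_corestrict lin_restrict_dom[OF t'] submod_sub[OF S']) auto
 have l2: "lin R (?F .| S) (?P .| (?t ` S)) ?t"
  by (intro lin_corestrict lin_restrict_dom[OF P(3)] SF) auto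
 show "fg_module R (?F .| S)"
  using pr t'im by (intro fg_module_image[OF _ submodule_left_module[OF F assms(3)] l])
   (auto simp: fg_projective_def)
 fix M :: "('a, 'b, 'm) ms" and N :: "('a, 'c, 'n) ms" and g f
 assume MN: "fg_module R M" "fg_module R N" "lin R M N g" "g ` el M = el N"
  and f: "lin R (?F .| S) N f"
 obtain h where h: "lin R (?P .| (?t ` S)) M h" "\<forall>x \<in> ?t ` S. g (h x) = f (?t' x)"
  using fg_projective_lift[OF pr MN lin_comp[OF l f]] by auto
 then show "\<exists>h. lin R (?F .| S) M h & (\<forall>x \<in> S. g (h x) = f x)"
  using lin_comp[OF l2 h(1)] t'S by (intro exI[of _ "%x. h (?t x)"]) auto
qed

section \<open>Finite-dimensional vector spaces\<close>

lemma (in abelian_group) add_eq_diff: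
 assumes "a .: G" "b .: G" "c .: G" "d .: G" "a \<oplus> b = c \<oplus> d"
 shows "a \<ominus> c = d \<ominus> b"
proof -
 have "a \<ominus> c = ((a \<oplus> b) \<ominus> b) \<ominus> c" using assms(1-4) by (simp add: a_minus_def a_assoc r_neg)
 also have "... = (d \<oplus> c \<ominus> c) \<ominus> b" unfolding assms(5) using assms by (simp add: a_minus_def a_ac)
 also have "... = d \<ominus> b" using assms by (simp add: a_minus_def a_assoc r_neg)
 finally show ?thesis .
qed

lemma set_add_iff: "x \<in> U <+>\<^bsub>M\<^esub> V <-> (\<exists>u \<in> U. \<exists>v \<in> V. x = u \<oplus>\<^sub>M v)"
 by (auto simp: set_add_def')

lemma submodule_set_add:
 assumes "lmod R M" "submodule U R M" "submodule V R M"
 shows "submodule (U <+>\<^bsub>M\<^esub> V) R M" "U <= U <+>\<^bsub>M\<^esub> V" "V <= U <+>\<^bsub>M\<^esub> V"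
proof -
 interpret M: left_module R M by fact
 have U: "!!x. x \<in> U ==> x .: M" and V: "!!x. x \<in> V ==> x .: M"
  using submod_sub assms by blast+
 show "U <= U <+>\<^bsub>M\<^esub> V"
 proof
  fix x assume "x \<in> U"
  then show "x \<in> U <+>\<^bsub>M\<^esub> V"
   unfolding set_add_iff using U submodule_zero[OF assms(3)]
   by (intro bexI[of _ x] bexI[of _ "\<zero>\<^sub>M"]) auto
 qed
 show "V <= U <+>\<^bsub>M\<^esub> V"
 proof
  fix x assume "x \<in> V"
  then show "x \<in> U <+>\<^bsub>M\<^esub> V"
   unfolding set_add_iff using V submodule_zero[OF assms(2)]
   by (intro bexI[of _ x] bexI[of _ "\<zero>\<^sub>M"]) auto
 qed
 show "submodule (U <+>\<^bsub>M\<^esub> V) R M"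
  unfolding M.submodule_iff
 proof (intro conjI ballI)
  show "U <+>\<^bsub>M\<^esub> V <= el M" using U V by (auto simp: set_add_iff)
  show "\<zero>\<^sub>M \<in> U <+>\<^bsub>M\<^esub> V" using \<open>U <= U <+>\<^bsub>M\<^esub> V\<close> submodule_zero[OF assms(2)] by blast
 next
  fix x y assume "x \<in> U <+>\<^bsub>M\<^esub> V" "y \<in> U <+>\<^bsub>M\<^esub> V"
  then obtain u v u' v' where *: "u \<in> U" "v \<in> V" "x = u \<oplus>\<^sub>M v" "u' \<in> U" "v' \<in> V" "y = u' \<oplus>\<^sub>M v'"
   by (auto simp: set_add_iff)
  then have "x \<oplus>\<^sub>M y = (u \<oplus>\<^sub>M u') \<oplus>\<^sub>M (v \<oplus>\<^sub>M v')" using U V by (simp add: M.M.a_ac)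
  then show "x \<oplus>\<^sub>M y \<in> U <+>\<^bsub>M\<^esub> V"
   unfolding set_add_iff using * submodule_add[OF assms(2)] submodule_add[OF assms(3)] by blast
 next
  fix a x assume "a .: R" "x \<in> U <+>\<^bsub>M\<^esub> V"
  then show "a \<odot>\<^sub>M x \<in> U <+>\<^bsub>M\<^esub> V"
   unfolding set_add_iff using submodule_smult[OF assms(2)] submodule_smult[OF assms(3)] U V
   by (metis M.smult_r_distr)
 qed
qed

lemma projection_exists:
 assumes "lmod R M" "submodule U R M" "submodule V R M"
  "U <+>\<^bsub>M\<^esub> V = el M" "U \<inter> V = {\<zero>\<^sub>M}"
 obtains p where "lin R M M p" "!!x. x .: M ==> p x \<in> U" "!!u. u \<in> U ==> p u = u"
  "!!v. v \<in> V ==> p v = \<zero>\<^sub>M"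
proof -
 interpret M: left_module R M by fact
 have U: "!!x. x \<in> U ==> x .: M" and V: "!!x. x \<in> V ==> x .: M"
  using submod_sub assms by blast+
 have uniq: "u = u'" if "u \<in> U" "u' \<in> U" "v \<in> V" "v' \<in> V" "u \<oplus>\<^sub>M v = u' \<oplus>\<^sub>M v'" for u u' v v'
 proof -
  have "u \<ominus>\<^sub>M u' = v' \<ominus>\<^sub>M v" using M.M.add_eq_diff[OF _ _ _ _ that(5)] that U V by simp
  then have "u \<ominus>\<^sub>M u' \<in> U \<inter> V"
   using submodule_diff[OF assms(2) that(1,2)] submodule_diff[OF assms(3) that(4,3)] by simp
  then show ?thesis using assms(5) M.M.diff_eq_zero that U by auto
 qed
 define p where "p x = (SOME u. u \<in> U & (\<exists>v \<in> V. x = u \<oplus>\<^sub>M v))" for x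
 have p: "p x \<in> U & (\<exists>v \<in> V. x = p x \<oplus>\<^sub>M v)" if "x .: M" for x
  unfolding p_def by (rule someI_ex) (use that assms(4) set_add_iff[of x M U V] in auto)
 have pI: "p x = u" if "u \<in> U" "v \<in> V" "x = u \<oplus>\<^sub>M v" for x u v
  using p[of x] uniq[of "p x" u _ v] that U V by auto
 show ?thesis
 proof (rule that)
  show "lin R M M p"
  proof (rule linI)
   fix x assume "x .: M" then show "p x .: M" using p U by blast
  next
   fix x y assume xy: "x .: M" "y .: M"
   then obtain v w where *: "v \<in> V" "w \<in> V" "x = p x \<oplus>\<^sub>M v" "y = p y \<oplus>\<^sub>M w" using p by metis
   have pc: "p x \<in> U" "p y \<in> U" using p xy by auto
   show "p (x \<oplus>\<^sub>M y) = p x \<oplus>\<^sub>M p y"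
   proof (rule pI)
    have "(p x \<oplus>\<^sub>M v) \<oplus>\<^sub>M (p y \<oplus>\<^sub>M w) = (p x \<oplus>\<^sub>M p y) \<oplus>\<^sub>M (v \<oplus>\<^sub>M w)"
     using pc *(1,2) U V by (simp add: M.M.a_ac)
    then show "x \<oplus>\<^sub>M y = (p x \<oplus>\<^sub>M p y) \<oplus>\<^sub>M (v \<oplus>\<^sub>M w)"
     unfolding *(3)[symmetric] *(4)[symmetric] .
   qed (use pc *(1,2) submodule_add[OF assms(2)] submodule_add[OF assms(3)] in auto)
  next
   fix a x assume ax: "a .: R" "x .: M"
   then obtain v where *: "v \<in> V" "x = p x \<oplus>\<^sub>M v" using p by metis
   have pc: "p x \<in> U" using p ax by auto
   show "p (a \<odot>\<^sub>M x) = a \<odot>\<^sub>M p x"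
   proof (rule pI)
    show "a \<odot>\<^sub>M x = a \<odot>\<^sub>M p x \<oplus>\<^sub>M a \<odot>\<^sub>M v"
     using M.smult_r_distr[of a "p x" v] * pc U V ax by metis
   qed (use pc * ax submodule_smult[OF assms(2)] submodule_smult[OF assms(3)] in auto)
  qed
  show "p x \<in> U" if "x .: M" for x using p that by auto
  show "p u = u" if "u \<in> U" for u
   using pI[OF that submodule_zero[OF assms(3)]] that U by simp
  show "p v = \<zero>\<^sub>M" if "v \<in> V" for v
   using pI[OF submodule_zero[OF assms(2)] that] that V by simp
 qed
qed

text \<open>A spanning set of least size is a basis: a nontrivial relation would make one of its elements superfluous.\<close>

lemma coordinates_exist:
 fixes F :: "('f, 'r) ring_scheme" and V :: "('f, 'b, 'm) ms"
 assumes "field F" "lmod F V" "fin_gen F V"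
 obtains n :: nat and b ps where "b \<in> {..<n} -> el V"
  "!!i. i < n ==> lin F V (regular_module F) (ps i)"
  "!!v. v .: V ==> (\<Oplus>\<^bsub>V\<^esub>i \<in> {..<n}. ps i v \<odot>\<^sub>V b i) = v"
  "!!i j. i < n ==> j < n ==> ps i (b j) = (if i = j then \<one>\<^sub>F else \<zero>\<^sub>F)"
proof -
 interpret F: field F by fact
 interpret V: left_module F V by fact
 define gen where "gen T <-> finite T & T <= el V & gen_submodule F V T = el V" for T
 obtain T0 where "gen T0" using assms(3) by (auto simp: fin_gen_def gen_def)
 from ex_has_least_nat[of gen T0 card, OF this] obtain T where T: "gen T" and least: "!!T'. gen T' ==> card T \<le> card T'"
  by blast
 have fin: "finite T" and TV: "T <= el V" using T by (auto simp: gen_def)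
 have idT: "(%x. x) \<in> T -> el V" using TV by auto
 let ?P = "free_module F T" and ?p = "%c. lcomb F V T c (%x. x)"
 note P = lm_free[OF F.ring_axioms, of T] and p = V.lin_lcomb[OF idT]
 interpret P: left_module F ?P by (rule P)
 have gP: "free_gen F t .: ?P" and pg: "?p (free_gen F t) = t" if "t \<in> T" for t
  by (rule free_gen_cl[OF F.ring_axioms that], rule V.lcomb_free_gen[OF idT that])
 note psum = V.lcomb_super[OF _ idT fin subset_refl Collect_subset]
 have "gen_submodule F V T <= ?p ` el ?P"
 proof (rule gen_submod(3)[OF assms(2) TV submodule_image[OF P assms(2) p submodule_carrier[OF P]]])
  show "T <= ?p ` el ?P"
  proof
   fix t assume t: "t \<in> T"
   show "t \<in> ?p ` el ?P" by (rule image_eqI[of _ ?p, OF pg[OF t, symmetric] gP[OF t]])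
  qed
 qed
 then have surj: "?p ` el ?P = el V" using T lin_cl[OF p] by (auto simp: gen_def)
 have inj: "inj_on ?p (el ?P)"
  unfolding lin_inj_iff[OF P.ag V.ag p]
 proof (intro ballI impI, rule ccontr)
  fix c assume c: "c .: ?P" "?p c = \<zero>\<^sub>V" "c ~= \<zero>\<^sub>?P"
  then obtain s where s: "s \<in> T" "c s ~= \<zero>\<^sub>F" by (auto simp: free_simps fun_eq_iff)
  have cF: "c t .: F" for t by (rule free_coeff[OF F.ring_axioms c(1)])
  have sV: "s .: V" using s TV by auto
  have T': "T - {s} <= el V" using TV by auto
  note W = gen_submod[OF assms(2) T']
  let ?W = "gen_submodule F V (T - {s})" and ?r = "\<Oplus>\<^bsub>V\<^esub>t \<in> T - {s}. c t \<odot>\<^sub>V t"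
  have r: "?r \<in> ?W"
   by (rule finsum_submodule(2)[OF assms(2) W(1)]) (use submodule_smult[OF W(1) cF] W(2) in auto)
  have rV: "?r .: V" using r submod_sub[OF W(1)] by blast
  have "(\<Oplus>\<^bsub>V\<^esub>t \<in> insert s (T - {s}). c t \<odot>\<^sub>V t) = c s \<odot>\<^sub>V s \<oplus>\<^sub>V ?r"
   by (rule V.M.finsum_insert) (use fin cF sV T' in auto)
  then have "c s \<odot>\<^sub>V s \<oplus>\<^sub>V ?r = \<zero>\<^sub>V" using psum[OF c(1)] c(2) s(1) by (simp add: insert_absorb)
  then have "c s \<odot>\<^sub>V s = \<ominus>\<^sub>V ?r" using V.M.minus_equality cF sV rV by simp
  then have cs: "c s \<odot>\<^sub>V s \<in> ?W" using submodule_minus[OF W(1) r] by simp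
  have inv: "inv\<^bsub>F\<^esub> c s .: F" "inv\<^bsub>F\<^esub> c s \<otimes>\<^sub>F c s = \<one>\<^sub>F"
   using s(2) cF F.field_Units by (auto simp: F.Units_l_inv)
  have "inv\<^bsub>F\<^esub> c s \<odot>\<^sub>V (c s \<odot>\<^sub>V s) = s"
   using V.smult_assoc1[OF inv(1) cF[of s] sV, symmetric] inv(2) sV by simp
  then have "s \<in> ?W" using submodule_smult[OF W(1) inv(1) cs] by simp
  then have "T <= ?W" using W(2) by auto
  then have "el V <= ?W" using gen_submod(3)[OF assms(2) TV W(1)] T by (simp add: gen_def)
  then have "gen (T - {s})" using fin T' submod_sub[OF W(1)] by (auto simp: gen_def)
  then show False using least[of "T - {s}"] card_Diff1_less[OF fin s(1)] by simp
 qed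
 have bij: "bij_betw ?p (el ?P) (el V)" using inj surj by (simp add: bij_betw_def)
 let ?q = "inv_into (el ?P) ?p"
 note q = lin_inv_into[OF P p bij] and inv = bij_inv[OF bij]
 obtain h where h: "bij_betw h {..<card T} T" using ex_bij_betw_nat_finite[OF fin] by (auto simp: lessThan_atLeast0)
 have hT: "h i \<in> T" if "i < card T" for i using h that by (auto simp: bij_betw_def)
 have ev: "lin F ?P (regular_module F) (%c. c t)" for t
  using free_coeff[OF F.ring_axioms] by (intro linI) (auto simp: free_simps)
 show ?thesis
 proof (rule that[of h "card T" "%i v. ?q v (h i)"])
  show "h \<in> {..<card T} -> el V" using hT TV by auto
  show "lin F V (regular_module F) (%v. ?q v (h i))" for i by (rule lin_comp[OF q ev])
  show "(\<Oplus>\<^bsub>V\<^esub>i \<in> {..<card T}. ?q v (h i) \<odot>\<^sub>V h i) = v" if v: "v .: V" for v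
  proof -
   note qv = inv(3)[OF v]
   have im: "h ` {..<card T} = T" using h by (simp add: bij_betw_def)
   have "(\<Oplus>\<^bsub>V\<^esub>t \<in> h ` {..<card T}. ?q v t \<odot>\<^sub>V t) = (\<Oplus>\<^bsub>V\<^esub>i \<in> {..<card T}. ?q v (h i) \<odot>\<^sub>V h i)"
    using free_coeff[OF F.ring_axioms qv] TV h im
    by (intro V.M.finsum_reindex) (auto simp: bij_betw_def)
   then show ?thesis using psum[OF qv] inv(2)[OF v] im by simp
  qed
  show "?q (h j) (h i) = (if i = j then \<one>\<^sub>F else \<zero>\<^sub>F)" if "i < card T" "j < card T" for i j
  proof -
   have "?q (?p (free_gen F (h j))) = free_gen F (h j)" by (rule inv(1)[OF gP[OF hT[OF that(2)]]])
   then have "?q (h j) = free_gen F (h j)" using pg[OF hT[OF that(2)]] by simp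
   moreover have "h i = h j <-> i = j" using h that by (auto simp: bij_betw_def inj_on_def)
   ultimately show ?thesis by (simp add: free_gen_def)
  qed
 qed
qed

text \<open>The rank of \<open>U\<close> is the number of its pivots, the positions \<open>k\<close> such that some vector of \<open>U\<close> has its last nonzero coordinate there.  By elimination, subspaces \<open>U \<subseteq> W\<close> with the same pivots are equal.\<close>

lemma rank_exists:
 fixes F :: "('f, 'r) ring_scheme" and V :: "('f, 'b, 'm) ms"
 assumes "field F" "lmod F V" "fin_gen F V"
 obtains rk :: "'b set => nat" and n where "!!U. rk U \<le> n"
  "!!U U'. submodule U F V ==> submodule U' F V ==> U \<subset> U' ==> rk U < rk U'"
proof -
 interpret F: field F by fact
 interpret V: left_module F V by fact
 obtain d b ps where b: "b \<in> {..<d::nat} -> el V"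
  and psi: "!!i. i < d ==> lin F V (regular_module F) (ps i)"
  and ex: "!!v. v .: V ==> (\<Oplus>\<^bsub>V\<^esub>i \<in> {..<d}. ps i v \<odot>\<^sub>V b i) = v"
  and "!!i j. i < d ==> j < d ==> ps i (b j) = (if i = j then \<one>\<^sub>F else \<zero>\<^sub>F)"
  by (rule coordinates_exist[OF assms]) (rule that)
 interpret RF: left_module F "regular_module F" by (rule lm_regular[OF F.ring_axioms])
 define N where "N k = {v \<in> el V. \<forall>i < d. k \<le> i --> ps i v = \<zero>\<^sub>F}" for k
 define K where "K U = {k. k < d & ~ U \<inter> N (Suc k) <= N k}" for U
 have NV: "N k <= el V" for k by (auto simp: N_def)
 have psiF: "ps i v .: F" if "i < d" "v .: V" for i v using lin_cl[OF psi[OF that(1)] that(2)] by simp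
 have step: "\<exists>a \<in> el F. x \<ominus>\<^sub>V a \<odot>\<^sub>V z \<in> N k"
  if xz: "x \<in> N (Suc k)" "z \<in> N (Suc k)" "z \<notin> N k" for k x z
 proof -
  have V: "x .: V" "z .: V" using xz NV by blast+
  have k: "k < d" "ps k z ~= \<zero>\<^sub>F" using xz(2,3) le_antisym not_less_eq_eq by (auto simp: N_def)
  let ?a = "ps k x \<otimes>\<^sub>F inv\<^bsub>F\<^esub> ps k z"
  have inv: "inv\<^bsub>F\<^esub> ps k z .: F" "inv\<^bsub>F\<^esub> ps k z \<otimes>\<^sub>F ps k z = \<one>\<^sub>F"
   using k(2) psiF[OF k(1) V(2)] F.field_Units by (auto simp: F.Units_l_inv)
  have a: "?a .: F" "?a \<otimes>\<^sub>F ps k z = ps k x" using inv psiF[OF k(1)] V by (auto simp: F.m_assoc)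
  have val: "ps i (x \<ominus>\<^sub>V ?a \<odot>\<^sub>V z) = \<zero>\<^sub>F" if i: "i < d" "k \<le> i" for i
  proof -
   have "ps i x = ?a \<otimes>\<^sub>F ps i z"
   proof (cases "i = k")
    case False
    then have "ps i x = \<zero>\<^sub>F" "ps i z = \<zero>\<^sub>F" using i xz(1,2) by (auto simp: N_def)
    then show ?thesis using a(1) by simp
   qed (use a(2) in simp)
   then show ?thesis
    using lin_diff[OF V.ag RF.ag psi[OF i(1)] V(1) V.smult_closed[OF a(1) V(2)]]
     lin_smult[OF psi[OF i(1)] a(1) V(2)] RF.M.diff_eq_zero a(1) psiF[OF i(1) V(2)] by simp
  qed
  show ?thesis by (rule bexI[OF _ a(1)]) (use val V a(1) in "simp add: N_def")
 qed
 have N0: "N 0 = {\<zero>\<^sub>V}"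
 proof -
  have "v = \<zero>\<^sub>V" if v: "v .: V" "\<forall>i < d. ps i v = \<zero>\<^sub>F" for v
  proof -
   have "(\<Oplus>\<^bsub>V\<^esub>i \<in> {..<d}. ps i v \<odot>\<^sub>V b i) = (\<Oplus>\<^bsub>V\<^esub>i \<in> {..<d}. \<zero>\<^sub>V)"
    using b v(2) V.smult_l_null[of "b _"] by (intro V.M.finsum_cong') (auto simp: Pi_def)
   then show ?thesis using ex[OF v(1)] by simp
  qed
  then show ?thesis
   using lin_zero[OF V.ag RF.ag psi] by (auto simp: N_def)
 qed
 have Nd: "N d = el V" by (auto simp: N_def)
 have mono: "K U <= K U'" if "U <= U'" for U U' using that by (auto simp: K_def)
 have strict: "U = U'" if U: "submodule U F V" "submodule U' F V" "U <= U'" "K U = K U'" for U U'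
 proof -
  have "U' \<inter> N k <= U" if "k \<le> d" for k
   using that
  proof (induction k)
   case 0 then show ?case using N0 submodule_zero[OF U(1)] by auto
  next
   case (Suc k)
   show ?case
   proof
    fix x assume x: "x \<in> U' \<inter> N (Suc k)"
    show "x \<in> U"
    proof (cases "x \<in> N k")
     case True then show ?thesis using Suc x by auto
    next
     case False
     then have "k \<in> K U'" using x Suc(2) by (auto simp: K_def)
     then have "k \<in> K U" using U(4) by simp
     then obtain z where z: "z \<in> U" "z \<in> N (Suc k)" "z \<notin> N k" by (auto simp: K_def)
     obtain a where a: "a .: F" "x \<ominus>\<^sub>V a \<odot>\<^sub>V z \<in> N k" using step z x by blast
     have az: "a \<odot>\<^sub>V z \<in> U" using submodule_smult[OF U(1) a(1) z(1)] .
     then have "x \<ominus>\<^sub>V a \<odot>\<^sub>V z \<in> U'" using x U(3) submodule_diff[OF U(2)] by blast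
     then have "x \<ominus>\<^sub>V a \<odot>\<^sub>V z \<in> U" using Suc a by auto
     then have "(x \<ominus>\<^sub>V a \<odot>\<^sub>V z) \<oplus>\<^sub>V a \<odot>\<^sub>V z \<in> U" using az submodule_add[OF U(1)] by blast
     then show ?thesis
      using x az submod_sub[OF U(1)] NV[of "Suc k"] V.M.diff_add by (metis IntD2 subsetD)
    qed
   qed
  qed
  then have "U' <= U" using Nd submod_sub[OF U(2)] by blast
  then show ?thesis using U(3) by auto
 qed
 show ?thesis
 proof (rule that)
  have "K U <= {..<d}" for U by (auto simp: K_def)
  then have fin: "finite (K U)" and "card (K U) \<le> card {..<d}" for U
   using finite_subset card_mono by (metis finite_lessThan)+
  then show "card (K U) \<le> d" for U by simp
  show "card (K U) < card (K U')" if "submodule U F V" "submodule U' F V" "U \<subset> U'" for U U'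
   using that mono[of U U'] strict[of U U'] fin by (metis psubset_card_mono psubset_eq)
 qed
qed

text \<open>A subspace of greatest rank among those that meet \<open>U\<close> trivially is a complement.\<close>

lemma complement_exists:
 assumes "field F" "lmod F V" "fin_gen F V" "submodule U F V"
 obtains C where "submodule C F V" "U \<inter> C = {\<zero>\<^sub>V}" "U <+>\<^bsub>V\<^esub> C = el V"
proof -
 interpret F: field F by fact
 interpret V: left_module F V by fact
 obtain rk :: "_ set => nat" and n where rk: "!!U. rk U \<le> n"
  "!!U U'. submodule U F V ==> submodule U' F V ==> U \<subset> U' ==> rk U < rk U'"
  by (rule rank_exists[OF assms(1-3)]) (rule that)
 define good where "good C <-> submodule C F V & U \<inter> C = {\<zero>\<^sub>V}" for C
 have "good {\<zero>\<^sub>V}"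
  using submodule_zero_set[OF assms(2)] submodule_zero[OF assms(4)] by (auto simp: good_def)
 then obtain C where C: "good C" and max: "!!C'. good C' ==> rk C' \<le> rk C"
  using ex_has_greatest_nat[of good "{\<zero>\<^sub>V}" rk "Suc n"] rk(1) by (auto simp: less_Suc_eq_le)
 have Cs: "submodule C F V" and CU: "U \<inter> C = {\<zero>\<^sub>V}" using C by (auto simp: good_def)
 note UC = submodule_set_add[OF assms(2,4) Cs]
 have "v \<in> U <+>\<^bsub>V\<^esub> C" if v: "v .: V" for v
 proof (rule ccontr)
  assume nv: "v \<notin> U <+>\<^bsub>V\<^esub> C"
  define L where "L = (%a. a \<odot>\<^sub>V v) ` el F"
  have L: "submodule L F V"
   unfolding V.submodule_iff
  proof (intro conjI ballI)
   show "L <= el V" using v by (auto simp: L_def)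
   show "\<zero>\<^sub>V \<in> L" unfolding L_def using v by (intro image_eqI[of _ _ "\<zero>\<^sub>F"]) auto
   show "x \<oplus>\<^sub>V y \<in> L" if "x \<in> L" "y \<in> L" for x y
    using that v unfolding L_def by (auto simp: V.smult_l_distr[symmetric])
   show "a \<odot>\<^sub>V x \<in> L" if "a .: F" "x \<in> L" for a x
    using that v unfolding L_def by (auto simp: V.smult_assoc1[symmetric])
  qed
  note CL = submodule_set_add[OF assms(2) Cs L]
  have vL: "v \<in> L" unfolding L_def using v by (intro image_eqI[of _ _ "\<one>\<^sub>F"]) auto
  have "U \<inter> (C <+>\<^bsub>V\<^esub> L) <= {\<zero>\<^sub>V}"
  proof
   fix u assume u: "u \<in> U \<inter> (C <+>\<^bsub>V\<^esub> L)"
   then obtain c a where ca: "c \<in> C" "a .: F" "u = c \<oplus>\<^sub>V a \<odot>\<^sub>V v"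
    by (auto simp: set_add_iff L_def)
   have cV: "c .: V" "u .: V" using ca(1) u submod_sub[OF Cs] submod_sub[OF assms(4)] by auto
   show "u \<in> {\<zero>\<^sub>V}"
   proof (cases "a = \<zero>\<^sub>F")
    case True
    then have "u = c" using ca cV v by simp
    then show ?thesis using u ca CU by auto
   next
    case False
    have inv: "inv\<^bsub>F\<^esub> a .: F" "inv\<^bsub>F\<^esub> a \<otimes>\<^sub>F a = \<one>\<^sub>F"
     using False ca(2) F.field_Units by (auto simp: F.Units_l_inv)
    have "a \<odot>\<^sub>V v = u \<oplus>\<^sub>V (\<ominus>\<^sub>V c)"
     using ca cV v by (simp add: V.M.a_ac V.M.r_neg2 V.M.r_neg1)
    then have "a \<odot>\<^sub>V v \<in> U <+>\<^bsub>V\<^esub> C"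
     unfolding set_add_iff using u ca submodule_minus[OF Cs ca(1)] by blast
    then have "inv\<^bsub>F\<^esub> a \<odot>\<^sub>V (a \<odot>\<^sub>V v) \<in> U <+>\<^bsub>V\<^esub> C"
     using submodule_smult[OF UC(1) inv(1)] by blast
    then show ?thesis using nv inv v ca by (simp add: V.smult_assoc1[symmetric])
   qed
  qed
  then have "good (C <+>\<^bsub>V\<^esub> L)"
   using CL submodule_zero[OF CL(1)] submodule_zero[OF assms(4)] by (auto simp: good_def)
  moreover have "C \<subset> C <+>\<^bsub>V\<^esub> L" using CL(2,3) vL nv UC(3) by auto
  ultimately show False using max rk(2)[OF Cs CL(1)] by (metis not_le)
 qed
 then have "U <+>\<^bsub>V\<^esub> C = el V" using submod_sub[OF UC(1)] by blast
 then show ?thesis using that Cs CU by blast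
qed

lemma functional_extend:
 assumes "field F" "lmod F V" "fin_gen F V" "submodule U F V" "lmod F W"
  "lin F (V .| U) W f"
 obtains h where "lin F V W h" "!!u. u \<in> U ==> h u = f u"
proof -
 obtain C where C: "submodule C F V" "U \<inter> C = {\<zero>\<^sub>V}" "U <+>\<^bsub>V\<^esub> C = el V"
  by (rule complement_exists[OF assms(1-4)])
 obtain p where p: "lin F V V p" "!!x. x .: V ==> p x \<in> U" "!!u. u \<in> U ==> p u = u"
  using projection_exists[OF assms(2,4) C(1,3,2)] by metis
 have "lin F V (V .| U) p" by (rule lin_corestrict[OF p(1)]) (use p(2) in auto)
 from lin_comp[OF this assms(6)] show ?thesis by (rule that) (use p(3) in simp)
qed

text \<open>Coordinates.\<close>

section \<open>Modules over a finite-dimensional algebra\<close>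

lemma (in abelian_group) add_swap:
 "a .: G ==> b .: G ==> c .: G ==> d .: G ==>
  (a \<oplus> b) \<oplus> (c \<oplus> d) = (a \<oplus> c) \<oplus> (b \<oplus> d)"
 by (simp add: a_ac)

definition rs ::
  "('f, 'a, 'm) ms => ('a, 'b, 'n) ms => ('f, 'b) module"
 where "rs A M =
  \<lparr>carrier = el M, monoid.mult = undefined, one = undefined, zero = zero M, add = add M,
  smult = (%c x. (c \<odot>\<^sub>A \<one>\<^sub>A) \<odot>\<^sub>M x)\<rparr>"

lemma rs_simps [simp]:
 "el (rs A M) = el M" "add (rs A M) = add M"
 "zero (rs A M) = zero M"
 "c \<odot>\<^sub>(rs A M) x = (c \<odot>\<^sub>A \<one>\<^sub>A) \<odot>\<^sub>M x"
 by (simp_all add: rs_def)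

context fin_dim_algebra
begin

lemma fieldF: "field F" by unfold_locales

lemma ringF: "ring F" by unfold_locales

lemma ringA: "ring A" by unfold_locales

lemma abelianA: "abelian_group A" by unfold_locales

lemma abelianF: "abelian_group F" by unfold_locales

lemma semiringA: "semiring A" by unfold_locales

lemma monoidA: "Group.monoid A" by unfold_locales

lemma semiringF: "semiring F" by unfold_locales

lemma comm_monoidF: "Group.comm_monoid F" by unfold_locales

lemma scalar_closed [simp]: "c .: F ==> c \<odot>\<^sub>A \<one>\<^sub>A .: A"
 by simp

lemma scalar_mult: "c .: F ==> x .: A ==> (c \<odot>\<^sub>A \<one>\<^sub>A) \<otimes>\<^sub>A x = c \<odot>\<^sub>A x"
 by (simp add: smult_mult_left)

lemma mult_scalar: "c .: F ==> x .: A ==> x \<otimes>\<^sub>A (c \<odot>\<^sub>A \<one>\<^sub>A) = c \<odot>\<^sub>A x"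
 by (simp add: smult_mult_right)

lemma lm_F_A: "lmod F A"
 by (intro left_moduleI ringF)
  (simp_all add: abelianA smult_l_distr smult_r_distr smult_assoc1)

lemma lm_rs:
 assumes "lmod A M" shows "lmod F (rs A M)"
proof -
 interpret M: left_module A M by fact
 show ?thesis
 proof (rule left_moduleI[OF ringF])
  show "abelian_group (rs A M)"
   by (rule abelian_group_image[where G = M and p = "%x. x"]) (simp_all add: M.ag)
  show "(c \<otimes> d) \<odot>\<^sub>(rs A M) x = c \<odot>\<^sub>(rs A M) (d \<odot>\<^sub>(rs A M) x)"
   if "c .: F" "d .: F" "x .: (rs A M)" for c d x
   using that scalar_mult[of c "d \<odot>\<^sub>A \<one>\<^sub>A"]
   by (simp add: M.smult_assoc1[symmetric] smult_assoc1)
 qed (simp_all add: smult_l_distr M.smult_l_distr M.smult_r_distr)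
qed

lemma lin_rs: "lin A M N f ==> lin F (rs A M) (rs A N) f"
 by (auto simp: lin_def)

lemma submodule_rs:
 assumes "lmod A M" "submodule U A M" shows "submodule U F (rs A M)"
proof -
 interpret M: left_module A M by fact
 interpret M': left_module F "rs A M" by (rule lm_rs[OF assms(1)])
 show ?thesis using assms(2) unfolding M'.submodule_iff M.submodule_iff by auto
qed

lemma fin_gen_rs:
 assumes "fg_module A M" shows "fin_gen F (rs A M)"
proof -
 note M = fgD[OF assms]
 interpret M: left_module A M by (rule M)
 note M' = lm_rs[OF M(1)]
 obtain d g where g: "g \<in> {..<d::nat} -> el M"
  and im: "(%c. lcomb A M {..<d} c g) ` el (free_module A {..<d}) = el M"
  by (rule fin_gen_lcomb[OF M])
 obtain S where S: "finite S" "S <= el A" "gen_submodule F A S = el A"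
  using fin_dim by (auto simp: fin_gen_def)
 let ?T = "(%(s, i). s \<odot>\<^sub>M g i) ` (S \<times> {..<d})"
 have T: "?T <= el (rs A M)" using S g by auto
 note W = gen_submod[OF M' T]
 let ?W = "gen_submodule F (rs A M) ?T"
 have a: "a \<odot>\<^sub>M g i \<in> ?W" if "i < d" "a .: A" for i a
 proof -
  have gi: "g i .: M" using g that by auto
  have l: "lin F A (rs A M) (%a. a \<odot>\<^sub>M g i)"
   using gi by (intro linI) (simp_all add: M.smult_l_distr M.smult_assoc1[symmetric] scalar_mult)
  have "gen_submodule F A S <= {a \<in> el A. a \<odot>\<^sub>M g i \<in> ?W}"
   using W(2) S(2) that
   by (intro gen_submod(3)[OF lm_F_A S(2)] submodule_vimage[OF lm_F_A M' l W(1)])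
    auto
  then show ?thesis using that S(3) by auto
 qed
 have "x \<in> ?W" if x: "x .: M" for x
 proof -
  obtain c where c: "c .: (free_module A {..<d})" "x = lcomb A M {..<d} c g" using im x by blast
  have cl: "c i .: A" for i by (rule free_coeff[OF ringA c(1)])
  let ?I = "{s \<in> {..<d}. c s ~= \<zero>\<^sub>A}"
  have gi: "g i .: M" if "i < d" for i using g that by auto
  interpret M': left_module F "rs A M" by (rule M')
  have f: "(%i. c i \<odot>\<^sub>M g i) \<in> ?I -> ?W" using a cl by auto
  have "x = (\<Oplus>\<^bsub>M\<^esub>i \<in> ?I. c i \<odot>\<^sub>M g i)" using c(2) by (simp add: lcomb_def)
  also have "... = (\<Oplus>\<^bsub>rs A M\<^esub>i \<in> ?I. c i \<odot>\<^sub>M g i)"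
   using gi cl by (intro add_finsum[OF M.ag M'.ag, of "%x. x"]) auto
  finally show ?thesis using finsum_submodule(2)[OF M' W(1) f] by simp
 qed
 then have "?W = el (rs A M)" using submod_sub[OF W(1)] by auto
 then show ?thesis unfolding fin_gen_def using T S(1) by (intro exI[of _ ?T]) auto
qed

lemma module_rank_exists:
 fixes M :: "('a, 'c, 'n) ms"
 assumes "fg_module A M"
 obtains rk :: "'c set => nat" and n where "!!U. rk U \<le> n"
  "!!U U'. submodule U A M ==> submodule U' A M ==> U \<subset> U' ==> rk U < rk U'"
proof -
 note M = fgD(1)[OF assms]
 obtain rk :: "'c set => nat" and n where rk: "!!U. rk U \<le> n"
  "!!U U'. submodule U F (rs A M) ==> submodule U' F (rs A M) ==> U \<subset> U' ==> rk U < rk U'"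
  by (rule rank_exists[OF fieldF lm_rs[OF M] fin_gen_rs[OF assms]]) (rule that)
 show ?thesis by (rule that[OF rk(1) rk(2)]) (use submodule_rs[OF M] in auto)
qed

lemma ascending_chain_stable:
 fixes M :: "('a, 'c, 'n) ms"
 assumes "fg_module A M" "!!k. submodule (U k) A M" "!!k. U k <= U (Suc k)"
 obtains n :: nat where "!!m. m \<ge> n ==> U m = U n"
proof -
 obtain rk :: "'c set => nat" and b where rk: "!!U. rk U \<le> b"
  "!!U U'. submodule U A M ==> submodule U' A M ==> U \<subset> U' ==> rk U < rk U'"
  by (rule module_rank_exists[OF assms(1)]) (rule that)
 obtain n where n: "!!m. rk (U m) \<le> rk (U n)"
  using ex_has_greatest_nat[of "%_. True" 0 "%m. rk (U m)" "Suc b"] rk(1) by (auto simp: less_Suc_eq_le)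
 show ?thesis
 proof (rule that[of n])
  fix m assume "m \<ge> n"
  then have "U n <= U m" using lift_Suc_mono_le[of U n m] assms(3) by auto
  then show "U m = U n" using rk(2)[OF assms(2) assms(2), of n m] n[of m] by (metis leD psubsetI)
 qed
qed

lemma descending_chain_stable:
 fixes M :: "('a, 'c, 'n) ms"
 assumes "fg_module A M" "!!k. submodule (U k) A M" "!!k. U (Suc k) <= U k"
 obtains n :: nat where "!!m. m \<ge> n ==> U m = U n"
proof -
 obtain rk :: "'c set => nat" and b where rk: "!!U. rk U \<le> b"
  "!!U U'. submodule U A M ==> submodule U' A M ==> U \<subset> U' ==> rk U < rk U'"
  by (rule module_rank_exists[OF assms(1)]) (rule that)
 obtain n where n: "!!m. rk (U n) \<le> rk (U m)"
  using ex_has_least_nat[of "%_. True" 0 "%m. rk (U m)"] by auto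
 show ?thesis
 proof (rule that[of n])
  fix m assume "m \<ge> n"
  then have "U m <= U n" using lift_Suc_antimono_le[of U n m] assms(3) by auto
  then show "U m = U n" using rk(2)[OF assms(2) assms(2), of m n] n[of m] by (metis leD psubsetI)
 qed
qed

lemma lin_funpow: "lin A M M f ==> lin A M M (f ^^ n)"
 by (induction n) (auto simp: lin_def)

text \<open>Fitting: \<open>M\<close> is the direct sum of the stable image and the stable kernel of \<open>f\<close>, so one of them is zero.\<close>

lemma indecomposable_endo:
 fixes M :: "('a, 'c, 'n) ms"
 assumes "fg_module A M" "indecomposable A M" "lin A M M f"
 shows "bij_betw f (el M) (el M) \<or> (\<exists>n. \<forall>x \<in> el M. (f ^^ n) x = \<zero>\<^sub>M)"
proof -
 note M = fgD(1)[OF assms(1)]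
 interpret M: left_module A M by (rule M)
 let ?g = "%n. f ^^ n"
 have g: "lin A M M (?g n)" for n by (rule lin_funpow[OF assms(3)])
 have gc: "x .: M ==> (f ^^ n) x .: M" for x n using lin_cl[OF g] .
 have z: "(f ^^ n) \<zero>\<^sub>M = \<zero>\<^sub>M" for n
  by (rule lin_zero[OF M.ag M.ag g])
 define K where "K n = {x \<in> el M. (f ^^ n) x = \<zero>\<^sub>M}" for n
 define I where "I n = (f ^^ n) ` el M" for n
 have K: "submodule (K n) A M" for n unfolding K_def by (rule submodule_kernel[OF M M g])
 have I: "submodule (I n) A M" for n unfolding I_def by (rule submodule_image[OF M M g submodule_carrier[OF M]])
 have Ks: "K n <= K (Suc n)" for n using z[of 1] by (auto simp: K_def)
 have Is: "I (Suc n) <= I n" for n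
  unfolding I_def using lin_cl[OF assms(3)] by (auto simp: funpow_swap1)
 obtain n1 where n1: "!!m. m \<ge> n1 ==> K m = K n1" by (rule ascending_chain_stable[where U = K, OF assms(1) K Ks]) blast
 obtain n2 where n2: "!!m. m \<ge> n2 ==> I m = I n2" by (rule descending_chain_stable[where U = I, OF assms(1) I Is]) blast
 define n where "n = Suc (max n1 n2)"
 have Kn: "K (n + n) = K n" using n1[of "n + n"] n1[of n] by (simp add: n_def)
 have In: "I (n + n) = I n" using n2[of "n + n"] n2[of n] by (simp add: n_def)
 have KI: "K n \<inter> I n = {\<zero>\<^sub>M}"
 proof -
  have "x = \<zero>\<^sub>M" if x: "x \<in> K n" "x \<in> I n" for x
  proof -
   obtain y where y: "y .: M" "x = (f ^^ n) y" using x(2) by (auto simp: I_def)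
   then have "y \<in> K (n + n)" using x(1) by (simp add: K_def funpow_add)
   then have "y \<in> K n" using Kn by simp
   then show ?thesis using y by (simp add: K_def)
  qed
  then show ?thesis using submodule_zero[OF K] submodule_zero[OF I] by auto
 qed
 have "K n <+>\<^bsub>M\<^esub> I n = el M"
 proof
  show "K n <+>\<^bsub>M\<^esub> I n <= el M" by (rule submod_sub[OF submodule_set_add(1)[OF M K I]])
  show "el M <= K n <+>\<^bsub>M\<^esub> I n"
  proof
   fix x assume x: "x .: M"
   have "(f ^^ n) x \<in> I (n + n)" unfolding In using x by (auto simp: I_def)
   then obtain y where y: "y .: M" "(f ^^ n) x = (f ^^ n) ((f ^^ n) y)"
    by (auto simp: I_def funpow_add)
   have d: "(f ^^ n) (x \<ominus>\<^sub>M (f ^^ n) y) = \<zero>\<^sub>M"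
    using lin_diff[OF M.ag M.ag g x gc[OF y(1)]] y x gc
     M.M.diff_eq_zero by simp
   have "x \<ominus>\<^sub>M (f ^^ n) y \<in> K n" using d x y gc by (simp add: K_def)
   moreover have "(f ^^ n) y \<in> I n" using y by (auto simp: I_def)
   moreover have "x = (x \<ominus>\<^sub>M (f ^^ n) y) \<oplus>\<^sub>M (f ^^ n) y" using M.M.diff_add x y gc by simp
   ultimately show "x \<in> K n <+>\<^bsub>M\<^esub> I n" unfolding set_add_iff by blast
  qed
 qed
 then consider "K n = {\<zero>\<^sub>M}" "I n = el M" | "I n = {\<zero>\<^sub>M}"
 proof -
  assume s: "K n <+>\<^bsub>M\<^esub> I n = el M"
  then have "K n = {\<zero>\<^sub>M} \<or> I n = {\<zero>\<^sub>M}"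
   using assms(2) K I KI by (auto simp: indecomposable_def)
  moreover have "I n = el M" if "K n = {\<zero>\<^sub>M}"
  proof -
   have "x \<in> I n" if "x .: M" for x
   proof -
    have "x \<in> K n <+>\<^bsub>M\<^esub> I n" using s \<open>x .: M\<close> by simp
    then show ?thesis
     unfolding set_add_iff \<open>K n = {\<zero>\<^sub>M}\<close> using submod_sub[OF I] by (auto simp: subset_iff)
   qed
   then show ?thesis using submod_sub[OF I] by blast
  qed
  ultimately show ?thesis using that by blast
 qed
 then show ?thesis
 proof cases
  case 1
  have "inj_on f (el M)"
  proof -
   have "x = \<zero>\<^sub>M" if "x .: M" "f x = \<zero>\<^sub>M" for x
   proof -
    have "(f ^^ n) x = \<zero>\<^sub>M" using that z by (simp add: n_def funpow_swap1)
    then show ?thesis using 1(1) that by (auto simp: K_def)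
   qed
   then show ?thesis using lin_inj_iff[OF M.ag M.ag assms(3)] by blast
  qed
  moreover have "f ` el M = el M"
  proof
   show "f ` el M <= el M" using lin_cl[OF assms(3)] by auto
   have "I n <= f ` el M" using gc by (auto simp: I_def n_def)
   then show "el M <= f ` el M" using 1(2) by simp
  qed
  ultimately show ?thesis by (simp add: bij_betw_def)
 next
  case 2
  then have "\<forall>x \<in> el M. (f ^^ n) x = \<zero>\<^sub>M" by (auto simp: I_def)
  then show ?thesis by blast
 qed
qed

end

section \<open>Injective modules\<close>

lemma lin_factor:
 assumes "lmod R P" "lmod R M" "lmod R Q" "lin R P M p" "p ` el P = el M"
  "lin R P Q G" "!!x. x .: P ==> p x = \<zero>\<^sub>M ==> G x = \<zero>\<^sub>Q"
 shows "\<exists>g. lin R M Q g & (\<forall>x \<in> el P. g (p x) = G x)"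
proof -
 interpret P: left_module R P by fact
 interpret M: left_module R M by fact
 interpret Q: left_module R Q by fact
 have eq: "G x = G y" if xy: "x .: P" "y .: P" "p x = p y" for x y
 proof -
  have "p (x \<ominus>\<^sub>P y) = \<zero>\<^sub>M"
   using lin_diff[OF P.ag M.ag assms(4) xy(1,2)] xy
    lin_cl[OF assms(4)] M.M.diff_eq_zero by simp
  then have "G (x \<ominus>\<^sub>P y) = \<zero>\<^sub>Q" using assms(7) xy by simp
  then show ?thesis
   using lin_diff[OF P.ag Q.ag assms(6) xy(1,2)] xy
    lin_cl[OF assms(6)] Q.M.diff_eq_zero by simp
 qed
 define r where "r y = inv_into (el P) p y" for y
 have r: "r y .: P" "p (r y) = y" if "y .: M" for y
 proof -
  have "y \<in> p ` el P" using that assms(5) by simp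
  then show "r y .: P" "p (r y) = y" unfolding r_def by (rule inv_into_into, rule f_inv_into_f)
 qed
 have g: "G (r (p x)) = G x" if "x .: P" for x
  by (rule eq[OF r(1)[OF lin_cl[OF assms(4) that]] that r(2)[OF lin_cl[OF assms(4) that]]])
 have "lin R M Q (%y. G (r y))"
 proof (rule linI)
  show "G (r x) .: Q" if "x .: M" for x using r that lin_cl[OF assms(6)] by simp
  show "G (r (x \<oplus>\<^sub>M y)) = G (r x) \<oplus>\<^sub>Q G (r y)" if "x .: M" "y .: M" for x y
   using g[of "r x \<oplus>\<^sub>P r y"] that r lin_add[OF assms(4)] lin_add[OF assms(6)] by simp
  show "G (r (a \<odot>\<^sub>M x)) = a \<odot>\<^sub>Q G (r x)" if "a .: R" "x .: M" for a x
   using g[of "a \<odot>\<^sub>P r x"] that r lin_smult[OF assms(4)] lin_smult[OF assms(6)] by simp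
 qed
 then show ?thesis using g by blast
qed

definition pow_mod :: "('a, 'b, 'm) ms => nat => ('a, nat => 'b) module"
 where "pow_mod M n =
  \<lparr>carrier = (\<Pi>\<^sub>E i \<in> {..<n}. el M), monoid.mult = undefined, one = undefined,
  zero = (\<lambda>i \<in> {..<n}. \<zero>\<^sub>M), add = (%f g. \<lambda>i \<in> {..<n}. f i \<oplus>\<^sub>M g i),
  smult = (%a f. \<lambda>i \<in> {..<n}. a \<odot>\<^sub>M f i)\<rparr>"

lemma pow_mod_simps:
 "el (pow_mod M n) = (\<Pi>\<^sub>E i \<in> {..<n}. el M)"
 "zero (pow_mod M n) = (\<lambda>i \<in> {..<n}. \<zero>\<^sub>M)"
 "add (pow_mod M n) f g = (\<lambda>i \<in> {..<n}. f i \<oplus>\<^sub>M g i)"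
 "a \<odot>\<^sub>(pow_mod M n) f = (\<lambda>i \<in> {..<n}. a \<odot>\<^sub>M f i)"
 by (simp_all add: pow_mod_def)

lemma lm_pow:
 assumes "lmod R M" shows "lmod R (pow_mod M n)"
proof -
 interpret M: left_module R M by fact
 show ?thesis
 proof (rule left_moduleI)
  show "ring R" by (rule M.R.ring_axioms)
  show "abelian_group (pow_mod M n)"
  proof (rule abelian_groupI)
   show "\<exists>y \<in> el (pow_mod M n). y \<oplus>\<^sub>(pow_mod M n) x = \<zero>\<^sub>(pow_mod M n)"
    if "x .: (pow_mod M n)" for x
    using that unfolding pow_mod_simps
    by (intro bexI[of _ "\<lambda>i \<in> {..<n}. \<ominus>\<^sub>M x i"])
     (auto simp: M.M.l_neg PiE_iff fun_eq_iff restrict_def extensional_def)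
  qed (auto simp: pow_mod_simps PiE_iff M.M.a_ac restrict_def fun_eq_iff extensional_def)
 qed (auto simp: pow_mod_simps PiE_iff restrict_def fun_eq_iff extensional_def
   M.smult_l_distr M.smult_r_distr M.smult_assoc1)
qed

definition pow_in :: "('a, 'b, 'm) ms => nat => nat => 'b => (nat => 'b)"
 where "pow_in M n i x = (\<lambda>j \<in> {..<n}. if j = i then x else \<zero>\<^sub>M)"

lemma lin_pow_in:
 assumes "lmod R M" shows "lin R M (pow_mod M n) (pow_in M n i)"
proof -
 interpret M: left_module R M by fact
 show ?thesis
  by (rule linI) (auto simp: pow_mod_simps pow_in_def restrict_def fun_eq_iff PiE_iff extensional_def)
qed

lemma lin_pow_proj: "i < n ==> lin R (pow_mod M n) M (%f. f i)"
 by (rule linI) (auto simp: pow_mod_simps PiE_iff)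

lemma lin_pow_tuple: "(!!i. i < n ==> lin R N M (h i)) ==> lin R N (pow_mod M n) (%x. \<lambda>i \<in> {..<n}. h i x)"
 by (rule linI) (auto simp: pow_mod_simps PiE_iff restrict_def fun_eq_iff extensional_def lin_def)

lemma pow_expand:
 assumes "lmod R M" "f .: (pow_mod M n)"
 shows "(\<Oplus>\<^bsub>pow_mod M n\<^esub>i \<in> {..<n}. pow_in M n i (f i)) = f"
proof -
 interpret M: left_module R M by fact
 interpret P: left_module R "pow_mod M n" by (rule lm_pow[OF assms(1)])
 have fc: "f i .: M" if "i < n" for i using assms(2) that by (auto simp: pow_mod_simps)
 have pc: "(%i. pow_in M n i (f i)) \<in> {..<n} -> el (pow_mod M n)"
  using fc lin_cl[OF lin_pow_in[OF assms(1)]] by auto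
 have sc: "(\<Oplus>\<^bsub>pow_mod M n\<^esub>i \<in> {..<n}. pow_in M n i (f i)) .: (pow_mod M n)"
  by (rule P.M.finsum_closed[OF pc])
 show ?thesis
 proof (rule extensionalityI[of _ "{..<n}"])
  show "(\<Oplus>\<^bsub>pow_mod M n\<^esub>i \<in> {..<n}. pow_in M n i (f i)) \<in> extensional {..<n}" "f \<in> extensional {..<n}"
   using sc assms(2) by (auto simp: pow_mod_simps PiE_iff)
  fix j assume j: "j \<in> {..<n}"
  have "(\<Oplus>\<^bsub>pow_mod M n\<^esub>i \<in> {..<n}. pow_in M n i (f i)) j = (\<Oplus>\<^bsub>M\<^esub>i \<in> {..<n}. pow_in M n i (f i) j)"
   using lin_finsum[OF P.ag M.ag lin_pow_proj pc, of j] j by simp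
  also have "... = (\<Oplus>\<^bsub>M\<^esub>i \<in> {j}. f i)"
   using j fc by (intro M.M.add.finprod_mono_neutral_cong_right) (auto simp: pow_in_def)
  also have "... = f j" using fc j by simp
  finally show "(\<Oplus>\<^bsub>pow_mod M n\<^esub>i \<in> {..<n}. pow_in M n i (f i)) j = f j" .
 qed
qed

lemma fg_module_pow:
 assumes "fg_module R M" shows "fg_module R (pow_mod M n)"
proof -
 note M = fgD[OF assms]
 interpret M: left_module R M by (rule M)
 note P = lm_pow[OF M(1), of n]
 interpret P: left_module R "pow_mod M n" by (rule P)
 obtain S where S: "finite S" "S <= el M" "gen_submodule R M S = el M"
  using M(2) by (auto simp: fin_gen_def)
 let ?T = "(%(i, s). pow_in M n i s) ` ({..<n} \<times> S)"
 note l = lin_pow_in[OF M(1), of n]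
 have T: "?T <= el (pow_mod M n)" using S(2) lin_cl[OF l] by auto
 note W = gen_submod[OF P T]
 have in_W: "pow_in M n i x \<in> gen_submodule R (pow_mod M n) ?T" if "i < n" "x .: M" for i x
 proof -
  have "gen_submodule R M S <= {x \<in> el M. pow_in M n i x \<in> gen_submodule R (pow_mod M n) ?T}"
   using W(2) S(2) that(1)
   by (intro gen_submod(3)[OF M(1) S(2)] submodule_vimage[OF M(1) P l W(1)]) auto
  then show ?thesis using that S(3) by auto
 qed
 have "f \<in> gen_submodule R (pow_mod M n) ?T" if f: "f .: (pow_mod M n)" for f
 proof -
  have "(%i. pow_in M n i (f i)) \<in> {..<n} -> gen_submodule R (pow_mod M n) ?T"
   using in_W f by (auto simp: pow_mod_simps PiE_iff)
  from finsum_submodule(2)[OF P W(1) this] show ?thesis using pow_expand[OF M(1) f] by simp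
 qed
 then have "gen_submodule R (pow_mod M n) ?T = el (pow_mod M n)" using submod_sub[OF W(1)] by auto
 then have "fin_gen R (pow_mod M n)" unfolding fin_gen_def using T S(1) by (intro exI[of _ ?T]) auto
 then show ?thesis using P by (simp add: fg_module_def)
qed

text \<open>Injectivity is tested on submodules of free modules of finite rank only; by \<open>injmod_extend\<close> this suffices for extensions to finitely generated modules.\<close>

definition injmod :: "('a, 'r) ring_scheme => ('a, 'b, 'm) ms => bool"
 where "injmod R Q <->
  (\<forall>(d :: nat) S f. submodule S R (free_module R {..<d}) -->
   lin R ((free_module R {..<d})\<lparr>carrier := S\<rparr>) Q f -->
   (\<exists>g. lin R (free_module R {..<d}) Q g & (\<forall>s \<in> S. g s = f s)))"

lemma injmod_extend:
 assumes "injmod R Q" "lmod R Q" "fg_module R Y" "submodule X R Y" "lin R (Y .| X) Q f"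
 shows "\<exists>g. lin R Y Q g & (\<forall>x \<in> X. g x = f x)"
proof -
 note Y = fgD[OF assms(3)]
 interpret Y: left_module R Y by (rule Y)
 interpret Q: left_module R Q by fact
 obtain d g where g: "g \<in> {..<d::nat} -> el Y"
  and im: "(%c. lcomb R Y {..<d} c g) ` el (free_module R {..<d}) = el Y"
  by (rule fin_gen_lcomb[OF Y])
 let ?P = "free_module R {..<d}" let ?p = "%c. lcomb R Y {..<d} c g"
 note P = lm_free[OF Y.R.ring_axioms, of "{..<d}"] and l = Y.lin_lcomb[OF g]
 interpret P: left_module R ?P by (rule P)
 define S where "S = {c \<in> el ?P. ?p c \<in> X}"
 have S: "submodule S R ?P" unfolding S_def by (rule submodule_vimage[OF P Y(1) l assms(4)])
 have "lin R (?P .| S) (Y .| X) ?p"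
  by (intro lin_corestrict lin_restrict_dom[OF l] submod_sub[OF S]) (auto simp: S_def)
 from lin_comp[OF this assms(5)] obtain G where G: "lin R ?P Q G" "!!s. s \<in> S ==> G s = f (?p s)"
  using assms(1) S unfolding injmod_def by blast
 have fz: "f \<zero>\<^sub>Y = \<zero>\<^sub>Q"
 proof -
  interpret X: left_module R "Y .| X" by (rule submodule_left_module[OF Y(1) assms(4)])
  show ?thesis using lin_zero[OF X.ag Q.ag assms(5)] by simp
 qed
 have "\<exists>h. lin R Y Q h & (\<forall>c \<in> el ?P. h (?p c) = G c)"
  by (rule lin_factor[OF P Y(1) assms(2) l im G(1)])
   (use G(2) fz submodule_zero[OF assms(4)] in "auto simp: S_def")
 then obtain h where h: "lin R Y Q h" "!!c. c .: ?P ==> h (?p c) = G c" by blast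
 have "h x = f x" if x: "x \<in> X" for x
 proof -
  obtain c where c: "c .: ?P" "x = ?p c"
   using im submod_sub[OF assms(4)] x by (metis (no_types, lifting) imageE subsetD)
  then show ?thesis using h(2)[OF c(1)] G(2)[of c] x by (simp add: S_def)
 qed
 then show ?thesis using h(1) by blast
qed

lemma injmod_pow:
 assumes "injmod R Q" shows "injmod R (pow_mod Q n)"
 unfolding injmod_def
proof (intro allI impI)
 fix d :: nat and S f
 let ?P = "free_module R {..<d}"
 assume S: "submodule S R ?P" and f: "lin R (?P .| S) (pow_mod Q n) f"
 have "\<exists>g. lin R ?P Q g & (\<forall>s \<in> S. g s = f s i)" if "i < n" for i
  using assms S lin_comp[OF f lin_pow_proj[OF that]] unfolding injmod_def by blast
 then obtain g where g: "!!i. i < n ==> lin R ?P Q (g i)" "!!i s. i < n ==> s \<in> S ==> g i s = f s i"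
  by metis
 have "(\<lambda>i \<in> {..<n}. g i s) = f s" if "s \<in> S" for s
  using lin_cl[OF f, of s] that g(2)
  by (intro extensionalityI[of _ "{..<n}"]) (auto simp: pow_mod_simps PiE_iff)
 then show "\<exists>g. lin R ?P (pow_mod Q n) g & (\<forall>s \<in> S. g s = f s)"
  using lin_pow_tuple[of n R ?P Q g] g(1) by (intro exI[of _ "%x. \<lambda>i \<in> {..<n}. g i x"]) auto
qed

text \<open>Over a hereditary ring quotients of injectives are injective: a map from a submodule of \<open>R\<^sup>d\<close>, which is projective, lifts to \<open>Q\<close> and is extended there.\<close>

lemma injmod_image:
 assumes "hereditary R" "ring R" "injmod R Q" "fg_module R Q" "fg_module R N" "lin R Q N p"
  "p ` el Q = el N"
 shows "injmod R N"
 unfolding injmod_def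
proof (intro allI impI)
 fix d :: nat and S f
 let ?P = "free_module R {..<d}"
 assume S: "submodule S R ?P" and f: "lin R (?P .| S) N f"
 obtain h where h: "lin R (?P .| S) Q h" "\<forall>x \<in> S. p (h x) = f x"
  using hereditary_lift[OF assms(1,2) S assms(4-7) f] by blast
 obtain g where g: "lin R ?P Q g" "\<forall>s \<in> S. g s = h s"
  using assms(3) S h(1) unfolding injmod_def by blast
 then show "\<exists>g. lin R ?P N g & (\<forall>s \<in> S. g s = f s)"
  using h(2) lin_comp[OF g(1) assms(6)] by (intro exI[of _ "%x. p (g x)"]) auto
qed

lemma injmod_summand:
 assumes "injmod R Q" "lmod R Q" "fg_module R Y" "lin R Q Y j" "inj_on j (el Q)"
 shows "\<exists>w. lin R Y Q w & (\<forall>x \<in> el Q. w (j x) = x)"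
proof -
 note Y = fgD[OF assms(3)]
 let ?X = "j ` el Q"
 have X: "submodule ?X R Y" by (rule submodule_image[OF assms(2) Y(1) assms(4) submodule_carrier[OF assms(2)]])
 have bij: "bij_betw j (el Q) (el (Y .| ?X))" using assms(5) by (simp add: bij_betw_def)
 have "lin R (Y .| ?X) Q (inv_into (el Q) j)"
  by (rule lin_inv_into[OF assms(2) lin_corestrict[OF assms(4)] bij]) simp
 from injmod_extend[OF assms(1-3) X this]
 obtain g where "lin R Y Q g" "!!x. x \<in> ?X ==> g x = inv_into (el Q) j x" by blast
 then show ?thesis using assms(5) by auto
qed

context fin_dim_algebra
begin

abbreviation "D \<equiv> dual_module F A"
abbreviation "L \<equiv> regular_module A"

lemma F_add_swap: "a .: F ==> b .: F ==> c .: F ==> d .: F ==>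
  (a \<oplus> b) \<oplus> (c \<oplus> d) = (a \<oplus> c) \<oplus> (b \<oplus> d)"
 by (rule abelian_group.add_swap[OF abelianF])

lemmas F_r_distr = semiring.r_distr[OF semiringF]
 and F_l_distr = semiring.l_distr[OF semiringF]
 and F_minus_add = abelian_group.minus_add[OF abelianF]
 and F_r_minus = ring.r_minus[OF ringF]
 and F_l_neg = abelian_group.l_neg[OF abelianF]
 and F_a_ac = abelian_monoid.a_ac[OF abelian_group.axioms(1)[OF abelianF]]
 and F_l_zero = abelian_monoid.l_zero[OF abelian_group.axioms(1)[OF abelianF]]
 and A_r_distr = semiring.r_distr[OF semiringA]
 and A_l_distr = semiring.l_distr[OF semiringA]
 and A_m_assoc = monoid.m_assoc[OF monoidA]
 and A_finsum_cong' = abelian_monoid.finsum_cong'[OF abelian_group.axioms(1)[OF abelianA]]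
 and A_finsum_closed = abelian_monoid.finsum_closed[OF abelian_group.axioms(1)[OF abelianA]]
 and F_finsum_cong' = abelian_monoid.finsum_cong'[OF abelian_group.axioms(1)[OF abelianF]]
 and F_m_comm = comm_monoid.m_comm[OF comm_monoidF]

lemma lm_L: "lmod A L" by (rule lm_regular[OF ringA])

lemma dual_simps:
 "el D = mod_hom F A (regular_module F)"
 "ph \<oplus>\<^sub>D ps = (\<lambda>x \<in> el A. ph x \<oplus> ps x)"
 "\<zero>\<^sub>D = (\<lambda>x \<in> el A. \<zero>)"
 "a \<odot>\<^sub>D ph = (\<lambda>x \<in> el A. ph (x \<otimes>\<^sub>A a))"
 by (simp_all add: dual_module_def)

lemma dual_lin: "ph .: D ==> lin F A (regular_module F) ph"
 by (simp add: dual_simps mod_hom_iff)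

lemma dual_closed: "ph .: D ==> x .: A ==> ph x .: F"
 using lin_cl[OF dual_lin] by simp

lemma dual_add: "ph .: D ==> x .: A ==> y .: A ==> ph (x \<oplus>\<^sub>A y) = ph x \<oplus> ph y"
 using lin_add[OF dual_lin] by simp

lemma dual_smult: "ph .: D ==> c .: F ==> x .: A ==> ph (c \<odot>\<^sub>A x) = c \<otimes> ph x"
 using lin_smult[OF dual_lin] by simp

lemma dual_eqI: "ph .: D ==> ps .: D ==> (!!x. x .: A ==> ph x = ps x) ==> ph = ps"
 unfolding dual_simps mod_hom_iff by (auto intro: extensionalityI)

lemma dualI:
 assumes "!!x. x .: A ==> f x .: F"
  and "!!x y. x .: A ==> y .: A ==> f (x \<oplus>\<^sub>A y) = f x \<oplus> f y"
  and "!!c x. c .: F ==> x .: A ==> f (c \<odot>\<^sub>A x) = c \<otimes> f x"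
 shows "(\<lambda>x \<in> el A. f x) .: D"
 unfolding dual_simps
 by (rule restrict_mod_hom[OF lm_F_A linI]) (simp_all add: assms)

lemma lm_D: "lmod A D"
proof (rule left_moduleI[OF ringA])
 have add: "ph \<oplus>\<^sub>D ps .: D" if "ph .: D" "ps .: D" for ph ps
  unfolding dual_simps(2) using that
  by (intro dualI) (auto simp: dual_closed dual_add dual_smult F_add_swap F_r_distr)
 have zero: "\<zero>\<^sub>D .: D"
  unfolding dual_simps(3) by (intro dualI) auto
 have sm: "a \<odot>\<^sub>D ph .: D" if "a .: A" "ph .: D" for a ph
  unfolding dual_simps(4) using that
  by (intro dualI) (auto simp: dual_closed dual_add dual_smult A_l_distr smult_mult_left)
 show "abelian_group D"
 proof (rule abelian_groupI)
  show "\<exists>ps \<in> el D. ps \<oplus>\<^sub>D ph = \<zero>\<^sub>D" if p: "ph .: D" for ph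
  proof (rule bexI)
   show m: "(\<lambda>x \<in> el A. \<ominus> ph x) .: D"
    using p by (intro dualI) (auto simp: dual_closed dual_add dual_smult F_minus_add F_r_minus)
   show "(\<lambda>x \<in> el A. \<ominus> ph x) \<oplus>\<^sub>D ph = \<zero>\<^sub>D"
    by (rule dual_eqI[OF add[OF m p] zero]) (use p in "auto simp: dual_simps(2,3) dual_closed F_l_neg")
  qed
  show "ph \<oplus>\<^sub>D ps \<oplus>\<^sub>D \<chi> = ph \<oplus>\<^sub>D (ps \<oplus>\<^sub>D \<chi>)" if "ph .: D" "ps .: D" "\<chi> .: D" for ph ps \<chi>
   by (rule dual_eqI) (use that in \<open>auto intro!: add\<close>, auto simp: dual_simps(2) dual_closed F_a_ac)
  show "ph \<oplus>\<^sub>D ps = ps \<oplus>\<^sub>D ph" if "ph .: D" "ps .: D" for ph ps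
   by (rule dual_eqI) (use that in \<open>auto intro!: add\<close>, auto simp: dual_simps(2) dual_closed F_a_ac)
  show "\<zero>\<^sub>D \<oplus>\<^sub>D ph = ph" if "ph .: D" for ph
   by (rule dual_eqI) (use that zero in \<open>auto intro!: add\<close>, auto simp: dual_simps(2,3) dual_closed F_l_zero)
 qed (use add zero in auto)
 show "a \<odot>\<^sub>D ph .: D" if "a .: A" "ph .: D" for a ph by (rule sm[OF that])
 show "(a \<oplus>\<^sub>A b) \<odot>\<^sub>D ph = a \<odot>\<^sub>D ph \<oplus>\<^sub>D b \<odot>\<^sub>D ph" if "a .: A" "b .: A" "ph .: D" for a b ph
  by (rule dual_eqI)
   (use that in \<open>auto intro!: add sm\<close>, auto simp: dual_simps(2,4) dual_add A_r_distr)
 show "a \<odot>\<^sub>D (ph \<oplus>\<^sub>D ps) = a \<odot>\<^sub>D ph \<oplus>\<^sub>D a \<odot>\<^sub>D ps" if "a .: A" "ph .: D" "ps .: D" for a ph ps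
  by (rule dual_eqI) (use that in \<open>auto intro!: add sm\<close>, auto simp: dual_simps(2,4))
 show "(a \<otimes>\<^sub>A b) \<odot>\<^sub>D ph = a \<odot>\<^sub>D (b \<odot>\<^sub>D ph)" if "a .: A" "b .: A" "ph .: D" for a b ph
  by (rule dual_eqI) (use that in \<open>auto intro!: sm\<close>, auto simp: dual_simps(4) A_m_assoc)
 show "\<one>\<^sub>A \<odot>\<^sub>D ph = ph" if "ph .: D" for ph
  by (rule dual_eqI) (use that in \<open>auto intro!: sm\<close>, auto simp: dual_simps(4))
qed

end

section \<open>The dual of the algebra\<close>

context fin_dim_algebra
begin

lemma smult_scalar:
 assumes "lmod A M" "c .: F" "x .: A" "m .: M"
 shows "(c \<odot>\<^sub>A x) \<odot>\<^sub>M m = (c \<odot>\<^sub>A \<one>\<^sub>A) \<odot>\<^sub>M (x \<odot>\<^sub>M m)"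
 using left_module.smult_assoc1[OF assms(1), of "c \<odot>\<^sub>A \<one>\<^sub>A" x m] assms by (simp add: scalar_mult)

text \<open>A basis of \<open>A\<close> and its dual basis in \<open>D\<close>.\<close>

lemma coordinates_A:
 obtains n :: nat and b ps where "b \<in> {..<n} -> el A" "!!i. i < n ==> ps i .: D"
  "!!a. a .: A ==> (\<Oplus>\<^bsub>A\<^esub>i \<in> {..<n}. ps i a \<odot>\<^sub>A b i) = a"
  "!!ph. ph .: D ==> (\<Oplus>\<^bsub>D\<^esub>i \<in> {..<n}. (ph (b i) \<odot>\<^sub>A \<one>\<^sub>A) \<odot>\<^sub>D ps i) = ph"
proof -
 interpret DD: left_module A D by (rule lm_D)
 obtain n :: nat and b ps where b: "b \<in> {..<n} -> el A"
  and psi: "!!i. i < n ==> lin F A (regular_module F) (ps i)"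
  and ex: "!!v. v .: A ==> (\<Oplus>\<^bsub>A\<^esub>i \<in> {..<n}. ps i v \<odot>\<^sub>A b i) = v"
  by (rule coordinates_exist[OF fieldF lm_F_A fin_dim]) (rule that)
 define ps' where "ps' i = (\<lambda>x \<in> el A. ps i x)" for i
 have psi': "ps' i .: D" if "i < n" for i
  unfolding ps'_def dual_simps by (rule restrict_mod_hom[OF lm_F_A psi[OF that]])
 have pc: "ps i x .: F" if "i < n" "x .: A" for i x
  using lin_cl[OF psi[OF that(1)] that(2)] by simp
 have bc: "b i .: A" if "i < n" for i using b that by auto
 show ?thesis
 proof (rule that[of b n ps'])
  show "b \<in> {..<n} -> el A" by fact
  show "ps' i .: D" if "i < n" for i by (rule psi'[OF that])
  show "(\<Oplus>\<^bsub>A\<^esub>i \<in> {..<n}. ps' i a \<odot>\<^sub>A b i) = a" if a: "a .: A" for a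
  proof -
   have "(\<Oplus>\<^bsub>A\<^esub>i \<in> {..<n}. ps' i a \<odot>\<^sub>A b i) = (\<Oplus>\<^bsub>A\<^esub>i \<in> {..<n}. ps i a \<odot>\<^sub>A b i)"
    using a bc pc by (intro A_finsum_cong') (auto simp: ps'_def)
   then show ?thesis using ex[OF a] by simp
  qed
  show "(\<Oplus>\<^bsub>D\<^esub>i \<in> {..<n}. (ph (b i) \<odot>\<^sub>A \<one>\<^sub>A) \<odot>\<^sub>D ps' i) = ph" if p: "ph .: D" for ph
  proof (rule dual_eqI)
   have cl: "(%i. (ph (b i) \<odot>\<^sub>A \<one>\<^sub>A) \<odot>\<^sub>D ps' i) \<in> {..<n} -> el D"
    using psi' dual_closed[OF p] bc by auto
   show "(\<Oplus>\<^bsub>D\<^esub>i \<in> {..<n}. (ph (b i) \<odot>\<^sub>A \<one>\<^sub>A) \<odot>\<^sub>D ps' i) .: D" by (rule DD.M.finsum_closed[OF cl])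
   fix x assume x: "x .: A"
   have "(\<Oplus>\<^bsub>D\<^esub>i \<in> {..<n}. (ph (b i) \<odot>\<^sub>A \<one>\<^sub>A) \<odot>\<^sub>D ps' i) x =
     (\<Oplus>i \<in> {..<n}. ((ph (b i) \<odot>\<^sub>A \<one>\<^sub>A) \<odot>\<^sub>D ps' i) x)"
    using x cl by (intro add_finsum[OF DD.ag abelianF, of "%ph. ph x"])
     (auto simp: dual_closed dual_simps(2))
   also have "... = (\<Oplus>i \<in> {..<n}. ph (ps i x \<odot>\<^sub>A b i))"
    using x bc pc dual_closed[OF p] p
    by (intro F_finsum_cong')
     (auto simp: dual_simps(4) ps'_def mult_scalar dual_smult lin_smult[OF psi] F_m_comm)
   also have "... = ph (\<Oplus>\<^bsub>A\<^esub>i \<in> {..<n}. ps i x \<odot>\<^sub>A b i)"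
    using bc pc x p
    by (intro add_finsum[OF abelianA abelianF, of ph, symmetric])
     (auto simp: dual_closed dual_add)
   finally show "(\<Oplus>\<^bsub>D\<^esub>i \<in> {..<n}. (ph (b i) \<odot>\<^sub>A \<one>\<^sub>A) \<odot>\<^sub>D ps' i) x = ph x" using ex[OF x] by simp
  qed (rule p)
 qed
qed

lemma fg_module_D: "fg_module A D"
proof -
 interpret DD: left_module A D by (rule lm_D)
 obtain n :: nat and b ps where b: "b \<in> {..<n} -> el A" and psi: "!!i. i < n ==> ps i .: D"
  and ex: "!!ph. ph .: D ==> (\<Oplus>\<^bsub>D\<^esub>i \<in> {..<n}. (ph (b i) \<odot>\<^sub>A \<one>\<^sub>A) \<odot>\<^sub>D ps i) = ph"
  by (rule coordinates_A) (rule that)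
 let ?S = "ps ` {..<n}"
 have S: "?S <= el D" using psi by auto
 note W = gen_submod[OF lm_D S]
 have "ph \<in> gen_submodule A D ?S" if p: "ph .: D" for ph
 proof -
  have bc: "ph (b i) .: F" if "i < n" for i using b dual_closed[OF p] that by auto
  have "(%i. (ph (b i) \<odot>\<^sub>A \<one>\<^sub>A) \<odot>\<^sub>D ps i) \<in> {..<n} -> gen_submodule A D ?S"
   using W(2) bc by (auto intro!: submodule_smult[OF W(1)])
  from finsum_submodule(2)[OF lm_D W(1) this] show ?thesis using ex[OF p] by simp
 qed
 then have "gen_submodule A D ?S = el D" using submod_sub[OF W(1)] by auto
 then have "fin_gen A D" unfolding fin_gen_def using S by (intro exI[of _ ?S]) auto
 then show ?thesis by (simp add: fg_module_def lm_D)
qed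

lemma fg_module_L: "fg_module A L"
proof -
 interpret LL: left_module A L by (rule lm_L)
 have S: "{\<one>\<^sub>A} <= el L" by simp
 note W = gen_submod[OF lm_L S]
 have "a \<in> gen_submodule A L {\<one>\<^sub>A}" if "a .: A" for a
  using submodule_smult[OF W(1) that, of "\<one>\<^sub>A"] W(2) that by simp
 then have "gen_submodule A L {\<one>\<^sub>A} = el L" using submod_sub[OF W(1)] by auto
 then have "fin_gen A L" unfolding fin_gen_def using S by (intro exI[of _ "{\<one>\<^sub>A}"]) auto
 then show ?thesis by (simp add: fg_module_def lm_L)
qed

lemma dual_rmult_lin:
 assumes "b .: A" shows "lin A D D (%ph. dual_rmult A ph b)"
proof -
 interpret DD: left_module A D by (rule lm_D)
 have cl: "dual_rmult A ph b .: D" if "ph .: D" for ph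
  unfolding dual_rmult_def using that assms
  by (intro dualI) (auto simp: dual_closed dual_add dual_smult A_r_distr smult_mult_right)
 show ?thesis
 proof (rule linI)
  show "dual_rmult A (ph \<oplus>\<^sub>D ps) b = dual_rmult A ph b \<oplus>\<^sub>D dual_rmult A ps b"
   if "ph .: D" "ps .: D" for ph ps
   by (rule dual_eqI) (use that cl assms in \<open>simp_all\<close>, simp add: dual_rmult_def dual_simps(2))
  show "dual_rmult A (a \<odot>\<^sub>D ph) b = a \<odot>\<^sub>D dual_rmult A ph b"
   if "a .: A" "ph .: D" for a ph
   by (rule dual_eqI) (use that cl assms in \<open>simp_all\<close>, simp add: dual_rmult_def dual_simps(4) A_m_assoc)
 qed (rule cl)
qed

lemma dual_rmult_closed: "b .: A ==> ph .: D ==> dual_rmult A ph b .: D"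
 using lin_cl[OF dual_rmult_lin] .

lemma dual_rmult_add:
 assumes "a .: A" "b .: A" "ph .: D"
 shows "dual_rmult A ph (a \<oplus>\<^sub>A b) = dual_rmult A ph a \<oplus>\<^sub>D dual_rmult A ph b"
proof -
 interpret DD: left_module A D by (rule lm_D)
 show ?thesis
  by (rule dual_eqI) (use assms dual_rmult_closed in \<open>simp_all\<close>,
   simp add: dual_rmult_def dual_simps(2) A_l_distr dual_add)
qed

lemma dual_rmult_mult:
 assumes "a .: A" "b .: A" "ph .: D"
 shows "dual_rmult A ph (a \<otimes>\<^sub>A b) = dual_rmult A (dual_rmult A ph a) b"
proof -
 show ?thesis
  by (rule dual_eqI) (use assms dual_rmult_closed in \<open>simp_all\<close>, simp add: dual_rmult_def A_m_assoc)
qed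

lemma dual_rmult_one: "ph .: D ==> dual_rmult A ph \<one>\<^sub>A = ph"
proof -
 show "ph .: D ==> dual_rmult A ph \<one>\<^sub>A = ph"
  by (rule dual_eqI) (simp_all add: dual_rmult_closed, simp add: dual_rmult_def)
qed

lemma dual_separates:
 assumes "b .: A" "!!ph. ph .: D ==> ph b = \<zero>"
 shows "b = \<zero>\<^sub>A"
proof -
 obtain n :: nat and e ps where e: "e \<in> {..<n} -> el A" and psi: "!!i. i < n ==> ps i .: D"
  and ex: "!!a. a .: A ==> (\<Oplus>\<^bsub>A\<^esub>i \<in> {..<n}. ps i a \<odot>\<^sub>A e i) = a"
  by (rule coordinates_A) (rule that)
 have "(\<Oplus>\<^bsub>A\<^esub>i \<in> {..<n}. ps i b \<odot>\<^sub>A e i) = (\<Oplus>\<^bsub>A\<^esub>i \<in> {..<n}. \<zero>\<^sub>A)"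
 proof (rule A_finsum_cong')
  fix i assume "i \<in> {..<n}"
  then have "ps i b = \<zero>" "e i .: A" using e assms(2)[OF psi] by auto
  then show "ps i b \<odot>\<^sub>A e i = \<zero>\<^sub>A" by simp
 qed auto
 then show ?thesis using ex[OF assms(1)] by simp
qed

text \<open>An endomorphism \<open>w\<close> is determined by the functional \<open>\<phi> \<mapsto> w(\<phi>)(1)\<close>, which is evaluation at some \<open>a\<close> because \<open>A\<close> is its own bidual.\<close>

lemma dual_endo:
 assumes "lin A D D w"
 shows "\<exists>a \<in> el A. \<forall>ph \<in> el D. w ph = dual_rmult A ph a"
proof -
 interpret DD: left_module A D by (rule lm_D)
 obtain n :: nat and b ps where b: "b \<in> {..<n} -> el A" and psi: "!!i. i < n ==> ps i .: D"
  and ex: "!!ph. ph .: D ==> (\<Oplus>\<^bsub>D\<^esub>i \<in> {..<n}. (ph (b i) \<odot>\<^sub>A \<one>\<^sub>A) \<odot>\<^sub>D ps i) = ph"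
  by (rule coordinates_A) (rule that)
 have bc: "b i .: A" if "i < n" for i using b that by auto
 have wc: "w ph .: D" if "ph .: D" for ph using lin_cl[OF assms that] .
 define a where "a = (\<Oplus>\<^bsub>A\<^esub>i \<in> {..<n}. w (ps i) \<one>\<^sub>A \<odot>\<^sub>A b i)"
 have wpc: "w (ps i) \<one>\<^sub>A .: F" if "i < n" for i using dual_closed[OF wc[OF psi[OF that]]] by simp
 have a: "a .: A" unfolding a_def using wpc bc by (intro A_finsum_closed) auto
 have one: "w ph \<one>\<^sub>A = ph a" if p: "ph .: D" for ph
 proof -
  have pc: "ph (b i) .: F" if "i < n" for i using dual_closed[OF p bc[OF that]] .
  have cl: "(%i. (ph (b i) \<odot>\<^sub>A \<one>\<^sub>A) \<odot>\<^sub>D ps i) \<in> {..<n} -> el D"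
   using psi pc by auto
  have "w ph \<one>\<^sub>A = w (\<Oplus>\<^bsub>D\<^esub>i \<in> {..<n}. (ph (b i) \<odot>\<^sub>A \<one>\<^sub>A) \<odot>\<^sub>D ps i) \<one>\<^sub>A" by (simp add: ex[OF p])
  also have "... = (\<Oplus>i \<in> {..<n}. w ((ph (b i) \<odot>\<^sub>A \<one>\<^sub>A) \<odot>\<^sub>D ps i) \<one>\<^sub>A)"
   using cl by (intro add_finsum[OF DD.ag abelianF, of "%ph. w ph \<one>\<^sub>A"])
    (auto simp: lin_add[OF assms] dual_closed wc, simp add: dual_simps(2))
  also have "... = (\<Oplus>i \<in> {..<n}. ph (w (ps i) \<one>\<^sub>A \<odot>\<^sub>A b i))"
  proof (rule F_finsum_cong')
   show "(%i. ph (w (ps i) \<one>\<^sub>A \<odot>\<^sub>A b i)) \<in> {..<n} -> el F"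
    using wpc bc by (auto intro!: dual_closed[OF p])
   fix i assume "i \<in> {..<n}"
   then have i: "i < n" by simp
   have "w ((ph (b i) \<odot>\<^sub>A \<one>\<^sub>A) \<odot>\<^sub>D ps i) \<one>\<^sub>A = ((ph (b i) \<odot>\<^sub>A \<one>\<^sub>A) \<odot>\<^sub>D w (ps i)) \<one>\<^sub>A"
    using lin_smult[OF assms _ psi[OF i], of "ph (b i) \<odot>\<^sub>A \<one>\<^sub>A"] pc[OF i] by simp
   also have "... = w (ps i) (ph (b i) \<odot>\<^sub>A \<one>\<^sub>A)" using pc[OF i] by (simp add: dual_simps(4) mult_scalar)
   also have "... = ph (b i) \<otimes> w (ps i) \<one>\<^sub>A" using pc[OF i] by (simp add: dual_smult wc psi i)
   also have "... = ph (w (ps i) \<one>\<^sub>A \<odot>\<^sub>A b i)" using p bc[OF i] pc[OF i] wpc[OF i] by (simp add: dual_smult F_m_comm)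
   finally show "w ((ph (b i) \<odot>\<^sub>A \<one>\<^sub>A) \<odot>\<^sub>D ps i) \<one>\<^sub>A = ph (w (ps i) \<one>\<^sub>A \<odot>\<^sub>A b i)" .
  qed simp
  also have "... = ph a"
   unfolding a_def using bc wpc p
   by (intro add_finsum[OF abelianA abelianF, of ph, symmetric]) (auto simp: dual_closed dual_add)
  finally show ?thesis .
 qed
 have "w ph = dual_rmult A ph a" if p: "ph .: D" for ph
 proof (rule dual_eqI[OF wc[OF p] dual_rmult_closed[OF a p]])
  fix x assume x: "x .: A"
  have "w ph x = (x \<odot>\<^sub>D w ph) \<one>\<^sub>A" using x by (simp add: dual_simps(4))
  also have "... = w (x \<odot>\<^sub>D ph) \<one>\<^sub>A" using lin_smult[OF assms x p] by simp
  also have "... = (x \<odot>\<^sub>D ph) a" using one x p by simp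
  also have "... = dual_rmult A ph a x" using x a by (simp add: dual_simps(4) dual_rmult_def)
  finally show "w ph x = dual_rmult A ph a x" .
 qed
 then show ?thesis using a by blast
qed

text \<open>Linear maps \<open>M \<rightarrow> D\<close> are the same as functionals on \<open>M\<close>, and functionals extend from subspaces.\<close>

lemma injmod_D: "injmod A D"
 unfolding injmod_def
proof (intro allI impI)
 fix d :: nat and S f
 let ?P = "free_module A {..<d}"
 assume S: "submodule S A ?P" and f: "lin A (?P .| S) D f"
 note fgP = fg_module_free[OF ringA, of d]
 note P = fgD(1)[OF fgP]
 interpret P: left_module A ?P by (rule P)
 have Sc: "s .: ?P" if "s \<in> S" for s using submod_sub[OF S] that by auto
 have fc: "f s .: D" if "s \<in> S" for s using lin_cl[OF f] that by simp
 have l: "lin F ((rs A ?P)\<lparr>carrier := S\<rparr>) (regular_module F) (%s. f s \<one>\<^sub>A)"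
 proof (rule linI)
  show "f s \<one>\<^sub>A .: (regular_module F)"
   if "s .: ((rs A ?P)\<lparr>carrier := S\<rparr>)" for s
   using that dual_closed[OF fc[of s], of "\<one>\<^sub>A"] by simp
  show "f (s \<oplus>\<^bsub>(rs A ?P)\<lparr>carrier := S\<rparr>\<^esub> t) \<one>\<^sub>A = f s \<one>\<^sub>A \<oplus>\<^sub>(regular_module F) f t \<one>\<^sub>A"
   if "s .: ((rs A ?P)\<lparr>carrier := S\<rparr>)"
    "t .: ((rs A ?P)\<lparr>carrier := S\<rparr>)" for s t
   using that lin_add[OF f, of s t] by (simp add: dual_simps(2))
  show "f (c \<odot>\<^bsub>(rs A ?P)\<lparr>carrier := S\<rparr>\<^esub> s) \<one>\<^sub>A = c \<odot>\<^sub>(regular_module F) f s \<one>\<^sub>A"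
   if "c .: F" "s .: ((rs A ?P)\<lparr>carrier := S\<rparr>)" for c s
   using that lin_smult[OF f, of "c \<odot>\<^sub>A \<one>\<^sub>A" s] fc[of s]
   by (simp add: dual_simps(4) dual_smult mult_scalar)
 qed
 have "\<exists>h. lin F (rs A ?P) (regular_module F) h & (\<forall>s \<in> S. h s = f s \<one>\<^sub>A)"
 proof (rule functional_extend[OF fieldF lm_rs[OF P] fin_gen_rs[OF fgP] submodule_rs[OF P S]
    lm_regular[OF ringF] l])
  fix h assume "lin F (rs A ?P) (regular_module F) h" "!!s. s \<in> S ==> h s = f s \<one>\<^sub>A"
  then show ?thesis by blast
 qed
 then obtain h where h: "lin F (rs A ?P) (regular_module F) h" "!!s. s \<in> S ==> h s = f s \<one>\<^sub>A"
  by blast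
 have hc: "h p .: F" if "p .: ?P" for p using lin_cl[OF h(1)] that by simp
 define g where "g p = (\<lambda>x \<in> el A. h (x \<odot>\<^sub>?P p))" for p
 have gc: "g p .: D" if "p .: ?P" for p
  unfolding g_def
 proof (rule dualI)
  show "h ((x \<oplus>\<^sub>A y) \<odot>\<^sub>?P p) = h (x \<odot>\<^sub>?P p) \<oplus> h (y \<odot>\<^sub>?P p)" if "x .: A" "y .: A" for x y
   using that \<open>p .: ?P\<close> lin_add[OF h(1), of "x \<odot>\<^sub>?P p" "y \<odot>\<^sub>?P p"] by (simp add: P.smult_l_distr)
  show "h ((c \<odot>\<^sub>A x) \<odot>\<^sub>?P p) = c \<otimes> h (x \<odot>\<^sub>?P p)" if "c .: F" "x .: A" for c x
   using that \<open>p .: ?P\<close> lin_smult[OF h(1) that(1), of "x \<odot>\<^sub>?P p"]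
    smult_scalar[OF P that, of p] by simp
 qed (use that hc in simp)
 have "lin A ?P D g"
 proof (rule linI)
  show "g (p \<oplus>\<^sub>?P q) = g p \<oplus>\<^sub>D g q" if "p .: ?P" "q .: ?P" for p q
   using that lin_add[OF h(1)] by (auto simp: g_def dual_simps(2) P.smult_r_distr)
  show "g (a \<odot>\<^sub>?P p) = a \<odot>\<^sub>D g p" if "a .: A" "p .: ?P" for a p
   using that by (auto simp: g_def dual_simps(4) P.smult_assoc1)
 qed (rule gc)
 moreover have "g s = f s" if s: "s \<in> S" for s
 proof (rule dual_eqI[OF gc[OF Sc[OF s]] fc[OF s]])
  fix x assume x: "x .: A"
  have "g s x = h (x \<odot>\<^sub>?P s)" using x by (simp add: g_def)
  also have "... = f (x \<odot>\<^sub>?P s) \<one>\<^sub>A" using h(2) submodule_smult[OF S x s] by simp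
  also have "... = (x \<odot>\<^sub>D f s) \<one>\<^sub>A" using lin_smult[OF f x, of s] s by simp
  also have "... = f s x" using x by (simp add: dual_simps(4))
  finally show "g s x = f s x" .
 qed
 ultimately show "\<exists>g. lin A ?P D g & (\<forall>s \<in> S. g s = f s)" by blast
qed

text \<open>The functional \<open>ps i\<close> of a basis gives the map \<open>m \<mapsto> (x \<mapsto> ps i (xm))\<close> to \<open>D\<close>; at \<open>x = 1\<close> these separate the points of \<open>M\<close>.\<close>

lemma embed_in_dual_power:
 fixes M :: "('a, 'c, 'n) ms"
 assumes "fg_module A M"
 obtains n j where "lin A M (pow_mod D n) j" "inj_on j (el M)"
proof -
 note M = fgD[OF assms]
 interpret M: left_module A M by (rule M)
 note M' = lm_rs[OF M(1)]
 interpret M': left_module F "rs A M" by (rule M')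
 obtain n :: nat and b ps where b: "b \<in> {..<n} -> el (rs A M)"
  and psi: "!!i. i < n ==> lin F (rs A M) (regular_module F) (ps i)"
  and ex: "!!v. v .: (rs A M) ==>
   (\<Oplus>\<^bsub>rs A M\<^esub>i \<in> {..<n}. ps i v \<odot>\<^sub>(rs A M) b i) = v"
  by (rule coordinates_exist[OF fieldF M' fin_gen_rs[OF assms]]) (rule that)
 define h where "h i m = (\<lambda>x \<in> el A. ps i (x \<odot>\<^sub>M m))" for i m
 have pc: "ps i m .: F" if "i < n" "m .: M" for i m
  using lin_cl[OF psi[OF that(1)]] that(2) by simp
 have h: "lin A M D (h i)" if i: "i < n" for i
 proof (rule linI)
  show "h i m .: D" if "m .: M" for m
   unfolding h_def
  proof (rule dualI)
   show "ps i ((x \<oplus>\<^sub>A y) \<odot>\<^sub>M m) = ps i (x \<odot>\<^sub>M m) \<oplus> ps i (y \<odot>\<^sub>M m)" if "x .: A" "y .: A" for x y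
    using that \<open>m .: M\<close> lin_add[OF psi[OF i], of "x \<odot>\<^sub>M m" "y \<odot>\<^sub>M m"] by (simp add: M.smult_l_distr)
   show "ps i ((c \<odot>\<^sub>A x) \<odot>\<^sub>M m) = c \<otimes> ps i (x \<odot>\<^sub>M m)" if "c .: F" "x .: A" for c x
    using that \<open>m .: M\<close> lin_smult[OF psi[OF i] that(1), of "x \<odot>\<^sub>M m"]
     smult_scalar[OF M(1) that, of m] by simp
  qed (use that pc i in simp)
  show "h i (m \<oplus>\<^sub>M m') = h i m \<oplus>\<^sub>D h i m'" if "m .: M" "m' .: M" for m m'
   using that lin_add[OF psi[OF i]] by (auto simp: h_def dual_simps(2) M.smult_r_distr)
  show "h i (a \<odot>\<^sub>M m) = a \<odot>\<^sub>D h i m" if "a .: A" "m .: M" for a m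
   using that by (auto simp: h_def dual_simps(4) M.smult_assoc1)
 qed
 have j: "lin A M (pow_mod D n) (%x. \<lambda>i \<in> {..<n}. h i x)" by (rule lin_pow_tuple[OF h])
 have "m = \<zero>\<^sub>M" if m: "m .: M" "(\<lambda>i \<in> {..<n}. h i m) = \<zero>\<^sub>(pow_mod D n)" for m
 proof -
  have "ps i m = \<zero>" if "i < n" for i
  proof -
   have "h i m = \<zero>\<^sub>D" using fun_cong[OF m(2), of i] that by (simp add: pow_mod_simps)
   moreover have "h i m \<one>\<^sub>A = ps i m" using m(1) by (simp add: h_def)
   moreover have "\<zero>\<^sub>D \<one>\<^sub>A = \<zero>" by (simp add: dual_simps(3))
   ultimately show ?thesis by simp
  qed
  then have "(\<Oplus>\<^bsub>rs A M\<^esub>i \<in> {..<n}. ps i m \<odot>\<^sub>(rs A M) b i) =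
    (\<Oplus>\<^bsub>rs A M\<^esub>i \<in> {..<n}. \<zero>\<^sub>M)"
   using b M'.smult_l_null M'.M.zero_closed by (intro M'.M.finsum_cong') (auto simp: Pi_def)
  also have "... = \<zero>\<^sub>M" using M'.M.finsum_zero[of "{..<n}"] by simp
  finally show ?thesis using ex[of m] m(1) by simp
 qed
 then have "inj_on (%x. \<lambda>i \<in> {..<n}. h i x) (el M)"
  using lin_inj_iff[OF M.ag _ j] lm_pow[OF lm_D, of n]
  by (metis (no_types, lifting) left_module.axioms(2))
 with j show ?thesis by (rule that)
qed

end

section \<open>Classes in \<open>Ext\<^sup>1\<close>\<close>

lemma hom_simps:
 "el (hom_group R M N) = mod_hom R M N"
 "zero (hom_group R M N) = (\<lambda>x \<in> el M. \<zero>\<^sub>N)"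
 "add (hom_group R M N) f g = (\<lambda>x \<in> el M. f x \<oplus>\<^sub>N g x)"
 by (simp_all add: hom_group_def)

lemma mod_hom_eqI:
 "f \<in> mod_hom R M N ==> g \<in> mod_hom R M N ==> (!!x. x .: M ==> f x = g x) ==> f = g"
 unfolding mod_hom_iff by (auto intro: extensionalityI)

lemma abelian_group_hom_group:
 assumes "lmod R M" "lmod R N" shows "abelian_group (hom_group R M N)"
proof -
 interpret N: left_module R N by fact
 have add: "f \<oplus>\<^sub>(hom_group R M N) g \<in> mod_hom R M N" if "f \<in> mod_hom R M N" "g \<in> mod_hom R M N" for f g
  unfolding hom_simps
  by (rule restrict_mod_hom[OF assms(1) lin_add_pt[OF assms(2)]]) (use that in "auto simp: mod_hom_lin")
 have zero: "\<zero>\<^sub>(hom_group R M N) \<in> mod_hom R M N"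
  unfolding hom_simps by (rule restrict_mod_hom[OF assms(1) lin_zero_pt[OF assms(2)]])
 have cl: "f x .: N" if "f \<in> mod_hom R M N" "x .: M" for f x
  using lin_cl[OF mod_hom_lin[OF that(1)] that(2)] .
 show ?thesis
 proof (rule abelian_groupI, unfold hom_simps(1))
  show "f \<oplus>\<^sub>(hom_group R M N) g \<oplus>\<^sub>(hom_group R M N) h = f \<oplus>\<^sub>(hom_group R M N) (g \<oplus>\<^sub>(hom_group R M N) h)"
   if "f \<in> mod_hom R M N" "g \<in> mod_hom R M N" "h \<in> mod_hom R M N" for f g h
   by (rule mod_hom_eqI[OF add[OF add[OF that(1,2)] that(3)] add[OF that(1) add[OF that(2,3)]]])
    (simp add: hom_simps N.M.a_ac cl that)
  show "f \<oplus>\<^sub>(hom_group R M N) g = g \<oplus>\<^sub>(hom_group R M N) f"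
   if "f \<in> mod_hom R M N" "g \<in> mod_hom R M N" for f g
   by (rule mod_hom_eqI[OF add[OF that] add[OF that(2,1)]]) (simp add: hom_simps N.M.a_ac cl that)
  show "\<zero>\<^sub>(hom_group R M N) \<oplus>\<^sub>(hom_group R M N) f = f" if "f \<in> mod_hom R M N" for f
   by (rule mod_hom_eqI[OF add[OF zero that] that]) (simp add: hom_simps cl that)
  show "\<exists>g \<in> mod_hom R M N. g \<oplus>\<^sub>(hom_group R M N) f = \<zero>\<^sub>(hom_group R M N)" if f: "f \<in> mod_hom R M N" for f
  proof (rule bexI)
   show m: "(\<lambda>x \<in> el M. \<ominus>\<^sub>N f x) \<in> mod_hom R M N"
    by (rule restrict_mod_hom[OF assms(1) lin_minus_pt[OF assms(2) mod_hom_lin[OF f]]])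
   show "(\<lambda>x \<in> el M. \<ominus>\<^sub>N f x) \<oplus>\<^sub>(hom_group R M N) f = \<zero>\<^sub>(hom_group R M N)"
    by (rule mod_hom_eqI[OF add[OF m f] zero]) (simp add: hom_simps cl f N.M.l_neg)
  qed
 qed (use add zero in auto)
qed

lemma lcomb_submodule:
 assumes "lmod R M" "submodule N R M" "g \<in> S -> N" "c .: (free_module R S)"
 shows "lcomb R (M .| N) S c g = lcomb R M S c g" "lcomb R M S c g \<in> N"
proof -
 interpret M: left_module R M by fact
 have "(%s. c s \<odot>\<^sub>M g s) \<in> {s \<in> S. c s ~= \<zero>\<^sub>R} -> N"
  using assms(3) free_coeff[OF M.R.ring_axioms assms(4)] submodule_smult[OF assms(2)] by auto
 from finsum_submodule[OF assms(1,2) this]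
 show "lcomb R (M .| N) S c g = lcomb R M S c g" "lcomb R M S c g \<in> N"
  by (simp_all add: lcomb_def)
qed

definition ext_class ::
  "('a, 'r) ring_scheme => ('a, 'x, 'm) ms => ('a, 'y, 'n) ms =>
  (('x => 'a) => 'y) => (('x => 'a) => 'y) set"
 where "ext_class R X Y h =
  ext_null R X Y +>\<^bsub>hom_group R (syzygy R X) Y\<^esub> restrict h (el (syzygy R X))"

context
 fixes R :: "('a, 'r) ring_scheme" and X :: "('a, 'x, 'm) ms"
 assumes X: "lmod R X"
begin

lemma ring_X: "ring R"
proof -
 interpret X: left_module R X by (rule X)
 show ?thesis by (rule X.R.ring_axioms)
qed

abbreviation "FX \<equiv> free_module R (el X)"
abbreviation "SX \<equiv> syzygy R X"

lemma lm_FX: "lmod R FX" by (rule lm_free[OF ring_X])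

lemma syzygy_carrier: "el SX = {c \<in> el FX. lcomb R X (el X) c (%x. x) = \<zero>\<^sub>X}"
 by (simp add: syzygy_def free_cover_def lcomb_def)

lemma syzygy_eq: "SX = FX .| (el SX)"
 by (simp add: syzygy_def free_cover_def)

lemma lin_value: "lin R FX X (%c. lcomb R X (el X) c (%x. x))"
proof -
 interpret X: left_module R X by (rule X)
 show ?thesis by (rule X.lin_lcomb) auto
qed

lemma submodule_SX: "submodule (el SX) R FX"
 unfolding syzygy_carrier by (rule submodule_kernel[OF lm_FX X lin_value])

lemma lm_SX: "lmod R SX"
 by (subst syzygy_eq) (rule submodule_left_module[OF lm_FX submodule_SX])

lemma syzygy_FX: "c .: SX ==> c .: FX" by (simp add: syzygy_carrier)

lemma syzygy_lin: "lmod R N ==> lin R X N f ==> c .: SX ==> lcomb R N (el X) c f = \<zero>\<^sub>N"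
proof -
 assume N: "lmod R N" and f: "lin R X N f" and c: "c .: SX"
 interpret X: left_module R X by (rule X)
 interpret N: left_module R N by (rule N)
 have "f (lcomb R X (el X) c (%x. x)) = lcomb R N (el X) c f"
  by (rule N.lin_lcomb_comp[OF X f _ syzygy_FX[OF c]]) auto
 then show ?thesis using c lin_zero[OF X.ag N.ag f] by (simp add: syzygy_carrier)
qed

lemma syzygy_smult:
 assumes "a .: R" "x .: X"
 shows "free_gen R (a \<odot>\<^sub>X x) \<ominus>\<^sub>FX a \<odot>\<^sub>FX free_gen R x .: SX"
proof -
 interpret X: left_module R X by (rule X)
 interpret P: left_module R FX by (rule lm_FX)
 note g = free_gen_cl[OF ring_X, where S = "el X"]
 have "lcomb R X (el X) (free_gen R x) (%x. x) = x" if "x .: X" for x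
  using X.lcomb_free_gen[of "%x. x" "el X" x] that by simp
 then show ?thesis
  using assms g P.smult_closed[OF assms(1) g[OF assms(2)]] X.M.diff_eq_zero
  by (simp add: syzygy_carrier lin_diff[OF P.ag X.ag lin_value]
    lin_smult[OF lin_value])
qed

lemma syzygy_add:
 assumes "x .: X" "y .: X"
 shows "free_gen R (x \<oplus>\<^sub>X y) \<ominus>\<^sub>FX (free_gen R x \<oplus>\<^sub>FX free_gen R y) .: SX"
proof -
 interpret X: left_module R X by (rule X)
 interpret P: left_module R FX by (rule lm_FX)
 note g = free_gen_cl[OF ring_X, where S = "el X"]
 have "lcomb R X (el X) (free_gen R x) (%x. x) = x" if "x .: X" for x
  using X.lcomb_free_gen[of "%x. x" "el X" x] that by simp
 then show ?thesis
  using assms g X.M.diff_eq_zero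
  by (simp add: syzygy_carrier lin_diff[OF P.ag X.ag lin_value]
    lin_add[OF lin_value])
qed

lemma syzygy_linI:
 assumes N: "lmod R N" and w: "w \<in> el X -> el N"
  and z: "!!c. c .: SX ==> lcomb R N (el X) c w = \<zero>\<^sub>N"
 shows "lin R X N w"
proof -
 interpret X: left_module R X by (rule X)
 interpret P: left_module R FX by (rule lm_FX)
 interpret N: left_module R N by (rule N)
 note g = free_gen_cl[OF ring_X, where S = "el X"]
 note l = N.lin_lcomb[OF w]
 have lg: "lcomb R N (el X) (free_gen R x) w = w x" if "x .: X" for x
  by (rule N.lcomb_free_gen[OF w that])
 note d = lin_diff[OF P.ag N.ag l]
 show ?thesis
 proof (rule linI)
  show "w x .: N" if "x .: X" for x using w that by auto
  show "w (x \<oplus>\<^sub>X y) = w x \<oplus>\<^sub>N w y" if "x .: X" "y .: X" for x y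
   using z[OF syzygy_add[OF that]] that g w N.M.diff_eq_zero
   by (simp add: d lin_add[OF l] lg Pi_def)
  show "w (a \<odot>\<^sub>X x) = a \<odot>\<^sub>N w x" if "a .: R" "x .: X" for a x
   using z[OF syzygy_smult[OF that]] that g P.smult_closed[OF that(1) g[OF that(2)]] w N.M.diff_eq_zero
   by (simp add: d lin_smult[OF l] lg Pi_def)
 qed
qed

lemma free_map_syzygy:
 assumes "lin R X X g" "c .: SX"
 shows "free_map R (el X) g c .: SX"
proof -
 interpret X: left_module R X by (rule X)
 have gX: "g \<in> el X -> el X" using lin_cl[OF assms(1)] by auto
 have "lcomb R X (el X) (free_map R (el X) g c) (%x. x) = lcomb R X (el X) c g"
  using X.lcomb_free_map[OF syzygy_FX[OF assms(2)] gX, of "%x. x"] by simp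
 then show ?thesis
  using lin_cl[OF lin_free_map[OF ring_X gX] syzygy_FX[OF assms(2)]] syzygy_lin[OF X assms(1,2)]
  by (simp add: syzygy_carrier)
qed

lemma lin_free_map_syzygy:
 assumes "lin R X X g" shows "lin R SX SX (free_map R (el X) g)"
proof -
 have gX: "g \<in> el X -> el X" using lin_cl[OF assms(1)] by auto
 have "lin R (FX .| (el SX)) (FX .| (el SX)) (free_map R (el X) g)"
  using free_map_syzygy[OF assms] submod_sub[OF submodule_SX]
  by (intro lin_corestrict lin_restrict_dom[OF lin_free_map[OF ring_X gX]]) auto
 then show ?thesis by (simp only: syzygy_eq[symmetric])
qed

lemma lin_lcomb_SX:
 assumes "lmod R Y" "g \<in> el X -> el Y"
 shows "lin R SX Y (%c. lcomb R Y (el X) c g)"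
proof -
 interpret Y: left_module R Y by fact
 have "lin R (FX .| (el SX)) Y (%c. lcomb R Y (el X) c g)"
  by (rule lin_restrict_dom[OF Y.lin_lcomb[OF assms(2)] submod_sub[OF submodule_SX]])
 then show ?thesis by (simp only: syzygy_eq[symmetric])
qed

context
 fixes Y :: "('a, 'y, 'n) ms"
 assumes Y: "lmod R Y"
begin

abbreviation "HY \<equiv> hom_group R SX Y"

lemma abelian_HY: "abelian_group HY" by (rule abelian_group_hom_group[OF lm_SX Y])

lemma ext_null_iff:
 "k \<in> ext_null R X Y <-> k \<in> mod_hom R SX Y &
  (\<exists>g \<in> el X -> el Y. \<forall>c \<in> el SX. k c = lcomb R Y (el X) c g)" (is "_ <-> ?r")
proof
 interpret Y: left_module R Y by (rule Y)
 assume "k \<in> ext_null R X Y"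
 then obtain h where h: "h \<in> mod_hom R FX Y" "k = restrict h (el SX)"
  by (auto simp: ext_null_def free_cover_def)
 have hl: "lin R FX Y h" by (rule mod_hom_lin[OF h(1)])
 have "lin R (FX .| (el SX)) Y h" by (rule lin_restrict_dom[OF hl submod_sub[OF submodule_SX]])
 then have "lin R SX Y h" by (simp only: syzygy_eq[symmetric])
 then have "k \<in> mod_hom R SX Y" unfolding h(2) by (rule restrict_mod_hom[OF lm_SX])
 moreover have "(%x. h (free_gen R x)) \<in> el X -> el Y"
  using lin_cl[OF hl free_gen_cl[OF ring_X]] by auto
 moreover have "\<forall>c \<in> el SX. k c = lcomb R Y (el X) c (%x. h (free_gen R x))"
  using lin_free_expand[OF Y hl syzygy_FX] by (simp add: h(2))
 ultimately show ?r by blast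
next
 interpret Y: left_module R Y by (rule Y)
 assume ?r
 then obtain g where k: "k \<in> mod_hom R SX Y" and g: "g \<in> el X -> el Y"
  and kg: "\<forall>c \<in> el SX. k c = lcomb R Y (el X) c g" by blast
 let ?h = "restrict (%c. lcomb R Y (el X) c g) (el FX)"
 have h: "?h \<in> mod_hom R FX Y" by (rule restrict_mod_hom[OF lm_FX Y.lin_lcomb[OF g]])
 have "k = restrict ?h (el SX)"
  using k kg syzygy_FX by (intro extensionalityI[of _ "el SX"]) (auto simp: mod_hom_iff)
 then show "k \<in> ext_null R X Y" unfolding ext_null_def free_cover_def by (rule image_eqI[OF _ h])
qed

lemma ext_null_subgroup: "subgroup (ext_null R X Y) (add_monoid HY)"
proof -
 have G: "abelian_group (hom_group R FX Y)" by (rule abelian_group_hom_group[OF lm_FX Y])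
 interpret G: abelian_group "hom_group R FX Y" by (rule G)
 interpret H: abelian_group HY by (rule abelian_HY)
 let ?r = "%h. restrict h (el SX)"
 have cl: "?r h \<in> mod_hom R SX Y" if "h \<in> mod_hom R FX Y" for h
  using ext_null_iff[of "?r h"] that by (auto simp: ext_null_def free_cover_def)
 have "group_hom (add_monoid (hom_group R FX Y)) (add_monoid HY) ?r"
 proof (rule group_hom.intro[OF G.a_group H.a_group group_hom_axioms.intro], rule homI)
  show "?r (h \<otimes>\<^bsub>add_monoid (hom_group R FX Y)\<^esub> k) = ?r h \<otimes>\<^sub>(add_monoid HY) ?r k"
   if "h .: (add_monoid (hom_group R FX Y))" "k .: (add_monoid (hom_group R FX Y))" for h k
   using that syzygy_FX by (auto simp: hom_simps restrict_def fun_eq_iff)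
 qed (use cl in "auto simp: hom_simps")
 from group_hom.img_is_subgroup[OF this] show ?thesis
  by (simp add: ext_null_def free_cover_def hom_simps)
qed

lemmas quotHY = abelian_HY ext_null_subgroup

lemma abelian_group_Ext1: "abelian_group (Ext1 R X Y)"
 unfolding Ext1_def by (rule abelian_group_quot[OF quotHY])

lemma restrict_HY: "lin R SX Y h ==> restrict h (el SX) .: HY"
 unfolding hom_simps by (rule restrict_mod_hom[OF lm_SX])

lemma Ext1_carrier: "el (Ext1 R X Y) = {ext_class R X Y h | h. lin R SX Y h}"
proof -
 have "el (Ext1 R X Y) = (%h. ext_null R X Y +>\<^bsub>HY\<^esub> h) ` mod_hom R SX Y"
  unfolding Ext1_def quot_group_carrier[OF quotHY] by (simp add: hom_simps)
 also have "... = {ext_class R X Y h | h. lin R SX Y h}"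
 proof (intro equalityI subsetI)
  fix e assume "e \<in> (%h. ext_null R X Y +>\<^bsub>HY\<^esub> h) ` mod_hom R SX Y"
  then obtain h where h: "h \<in> mod_hom R SX Y" "e = ext_null R X Y +>\<^bsub>HY\<^esub> h" by auto
  then have "restrict h (el SX) = h" by (simp add: mod_hom_iff extensional_restrict)
  then have "e = ext_class R X Y h" using h by (simp add: ext_class_def)
  then show "e \<in> {ext_class R X Y h | h. lin R SX Y h}" using mod_hom_lin[OF h(1)] by blast
 next
  fix e assume "e \<in> {ext_class R X Y h | h. lin R SX Y h}"
  then show "e \<in> (%h. ext_null R X Y +>\<^bsub>HY\<^esub> h) ` mod_hom R SX Y"
   using restrict_mod_hom[OF lm_SX] by (auto simp: ext_class_def)
 qed
 finally show ?thesis .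
qed

lemma ext_class_closed: "lin R SX Y h ==> ext_class R X Y h .: (Ext1 R X Y)"
 unfolding Ext1_carrier by blast

lemma ext_class_add:
 assumes "lin R SX Y h" "lin R SX Y k"
 shows "add (Ext1 R X Y) (ext_class R X Y h) (ext_class R X Y k) = ext_class R X Y (%c. h c \<oplus>\<^sub>Y k c)"
proof -
 have "restrict h (el SX) \<oplus>\<^sub>HY restrict k (el SX) = restrict (%c. h c \<oplus>\<^sub>Y k c) (el SX)"
  by (auto simp: hom_simps restrict_def fun_eq_iff)
 then show ?thesis
  unfolding Ext1_def ext_class_def using coset_add[OF quotHY restrict_HY[OF assms(1)] restrict_HY[OF assms(2)]]
  by simp
qed

lemma ext_class_eq_iff:
 assumes "lin R SX Y h" "lin R SX Y k"
 shows "ext_class R X Y h = ext_class R X Y k <->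
  (\<exists>g \<in> el X -> el Y. \<forall>c \<in> el SX. h c = lcomb R Y (el X) c g \<oplus>\<^sub>Y k c)"
proof -
 interpret Y: left_module R Y by (rule Y)
 interpret H: abelian_group HY by (rule abelian_HY)
 let ?h = "restrict h (el SX)" and ?k = "restrict k (el SX)"
 note hk = restrict_HY[OF assms(1)] restrict_HY[OF assms(2)]
 have d: "?h \<ominus>\<^sub>HY ?k .: HY" using hk by simp
 have val: "(?h \<ominus>\<^sub>HY ?k) c \<oplus>\<^sub>Y k c = h c" if "c .: SX" for c
  using fun_cong[OF H.diff_add[OF hk], of c] that by (simp add: hom_simps)
 have dc: "(?h \<ominus>\<^sub>HY ?k) c .: Y" "h c .: Y" "k c .: Y" if "c .: SX" for c
  using lin_cl[OF mod_hom_lin that] d assms lin_cl[OF _ that] by (auto simp: hom_simps)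
 have "ext_class R X Y h = ext_class R X Y k <-> ?h \<ominus>\<^sub>HY ?k \<in> ext_null R X Y"
  unfolding ext_class_def by (rule coset_eq_iff[OF quotHY hk])
 also have "... <-> (\<exists>g \<in> el X -> el Y. \<forall>c \<in> el SX. (?h \<ominus>\<^sub>HY ?k) c = lcomb R Y (el X) c g)"
  using d by (simp add: ext_null_iff hom_simps)
 also have "... <-> (\<exists>g \<in> el X -> el Y. \<forall>c \<in> el SX. h c = lcomb R Y (el X) c g \<oplus>\<^sub>Y k c)"
 proof (intro bex_cong ball_cong refl)
  fix g c assume g: "g \<in> el X -> el Y" and c: "c .: SX"
  have "lcomb R Y (el X) c g .: Y" by (rule Y.lcomb_closed[OF syzygy_FX[OF c] g])
  then show "(?h \<ominus>\<^sub>HY ?k) c = lcomb R Y (el X) c g <-> h c = lcomb R Y (el X) c g \<oplus>\<^sub>Y k c"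
   using val[OF c] dc[OF c] Y.M.add.right_cancel by metis
 qed
 finally show ?thesis .
qed

lemma ext_class_zero: "zero (Ext1 R X Y) = ext_class R X Y (%_. \<zero>\<^sub>Y)"
 unfolding Ext1_def ext_class_def quot_group_zero[OF quotHY] by (simp add: hom_simps)

lemma ext_class_eq_zero_iff:
 assumes "lin R SX Y h"
 shows "ext_class R X Y h = zero (Ext1 R X Y) <->
  (\<exists>g \<in> el X -> el Y. \<forall>c \<in> el SX. h c = lcomb R Y (el X) c g)"
proof -
 interpret Y: left_module R Y by (rule Y)
 show ?thesis
  unfolding ext_class_zero ext_class_eq_iff[OF assms lin_zero_pt[OF Y]]
  using Y.lcomb_closed[OF syzygy_FX] by (intro bex_cong ball_cong refl) auto
qed

lemma ext_class_mem:
 assumes "lin R SX Y h" "h' \<in> ext_class R X Y h"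
 shows "lin R SX Y h'" "ext_class R X Y h' = ext_class R X Y h" "h' \<in> extensional (el SX)"
proof -
 have m: "h' .: HY" "ext_null R X Y +>\<^bsub>HY\<^esub> h' = ext_class R X Y h"
  using coset_mem[OF quotHY restrict_HY[OF assms(1)]] assms(2) unfolding ext_class_def by auto
 then show "lin R SX Y h'" "h' \<in> extensional (el SX)" by (auto simp: hom_simps mod_hom_iff)
 then have "restrict h' (el SX) = h'" by (simp add: extensional_restrict)
 then show "ext_class R X Y h' = ext_class R X Y h" using m(2) by (simp add: ext_class_def)
qed

lemma ext_class_self: "lin R SX Y h ==> restrict h (el SX) \<in> ext_class R X Y h"
 unfolding ext_class_def by (rule coset_self[OF quotHY restrict_HY])

lemma ext_class_Union:
 assumes "lin R SX Y h" "!!h'. h' \<in> ext_class R X Y h ==> f h' = t"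
 shows "(\<Union>h' \<in> ext_class R X Y h. f h') = t"
proof -
 have "(\<Union>h' \<in> ext_class R X Y h. f h') = (\<Union>h' \<in> ext_class R X Y h. t)" by (intro SUP_cong refl assms(2))
 then show ?thesis using ext_class_self[OF assms(1)] by auto
qed

lemma Ext1_pull_class:
 assumes "lin R SX Y h" "lin R X X g"
 shows "Ext1_pull R X Y g (ext_class R X Y h) = ext_class R X Y (%c. h (free_map R (el X) g c))"
 unfolding Ext1_pull_def
proof (rule ext_class_Union[OF assms(1)])
 interpret Y: left_module R Y by (rule Y)
 fix h' assume h': "h' \<in> ext_class R X Y h"
 note h'l = ext_class_mem[OF assms(1) h']
 note fm = lin_free_map_syzygy[OF assms(2)]
 have gX: "g \<in> el X -> el X" using lin_cl[OF assms(2)] by auto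
 obtain k where k: "k \<in> el X -> el Y"
  "!!c. c .: SX ==> h' c = lcomb R Y (el X) c k \<oplus>\<^sub>Y h c"
  using h'l(2) unfolding ext_class_eq_iff[OF h'l(1) assms(1)] by blast
 have "ext_class R X Y (%c. h' (free_map R (el X) g c)) = ext_class R X Y (%c. h (free_map R (el X) g c))"
  unfolding ext_class_eq_iff[OF lin_comp[OF fm h'l(1)] lin_comp[OF fm assms(1)]]
 proof (rule bexI[of _ "%x. k (g x)"], rule ballI)
  fix c assume c: "c .: SX"
  show "h' (free_map R (el X) g c) =
    lcomb R Y (el X) c (%x. k (g x)) \<oplus>\<^sub>Y h (free_map R (el X) g c)"
   using k(2)[OF lin_cl[OF fm c]] Y.lcomb_free_map[OF syzygy_FX[OF c] gX k(1)] by simp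
 qed (use k(1) gX in auto)
 moreover have "compose (el SX) h' (free_map R (el X) g) =
   restrict (%c. h' (free_map R (el X) g c)) (el SX)"
  by (simp add: compose_def restrict_def)
 ultimately show "ext_null R X Y +>\<^bsub>HY\<^esub> compose (el SX) h' (free_map R (el X) g) =
   ext_class R X Y (%c. h (free_map R (el X) g c))"
  by (simp add: ext_class_def)
qed

end

lemma Ext1_push_class:
 assumes Y: "lmod R Y" and Y': "lmod R Y'" and h: "lin R SX Y h" and k: "lin R Y Y' k"
 shows "Ext1_push R X Y' k (ext_class R X Y h) = ext_class R X Y' (%c. k (h c))"
 unfolding Ext1_push_def
proof (rule ext_class_Union[OF Y h])
 interpret Y: left_module R Y by (rule Y)
 interpret Y': left_module R Y' by (rule Y')
 fix h' assume h': "h' \<in> ext_class R X Y h"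
 note h'l = ext_class_mem[OF Y h h']
 obtain g where g: "g \<in> el X -> el Y"
  "!!c. c .: SX ==> h' c = lcomb R Y (el X) c g \<oplus>\<^sub>Y h c"
  using h'l(2) unfolding ext_class_eq_iff[OF Y h'l(1) h] by blast
 have "ext_class R X Y' (%c. k (h' c)) = ext_class R X Y' (%c. k (h c))"
  unfolding ext_class_eq_iff[OF Y' lin_comp[OF h'l(1) k] lin_comp[OF h k]]
 proof (rule bexI[of _ "%x. k (g x)"], rule ballI)
  fix c assume c: "c .: SX"
  have "lcomb R Y (el X) c g .: Y" by (rule Y.lcomb_closed[OF syzygy_FX[OF c] g(1)])
  then show "k (h' c) = lcomb R Y' (el X) c (%x. k (g x)) \<oplus>\<^sub>Y' k (h c)"
   using g(2)[OF c] lin_add[OF k] lin_cl[OF h c] Y'.lin_lcomb_comp[OF Y k g(1) syzygy_FX[OF c]] by simp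
 qed (use g(1) lin_cl[OF k] in auto)
 moreover have "compose (el SX) k h' = restrict (%c. k (h' c)) (el SX)"
  by (simp add: compose_def restrict_def)
 ultimately show "ext_null R X Y' +>\<^bsub>hom_group R SX Y'\<^esub> compose (el SX) k h' = ext_class R X Y' (%c. k (h c))"
  by (simp add: ext_class_def)
qed

end

section \<open>\<open>Ext\<^sup>1\<close> from an injective copresentation\<close>

definition short_exact ::
  "('a, 'r) ring_scheme => ('a, 'y, 'n) ms => ('a, 'q, 'k) ms =>
  ('a, 'p, 'l) ms => ('y => 'q) => ('q => 'p) => bool"
 where "short_exact R Y Q0 Q1 j p <-> lmod R Y & lmod R Q0 & lmod R Q1 &
  lin R Y Q0 j & inj_on j (el Y) & lin R Q0 Q1 p & p ` el Q0 = el Q1 &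
  (\<forall>q \<in> el Q0. p q = \<zero>\<^sub>Q1 <-> q \<in> j ` el Y)"

lemma short_exactD:
 assumes "short_exact R Y Q0 Q1 j p"
 shows "lmod R Y" "lmod R Q0" "lmod R Q1" "lin R Y Q0 j" "inj_on j (el Y)"
  "lin R Q0 Q1 p" "p ` el Q0 = el Q1"
  "!!q. q .: Q0 ==> p q = \<zero>\<^sub>Q1 ==> q \<in> j ` el Y"
  "!!y. y .: Y ==> p (j y) = \<zero>\<^sub>Q1"
 using assms lin_cl unfolding short_exact_def by fast+

lemma short_exact_quot:
 assumes "lmod R Y" "lmod R Q" "lin R Y Q j" "inj_on j (el Y)"
 shows "short_exact R Y Q (quot_mod Q (j ` el Y)) j (%x. (j ` el Y) +>\<^bsub>Q\<^esub> x)"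
proof -
 have s: "submodule (j ` el Y) R Q"
  by (rule submodule_image[OF assms(1-3) submodule_carrier[OF assms(1)]])
 show ?thesis
  unfolding short_exact_def
  using assms lm_quot[OF assms(2) s] lin_quot[OF assms(2) s] quot_mod_carrier[OF assms(2) s]
   quot_mod_zero_iff[OF assms(2) s] by simp
qed

lemma short_exact_factor:
 assumes "short_exact R Y Q0 Q1 j p" "lmod R N" "lin R N Q0 f" "!!x. x .: N ==> p (f x) = \<zero>\<^sub>Q1"
 shows "lin R N Y (%x. inv_into (el Y) j (f x))"
  "!!x. x .: N ==> j (inv_into (el Y) j (f x)) = f x"
proof -
 note S = short_exactD[OF assms(1)]
 have s: "submodule (j ` el Y) R Q0"
  by (rule submodule_image[OF S(1,2,4) submodule_carrier[OF S(1)]])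
 have im: "f x \<in> j ` el Y" if "x .: N" for x
  by (rule S(8)[OF lin_cl[OF assms(3) that] assms(4)[OF that]])
 have "bij_betw j (el Y) (el (Q0 .| (j ` el Y)))" using S(5) by (simp add: bij_betw_def)
 then have "lin R (Q0 .| (j ` el Y)) Y (inv_into (el Y) j)"
  by (intro lin_inv_into[OF S(1)] lin_corestrict[OF S(4)]) auto
 moreover have "lin R N (Q0 .| (j ` el Y)) f" using im by (intro lin_corestrict[OF assms(3)]) auto
 ultimately show "lin R N Y (%x. inv_into (el Y) j (f x))" using lin_comp by blast
 show "!!x. x .: N ==> j (inv_into (el Y) j (f x)) = f x"
  using f_inv_into_f[OF im] .
qed

text \<open>For an exact sequence \<open>0 \<rightarrow> Y \<rightarrow> Q\<^sub>0 \<rightarrow> Q\<^sub>1 \<rightarrow> 0\<close> a map \<open>u : X \<rightarrow> Q\<^sub>1\<close> is lifted, elementwise and not linearly, to \<open>sg : X \<rightarrow> Q\<^sub>0\<close>.  The extension of \<open>sg\<close> to the free cover sends the syzygy to \<open>Y\<close>; the result \<open>h\<close> represents the image of \<open>u\<close> under the connecting homomorphism, which is \<open>ext_of\<close>.\<close>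

definition ext_rep ::
  "('a, 'r) ring_scheme => ('a, 'x, 'm) ms => ('a, 'y, 'n) ms =>
  ('a, 'q, 'k) ms => ('a, 'p, 'l) ms => ('y => 'q) => ('q => 'p) =>
  (('x => 'a) => 'y) => ('x => 'p) => bool"
 where "ext_rep R X Y Q0 Q1 j p h u <-> lin R (syzygy R X) Y h & lin R X Q1 u &
  (\<exists>sg \<in> el X -> el Q0. (\<forall>x \<in> el X. p (sg x) = u x) &
   (\<forall>c \<in> el (syzygy R X). j (h c) = lcomb R Q0 (el X) c sg))"

definition ext_of ::
  "('a, 'r) ring_scheme => ('a, 'x, 'm) ms => ('a, 'y, 'n) ms =>
  ('a, 'q, 'k) ms => ('a, 'p, 'l) ms => ('y => 'q) => ('q => 'p) =>
  ('x => 'p) => (('x => 'a) => 'y) set"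
 where "ext_of R X Y Q0 Q1 j p u = ext_class R X Y (SOME h. ext_rep R X Y Q0 Q1 j p h u)"

context
 fixes R :: "('a, 'r) ring_scheme" and X :: "('a, 'x, 'm) ms"
  and Y :: "('a, 'y, 'n) ms" and Q0 :: "('a, 'q, 'k) ms"
  and Q1 :: "('a, 'p, 'l) ms" and j p
 assumes X: "lmod R X" and ses: "short_exact R Y Q0 Q1 j p"
begin

abbreviation "ExtRep \<equiv> ext_rep R X Y Q0 Q1 j p"
abbreviation "ExtCl \<equiv> ext_of R X Y Q0 Q1 j p"
abbreviation "Syz \<equiv> syzygy R X"

lemmas ses' = short_exactD[OF ses]

lemma ext_rep_exists:
 assumes "lin R X Q1 u" shows "\<exists>h. ExtRep h u"
proof -
 interpret Q0: left_module R Q0 by (rule ses')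
 interpret Q1: left_module R Q1 by (rule ses')
 define sg where "sg x = inv_into (el Q0) p (u x)" for x
 have ux: "u x \<in> p ` el Q0" if "x .: X" for x using lin_cl[OF assms that] ses'(7) by simp
 have sc: "sg \<in> el X -> el Q0" using ux by (auto simp: sg_def inv_into_into)
 have ps: "p (sg x) = u x" if "x .: X" for x unfolding sg_def by (rule f_inv_into_f[OF ux[OF that]])
 let ?f = "%c. lcomb R Q0 (el X) c sg"
 have pf: "p (?f c) = \<zero>\<^sub>Q1" if c: "c .: Syz" for c
 proof -
  have "p (?f c) = lcomb R Q1 (el X) c (%x. p (sg x))"
   by (rule Q1.lin_lcomb_comp[OF ses'(2,6) sc syzygy_FX[OF X c]])
  also have "... = lcomb R Q1 (el X) c u"
   using lin_cl[OF assms] by (intro Q1.lcomb_cong ps syzygy_FX[OF X c]) auto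
  also have "... = \<zero>\<^sub>Q1" by (rule syzygy_lin[OF X ses'(3) assms c])
  finally show ?thesis .
 qed
 note f = short_exact_factor[OF ses lm_SX[OF X] lin_lcomb_SX[OF X ses'(2) sc] pf]
 show ?thesis
  unfolding ext_rep_def using f assms sc ps by (intro exI conjI bexI[of _ sg]) auto
qed

lemma ext_rep_unique:
 assumes "ExtRep h u" "ExtRep h' u'" "!!x. x .: X ==> u x = u' x"
 shows "ext_class R X Y h = ext_class R X Y h'"
proof -
 interpret Y: left_module R Y by (rule ses')
 interpret Q0: left_module R Q0 by (rule ses')
 interpret Q1: left_module R Q1 by (rule ses')
 note h = assms(1)[unfolded ext_rep_def, THEN conjunct1] and h' = assms(2)[unfolded ext_rep_def, THEN conjunct1]
 obtain sg where s: "sg \<in> el X -> el Q0" "!!x. x .: X ==> p (sg x) = u x"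
  "!!c. c .: Syz ==> j (h c) = lcomb R Q0 (el X) c sg"
  using assms(1) unfolding ext_rep_def by blast
 obtain sg' where s': "sg' \<in> el X -> el Q0" "!!x. x .: X ==> p (sg' x) = u' x"
  "!!c. c .: Syz ==> j (h' c) = lcomb R Q0 (el X) c sg'"
  using assms(2) unfolding ext_rep_def by blast
 have sx: "sg x .: Q0" "sg' x .: Q0" if "x .: X" for x using s(1) s'(1) that by auto
 have uc: "u x .: Q1" if "x .: X" for x
  using lin_cl[OF ses'(6) sx(1)[OF that]] s(2)[OF that] by simp
 have k: "sg x \<ominus>\<^sub>Q0 sg' x \<in> j ` el Y" if x: "x .: X" for x
 proof (rule ses'(8))
  show "p (sg x \<ominus>\<^sub>Q0 sg' x) = \<zero>\<^sub>Q1"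
   using lin_diff[OF Q0.ag Q1.ag ses'(6) sx[OF x]]
    s(2)[OF x] s'(2)[OF x] assms(3)[OF x] uc[OF x] Q1.M.diff_eq_zero[of "u x" "u x"] by simp
 qed (use sx[OF x] in simp)
 define g where "g x = inv_into (el Y) j (sg x \<ominus>\<^sub>Q0 sg' x)" for x
 have g: "g \<in> el X -> el Y" using k by (auto simp: g_def inv_into_into)
 have jg: "j (g x) \<oplus>\<^sub>Q0 sg' x = sg x" if "x .: X" for x
  using f_inv_into_f[OF k[OF that]] Q0.M.diff_add sx[OF that] by (simp add: g_def)
 show ?thesis
  unfolding ext_class_eq_iff[OF X ses'(1) h h']
 proof (intro bexI[of _ g] ballI g)
  fix c assume c: "c .: Syz"
  note cF = syzygy_FX[OF X c]
  have lg: "lcomb R Y (el X) c g .: Y" by (rule Y.lcomb_closed[OF cF g])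
  have "j (h c) = lcomb R Q0 (el X) c (%x. j (g x) \<oplus>\<^sub>Q0 sg' x)"
   unfolding s(3)[OF c] using s(1) jg by (intro Q0.lcomb_cong[symmetric] cF) auto
  also have "... = lcomb R Q0 (el X) c (%x. j (g x)) \<oplus>\<^sub>Q0 lcomb R Q0 (el X) c sg'"
   using g lin_cl[OF ses'(4)] by (intro Q0.lcomb_add s' cF) auto
  also have "... = j (lcomb R Y (el X) c g) \<oplus>\<^sub>Q0 j (h' c)"
   using Q0.lin_lcomb_comp[OF ses'(1,4) g cF] s'(3)[OF c] by simp
  also have "... = j (lcomb R Y (el X) c g \<oplus>\<^sub>Y h' c)"
   using lin_add[OF ses'(4) lg lin_cl[OF h' c]] by simp
  finally show "h c = lcomb R Y (el X) c g \<oplus>\<^sub>Y h' c"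
   using inj_onD[OF ses'(5)] lin_cl[OF h c] lin_cl[OF h' c] lg by simp
 qed
qed

lemma ext_of_rep: "ExtRep h u ==> ExtCl u = ext_class R X Y h"
 unfolding ext_of_def by (rule ext_rep_unique[OF someI[of "%h. ExtRep h u"]]) auto

lemma ext_of_obtain:
 assumes "lin R X Q1 u"
 obtains h where "ExtRep h u" "ExtCl u = ext_class R X Y h" "lin R Syz Y h"
 using ext_rep_exists[OF assms] ext_of_rep by (auto simp: ext_rep_def)

lemma ext_of_closed: "lin R X Q1 u ==> ExtCl u .: (Ext1 R X Y)"
 using ext_of_obtain ext_class_closed[OF X ses'(1)] by metis

lemma ext_of_add:
 assumes "lin R X Q1 u" "lin R X Q1 u'"
 shows "ExtCl (%x. u x \<oplus>\<^sub>Q1 u' x) = add (Ext1 R X Y) (ExtCl u) (ExtCl u')"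
proof -
 interpret Q0: left_module R Q0 by (rule ses')
 interpret Q1: left_module R Q1 by (rule ses')
 obtain h where h: "ExtRep h u" "ExtCl u = ext_class R X Y h" "lin R Syz Y h" by (rule ext_of_obtain[OF assms(1)])
 obtain h' where h': "ExtRep h' u'" "ExtCl u' = ext_class R X Y h'" "lin R Syz Y h'" by (rule ext_of_obtain[OF assms(2)])
 obtain sg where s: "sg \<in> el X -> el Q0" "!!x. x .: X ==> p (sg x) = u x"
  "!!c. c .: Syz ==> j (h c) = lcomb R Q0 (el X) c sg"
  using h(1) unfolding ext_rep_def by blast
 obtain sg' where s': "sg' \<in> el X -> el Q0" "!!x. x .: X ==> p (sg' x) = u' x"
  "!!c. c .: Syz ==> j (h' c) = lcomb R Q0 (el X) c sg'"
  using h'(1) unfolding ext_rep_def by blast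
 have "ExtRep (%c. h c \<oplus>\<^sub>Y h' c) (%x. u x \<oplus>\<^sub>Q1 u' x)"
  unfolding ext_rep_def
 proof (intro conjI bexI[of _ "%x. sg x \<oplus>\<^sub>Q0 sg' x"] ballI)
  show "lin R Syz Y (%c. h c \<oplus>\<^sub>Y h' c)" by (rule lin_add_pt[OF ses'(1) h(3) h'(3)])
  show "lin R X Q1 (%x. u x \<oplus>\<^sub>Q1 u' x)" by (rule lin_add_pt[OF ses'(3) assms])
  show "p (sg x \<oplus>\<^sub>Q0 sg' x) = u x \<oplus>\<^sub>Q1 u' x" if "x .: X" for x
   using lin_add[OF ses'(6), of "sg x" "sg' x"] s s' that by (simp add: Pi_def)
  show "j (h c \<oplus>\<^sub>Y h' c) = lcomb R Q0 (el X) c (%x. sg x \<oplus>\<^sub>Q0 sg' x)" if c: "c .: Syz" for c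
   using lin_add[OF ses'(4) lin_cl[OF h(3) c] lin_cl[OF h'(3) c]] s(3)[OF c] s'(3)[OF c]
    Q0.lcomb_add[OF s(1) s'(1) syzygy_FX[OF X c]] by simp
 qed (use s s' in auto)
 then show ?thesis
  using ext_of_rep ext_class_add[OF X ses'(1) h(3) h'(3)] h(2) h'(2) by simp
qed

lemma ext_of_cong: "lin R X Q1 u ==> (!!x. x .: X ==> u x = u' x) ==> ExtCl u = ExtCl u'"
proof -
 assume u: "lin R X Q1 u" and e: "!!x. x .: X ==> u x = u' x"
 have u': "lin R X Q1 u'" by (rule lin_congI[OF X u]) (simp add: e)
 obtain h where h: "ExtRep h u" "ExtCl u = ext_class R X Y h" "lin R Syz Y h" by (rule ext_of_obtain[OF u])
 obtain h' where h': "ExtRep h' u'" "ExtCl u' = ext_class R X Y h'" "lin R Syz Y h'" by (rule ext_of_obtain[OF u'])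
 show ?thesis unfolding h(2) h'(2) by (rule ext_rep_unique[OF h(1) h'(1) e])
qed

text \<open>Exactness of \<open>Hom(X, Q\<^sub>0) \<rightarrow> Hom(X, Q\<^sub>1) \<rightarrow> Ext\<^sup>1(X, Y)\<close>.\<close>

lemma ext_of_zero_iff:
 assumes "lin R X Q1 u"
 shows "ExtCl u = zero (Ext1 R X Y) <-> (\<exists>w. lin R X Q0 w & (\<forall>x \<in> el X. p (w x) = u x))"
proof
 interpret Y: left_module R Y by (rule ses')
 interpret Q0: left_module R Q0 by (rule ses')
 interpret Q1: left_module R Q1 by (rule ses')
 obtain h where h: "ExtRep h u" "ExtCl u = ext_class R X Y h" "lin R Syz Y h" by (rule ext_of_obtain[OF assms])
 obtain sg where s: "sg \<in> el X -> el Q0" "!!x. x .: X ==> p (sg x) = u x"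
  "!!c. c .: Syz ==> j (h c) = lcomb R Q0 (el X) c sg"
  using h(1) unfolding ext_rep_def by blast
 assume "ExtCl u = zero (Ext1 R X Y)"
 then obtain g where g: "g \<in> el X -> el Y" "!!c. c .: Syz ==> h c = lcomb R Y (el X) c g"
  unfolding h(2) ext_class_eq_zero_iff[OF X ses'(1) h(3)] by blast
 define w where "w x = sg x \<oplus>\<^sub>Q0 (\<ominus>\<^sub>Q0 j (g x))" for x
 have jg: "j (g x) .: Q0" "p (j (g x)) = \<zero>\<^sub>Q1" if "x .: X" for x
  using g(1) that lin_cl[OF ses'(4)] ses'(9) by auto
 have sx: "sg x .: Q0" if "x .: X" for x using s(1) that by auto
 have wc: "w \<in> el X -> el Q0" using jg sx by (auto simp: w_def)
 have "lin R X Q0 w"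
 proof (rule syzygy_linI[OF X ses'(2) wc])
  fix c assume c: "c .: Syz"
  note cF = syzygy_FX[OF X c]
  have "lcomb R Q0 (el X) c (%x. w x \<oplus>\<^sub>Q0 j (g x)) = lcomb R Q0 (el X) c sg"
  proof (rule Q0.lcomb_cong[OF _ s(1) cF])
   fix x assume "x .: X"
   then show "w x \<oplus>\<^sub>Q0 j (g x) = sg x" using jg sx by (simp add: w_def Q0.M.a_assoc Q0.M.l_neg)
  qed
  then have "lcomb R Q0 (el X) c w \<oplus>\<^sub>Q0 lcomb R Q0 (el X) c (%x. j (g x)) = j (h c)"
   using Q0.lcomb_add[OF wc _ cF, of "%x. j (g x)"] jg s(3)[OF c] by auto
  also have "j (h c) = lcomb R Q0 (el X) c (%x. j (g x))"
   using Q0.lin_lcomb_comp[OF ses'(1,4) g(1) cF] g(2)[OF c] by simp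
  finally show "lcomb R Q0 (el X) c w = \<zero>\<^sub>Q0"
   using Q0.lcomb_closed[OF cF wc] Q0.lcomb_closed[OF cF, of "%x. j (g x)"] jg
   by (simp add: Pi_def)
 qed
 moreover have "p (w x) = u x" if "x .: X" for x
  using lin_add[OF ses'(6), of "sg x" "\<ominus>\<^sub>Q0 j (g x)"] jg[OF that] sx[OF that] s(2)[OF that]
   lin_minus[OF Q0.ag Q1.ag ses'(6) jg(1)[OF that]]
   Q1.M.minus_equality[of "\<zero>\<^sub>Q1" "\<zero>\<^sub>Q1"] lin_cl[OF assms that]
  by (simp add: w_def)
 ultimately show "\<exists>w. lin R X Q0 w & (\<forall>x \<in> el X. p (w x) = u x)" by blast
next
 interpret Y: left_module R Y by (rule ses')
 assume "\<exists>w. lin R X Q0 w & (\<forall>x \<in> el X. p (w x) = u x)"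
 then obtain w where w: "lin R X Q0 w" "!!x. x .: X ==> p (w x) = u x" by blast
 have jz: "j \<zero>\<^sub>Y = \<zero>\<^sub>Q0"
 proof -
  interpret Q0: left_module R Q0 by (rule ses')
  show ?thesis by (rule lin_zero[OF Y.ag Q0.ag ses'(4)])
 qed
 have "ExtRep (%_. \<zero>\<^sub>Y) u"
  unfolding ext_rep_def using assms w lin_cl[OF w(1)] syzygy_lin[OF X ses'(2) w(1)] jz
  by (intro conjI bexI[of _ w]) (auto intro: lin_zero_pt[OF ses'(1)])
 then show "ExtCl u = zero (Ext1 R X Y)" using ext_of_rep ext_class_zero[OF X ses'(1)] by simp
qed

lemma ext_of_pull:
 assumes "lin R X Q1 u" "lin R X X g"
 shows "Ext1_pull R X Y g (ExtCl u) = ExtCl (%x. u (g x))"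
proof -
 interpret Q0: left_module R Q0 by (rule ses')
 obtain h where h: "ExtRep h u" "ExtCl u = ext_class R X Y h" "lin R Syz Y h" by (rule ext_of_obtain[OF assms(1)])
 obtain sg where s: "sg \<in> el X -> el Q0" "!!x. x .: X ==> p (sg x) = u x"
  "!!c. c .: Syz ==> j (h c) = lcomb R Q0 (el X) c sg"
  using h(1) unfolding ext_rep_def by blast
 have gX: "g \<in> el X -> el X" using lin_cl[OF assms(2)] by auto
 have "ExtRep (%c. h (free_map R (el X) g c)) (%x. u (g x))"
  unfolding ext_rep_def
 proof (intro conjI bexI[of _ "%x. sg (g x)"] ballI)
  show "lin R Syz Y (%c. h (free_map R (el X) g c))"
   by (rule lin_comp[OF lin_free_map_syzygy[OF X assms(2)] h(3)])
  show "lin R X Q1 (%x. u (g x))" by (rule lin_comp[OF assms(2,1)])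
  show "j (h (free_map R (el X) g c)) = lcomb R Q0 (el X) c (%x. sg (g x))" if c: "c .: Syz" for c
   using s(3)[OF free_map_syzygy[OF X assms(2) c]] Q0.lcomb_free_map[OF syzygy_FX[OF X c] gX s(1)] by simp
 qed (use s gX in auto)
 then show ?thesis using ext_of_rep Ext1_pull_class[OF X ses'(1) h(3) assms(2)] h(2) by simp
qed

text \<open>The connecting homomorphism is onto because \<open>Ext\<^sup>1(X, Q\<^sub>0) = 0\<close>.  Injectivity of \<open>Q\<^sub>0\<close> is available for free modules of finite rank only, while the cover of \<open>X\<close> is free on all of \<open>X\<close>; so \<open>h\<close> is restricted to a presentation of \<open>X\<close> by a free module of finite rank and extended there.\<close>

lemma ext_of_surj:
 assumes "injmod R Q0" "fg_module R X" "e .: (Ext1 R X Y)"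
 obtains u where "lin R X Q1 u" "e = ExtCl u"
proof -
 interpret X: left_module R X by (rule X)
 interpret Y: left_module R Y by (rule ses')
 interpret Q0: left_module R Q0 by (rule ses')
 interpret Q1: left_module R Q1 by (rule ses')
 obtain h where e: "e = ext_class R X Y h" and h: "lin R Syz Y h"
  using assms(3) unfolding Ext1_carrier[OF X ses'(1)] by blast
 have rR: "ring R" by (rule ring_X[OF X])
 obtain d g where g: "g \<in> {..<d::nat} -> el X"
  and im: "(%c. lcomb R X {..<d} c g) ` el (free_module R {..<d}) = el X"
  by (rule fin_gen_lcomb[OF X fgD(2)[OF assms(2)]])
 let ?P = "free_module R {..<d}" let ?q = "%a. lcomb R X {..<d} a g" let ?FX = "free_module R (el X)"
 note P = lm_free[OF rR, of "{..<d}"] and FX = lm_free[OF rR, of "el X"]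
 interpret P: left_module R ?P by (rule P)
 interpret FX: left_module R ?FX by (rule FX)
 interpret SX: left_module R Syz by (rule lm_SX[OF X])
 note q = X.lin_lcomb[OF g] and fgen = free_gen_cl[OF rR, where S = "el X"]
 have fg: "(%i. free_gen R (g i)) \<in> {..<d} -> el ?FX" using g fgen by auto
 let ?\<Phi> = "%a. lcomb R ?FX {..<d} a (%i. free_gen R (g i))"
 note Phi = FX.lin_lcomb[OF fg]
 note val = lin_value[OF X]
 have vgen: "lcomb R X (el X) (free_gen R x) (%x. x) = x" if "x .: X" for x
  using X.lcomb_free_gen[of "%x. x" "el X" x] that by simp
 have vPhi: "lcomb R X (el X) (?\<Phi> a) (%x. x) = ?q a" if "a .: ?P" for a
 proof -
  have "lcomb R X (el X) (?\<Phi> a) (%x. x) =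
    lcomb R X {..<d} a (%i. lcomb R X (el X) (free_gen R (g i)) (%x. x))"
   by (rule X.lin_lcomb_comp[OF FX val fg that])
  also have "... = ?q a" using g vgen by (intro X.lcomb_cong that) auto
  finally show ?thesis .
 qed
 define S' where "S' = {a \<in> el ?P. ?q a = \<zero>\<^sub>X}"
 have S': "submodule S' R ?P" unfolding S'_def by (rule submodule_kernel[OF P X q])
 have PhiS: "?\<Phi> a .: Syz" if "a \<in> S'" for a
  using that vPhi lin_cl[OF Phi] by (auto simp: S'_def syzygy_carrier[OF X])
 have "lin R (?P .| S') (?FX .| (el Syz)) ?\<Phi>"
  using PhiS by (intro lin_corestrict lin_restrict_dom[OF Phi] submod_sub[OF S']) auto
 then have PhiL: "lin R (?P .| S') Syz ?\<Phi>" by (simp only: syzygy_eq[OF X, symmetric])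
 obtain G where G: "lin R ?P Q0 G" "!!a. a \<in> S' ==> G a = j (h (?\<Phi> a))"
  using assms(1) S' lin_comp[OF PhiL lin_comp[OF h ses'(4)]] unfolding injmod_def by blast
 define r where "r x = inv_into (el ?P) ?q x" for x
 have r: "r x .: ?P" "?q (r x) = x" if "x .: X" for x
 proof -
  have "x \<in> ?q ` el ?P" using im that by simp
  then show "r x .: ?P" "?q (r x) = x" unfolding r_def by (rule inv_into_into, rule f_inv_into_f)
 qed
 define g0 where "g0 x = free_gen R x \<ominus>\<^sub>?FX ?\<Phi> (r x)" for x
 have Pr: "?\<Phi> (r x) .: ?FX" if "x .: X" for x using lin_cl[OF Phi] r that by simp
 have g0: "g0 x .: Syz" if x: "x .: X" for x
 proof -
  have "lcomb R X (el X) (g0 x) (%x. x) = x \<ominus>\<^sub>X x"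
   unfolding g0_def
   using lin_diff[OF FX.ag X.ag val fgen[OF x] Pr[OF x]]
    vgen[OF x] vPhi[OF r(1)[OF x]] r(2)[OF x] by simp
  then show ?thesis using x fgen[OF x] Pr[OF x] X.M.diff_eq_zero[OF x x] by (simp add: syzygy_carrier[OF X] g0_def)
 qed
 define sg where "sg x = G (r x) \<oplus>\<^sub>Q0 j (h (g0 x))" for x
 have jh: "lin R Syz Q0 (%c. j (h c))" by (rule lin_comp[OF h ses'(4)])
 have c1: "(%x. G (r x)) \<in> el X -> el Q0" using lin_cl[OF G(1)] r by auto
 have c2: "(%x. j (h (g0 x))) \<in> el X -> el Q0" using lin_cl[OF jh] g0 by auto
 have sc: "sg \<in> el X -> el Q0" unfolding sg_def using c1 c2 by auto
 have main: "lcomb R Q0 (el X) c sg = j (h c)" if c: "c .: Syz" for c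
 proof -
  note cF = syzygy_FX[OF X c]
  have rP: "r \<in> el X -> el ?P" using r by auto
  have g0S: "g0 \<in> el X -> el Syz" using g0 by auto
  let ?a = "lcomb R ?P (el X) c r"
  have a: "?a \<in> S'"
  proof -
   have "?q ?a = lcomb R X (el X) c (%x. ?q (r x))" by (rule X.lin_lcomb_comp[OF P q rP cF])
   also have "... = lcomb R X (el X) c (%x. x)" using r by (intro X.lcomb_cong cF) auto
   also have "... = \<zero>\<^sub>X" using c by (simp add: syzygy_carrier[OF X])
   finally show ?thesis using P.lcomb_closed[OF cF rP] by (simp add: S'_def)
  qed
  let ?b = "lcomb R Syz (el X) c g0"
  have bS: "?b .: Syz" by (rule SX.lcomb_closed[OF cF g0S])
  have bF: "?b = lcomb R ?FX (el X) c g0"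
   using lcomb_submodule(1)[OF FX submodule_SX[OF X] g0S cF] by (simp only: syzygy_eq[OF X, symmetric])
  have "c = lcomb R ?FX (el X) c (free_gen R)" by (rule free_module_expand[OF rR cF, symmetric])
  also have "... = lcomb R ?FX (el X) c (%x. g0 x \<oplus>\<^sub>?FX ?\<Phi> (r x))"
   using fgen Pr FX.M.diff_add g0 syzygy_FX[OF X] by (intro FX.lcomb_cong cF) (auto simp: g0_def)
  also have "... = lcomb R ?FX (el X) c g0 \<oplus>\<^sub>?FX lcomb R ?FX (el X) c (%x. ?\<Phi> (r x))"
   using g0 Pr syzygy_FX[OF X] by (intro FX.lcomb_add cF) auto
  also have "lcomb R ?FX (el X) c (%x. ?\<Phi> (r x)) = ?\<Phi> ?a"
   by (rule FX.lin_lcomb_comp[OF P Phi rP cF, symmetric])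
  also have "lcomb R ?FX (el X) c g0 \<oplus>\<^sub>?FX ?\<Phi> ?a = ?b \<oplus>\<^sub>Syz ?\<Phi> ?a"
   unfolding bF by (simp add: syzygy_def free_cover_def)
  finally have ceq: "c = ?b \<oplus>\<^sub>Syz ?\<Phi> ?a" .
  have "lcomb R Q0 (el X) c sg = lcomb R Q0 (el X) c (%x. G (r x)) \<oplus>\<^sub>Q0 lcomb R Q0 (el X) c (%x. j (h (g0 x)))"
   unfolding sg_def by (rule Q0.lcomb_add[OF c1 c2 cF])
  also have "lcomb R Q0 (el X) c (%x. G (r x)) = G ?a" by (rule Q0.lin_lcomb_comp[OF P G(1) rP cF, symmetric])
  also have "G ?a = j (h (?\<Phi> ?a))" by (rule G(2)[OF a])
  also have "lcomb R Q0 (el X) c (%x. j (h (g0 x))) = j (h ?b)"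
   by (rule Q0.lin_lcomb_comp[OF SX.left_module_axioms jh g0S cF, symmetric])
  also have "j (h (?\<Phi> ?a)) \<oplus>\<^sub>Q0 j (h ?b) = j (h (?b \<oplus>\<^sub>Syz ?\<Phi> ?a))"
   using lin_add[OF jh bS PhiS[OF a]] lin_cl[OF jh bS] lin_cl[OF jh PhiS[OF a]] by (simp add: Q0.M.a_comm)
  finally show ?thesis using ceq by simp
 qed
 let ?u = "%x. p (sg x)"
 have u: "lin R X Q1 ?u"
 proof (rule syzygy_linI[OF X ses'(3)])
  show "?u \<in> el X -> el Q1" using sc lin_cl[OF ses'(6)] by auto
  fix c assume c: "c .: Syz"
  have "lcomb R Q1 (el X) c ?u = p (lcomb R Q0 (el X) c sg)"
   by (rule Q1.lin_lcomb_comp[OF ses'(2,6) sc syzygy_FX[OF X c], symmetric])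
  then show "lcomb R Q1 (el X) c ?u = \<zero>\<^sub>Q1" using main[OF c] ses'(9) lin_cl[OF h c] by simp
 qed
 have "ExtRep h ?u" unfolding ext_rep_def using h u sc main by (intro conjI bexI[of _ sg]) auto
 then show ?thesis using that[OF u] e ext_of_rep by simp
qed

end

text \<open>Naturality of the connecting homomorphism in a morphism of exact sequences.\<close>

lemma ext_of_push:
 assumes X: "lmod R X" and s: "short_exact R Y Q0 Q1 j p" and s': "short_exact R Y' Q0' Q1' j' p'"
  and f: "lin R Y Y' f" and G: "lin R Q0 Q0' G" and t: "lin R Q1 Q1' t"
  and Gj: "!!y. y .: Y ==> G (j y) = j' (f y)" and tp: "!!q. q .: Q0 ==> t (p q) = p' (G q)"
  and u: "lin R X Q1 u"
 shows "Ext1_push R X Y' f (ext_of R X Y Q0 Q1 j p u) = ext_of R X Y' Q0' Q1' j' p' (%x. t (u x))"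
proof -
 note S = short_exactD[OF s] and S' = short_exactD[OF s']
 interpret Q0': left_module R Q0' by (rule S')
 obtain h where h: "ext_rep R X Y Q0 Q1 j p h u" "ext_of R X Y Q0 Q1 j p u = ext_class R X Y h"
  "lin R (syzygy R X) Y h"
  by (rule ext_of_obtain[OF X s u])
 obtain sg where sg: "sg \<in> el X -> el Q0" "!!x. x .: X ==> p (sg x) = u x"
  "!!c. c .: (syzygy R X) ==> j (h c) = lcomb R Q0 (el X) c sg"
  using h(1) unfolding ext_rep_def by blast
 have "ext_rep R X Y' Q0' Q1' j' p' (%c. f (h c)) (%x. t (u x))"
  unfolding ext_rep_def
 proof (intro conjI bexI[of _ "%x. G (sg x)"] ballI)
  show "lin R (syzygy R X) Y' (%c. f (h c))" by (rule lin_comp[OF h(3) f])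
  show "lin R X Q1' (%x. t (u x))" by (rule lin_comp[OF u t])
  show "p' (G (sg x)) = t (u x)" if "x .: X" for x
   using tp[OF funcset_mem[OF sg(1) that]] sg(2)[OF that] by simp
  show "j' (f (h c)) = lcomb R Q0' (el X) c (%x. G (sg x))" if c: "c .: (syzygy R X)" for c
   using Gj[OF lin_cl[OF h(3) c]] sg(3)[OF c] Q0'.lin_lcomb_comp[OF S(2) G sg(1) syzygy_FX[OF X c]] by simp
 qed (use sg lin_cl[OF G] in auto)
 then show ?thesis
  using ext_of_rep[OF X s'] Ext1_push_class[OF X S(1) S'(1) h(3) f] h(2) by simp
qed

section \<open>The module \<open>Ext\<^sup>1(D, Y)\<close>\<close>

lemma ext_of_zero:
 assumes X: "lmod R X" and s: "short_exact R Y Q0 Q1 j p"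
 shows "ext_of R X Y Q0 Q1 j p (%_. \<zero>\<^sub>Q1) = zero (Ext1 R X Y)"
proof -
 note S = short_exactD[OF s]
 interpret Q0: left_module R Q0 by (rule S)
 interpret Q1: left_module R Q1 by (rule S)
 have "p \<zero>\<^sub>Q0 = \<zero>\<^sub>Q1" by (rule lin_zero[OF Q0.ag Q1.ag S(6)])
 then show ?thesis
  unfolding ext_of_zero_iff[OF X s lin_zero_pt[OF S(3)]]
  by (intro exI[of _ "%_. \<zero>\<^sub>Q0"]) (simp add: lin_zero_pt[OF S(2)])
qed

lemma ext_of_finsum:
 assumes X: "lmod R X" and s: "short_exact R Y Q0 Q1 j p"
  and "finite I" "!!i. i \<in> I ==> lin R X Q1 (U i)"
 shows "ext_of R X Y Q0 Q1 j p (%x. \<Oplus>\<^bsub>Q1\<^esub>i \<in> I. U i x) = (\<Oplus>\<^bsub>Ext1 R X Y\<^esub>i \<in> I. ext_of R X Y Q0 Q1 j p (U i))"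
 using assms(3,4)
proof (induction I)
 note S = short_exactD[OF s]
 interpret Q1: left_module R Q1 by (rule S)
 interpret Ex: abelian_group "Ext1 R X Y" by (rule abelian_group_Ext1[OF X S(1)])
 {
  case empty
  show ?case using ext_of_zero[OF X s] by simp
 next
  case (insert k I)
  have l: "lin R X Q1 (%x. \<Oplus>\<^bsub>Q1\<^esub>i \<in> I. U i x)" by (rule lin_finsum_pt[OF X S(3)]) (use insert in auto)
  have "ext_of R X Y Q0 Q1 j p (%x. \<Oplus>\<^bsub>Q1\<^esub>i \<in> insert k I. U i x) =
    ext_of R X Y Q0 Q1 j p (%x. U k x \<oplus>\<^sub>Q1 (\<Oplus>\<^bsub>Q1\<^esub>i \<in> I. U i x))"
  proof (rule ext_of_cong[OF X s, symmetric])
   show "lin R X Q1 (%x. U k x \<oplus>\<^sub>Q1 (\<Oplus>\<^bsub>Q1\<^esub>i \<in> I. U i x))" using insert l by (intro lin_add_pt[OF S(3)]) auto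
   show "U k x \<oplus>\<^sub>Q1 (\<Oplus>\<^bsub>Q1\<^esub>i \<in> I. U i x) = (\<Oplus>\<^bsub>Q1\<^esub>i \<in> insert k I. U i x)" if "x .: X" for x
   proof (rule Q1.M.finsum_insert[symmetric])
    show "(%i. U i x) \<in> I -> el Q1" "U k x .: Q1"
     using lin_cl[OF insert(4) that] by auto
   qed (use insert in auto)
  qed
  also have "... = ext_of R X Y Q0 Q1 j p (U k) \<oplus>\<^sub>(Ext1 R X Y) ext_of R X Y Q0 Q1 j p (%x. \<Oplus>\<^bsub>Q1\<^esub>i \<in> I. U i x)"
   using insert l by (intro ext_of_add[OF X s]) auto
  also have "... = (\<Oplus>\<^bsub>Ext1 R X Y\<^esub>i \<in> insert k I. ext_of R X Y Q0 Q1 j p (U i))"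
   using insert ext_of_closed[OF X s] by (subst Ex.finsum_insert) auto
  finally show ?case .
 }
qed

context fin_dim_algebra
begin

abbreviation "rho b \<equiv> (\<lambda>ph \<in> el D. dual_rmult A ph b)"

lemma rho_lin: "b .: A ==> lin A D D (rho b)"
 by (rule lin_congI[OF lm_D dual_rmult_lin]) auto

text \<open>Like \<open>E\<close>, the group \<open>Ext\<^sup>1(D, Y)\<close> is a left \<open>A\<close>-module through the right action on \<open>D\<close>.\<close>

definition ext_mod :: "('a, 'y, 'n) ms => ('a, ((('a => 'f) => 'a) => 'y) set) module"
 where "ext_mod Y =
  \<lparr>carrier = el (Ext1 A D Y), monoid.mult = undefined, one = undefined,
  zero = zero (Ext1 A D Y), add = add (Ext1 A D Y), smult = (%b. Ext1_pull A D Y (rho b))\<rparr>"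

lemma ext_mod_simps:
 "el (ext_mod Y) = el (Ext1 A D Y)" "zero (ext_mod Y) = zero (Ext1 A D Y)"
 "add (ext_mod Y) = add (Ext1 A D Y)" "b \<odot>\<^sub>(ext_mod Y) e = Ext1_pull A D Y (rho b) e"
 by (simp_all add: ext_mod_def)

definition inj_pres where "inj_pres Y Q0 Q1 j p <-> short_exact A Y Q0 Q1 j p & injmod A Q0 & fg_module A Q0"

lemma inj_pres_exists:
 fixes Y :: "('a, 'y, 'n) ms"
 assumes "fg_module A Y"
 obtains n and j :: "'y => nat => 'a => 'f" where
  "inj_pres Y (pow_mod D n) (quot_mod (pow_mod D n) (j ` el Y)) j (%x. (j ` el Y) +>\<^bsub>pow_mod D n\<^esub> x)"
proof -
 obtain n j where j: "lin A Y (pow_mod D n) j" "inj_on j (el Y)" by (rule embed_in_dual_power[OF assms])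
 show ?thesis
  by (rule that[of n j], unfold inj_pres_def)
   (intro conjI short_exact_quot[OF fgD(1)[OF assms] lm_pow[OF lm_D] j]
    injmod_pow injmod_D fg_module_pow fg_module_D)
qed

lemma finsum_ext_mod:
 assumes "lmod A Y" "f \<in> I -> el (Ext1 A D Y)" "abelian_group (ext_mod Y)"
 shows "finsum (ext_mod Y) f I = finsum (Ext1 A D Y) f I"
 using add_finsum[OF abelian_group_Ext1[OF lm_D assms(1)] assms(3), of "%x. x" f I] assms(2)
 by (simp add: ext_mod_simps)

context
 fixes Y :: "('a, 'y, 'n) ms" and Q0 :: "('a, 'q, 'k) ms"
  and Q1 :: "('a, 'r1, 'l) ms" and j p
 assumes pres: "inj_pres Y Q0 Q1 j p"
begin

abbreviation "clY \<equiv> ext_of A D Y Q0 Q1 j p"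

lemma presD: "short_exact A Y Q0 Q1 j p" "injmod A Q0" "fg_module A Q0"
 using pres by (auto simp: inj_pres_def)

lemmas presS = short_exactD[OF presD(1)]

lemma clY_smult:
 assumes "a .: A" "lin A D Q1 u"
 shows "a \<odot>\<^sub>(ext_mod Y) clY u = clY (%ph. u (dual_rmult A ph a))"
proof -
 have "a \<odot>\<^sub>(ext_mod Y) clY u = clY (%ph. u (rho a ph))"
  unfolding ext_mod_simps by (rule ext_of_pull[OF lm_D presD(1) assms(2) rho_lin[OF assms(1)]])
 also have "... = clY (%ph. u (dual_rmult A ph a))"
  by (rule ext_of_cong[OF lm_D presD(1) lin_comp[OF rho_lin[OF assms(1)] assms(2)]]) simp
 finally show ?thesis .
qed

lemma ext_mod_obtain:
 assumes "e .: (ext_mod Y)"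
 obtains u where "lin A D Q1 u" "e = clY u"
 using ext_of_surj[OF lm_D presD(1,2) fg_module_D, of e] assms by (auto simp: ext_mod_simps)

lemma clY_closed: "lin A D Q1 u ==> clY u .: (ext_mod Y)"
 using ext_of_closed[OF lm_D presD(1)] by (simp add: ext_mod_simps)

lemma lm_ext_mod: "lmod A (ext_mod Y)"
proof (rule left_moduleI[OF ringA])
 interpret Q1: left_module A Q1 by (rule presS)
 note cong = ext_of_cong[OF lm_D presD(1)]
 note comp = lin_comp[OF dual_rmult_lin]
 show "abelian_group (ext_mod Y)"
  by (rule abelian_group_image[where G = "Ext1 A D Y" and p = "%x. x"])
   (simp_all add: ext_mod_simps abelian_group_Ext1[OF lm_D presS(1)])
 show "a \<odot>\<^sub>(ext_mod Y) e .: (ext_mod Y)" if ae: "a .: A" "e .: (ext_mod Y)" for a e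
 proof -
  obtain u where u: "lin A D Q1 u" "e = clY u" by (rule ext_mod_obtain[OF ae(2)])
  show ?thesis unfolding u(2) clY_smult[OF ae(1) u(1)] by (rule clY_closed[OF comp[OF ae(1) u(1)]])
 qed
 show "(a \<oplus>\<^sub>A b) \<odot>\<^sub>(ext_mod Y) e = a \<odot>\<^sub>(ext_mod Y) e \<oplus>\<^sub>(ext_mod Y) b \<odot>\<^sub>(ext_mod Y) e"
  if ab: "a .: A" "b .: A" and e: "e .: (ext_mod Y)" for a b e
 proof -
  obtain u where u: "lin A D Q1 u" "e = clY u" by (rule ext_mod_obtain[OF e])
  have "a \<oplus>\<^sub>A b .: A" using ab by (rule abelian_monoid.a_closed[OF abelian_group.axioms(1)[OF abelianA]])
  then have "(a \<oplus>\<^sub>A b) \<odot>\<^sub>(ext_mod Y) e = clY (%ph. u (dual_rmult A ph (a \<oplus>\<^sub>A b)))" unfolding u(2) by (rule clY_smult[OF _ u(1)])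
  also have "... = clY (%ph. u (dual_rmult A ph a) \<oplus>\<^sub>Q1 u (dual_rmult A ph b))"
   by (rule cong[OF comp[OF \<open>a \<oplus>\<^sub>A b .: A\<close> u(1)]])
    (simp add: dual_rmult_add ab lin_add[OF u(1)] dual_rmult_closed)
  also have "... = a \<odot>\<^sub>(ext_mod Y) e \<oplus>\<^sub>(ext_mod Y) b \<odot>\<^sub>(ext_mod Y) e"
   using ext_of_add[OF lm_D presD(1) comp[OF ab(1) u(1)] comp[OF ab(2) u(1)]]
   by (simp add: u(2) clY_smult[OF _ u(1)] ab ext_mod_simps(3))
  finally show ?thesis .
 qed
 show "a \<odot>\<^sub>(ext_mod Y) (e \<oplus>\<^sub>(ext_mod Y) e') = a \<odot>\<^sub>(ext_mod Y) e \<oplus>\<^sub>(ext_mod Y) a \<odot>\<^sub>(ext_mod Y) e'"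
  if a: "a .: A" and e: "e .: (ext_mod Y)" "e' .: (ext_mod Y)" for a e e'
 proof -
  obtain u where u: "lin A D Q1 u" "e = clY u" by (rule ext_mod_obtain[OF e(1)])
  obtain u' where u': "lin A D Q1 u'" "e' = clY u'" by (rule ext_mod_obtain[OF e(2)])
  have "e \<oplus>\<^sub>(ext_mod Y) e' = clY (%ph. u ph \<oplus>\<^sub>Q1 u' ph)"
   using ext_of_add[OF lm_D presD(1) u(1) u'(1)] by (simp add: u(2) u'(2) ext_mod_simps(3))
  then have "a \<odot>\<^sub>(ext_mod Y) (e \<oplus>\<^sub>(ext_mod Y) e') = clY (%ph. u (dual_rmult A ph a) \<oplus>\<^sub>Q1 u' (dual_rmult A ph a))"
   using clY_smult[OF a lin_add_pt[OF presS(3) u(1) u'(1)]] by simp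
  also have "... = a \<odot>\<^sub>(ext_mod Y) e \<oplus>\<^sub>(ext_mod Y) a \<odot>\<^sub>(ext_mod Y) e'"
   using ext_of_add[OF lm_D presD(1) comp[OF a u(1)] comp[OF a u'(1)]]
   by (simp add: u(2) u'(2) clY_smult[OF a u(1)] clY_smult[OF a u'(1)] ext_mod_simps(3))
  finally show ?thesis .
 qed
 show "(a \<otimes>\<^sub>A b) \<odot>\<^sub>(ext_mod Y) e = a \<odot>\<^sub>(ext_mod Y) (b \<odot>\<^sub>(ext_mod Y) e)"
  if ab: "a .: A" "b .: A" and e: "e .: (ext_mod Y)" for a b e
 proof -
  obtain u where u: "lin A D Q1 u" "e = clY u" by (rule ext_mod_obtain[OF e])
  have c: "a \<otimes>\<^sub>A b .: A" using ab by (rule monoid.m_closed[OF monoidA])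
  then have "(a \<otimes>\<^sub>A b) \<odot>\<^sub>(ext_mod Y) e = clY (%ph. u (dual_rmult A ph (a \<otimes>\<^sub>A b)))" unfolding u(2) by (rule clY_smult[OF _ u(1)])
  also have "... = clY (%ph. u (dual_rmult A (dual_rmult A ph a) b))"
   by (rule cong[OF comp[OF c u(1)]]) (simp add: dual_rmult_mult ab)
  also have "... = a \<odot>\<^sub>(ext_mod Y) (b \<odot>\<^sub>(ext_mod Y) e)"
   using clY_smult[OF ab(1) comp[OF ab(2) u(1)]] clY_smult[OF ab(2) u(1)] by (simp add: u(2))
  finally show ?thesis .
 qed
 show "\<one>\<^sub>A \<odot>\<^sub>(ext_mod Y) e = e" if e: "e .: (ext_mod Y)" for e
 proof -
  obtain u where u: "lin A D Q1 u" "e = clY u" by (rule ext_mod_obtain[OF e])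
  have o: "\<one>\<^sub>A .: A" by (rule monoid.one_closed[OF monoidA])
  show ?thesis
   unfolding u(2) clY_smult[OF o u(1)]
   by (rule cong[OF comp[OF o u(1)]]) (simp add: dual_rmult_one)
 qed
qed

lemma clY_combination:
 assumes "finite I" "!!k. k \<in> I ==> lin A D Q1 (t k)" "!!k. k \<in> I ==> \<mu> k .: A"
 shows "clY (%ph. \<Oplus>\<^bsub>Q1\<^esub>k \<in> I. t k (dual_rmult A ph (\<mu> k))) = (\<Oplus>\<^bsub>ext_mod Y\<^esub>k \<in> I. \<mu> k \<odot>\<^sub>(ext_mod Y) clY (t k))"
proof -
 interpret Em: left_module A "ext_mod Y" by (rule lm_ext_mod)
 have l: "lin A D Q1 (%ph. t k (dual_rmult A ph (\<mu> k)))" if "k \<in> I" for k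
  by (rule lin_comp[OF dual_rmult_lin[OF assms(3)[OF that]] assms(2)[OF that]])
 have "clY (%ph. \<Oplus>\<^bsub>Q1\<^esub>k \<in> I. t k (dual_rmult A ph (\<mu> k))) =
   (\<Oplus>\<^bsub>Ext1 A D Y\<^esub>k \<in> I. clY (%ph. t k (dual_rmult A ph (\<mu> k))))"
  by (rule ext_of_finsum[OF lm_D presD(1) assms(1) l])
 also have "... = (\<Oplus>\<^bsub>ext_mod Y\<^esub>k \<in> I. clY (%ph. t k (dual_rmult A ph (\<mu> k))))"
  using l clY_closed by (intro finsum_ext_mod[symmetric] presS(1) Em.ag) (auto simp: ext_mod_simps)
 also have "... = (\<Oplus>\<^bsub>ext_mod Y\<^esub>k \<in> I. \<mu> k \<odot>\<^sub>(ext_mod Y) clY (t k))"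
  using assms clY_closed by (intro Em.M.finsum_cong') (auto simp: clY_smult)
 finally show ?thesis .
qed

end

text \<open>An injective module is a direct summand of a power of \<open>D\<close>, here in the form of a partition of its identity into maps through \<open>D\<close>.\<close>

lemma dual_summand:
 fixes I :: "('a, 'i, 'n) ms"
 assumes "fg_module A I" "injmod A I"
 obtains m :: nat and u v where "!!k. k < m ==> lin A D I (u k)" "!!k. k < m ==> lin A I D (v k)"
  "!!x. x .: I ==> (\<Oplus>\<^bsub>I\<^esub>k \<in> {..<m}. u k (v k x)) = x"
proof -
 note I = fgD(1)[OF assms(1)]
 interpret I: left_module A I by (rule I)
 obtain m z where z: "lin A I (pow_mod D m) z" "inj_on z (el I)" by (rule embed_in_dual_power[OF assms(1)])
 interpret P: left_module A "pow_mod D m" by (rule lm_pow[OF lm_D])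
 obtain w where w: "lin A (pow_mod D m) I w" "!!x. x .: I ==> w (z x) = x"
  using injmod_summand[OF assms(2) I fg_module_pow[OF fg_module_D] z] by blast
 show ?thesis
 proof (rule that[of m "%k ph. w (pow_in D m k ph)" "%k x. z x k"])
  show "lin A D I (%ph. w (pow_in D m k ph))" if "k < m" for k
   by (rule lin_comp[OF lin_pow_in[OF lm_D] w(1)])
  show "lin A I D (%x. z x k)" if "k < m" for k by (rule lin_comp[OF z(1) lin_pow_proj[OF that]])
  show "(\<Oplus>\<^bsub>I\<^esub>k \<in> {..<m}. w (pow_in D m k (z x k))) = x" if x: "x .: I" for x
  proof -
   have zx: "z x .: (pow_mod D m)" by (rule lin_cl[OF z(1) x])
   have "(%k. pow_in D m k (z x k)) \<in> {..<m} -> el (pow_mod D m)"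
    using zx lin_cl[OF lin_pow_in[OF lm_D]] by (auto simp: pow_mod_simps PiE_iff)
   from lin_finsum[OF P.ag I.ag w(1) this]
   show ?thesis using pow_expand[OF lm_D zx] w(2)[OF x] by simp
  qed
 qed
qed

abbreviation "E \<equiv> AR_bimodule F A"

lemma E_simps:
 "el E = el (ext_mod L)" "zero E = zero (ext_mod L)" "add E = add (ext_mod L)"
 "smult E = smult (ext_mod L)"
 "rsmult E e b = Ext1_push A D L (\<lambda>x \<in> el A. x \<otimes>\<^sub>A b) e"
 by (simp_all add: AR_bimodule_def Let_def ext_mod_def)

definition act :: "('a, 'y, 'n) ms => 'y => 'a => 'y"
 where "act Y y = (\<lambda>a \<in> el A. a \<odot>\<^sub>Y y)"

lemma act_lin:
 assumes "lmod A Y" "y .: Y" shows "lin A L Y (act Y y)"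
proof -
 interpret Y: left_module A Y by fact
 have "lin A L Y (%a. a \<odot>\<^sub>Y y)" by (rule linI) (simp_all add: assms Y.smult_l_distr Y.smult_assoc1)
 then show ?thesis by (rule lin_congI[OF lm_L]) (simp add: act_def)
qed

abbreviation push :: "('a, 'y, 'n) ms => 'y => _"
 where "push Y y \<equiv> Ext1_push A D Y (act Y y)"

lemma rsmult_push: "rsmult E e b = push L b e"
 by (simp add: E_simps act_def restrict_def)

end

section \<open>Homomorphisms out of \<open>Ext\<^sup>1(D, L)\<close>\<close>

context fin_dim_algebra
begin

context
 fixes n m :: nat and j0 :: "'a => nat => 'a => 'f" and I1 :: "('a, 'i, 'k) ms" and p0 u v
 assumes presL: "inj_pres L (pow_mod D n) I1 j0 p0"
  and u: "!!k. k < m ==> lin A D I1 (u k)" and v: "!!k. k < m ==> lin A I1 D (v k)"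
  and uv: "!!x. x .: I1 ==> (\<Oplus>\<^bsub>I1\<^esub>k \<in> {..<m}. u k (v k x)) = x"
begin

abbreviation "I0 \<equiv> pow_mod D n"
abbreviation "clL \<equiv> ext_of A D L I0 I1 j0 p0"

lemmas presLS = presS[OF presL]

lemma p0_j0: "a .: A ==> p0 (j0 a) = \<zero>\<^sub>I1" using presLS(9) by simp

lemma coefficients:
 assumes "lin A D I1 w"
 obtains \<mu> where "!!k. k < m ==> \<mu> k .: A"
  "!!k ph. k < m ==> ph .: D ==> v k (w ph) = dual_rmult A ph (\<mu> k)"
proof -
 have "\<forall>k. \<exists>a. k < m --> a .: A & (\<forall>ph \<in> el D. v k (w ph) = dual_rmult A ph a)"
  using dual_endo[OF lin_comp[OF assms v]] by blast
 then obtain \<mu> where "!!k. k < m --> \<mu> k .: A & (\<forall>ph \<in> el D. v k (w ph) = dual_rmult A ph (\<mu> k))"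
  by metis
 then show ?thesis using that by blast
qed

text \<open>With the endomorphisms of \<open>D\<close> known, a map \<open>D \<rightarrow> I\<^sub>1\<close> is a combination of the \<open>u\<^sub>k\<close> with coefficients in \<open>A\<close>; so the classes of the \<open>u\<^sub>k\<close> generate \<open>Ext\<^sup>1(D, L)\<close>.\<close>

lemma clL_expand:
 assumes "lin A D I1 w" "!!k. k < m ==> \<mu> k .: A"
  "!!k ph. k < m ==> ph .: D ==> v k (w ph) = dual_rmult A ph (\<mu> k)"
 shows "clL w = (\<Oplus>\<^bsub>ext_mod L\<^esub>k \<in> {..<m}. \<mu> k \<odot>\<^sub>(ext_mod L) clL (u k))"
proof -
 interpret I1: left_module A I1 by (rule presLS)
 have "clL w = clL (%ph. \<Oplus>\<^bsub>I1\<^esub>k \<in> {..<m}. u k (dual_rmult A ph (\<mu> k)))"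
 proof (rule ext_of_cong[OF lm_D presD(1)[OF presL] assms(1)])
  fix ph assume p: "ph .: D"
  have "w ph = (\<Oplus>\<^bsub>I1\<^esub>k \<in> {..<m}. u k (v k (w ph)))" by (rule uv[OF lin_cl[OF assms(1) p], symmetric])
  also have "... = (\<Oplus>\<^bsub>I1\<^esub>k \<in> {..<m}. u k (dual_rmult A ph (\<mu> k)))"
   using assms(2,3) p lin_cl[OF u] dual_rmult_closed by (intro I1.M.finsum_cong') auto
  finally show "w ph = (\<Oplus>\<^bsub>I1\<^esub>k \<in> {..<m}. u k (dual_rmult A ph (\<mu> k)))" .
 qed
 also have "... = (\<Oplus>\<^bsub>ext_mod L\<^esub>k \<in> {..<m}. \<mu> k \<odot>\<^sub>(ext_mod L) clL (u k))"
  by (rule clY_combination[OF presL]) (use u assms(2) in auto)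
 finally show ?thesis .
qed

text \<open>As \<open>I\<^sub>1\<close> is a summand of a power of \<open>D\<close>, prescribing images of the classes of the \<open>u\<^sub>k\<close> amounts to a map \<open>I\<^sub>1 \<rightarrow> Q\<^sub>1\<close>.\<close>

lemma ext_hom_induced:
 fixes Y :: "('a, 'y, 'n) ms" and Q0 :: "('a, 'q, 'l) ms"
  and Q1 :: "('a, 'r1, 'o) ms"
 assumes presY: "inj_pres Y Q0 Q1 j p" and H: "lin A (ext_mod L) (ext_mod Y) H"
 obtains t where "lin A I1 Q1 t" "!!w. lin A D I1 w ==> H (clL w) = ext_of A D Y Q0 Q1 j p (%ph. t (w ph))"
proof -
 let ?clY = "ext_of A D Y Q0 Q1 j p"
 interpret I1: left_module A I1 by (rule presLS)
 interpret Q1: left_module A Q1 by (rule presS[OF presY])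
 interpret EL: left_module A "ext_mod L" by (rule lm_ext_mod[OF presL])
 interpret EY: left_module A "ext_mod Y" by (rule lm_ext_mod[OF presY])
 have "\<forall>k. \<exists>t. k < m --> lin A D Q1 t & H (clL (u k)) = ?clY t"
 proof (intro allI)
  fix k
  show "\<exists>t. k < m --> lin A D Q1 t & H (clL (u k)) = ?clY t"
  proof (cases "k < m")
   case True
   show ?thesis
    by (rule ext_mod_obtain[OF presY lin_cl[OF H clY_closed[OF presL u[OF True]]]]) blast
  qed simp
 qed
 then obtain t where "!!k. k < m --> lin A D Q1 (t k) & H (clL (u k)) = ?clY (t k)" by metis
 then have t: "!!k. k < m ==> lin A D Q1 (t k)" "!!k. k < m ==> H (clL (u k)) = ?clY (t k)" by auto
 define T where "T x = (\<Oplus>\<^bsub>Q1\<^esub>k \<in> {..<m}. t k (v k x))" for x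
 have T: "lin A I1 Q1 T"
  unfolding T_def by (rule lin_finsum_pt[OF I1.left_module_axioms Q1.left_module_axioms]) (use lin_comp[OF v t(1)] in auto)
 have "H (clL w) = ?clY (%ph. T (w ph))" if w: "lin A D I1 w" for w
 proof -
  obtain \<mu> where mu: "!!k. k < m ==> \<mu> k .: A"
   "!!k ph. k < m ==> ph .: D ==> v k (w ph) = dual_rmult A ph (\<mu> k)"
   by (rule coefficients[OF w]) (rule that)
  have cl: "(%k. \<mu> k \<odot>\<^sub>(ext_mod L) clL (u k)) \<in> {..<m} -> el (ext_mod L)"
   using mu(1) clY_closed[OF presL u] by auto
  have "H (clL w) = H (\<Oplus>\<^bsub>ext_mod L\<^esub>k \<in> {..<m}. \<mu> k \<odot>\<^sub>(ext_mod L) clL (u k))"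
   using clL_expand[OF w mu] by simp
  also have "... = (\<Oplus>\<^bsub>ext_mod Y\<^esub>k \<in> {..<m}. H (\<mu> k \<odot>\<^sub>(ext_mod L) clL (u k)))"
   by (rule lin_finsum[OF EL.ag EY.ag H cl])
  also have "... = (\<Oplus>\<^bsub>ext_mod Y\<^esub>k \<in> {..<m}. \<mu> k \<odot>\<^sub>(ext_mod Y) ?clY (t k))"
   using mu(1) clY_closed[OF presL u] clY_closed[OF presY t(1)]
   by (intro EY.M.finsum_cong') (auto simp: lin_smult[OF H] t(2))
  also have "... = ?clY (%ph. \<Oplus>\<^bsub>Q1\<^esub>k \<in> {..<m}. t k (dual_rmult A ph (\<mu> k)))"
   by (rule clY_combination[OF presY, symmetric]) (use t mu in auto)
  also have "... = ?clY (%ph. T (w ph))"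
  proof (rule ext_of_cong[OF lm_D presD(1)[OF presY], symmetric, OF lin_comp[OF w T]])
   fix ph assume p: "ph .: D"
   show "T (w ph) = (\<Oplus>\<^bsub>Q1\<^esub>k \<in> {..<m}. t k (dual_rmult A ph (\<mu> k)))"
    unfolding T_def using mu p lin_cl[OF t(1)] dual_rmult_closed by (intro Q1.M.finsum_cong') auto
  qed
  finally show ?thesis .
 qed
 with T show ?thesis by (rule that)
qed

text \<open>The map \<open>t : I\<^sub>1 \<rightarrow> Q\<^sub>1\<close> that induces \<open>H\<close> sends classes that vanish to classes that vanish; hence \<open>t p\<^sub>0\<close> lifts to \<open>G : I\<^sub>0 \<rightarrow> Q\<^sub>0\<close>, and \<open>G\<close> restricts to a map \<open>L \<rightarrow> Y\<close>, which is the action on some \<open>y\<close>.\<close>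

lemma ext_hom_is_push':
 fixes Y :: "('a, 'y, 'n) ms" and Q0 :: "('a, 'q, 'l) ms"
  and Q1 :: "('a, 'r1, 'o) ms"
 assumes presY: "inj_pres Y Q0 Q1 j p" and H: "lin A (ext_mod L) (ext_mod Y) H"
 shows "\<exists>y \<in> el Y. \<forall>e \<in> el E. H e = push Y y e"
proof -
 let ?clY = "ext_of A D Y Q0 Q1 j p"
 note SY = presS[OF presY]
 interpret I0: left_module A I0 by (rule presLS)
 interpret I1: left_module A I1 by (rule presLS)
 interpret Y: left_module A Y by (rule SY)
 interpret Q0: left_module A Q0 by (rule SY)
 interpret Q1: left_module A Q1 by (rule SY)
 interpret EL: left_module A "ext_mod L" by (rule lm_ext_mod[OF presL])
 interpret EY: left_module A "ext_mod Y" by (rule lm_ext_mod[OF presY])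
 obtain t where t: "lin A I1 Q1 t" "!!w. lin A D I1 w ==> H (clL w) = ?clY (%ph. t (w ph))"
  by (rule ext_hom_induced[OF presY H]) (rule that)
 have tz: "t \<zero>\<^sub>I1 = \<zero>\<^sub>Q1" by (rule lin_zero[OF I1.ag Q1.ag t(1)])
 note pin = lin_pow_in[OF lm_D, of n]
 have "\<exists>W. lin A D Q0 W & (\<forall>ph \<in> el D. p (W ph) = t (p0 (pow_in D n i ph)))" for i
 proof -
  have w: "lin A D I1 (%ph. p0 (pow_in D n i ph))" by (rule lin_comp[OF pin presLS(6)])
  have "clL (%ph. p0 (pow_in D n i ph)) = \<zero>\<^sub>(ext_mod L)"
   unfolding ext_mod_simps ext_of_zero_iff[OF lm_D presD(1)[OF presL] w] using pin by blast
  then have "?clY (%ph. t (p0 (pow_in D n i ph))) = \<zero>\<^sub>(ext_mod Y)"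
   using t(2)[OF w] lin_zero[OF EL.ag EY.ag H] by simp
  then show ?thesis
   unfolding ext_mod_simps ext_of_zero_iff[OF lm_D presD(1)[OF presY] lin_comp[OF w t(1)]] .
 qed
 then obtain W where W: "!!i. lin A D Q0 (W i)"
  "!!i ph. ph .: D ==> p (W i ph) = t (p0 (pow_in D n i ph))" by metis
 define G where "G q = (\<Oplus>\<^bsub>Q0\<^esub>i \<in> {..<n}. W i (q i))" for q
 have G: "lin A I0 Q0 G"
  unfolding G_def
  by (rule lin_finsum_pt[OF I0.left_module_axioms Q0.left_module_axioms]) (use lin_comp[OF lin_pow_proj W(1)] in auto)
 have pG: "p (G q) = t (p0 q)" if q: "q .: I0" for q
 proof -
  have qi: "q i .: D" if "i < n" for i using q that by (auto simp: pow_mod_simps PiE_iff)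
  have c: "(%i. pow_in D n i (q i)) \<in> {..<n} -> el I0" using qi lin_cl[OF pin] by auto
  have "p (G q) = (\<Oplus>\<^bsub>Q1\<^esub>i \<in> {..<n}. p (W i (q i)))"
   unfolding G_def using qi lin_cl[OF W(1)]
   by (intro lin_finsum[OF Q0.ag Q1.ag SY(6)]) auto
  also have "... = (\<Oplus>\<^bsub>Q1\<^esub>i \<in> {..<n}. t (p0 (pow_in D n i (q i))))"
   using qi W(2) c lin_cl[OF lin_comp[OF presLS(6) t(1)]] by (intro Q1.M.finsum_cong') (auto simp: Pi_def)
  also have "... = t (p0 (\<Oplus>\<^bsub>I0\<^esub>i \<in> {..<n}. pow_in D n i (q i)))"
   by (rule lin_finsum[OF I0.ag Q1.ag lin_comp[OF presLS(6) t(1)] c, symmetric])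
  finally show ?thesis using pow_expand[OF lm_D q] by simp
 qed
 have o: "\<one>\<^sub>A .: A" by (rule monoid.one_closed[OF monoidA])
 have jc: "j0 a .: I0" if "a .: A" for a using lin_cl[OF presLS(4)] that by simp
 have "G (j0 \<one>\<^sub>A) \<in> j ` el Y"
  by (rule SY(8)[OF lin_cl[OF G jc[OF o]]]) (simp add: pG[OF jc[OF o]] p0_j0[OF o] tz)
 then obtain y where y: "y .: Y" "G (j0 \<one>\<^sub>A) = j y" by auto
 have Gj: "G (j0 a) = j (act Y y a)" if a: "a .: L" for a
 proof -
  have a': "a .: A" using a by simp
  have "j0 a = a \<odot>\<^sub>I0 j0 \<one>\<^sub>A"
   using lin_smult[OF presLS(4) a', of "\<one>\<^sub>A"] o monoid.r_one[OF monoidA a'] by simp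
  then have "G (j0 a) = a \<odot>\<^sub>Q0 j y" using lin_smult[OF G a' jc[OF o]] y(2) by simp
  then show ?thesis using lin_smult[OF SY(4) a' y(1)] a' by (simp add: act_def)
 qed
 have "H e = push Y y e" if "e .: E" for e
 proof -
  have "e .: (ext_mod L)" using that by (simp add: E_simps)
  then obtain w where w: "lin A D I1 w" "e = clL w" by (rule ext_mod_obtain[OF presL])
  have "push Y y (clL w) = ?clY (%ph. t (w ph))"
   by (rule ext_of_push[where G = G and t = t and p = p0 and p' = p and j = j0 and j' = j and f = "act Y y", OF lm_D presD(1)[OF presL] presD(1)[OF presY] act_lin[OF SY(1) y(1)] G t(1) Gj _ w(1)])
    (simp_all add: pG)
  then show ?thesis using t(2)[OF w(1)] w(2) by simp
 qed
 then show ?thesis using y(1) by blast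
qed

text \<open>Extend the action map \<open>L \<rightarrow> Y\<close> to \<open>(G, t)\<close> between the copresentations.  If it is zero on \<open>Ext\<^sup>1(D, -)\<close>, then \<open>t\<close> lifts to \<open>K : I\<^sub>1 \<rightarrow> Q\<^sub>0\<close>, and \<open>G - K p\<^sub>0\<close> maps the injective \<open>I\<^sub>0\<close> to \<open>Y\<close> and \<open>1 \<in> L\<close> to \<open>y\<close>.\<close>

lemma push_zero_imp_injective_image':
 fixes Y :: "('a, 'y, 'n) ms" and Q0 :: "('a, 'q, 'l) ms"
  and Q1 :: "('a, 'r1, 'o) ms"
 assumes presY: "inj_pres Y Q0 Q1 j p" and y: "y .: Y"
  and z: "!!e. e .: E ==> push Y y e = \<zero>\<^sub>(ext_mod Y)"
 shows "\<exists>N. lin A I0 Y N & y \<in> N ` el I0"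
proof -
 let ?clY = "ext_of A D Y Q0 Q1 j p"
 note SY = presS[OF presY]
 interpret I0: left_module A I0 by (rule presLS)
 interpret I1: left_module A I1 by (rule presLS)
 interpret Y: left_module A Y by (rule SY)
 interpret Q0: left_module A Q0 by (rule SY)
 interpret Q1: left_module A Q1 by (rule SY)
 have act: "lin A L Y (act Y y)" by (rule act_lin[OF SY(1) y])
 have o: "\<one>\<^sub>A .: A" by (rule monoid.one_closed[OF monoidA])
 let ?X = "j0 ` el L"
 have X: "submodule ?X A I0" by (rule submodule_image[OF lm_L presLS(2,4) submodule_carrier[OF lm_L]])
 have bij: "bij_betw j0 (el L) (el (I0 .| ?X))" using presLS(5) by (simp add: bij_betw_def)
 have "lin A (I0 .| ?X) L (inv_into (el L) j0)"
  by (rule lin_inv_into[OF lm_L lin_corestrict[OF presLS(4)] bij]) simp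
 from injmod_extend[OF presD(2)[OF presY] SY(2) presD(3)[OF presL] X lin_comp[OF lin_comp[OF this act] SY(4)]]
 obtain G where G: "lin A I0 Q0 G" "!!x. x \<in> ?X ==> G x = j (act Y y (inv_into (el L) j0 x))" by blast
 have Gj: "G (j0 a) = j (act Y y a)" if "a .: L" for a
  using G(2)[of "j0 a"] that presLS(5) by simp
 have "\<exists>t. lin A I1 Q1 t & (\<forall>x \<in> el I0. t (p0 x) = p (G x))"
 proof (rule lin_factor[OF presLS(2,3) SY(3) presLS(6,7) lin_comp[OF G(1) SY(6)]])
  fix x assume "x .: I0" "p0 x = \<zero>\<^sub>I1"
  then obtain a where a: "a .: L" "x = j0 a" using presLS(8) by blast
  show "p (G x) = \<zero>\<^sub>Q1" unfolding a(2) Gj[OF a(1)] by (rule SY(9)[OF lin_cl[OF act a(1)]])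
 qed
 then obtain t where t: "lin A I1 Q1 t" "!!x. x .: I0 ==> t (p0 x) = p (G x)" by blast
 have "\<exists>W. k < m --> lin A D Q0 W & (\<forall>ph \<in> el D. p (W ph) = t (u k ph))" for k
 proof (cases "k < m")
  case True
  have "push Y y (clL (u k)) = ?clY (%ph. t (u k ph))"
   by (rule ext_of_push[where G = G and t = t and p = p0 and p' = p and j = j0 and j' = j and f = "act Y y", OF lm_D presD(1)[OF presL] presD(1)[OF presY] act G(1) t(1) Gj t(2) u[OF True]])
  moreover have "push Y y (clL (u k)) = \<zero>\<^sub>(ext_mod Y)"
   by (rule z) (simp add: E_simps clY_closed[OF presL u[OF True]])
  ultimately have "?clY (%ph. t (u k ph)) = zero (Ext1 A D Y)" by (simp add: ext_mod_simps)
  then show ?thesis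
   unfolding ext_of_zero_iff[OF lm_D presD(1)[OF presY] lin_comp[OF u[OF True] t(1)]] by blast
 qed simp
 then obtain W where "!!k. k < m --> lin A D Q0 (W k) & (\<forall>ph \<in> el D. p (W k ph) = t (u k ph))" by metis
 then have W: "!!k. k < m ==> lin A D Q0 (W k)" "!!k ph. k < m ==> ph .: D ==> p (W k ph) = t (u k ph)" by auto
 define K where "K x = (\<Oplus>\<^bsub>Q0\<^esub>k \<in> {..<m}. W k (v k x))" for x
 have K: "lin A I1 Q0 K"
  unfolding K_def by (rule lin_finsum_pt[OF I1.left_module_axioms Q0.left_module_axioms]) (use lin_comp[OF v W(1)] in auto)
 have pK: "p (K x) = t x" if x: "x .: I1" for x
 proof -
  have vx: "v k x .: D" if "k < m" for k using lin_cl[OF v[OF that] x] .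
  have "p (K x) = (\<Oplus>\<^bsub>Q1\<^esub>k \<in> {..<m}. p (W k (v k x)))"
   unfolding K_def using vx lin_cl[OF W(1)]
   by (intro lin_finsum[OF Q0.ag Q1.ag SY(6)]) auto
  also have "... = (\<Oplus>\<^bsub>Q1\<^esub>k \<in> {..<m}. t (u k (v k x)))"
   using vx W(2) lin_cl[OF lin_comp[OF u t(1)]] by (intro Q1.M.finsum_cong') auto
  also have "... = t (\<Oplus>\<^bsub>I1\<^esub>k \<in> {..<m}. u k (v k x))"
   using vx lin_cl[OF u] by (intro lin_finsum[OF I1.ag Q1.ag t(1), symmetric]) auto
  finally show ?thesis using uv[OF x] by simp
 qed
 let ?f = "%q. G q \<ominus>\<^sub>Q0 K (p0 q)"
 have Kp: "lin A I0 Q0 (%q. K (p0 q))" by (rule lin_comp[OF presLS(6) K])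
 have f: "lin A I0 Q0 ?f" by (rule lin_diff_pt[OF SY(2) G(1) Kp])
 have pf: "p (?f q) = \<zero>\<^sub>Q1" if q: "q .: I0" for q
 proof -
  have "p (?f q) = p (G q) \<ominus>\<^sub>Q1 p (K (p0 q))"
   by (rule lin_diff[OF Q0.ag Q1.ag SY(6) lin_cl[OF G(1) q] lin_cl[OF Kp q]])
  also have "... = \<zero>\<^sub>Q1"
   using t(2)[OF q] pK[OF lin_cl[OF presLS(6) q]] lin_cl[OF SY(6) lin_cl[OF G(1) q]] Q1.M.diff_eq_zero by simp
  finally show ?thesis .
 qed
 note N = short_exact_factor[OF presD(1)[OF presY] presLS(2) f pf]
 have q: "j0 \<one>\<^sub>A .: I0" using lin_cl[OF presLS(4)] o by simp
 have "K \<zero>\<^sub>I1 = \<zero>\<^sub>Q0" by (rule lin_zero[OF I1.ag Q0.ag K])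
 moreover have "act Y y \<one>\<^sub>A = y" using o y by (simp add: act_def)
 ultimately have "?f (j0 \<one>\<^sub>A) = j y"
  using Gj[of "\<one>\<^sub>A"] o p0_j0[OF o] lin_cl[OF SY(4) y] Q0.M.minus_equality[of "\<zero>\<^sub>Q0" "\<zero>\<^sub>Q0"]
  by (simp add: a_minus_def)
 then have "inv_into (el Y) j (?f (j0 \<one>\<^sub>A)) = y" using SY(5) y by simp
 then show ?thesis using N(1) q by (intro exI[of _ "%x. inv_into (el Y) j (?f x)"] conjI) (auto intro: rev_image_eqI)
qed

text \<open>A map \<open>H : Ext\<^sup>1(D, L) \<rightarrow> L\<close> corresponds to a map \<open>t : I\<^sub>1 \<rightarrow> D\<close> with \<open>t p\<^sub>0 = 0\<close>; as \<open>p\<^sub>0\<close> is onto, \<open>t = 0\<close>.\<close>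

lemma ext_hom_to_regular_zero':
 assumes H: "lin A (ext_mod L) L H" and e: "e .: (ext_mod L)"
 shows "H e = \<zero>\<^sub>A"
proof -
 interpret I0: left_module A I0 by (rule presLS)
 interpret I1: left_module A I1 by (rule presLS)
 interpret DD: left_module A D by (rule lm_D)
 interpret EL: left_module A "ext_mod L" by (rule lm_ext_mod[OF presL])
 interpret LL: left_module A L by (rule lm_L)
 have Hc: "H (clL (u k)) .: A" if "k < m" for k
  using lin_cl[OF H clY_closed[OF presL u[OF that]]] by simp
 define t where "t x = (\<Oplus>\<^bsub>D\<^esub>k \<in> {..<m}. dual_rmult A (v k x) (H (clL (u k))))" for x
 have t: "lin A I1 D t"
  unfolding t_def
  by (rule lin_finsum_pt[OF I1.left_module_axioms lm_D]) (use lin_comp[OF v dual_rmult_lin[OF Hc]] in auto)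
 have tw: "t (w ph) = dual_rmult A ph (H (clL w))" if w: "lin A D I1 w" and p: "ph .: D" for w ph
 proof -
  obtain \<mu> where mu: "!!k. k < m ==> \<mu> k .: A"
   "!!k ph. k < m ==> ph .: D ==> v k (w ph) = dual_rmult A ph (\<mu> k)"
   by (rule coefficients[OF w]) (rule that)
  have cl: "(%k. \<mu> k \<odot>\<^sub>(ext_mod L) clL (u k)) \<in> {..<m} -> el (ext_mod L)"
   using mu(1) clY_closed[OF presL u] by auto
  have mH: "\<mu> k \<otimes>\<^sub>A H (clL (u k)) .: A" if "k < m" for k
   by (rule monoid.m_closed[OF monoidA mu(1)[OF that] Hc[OF that]])
  have "H (clL w) = H (\<Oplus>\<^bsub>ext_mod L\<^esub>k \<in> {..<m}. \<mu> k \<odot>\<^sub>(ext_mod L) clL (u k))" using clL_expand[OF w mu] by simp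
  also have "... = (\<Oplus>\<^bsub>L\<^esub>k \<in> {..<m}. H (\<mu> k \<odot>\<^sub>(ext_mod L) clL (u k)))"
   by (rule lin_finsum[OF EL.ag LL.ag H cl])
  also have "... = (\<Oplus>\<^bsub>L\<^esub>k \<in> {..<m}. \<mu> k \<otimes>\<^sub>A H (clL (u k)))"
   using mu(1) mH clY_closed[OF presL u] by (intro LL.M.finsum_cong') (auto simp: lin_smult[OF H])
  finally have Hw: "H (clL w) = (\<Oplus>\<^bsub>L\<^esub>k \<in> {..<m}. \<mu> k \<otimes>\<^sub>A H (clL (u k)))" .
  have "t (w ph) = (\<Oplus>\<^bsub>D\<^esub>k \<in> {..<m}. dual_rmult A ph (\<mu> k \<otimes>\<^sub>A H (clL (u k))))"
   unfolding t_def using mu p Hc dual_rmult_closed mH by (intro DD.M.finsum_cong') (auto simp: dual_rmult_mult)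
  also have "... = dual_rmult A ph (\<Oplus>\<^bsub>L\<^esub>k \<in> {..<m}. \<mu> k \<otimes>\<^sub>A H (clL (u k)))"
   using mH p dual_rmult_closed
   by (intro add_finsum[OF LL.ag DD.ag, of "dual_rmult A ph", symmetric])
    (auto simp: dual_rmult_add)
  finally show ?thesis using Hw by simp
 qed
 have r0: "dual_rmult A ph \<zero>\<^sub>A = \<zero>\<^sub>D" if p: "ph .: D" for ph
  using add_finsum[OF LL.ag DD.ag, of "dual_rmult A ph" _ "{}"] p
   dual_rmult_closed by (simp add: dual_rmult_add)
 note pin = lin_pow_in[OF lm_D, of n]
 have "t (p0 (pow_in D n i ph)) = \<zero>\<^sub>D" if p: "ph .: D" for i ph
 proof -
  have w: "lin A D I1 (%ph. p0 (pow_in D n i ph))" by (rule lin_comp[OF pin presLS(6)])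
  have "clL (%ph. p0 (pow_in D n i ph)) = \<zero>\<^sub>(ext_mod L)"
   unfolding ext_mod_simps ext_of_zero_iff[OF lm_D presD(1)[OF presL] w] using pin by blast
  then have "H (clL (%ph. p0 (pow_in D n i ph))) = \<zero>\<^sub>A"
   using lin_zero[OF EL.ag LL.ag H] by simp
  then show ?thesis using tw[OF w p] r0[OF p] by simp
 qed
 note tz = this
 have "t (p0 q) = \<zero>\<^sub>D" if q: "q .: I0" for q
 proof -
  have qi: "q i .: D" if "i < n" for i using q that by (auto simp: pow_mod_simps PiE_iff)
  have c: "(%i. pow_in D n i (q i)) \<in> {..<n} -> el I0" using qi lin_cl[OF pin] by auto
  have "t (p0 (\<Oplus>\<^bsub>I0\<^esub>i \<in> {..<n}. pow_in D n i (q i))) = (\<Oplus>\<^bsub>D\<^esub>i \<in> {..<n}. t (p0 (pow_in D n i (q i))))"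
   by (rule lin_finsum[OF I0.ag DD.ag lin_comp[OF presLS(6) t] c])
  also have "... = (\<Oplus>\<^bsub>D\<^esub>i \<in> {..<n}. \<zero>\<^sub>D)" using tz qi by (intro DD.M.finsum_cong') auto
  finally show ?thesis using pow_expand[OF lm_D q] by simp
 qed
 then have t0: "t x = \<zero>\<^sub>D" if "x .: I1" for x
  using that presLS(7) by (metis imageE)
 obtain w where w: "lin A D I1 w" "e = clL w" by (rule ext_mod_obtain[OF presL e])
 have Hec: "H e .: A" using lin_cl[OF H e] by simp
 show ?thesis
 proof (rule dual_separates[OF Hec])
  fix ph assume p: "ph .: D"
  have "dual_rmult A ph (H e) = \<zero>\<^sub>D" using tw[OF w(1) p] t0[OF lin_cl[OF w(1) p]] w(2) by simp
  then have "dual_rmult A ph (H e) \<one>\<^sub>A = \<zero>\<^sub>D \<one>\<^sub>A" by simp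
  then show "ph (H e) = \<zero>"
   using monoid.one_closed[OF monoidA] monoid.r_one[OF monoidA Hec] by (simp add: dual_rmult_def dual_simps(3))
 qed
qed

lemma fg_module_ext_L': "fg_module A (ext_mod L)"
proof -
 interpret EL: left_module A "ext_mod L" by (rule lm_ext_mod[OF presL])
 let ?S = "(%k. clL (u k)) ` {..<m}"
 have S: "?S <= el (ext_mod L)" using clY_closed[OF presL u] by auto
 note W = gen_submod[OF EL.left_module_axioms S]
 have "e \<in> gen_submodule A (ext_mod L) ?S" if e: "e .: (ext_mod L)" for e
 proof -
  obtain w where w: "lin A D I1 w" "e = clL w" by (rule ext_mod_obtain[OF presL e])
  obtain \<mu> where mu: "!!k. k < m ==> \<mu> k .: A"
   "!!k ph. k < m ==> ph .: D ==> v k (w ph) = dual_rmult A ph (\<mu> k)"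
   by (rule coefficients[OF w(1)]) (rule that)
  have "(%k. \<mu> k \<odot>\<^sub>(ext_mod L) clL (u k)) \<in> {..<m} -> gen_submodule A (ext_mod L) ?S"
   using W(2) mu(1) by (auto intro!: submodule_smult[OF W(1)])
  from finsum_submodule(2)[OF EL.left_module_axioms W(1) this] show ?thesis
   unfolding w(2) using clL_expand[OF w(1) mu] by simp
 qed
 then have "gen_submodule A (ext_mod L) ?S = el (ext_mod L)" using submod_sub[OF W(1)] by auto
 then have "fin_gen A (ext_mod L)" unfolding fin_gen_def using S by (intro exI[of _ ?S]) auto
 then show ?thesis by (simp add: fg_module_def EL.left_module_axioms)
qed

end

lemma regular_pres_exists:
 assumes "hereditary A"
 obtains n m :: nat and j0 :: "'a => nat => 'a => 'f" and I1 :: "('a, (nat => 'a => 'f) set) module" and p0 u v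
 where "inj_pres L (pow_mod D n) I1 j0 p0"
  "!!k. k < m ==> lin A D I1 (u k)" "!!k. k < m ==> lin A I1 D (v k)"
  "!!x. x .: I1 ==> (\<Oplus>\<^bsub>I1\<^esub>k \<in> {..<m}. u k (v k x)) = x"
proof -
 obtain n and j :: "'a => nat => 'a => 'f" where pr:
  "inj_pres L (pow_mod D n) (quot_mod (pow_mod D n) (j ` el L)) j (%x. (j ` el L) +>\<^bsub>pow_mod D n\<^esub> x)"
  by (rule inj_pres_exists[OF fg_module_L])
 let ?I1 = "quot_mod (pow_mod D n) (j ` el L)"
 note S = presS[OF pr] and P = presD[OF pr]
 have fg: "fg_module A ?I1" by (rule fg_module_image[OF P(3) S(3,6,7)])
 have inj: "injmod A ?I1" by (rule injmod_image[OF assms ringA P(2,3) fg S(6,7)])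
 obtain m :: nat and u v where "!!k. k < m ==> lin A D ?I1 (u k)" "!!k. k < m ==> lin A ?I1 D (v k)"
  "!!x. x .: ?I1 ==> (\<Oplus>\<^bsub>?I1\<^esub>k \<in> {..<m}. u k (v k x)) = x"
  by (rule dual_summand[OF fg inj]) (rule that)
 then show ?thesis by (rule that[OF pr])
qed

theorem ext_hom_is_push:
 fixes Y :: "('a, 'y, 'n) ms"
 assumes "hereditary A" "fg_module A Y" "lin A E (ext_mod Y) H"
 shows "\<exists>y \<in> el Y. \<forall>e \<in> el E. H e = push Y y e"
proof -
 obtain n and j :: "'y => nat => 'a => 'f" where pr:
  "inj_pres Y (pow_mod D n) (quot_mod (pow_mod D n) (j ` el Y)) j (%x. (j ` el Y) +>\<^bsub>pow_mod D n\<^esub> x)"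
  by (rule inj_pres_exists[OF assms(2)])
 have H: "lin A (ext_mod L) (ext_mod Y) H" using assms(3) by (simp add: lin_def E_simps)
 show ?thesis by (rule regular_pres_exists[OF assms(1)]) (rule ext_hom_is_push'[OF _ _ _ _ pr H])
qed

theorem push_zero_imp_injective_image:
 fixes Y :: "('a, 'y, 'n) ms"
 assumes "hereditary A" "fg_module A Y" "y .: Y"
  "!!e. e .: E ==> push Y y e = \<zero>\<^sub>(ext_mod Y)"
 shows "\<exists>n N. lin A (pow_mod D n) Y N & y \<in> N ` el (pow_mod D n)"
proof -
 obtain n and j :: "'y => nat => 'a => 'f" where pr:
  "inj_pres Y (pow_mod D n) (quot_mod (pow_mod D n) (j ` el Y)) j (%x. (j ` el Y) +>\<^bsub>pow_mod D n\<^esub> x)"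
  by (rule inj_pres_exists[OF assms(2)])
 show ?thesis
  by (rule regular_pres_exists[OF assms(1)]) (rule exI, rule push_zero_imp_injective_image'[OF _ _ _ _ pr assms(3,4)])
qed

theorem ext_hom_to_regular_zero:
 assumes "hereditary A" "lin A E L H" "e .: E"
 shows "H e = \<zero>\<^sub>A"
proof -
 have H: "lin A (ext_mod L) L H" and e: "e .: (ext_mod L)" using assms(2,3) by (simp_all add: lin_def E_simps)
 show ?thesis by (rule regular_pres_exists[OF assms(1)]) (rule ext_hom_to_regular_zero'[OF _ _ _ _ H e])
qed

theorem fg_module_ext_L:
 assumes "hereditary A" shows "fg_module A (ext_mod L)"
 by (rule regular_pres_exists[OF assms]) (rule fg_module_ext_L')

text \<open>The sequence \<open>0 \<rightarrow> Y \<rightarrow> Y \<rightarrow> 0 \<rightarrow> 0\<close> is an injective copresentation.\<close>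

theorem ext_injective_zero:
 assumes "fg_module A Y" "injmod A Y" "e .: (ext_mod Y)"
 shows "e = \<zero>\<^sub>(ext_mod Y)"
proof -
 note Y = fgD(1)[OF assms(1)]
 let ?Q = "quot_mod Y ((%x. x) ` el Y)"
 have "short_exact A Y Y ?Q (%x. x) (%x. ((%x. x) ` el Y) +>\<^bsub>Y\<^esub> x)"
  by (rule short_exact_quot[OF Y Y lin_id]) simp
 then have pr: "inj_pres Y Y ?Q (%x. x) (%x. ((%x. x) ` el Y) +>\<^bsub>Y\<^esub> x)"
  using assms by (simp add: inj_pres_def)
 note S = presS[OF pr]
 interpret Y: left_module A Y by (rule Y)
 obtain w where w: "lin A D ?Q w" "e = ext_of A D Y Y ?Q (%x. x) (%x. ((%x. x) ` el Y) +>\<^bsub>Y\<^esub> x) w"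
  by (rule ext_mod_obtain[OF pr assms(3)])
 have Q0: "q = \<zero>\<^sub>?Q" if "q .: ?Q" for q
 proof -
  have "q \<in> (%x. ((%x. x) ` el Y) +>\<^bsub>Y\<^esub> x) ` el Y" using that S(7) by simp
  then obtain y where "y .: Y" "q = ((%x. x) ` el Y) +>\<^bsub>Y\<^esub> y" by (rule imageE)
  then show ?thesis using S(9)[of y] by simp
 qed
 show ?thesis
  unfolding w(2) ext_mod_simps ext_of_zero_iff[OF lm_D presD(1)[OF pr] w(1)]
 proof (intro exI[of _ "%_. \<zero>\<^sub>Y"] conjI ballI)
  show "lin A D Y (%_. \<zero>\<^sub>Y)" by (rule lin_zero_pt[OF Y])
  fix ph assume "ph .: D"
  then show "((%x. x) ` el Y) +>\<^bsub>Y\<^esub> \<zero>\<^sub>Y = w ph" using S(9)[of "\<zero>\<^sub>Y"] Q0[OF lin_cl[OF w(1)]] by simp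
 qed
qed

end

section \<open>Tensor products\<close>

lemma ring_int: "ring \<Z>"
 by (rule cring.axioms(1)[OF int_is_cring])

text \<open>The tensor product is built from modules over the integers; viewing a target group as such a module gives access to the universal property of free modules.\<close>

definition int_module :: "('b, 'm) ring_scheme => (int, 'b) module"
 where "int_module Z =
  \<lparr>carrier = el Z, monoid.mult = undefined, one = undefined, zero = zero Z, add = add Z,
  smult = (%k x. [k] \<cdot>\<^bsub>Z\<^esub> x)\<rparr>"

lemma int_module_simps [simp]:
 "el (int_module Z) = el Z" "zero (int_module Z) = zero Z" "add (int_module Z) = add Z"
 "k \<odot>\<^sub>(int_module Z) x = [k] \<cdot>\<^bsub>Z\<^esub> x"
 by (simp_all add: int_module_def)

lemma lm_int:
 assumes "abelian_group Z" shows "left_module \<Z> (int_module Z)"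
proof -
 interpret Z: abelian_group Z by fact
 show ?thesis
 proof (rule left_moduleI[OF ring_int])
  show "abelian_group (int_module Z)"
   by (rule abelian_group_image[where G = Z and p = "%x. x"]) (simp_all add: assms)
  show "(k \<otimes>\<^bsub>\<Z>\<^esub> l) \<odot>\<^sub>(int_module Z) x = k \<odot>\<^sub>(int_module Z) (l \<odot>\<^sub>(int_module Z) x)"
   if "x .: (int_module Z)" for k l :: int and x
   using Z.add.int_pow_pow[of x l k] Z.add.int_pow_pow[of x k l] that by (simp add: mult.commute)
 qed (simp_all add: Z.add.int_pow_mult Z.add.int_pow_distrib)
qed

lemma int_smult_closed:
 assumes "left_module \<Z> M" "H <= el M" "\<zero>\<^sub>M \<in> H" "!!x y. x \<in> H ==> y \<in> H ==> x \<oplus>\<^sub>M y \<in> H"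
  "!!x. x \<in> H ==> \<ominus>\<^sub>M x \<in> H" "x \<in> H"
 shows "(k :: int) \<odot>\<^sub>M x \<in> H"
proof -
 interpret M: left_module \<Z> M by fact
 have x: "x .: M" using assms by auto
 have nat: "int n \<odot>\<^sub>M x \<in> H" for n
 proof (induction n)
  case 0
  show ?case using M.smult_l_null[OF x] assms(3) by simp
 next
  case (Suc n)
  have "(int n \<oplus>\<^bsub>\<Z>\<^esub> \<one>\<^bsub>\<Z>\<^esub>) \<odot>\<^sub>M x = int n \<odot>\<^sub>M x \<oplus>\<^sub>M \<one>\<^bsub>\<Z>\<^esub> \<odot>\<^sub>M x"
   by (rule left_module.smult_l_distr[OF assms(1)]) (simp_all add: x)
  also have "... = int n \<odot>\<^sub>M x \<oplus>\<^sub>M x" using M.smult_one[OF x] by simp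
  finally have "int (Suc n) \<odot>\<^sub>M x = int n \<odot>\<^sub>M x \<oplus>\<^sub>M x" by (simp add: add.commute)
  then show ?case using assms(4)[OF Suc assms(6)] by simp
 qed
 show ?thesis
 proof (cases "k \<ge> 0")
  case True then show ?thesis using nat[of "nat k"] by simp
 next
  case False
  have "k \<odot>\<^sub>M x \<oplus>\<^sub>M (- k) \<odot>\<^sub>M x = (k \<oplus>\<^bsub>\<Z>\<^esub> (- k)) \<odot>\<^sub>M x"
   by (rule left_module.smult_l_distr[OF assms(1), symmetric]) (simp_all add: x)
  also have "... = \<zero>\<^sub>M" using M.smult_l_null[OF x] by simp
  finally have "k \<odot>\<^sub>M x = \<ominus>\<^sub>M ((- k) \<odot>\<^sub>M x)"
   using M.M.minus_equality M.smult_closed[OF _ x] by simp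
  then show ?thesis using assms(5)[OF nat[of "nat (- k)"]] False by simp
 qed
qed

definition bimod :: "('a, 'r) ring_scheme => ('a, 'e, 'l) bimodule_scheme => bool"
 where "bimod R E <-> lmod R E & (\<forall>e \<in> el E. \<forall>a \<in> el R. rsmult E e a .: E) &
  (\<forall>e \<in> el E. \<forall>a \<in> el R. \<forall>b \<in> el R. b \<odot>\<^sub>E rsmult E e a = rsmult E (b \<odot>\<^sub>E e) a)"

definition tens ::
  "('a, 'r) ring_scheme => ('a, 'e, 'l) bimodule_scheme => ('a, 'b, 'm) ms =>
  'e => 'b => ('e \<times> 'b => int) set"
 where "tens R E M e x =
  tensor_null R E M +>\<^bsub>free_module \<Z> (el E \<times> el M)\<^esub> free_gen \<Z> (e, x)"

context
 fixes R :: "('a, 'r) ring_scheme" and E :: "('a, 'e, 'l) bimodule_scheme"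
 assumes bi: "bimod R E"
begin

lemma bimodD: "lmod R E" "e .: E ==> a .: R ==> rsmult E e a .: E"
 "e .: E ==> a .: R ==> b .: R ==> b \<odot>\<^sub>E rsmult E e a = rsmult E (b \<odot>\<^sub>E e) a"
 using bi by (auto simp: bimod_def)

lemma E_add_closed: "e .: E ==> e' .: E ==> e \<oplus>\<^sub>E e' .: E"
proof -
 interpret E: left_module R E by (rule bimodD)
 show "e .: E ==> e' .: E ==> e \<oplus>\<^sub>E e' .: E" by simp
qed

lemma E_smult_closed: "a .: R ==> e .: E ==> a \<odot>\<^sub>E e .: E"
proof -
 interpret E: left_module R E by (rule bimodD)
 show "a .: R ==> e .: E ==> a \<odot>\<^sub>E e .: E" by simp
qed

context
 fixes M :: "('a, 'b, 'm) ms"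
 assumes M: "lmod R M"
begin

abbreviation "TG \<equiv> free_module \<Z> (el E \<times> el M)"
abbreviation "TN \<equiv> tensor_null R E M"
abbreviation "TT \<equiv> tensor R E M"

lemma TG: "left_module \<Z> TG" by (rule lm_free[OF ring_int])

lemma TG_ag: "abelian_group TG" by (rule left_module.axioms(2)[OF TG])

lemma M_closed: "x .: M ==> x' .: M ==> x \<oplus>\<^sub>M x' .: M"
 "a .: R ==> x .: M ==> a \<odot>\<^sub>M x .: M"
proof -
 interpret M: left_module R M by (rule M)
 show "x .: M ==> x' .: M ==> x \<oplus>\<^sub>M x' .: M"
  "a .: R ==> x .: M ==> a \<odot>\<^sub>M x .: M" by simp_all
qed

lemma TG_gen: "e .: E ==> x .: M ==> free_gen \<Z> (e, x) .: TG"
 by (rule free_gen_cl[OF ring_int]) simp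

lemma TG_closed: "c .: TG ==> d .: TG ==> c \<ominus>\<^sub>TG d .: TG"
 "c .: TG ==> d .: TG ==> c \<oplus>\<^sub>TG d .: TG"
 using abelian_group.minus_closed[OF TG_ag] abelian_monoid.a_closed[OF abelian_group.axioms(1)[OF TG_ag]] by auto

lemma tensor_rels_cases:
 assumes "r \<in> tensor_rels R E M"
 obtains (add_left) e e' x where "e .: E" "e' .: E" "x .: M"
   "r = free_gen \<Z> (e \<oplus>\<^sub>E e', x) \<ominus>\<^sub>TG (free_gen \<Z> (e, x) \<oplus>\<^sub>TG free_gen \<Z> (e', x))"
  | (add_right) e x x' where "e .: E" "x .: M" "x' .: M"
   "r = free_gen \<Z> (e, x \<oplus>\<^sub>M x') \<ominus>\<^sub>TG (free_gen \<Z> (e, x) \<oplus>\<^sub>TG free_gen \<Z> (e, x'))"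
  | (balanced) e a x where "e .: E" "a .: R" "x .: M"
   "r = free_gen \<Z> (rsmult E e a, x) \<ominus>\<^sub>TG free_gen \<Z> (e, a \<odot>\<^sub>M x)"
 using assms unfolding tensor_rels_def Let_def by blast

lemma tensor_relsI:
 "e .: E ==> e' .: E ==> x .: M ==>
  free_gen \<Z> (e \<oplus>\<^sub>E e', x) \<ominus>\<^sub>TG (free_gen \<Z> (e, x) \<oplus>\<^sub>TG free_gen \<Z> (e', x)) \<in> tensor_rels R E M"
 "e .: E ==> x .: M ==> x' .: M ==>
  free_gen \<Z> (e, x \<oplus>\<^sub>M x') \<ominus>\<^sub>TG (free_gen \<Z> (e, x) \<oplus>\<^sub>TG free_gen \<Z> (e, x')) \<in> tensor_rels R E M"
 "e .: E ==> a .: R ==> x .: M ==>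
  free_gen \<Z> (rsmult E e a, x) \<ominus>\<^sub>TG free_gen \<Z> (e, a \<odot>\<^sub>M x) \<in> tensor_rels R E M"
 unfolding tensor_rels_def Let_def by blast+

lemma tensor_rels_closed: "tensor_rels R E M <= el TG"
proof
 fix r assume "r \<in> tensor_rels R E M"
 then show "r .: TG"
  by (cases rule: tensor_rels_cases)
   (auto intro!: TG_closed TG_gen E_add_closed M_closed bimodD)
qed

lemmas TN = gen_submod[OF TG tensor_rels_closed, folded tensor_null_def]

lemmas TQ = TG_ag submodule_subgroup[OF TN(1)]

lemma tensor_simps:
 "el TT = el (quot_mod TG TN)" "zero TT = zero (quot_mod TG TN)" "add TT = add (quot_mod TG TN)"
 by (simp_all add: tensor_def Let_def quot_mod_def)

lemma abelian_group_tensor: "abelian_group TT"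
 by (rule abelian_group_image[where G = "quot_mod TG TN" and p = "%x. x"])
  (simp_all add: tensor_simps left_module.axioms(2)[OF lm_quot[OF TG TN(1)]])

lemma tensor_carrier: "el TT = (%c. TN +>\<^bsub>TG\<^esub> c) ` el TG"
 unfolding tensor_simps by (rule quot_mod_carrier[OF TG TN(1)])

lemma tens_closed: "e .: E ==> x .: M ==> tens R E M e x .: TT"
 unfolding tensor_carrier tens_def using TG_gen by blast

lemma tensor_proj_add:
 "c .: TG ==> d .: TG ==> TN +>\<^bsub>TG\<^esub> (c \<oplus>\<^sub>TG d) = (TN +>\<^bsub>TG\<^esub> c) \<oplus>\<^sub>TT (TN +>\<^bsub>TG\<^esub> d)"
 unfolding tensor_simps using lin_add[OF lin_quot[OF TG TN(1)]] .

lemma tensor_proj_eq: "c .: TG ==> d .: TG ==> TN +>\<^bsub>TG\<^esub> c = TN +>\<^bsub>TG\<^esub> d <-> c \<ominus>\<^sub>TG d \<in> TN"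
 by (rule coset_eq_iff[OF TQ])

lemma tens_add_left:
 assumes "e .: E" "e' .: E" "x .: M"
 shows "tens R E M (e \<oplus>\<^sub>E e') x = tens R E M e x \<oplus>\<^sub>TT tens R E M e' x"
proof -
 note g = TG_gen[OF E_add_closed[OF assms(1,2)] assms(3)] TG_gen[OF assms(1,3)] TG_gen[OF assms(2,3)]
 show ?thesis
  unfolding tens_def tensor_proj_add[OF g(2,3), symmetric] tensor_proj_eq[OF g(1) TG_closed(2)[OF g(2,3)]]
  using tensor_relsI(1)[OF assms] TN(2) by blast
qed

lemma tens_add_right:
 assumes "e .: E" "x .: M" "x' .: M"
 shows "tens R E M e (x \<oplus>\<^sub>M x') = tens R E M e x \<oplus>\<^sub>TT tens R E M e x'"
proof -
 note g = TG_gen[OF assms(1) M_closed(1)[OF assms(2,3)]] TG_gen[OF assms(1,2)] TG_gen[OF assms(1,3)]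
 show ?thesis
  unfolding tens_def tensor_proj_add[OF g(2,3), symmetric] tensor_proj_eq[OF g(1) TG_closed(2)[OF g(2,3)]]
  using tensor_relsI(2)[OF assms] TN(2) by blast
qed

lemma tens_balanced:
 assumes "e .: E" "a .: R" "x .: M"
 shows "tens R E M (rsmult E e a) x = tens R E M e (a \<odot>\<^sub>M x)"
proof -
 note g = TG_gen[OF bimodD(2)[OF assms(1,2)] assms(3)] TG_gen[OF assms(1) M_closed(2)[OF assms(2,3)]]
 show ?thesis
  unfolding tens_def tensor_proj_eq[OF g] using tensor_relsI(3)[OF assms] TN(2) by blast
qed

lemma tensor_induct:
 assumes "t .: TT" "H <= el TT" "\<zero>\<^sub>TT \<in> H"
  "!!s t. s \<in> H ==> t \<in> H ==> s \<oplus>\<^sub>TT t \<in> H" "!!t. t \<in> H ==> \<ominus>\<^sub>TT t \<in> H"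
  "!!e x. e .: E ==> x .: M ==> tens R E M e x \<in> H"
 shows "t \<in> H"
proof -
 let ?Q = "quot_mod TG TN" and ?S = "el E \<times> el M"
 note Q = lm_quot[OF TG TN(1)] and q = lin_quot[OF TG TN(1)]
 interpret G: left_module \<Z> TG by (rule TG)
 interpret Q: left_module \<Z> ?Q by (rule Q)
 interpret T: abelian_group TT by (rule abelian_group_tensor)
 have inv: "\<ominus>\<^sub>?Q t = \<ominus>\<^sub>TT t" if "t .: TT" for t
 proof -
  have "(\<ominus>\<^sub>TT t) \<oplus>\<^sub>?Q t = \<zero>\<^sub>?Q" using T.l_neg[OF that] by (simp add: tensor_simps)
  then show ?thesis using Q.M.minus_equality[of "\<ominus>\<^sub>TT t" t] T.a_inv_closed[OF that] that by (simp add: tensor_simps)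
 qed
 have sm: "k \<odot>\<^sub>?Q t \<in> H" if "t \<in> H" for t and k :: int
 proof (rule int_smult_closed[OF Q _ _ _ _ that])
  show "H <= el ?Q" "\<zero>\<^sub>?Q \<in> H" using assms(2,3) by (simp_all add: tensor_simps)
  show "s \<oplus>\<^sub>?Q t \<in> H" if "s \<in> H" "t \<in> H" for s t using assms(4)[OF that] by (simp add: tensor_simps)
  show "\<ominus>\<^sub>?Q t \<in> H" if "t \<in> H" for t
  proof -
   have "t .: TT" using that assms(2) by blast
   then show ?thesis using assms(5)[OF that] inv by simp
  qed
 qed
 have H: "submodule H \<Z> ?Q"
  unfolding Q.submodule_iff using assms(2,3,4) sm by (auto simp: tensor_simps)
 obtain c where c: "c .: TG" "t = TN +>\<^bsub>TG\<^esub> c" using assms(1) unfolding tensor_carrier by blast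
 have "TN +>\<^bsub>TG\<^esub> c = lcomb \<Z> ?Q ?S c (%s. TN +>\<^bsub>TG\<^esub> free_gen \<Z> s)"
  by (rule lin_free_expand[OF Q q c(1)])
 moreover have "(%s. TN +>\<^bsub>TG\<^esub> free_gen \<Z> s) \<in> ?S -> H"
 proof
  fix s assume "s \<in> ?S"
  then show "TN +>\<^bsub>TG\<^esub> free_gen \<Z> s \<in> H" using assms(6)[of "fst s" "snd s"] by (auto simp: tens_def)
 qed
 ultimately show ?thesis using lcomb_submodule(2)[OF Q H _ c(1)] c(2) by metis
qed

text \<open>The universal property of the tensor product.\<close>

lemma tensor_lift:
 assumes Z: "abelian_group Z"
  and b: "!!e x. e .: E ==> x .: M ==> b e x .: Z"
  and bl: "!!e e' x. e .: E ==> e' .: E ==> x .: M ==> b (e \<oplus>\<^sub>E e') x = b e x \<oplus>\<^sub>Z b e' x"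
  and br: "!!e x x'. e .: E ==> x .: M ==> x' .: M ==> b e (x \<oplus>\<^sub>M x') = b e x \<oplus>\<^sub>Z b e x'"
  and bb: "!!e a x. e .: E ==> a .: R ==> x .: M ==> b (rsmult E e a) x = b e (a \<odot>\<^sub>M x)"
 obtains \<Phi> where "!!t. t .: TT ==> \<Phi> t .: Z"
  "!!s t. s .: TT ==> t .: TT ==> \<Phi> (s \<oplus>\<^sub>TT t) = \<Phi> s \<oplus>\<^sub>Z \<Phi> t"
  "!!e x. e .: E ==> x .: M ==> \<Phi> (tens R E M e x) = b e x"
proof -
 let ?Q = "quot_mod TG TN" and ?S = "el E \<times> el M" and ?Z = "int_module Z"
 note Zm = lm_int[OF Z]
 interpret Z: abelian_group Z by (rule Z)
 interpret Zm: left_module \<Z> ?Z by (rule Zm)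
 interpret G: left_module \<Z> TG by (rule TG)
 let ?b = "%s. b (fst s) (snd s)"
 have bc: "?b \<in> ?S -> el ?Z" using b by auto
 let ?f = "%c. lcomb \<Z> ?Z ?S c ?b"
 have f: "lin \<Z> TG ?Z ?f" by (rule Zm.lin_lcomb[OF bc])
 have fg: "?f (free_gen \<Z> (e, x)) = b e x" if "e .: E" "x .: M" for e x
  using Zm.lcomb_free_gen[OF bc, of "(e, x)"] that by simp
 have K: "submodule {c \<in> el TG. ?f c = \<zero>\<^sub>?Z} \<Z> TG" by (rule submodule_kernel[OF TG Zm f])
 note fd = lin_diff[OF G.ag Zm.ag f] and fa = lin_add[OF f]
 have zd: "x \<ominus>\<^sub>?Z x = \<zero>\<^sub>?Z" if "x .: Z" for x using Zm.M.diff_eq_zero[of x x] that by simp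
 have rel: "?f r = \<zero>\<^sub>?Z" if "r \<in> tensor_rels R E M" for r
  using that
 proof (cases rule: tensor_rels_cases)
  case (add_left e e' x)
  note g = TG_gen[OF E_add_closed[OF add_left(1,2)] add_left(3)] TG_gen[OF add_left(1,3)] TG_gen[OF add_left(2,3)]
  show ?thesis
   unfolding add_left(4) fd[OF g(1) TG_closed(2)[OF g(2,3)]] fa[OF g(2,3)]
    fg[OF E_add_closed[OF add_left(1,2)] add_left(3)] fg[OF add_left(1,3)] fg[OF add_left(2,3)] bl[OF add_left(1-3)] int_module_simps
   using zd b add_left by simp
 next
  case (add_right e x x')
  note g = TG_gen[OF add_right(1) M_closed(1)[OF add_right(2,3)]] TG_gen[OF add_right(1,2)] TG_gen[OF add_right(1,3)]
  show ?thesis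
   unfolding add_right(4) fd[OF g(1) TG_closed(2)[OF g(2,3)]] fa[OF g(2,3)]
    fg[OF add_right(1) M_closed(1)[OF add_right(2,3)]] fg[OF add_right(1,2)] fg[OF add_right(1,3)] br[OF add_right(1-3)] int_module_simps
   using zd b add_right by simp
 next
  case (balanced e a x)
  note g = TG_gen[OF bimodD(2)[OF balanced(1,2)] balanced(3)] TG_gen[OF balanced(1) M_closed(2)[OF balanced(2,3)]]
  show ?thesis
   unfolding balanced(4) fd[OF g] fg[OF bimodD(2)[OF balanced(1,2)] balanced(3)]
    fg[OF balanced(1) M_closed(2)[OF balanced(2,3)]] bb[OF balanced(1-3)]
   using zd b[OF balanced(1) M_closed(2)[OF balanced(2,3)]] by simp
 qed
 have "TN <= {c \<in> el TG. ?f c = \<zero>\<^sub>?Z}"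
  by (rule TN(3)[OF K]) (use rel tensor_rels_closed in auto)
 then have ker: "?f c = \<zero>\<^sub>?Z" if "c \<in> TN" for c using that by blast
 have "\<exists>g. lin \<Z> ?Q ?Z g & (\<forall>c \<in> el TG. g (TN +>\<^bsub>TG\<^esub> c) = ?f c)"
 proof (rule lin_factor[OF TG lm_quot[OF TG TN(1)] Zm lin_quot[OF TG TN(1)] quot_mod_carrier[OF TG TN(1), symmetric] f])
  fix c assume "c .: TG" "TN +>\<^bsub>TG\<^esub> c = \<zero>\<^sub>?Q"
  then show "?f c = \<zero>\<^sub>?Z" using quot_mod_zero_iff[OF TG TN(1)] ker by blast
 qed
 then obtain g where g: "lin \<Z> ?Q ?Z g" "!!c. c .: TG ==> g (TN +>\<^bsub>TG\<^esub> c) = ?f c" by blast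
 show ?thesis
 proof (rule that[of g])
  show "g t .: Z" if "t .: TT" for t using lin_cl[OF g(1)] that by (simp add: tensor_simps)
  show "g (s \<oplus>\<^sub>TT t) = g s \<oplus>\<^sub>Z g t" if "s .: TT" "t .: TT" for s t
   using lin_add[OF g(1)] that by (simp add: tensor_simps)
  show "g (tens R E M e x) = b e x" if "e .: E" "x .: M" for e x
   unfolding tens_def g(2)[OF TG_gen[OF that]] by (rule fg[OF that])
 qed
qed

end

lemma tensor_induced:
 fixes M :: "('a, 'b, 'm) ms" and N :: "('a, 'c, 'n) ms"
 assumes M: "lmod R M" and N: "lmod R N"
  and k: "k \<in> el E \<times> el M -> el E \<times> el N"
  and r: "!!r. r \<in> tensor_rels R E M ==> free_map \<Z> (el E \<times> el M) k r \<in> tensor_null R E N"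
  and c: "c .: (free_module \<Z> (el E \<times> el M))"
 shows "(\<Union>c' \<in> tensor_null R E M +>\<^bsub>free_module \<Z> (el E \<times> el M)\<^esub> c.
   tensor_null R E N +>\<^bsub>free_module \<Z> (el E \<times> el N)\<^esub> free_map \<Z> (el E \<times> el M) k c')
  = tensor_null R E N +>\<^bsub>free_module \<Z> (el E \<times> el N)\<^esub> free_map \<Z> (el E \<times> el M) k c"
proof (rule coset_Union[OF TQ[OF M] c])
 let ?GM = "free_module \<Z> (el E \<times> el M)" and ?GN = "free_module \<Z> (el E \<times> el N)"
 let ?f = "free_map \<Z> (el E \<times> el M) k"
 have f: "lin \<Z> ?GM ?GN ?f" by (rule lin_free_map[OF ring_int k])
 have "tensor_null R E M <= {c \<in> el ?GM. ?f c \<in> tensor_null R E N}"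
  by (rule TN(3)[OF M submodule_vimage[OF TG[OF M] TG[OF N] f TN(1)[OF N]]])
   (use r tensor_rels_closed[OF M] in auto)
 then have n: "?f c \<in> tensor_null R E N" if "c \<in> tensor_null R E M" for c using that by blast
 fix c' assume c': "c' \<in> tensor_null R E M +>\<^bsub>?GM\<^esub> c"
 note cc = coset_mem[OF TQ[OF M] c c']
 have "c' \<ominus>\<^sub>?GM c \<in> tensor_null R E M" using coset_eq_iff[OF TQ[OF M] cc(1) c] cc(2) by simp
 then have "?f c' \<ominus>\<^sub>?GN ?f c \<in> tensor_null R E N"
  using n lin_diff[OF TG_ag[OF M] TG_ag[OF N] f cc(1) c] by metis
 then show "tensor_null R E N +>\<^bsub>?GN\<^esub> ?f c' = tensor_null R E N +>\<^bsub>?GN\<^esub> ?f c"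
  using coset_eq_iff[OF TQ[OF N] lin_cl[OF f cc(1)] lin_cl[OF f c]] by simp
qed

lemma tensor_smult:
 fixes M :: "('a, 'b, 'm) ms"
 assumes M: "lmod R M" and a: "a .: R" and c: "c .: (free_module \<Z> (el E \<times> el M))"
 shows "a \<odot>\<^sub>(tensor R E M) (tensor_null R E M +>\<^bsub>free_module \<Z> (el E \<times> el M)\<^esub> c) =
  tensor_null R E M +>\<^bsub>free_module \<Z> (el E \<times> el M)\<^esub>
   free_map \<Z> (el E \<times> el M) (%(e, x). (a \<odot>\<^sub>E e, x)) c"
proof -
 interpret E: left_module R E by (rule bimodD)
 let ?S = "el E \<times> el M" let ?G = "free_module \<Z> ?S" and ?k = "%(e, x). (a \<odot>\<^sub>E e, x)"
 have k: "?k \<in> ?S -> ?S" using a by auto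
 have f: "lin \<Z> ?G ?G (free_map \<Z> ?S ?k)" by (rule lin_free_map[OF ring_int k])
 have fg: "free_map \<Z> ?S ?k (free_gen \<Z> (e, x)) = free_gen \<Z> (a \<odot>\<^sub>E e, x)" if "e .: E" "x .: M" for e x
  using free_map_free_gen[OF ring_int k, of "(e, x)"] that by simp
 note fd = lin_diff[OF TG_ag[OF M] TG_ag[OF M] f] and fa = lin_add[OF f]
 have "free_map \<Z> ?S ?k r \<in> tensor_rels R E M" if "r \<in> tensor_rels R E M" for r
  using that
 proof (cases rule: tensor_rels_cases[OF M, consumes 1])
  case (1 e e' x)
  note g = TG_gen[OF M E_add_closed[OF 1(1,2)] 1(3)] TG_gen[OF M 1(1,3)] TG_gen[OF M 1(2,3)]
  show ?thesis
   unfolding 1(4) fd[OF g(1) TG_closed(2)[OF M g(2,3)]] fa[OF g(2,3)]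
    fg[OF E_add_closed[OF 1(1,2)] 1(3)] fg[OF 1(1,3)] fg[OF 1(2,3)] E.smult_r_distr[OF a 1(1,2)]
   by (rule tensor_relsI(1)[OF M]) (use a 1 in auto)
 next
  case (2 e x x')
  note g = TG_gen[OF M 2(1) M_closed(1)[OF M 2(2,3)]] TG_gen[OF M 2(1,2)] TG_gen[OF M 2(1,3)]
  show ?thesis
   unfolding 2(4) fd[OF g(1) TG_closed(2)[OF M g(2,3)]] fa[OF g(2,3)]
    fg[OF 2(1) M_closed(1)[OF M 2(2,3)]] fg[OF 2(1,2)] fg[OF 2(1,3)]
   by (rule tensor_relsI(2)[OF M]) (use a 2 in auto)
 next
  case (3 e b x)
  note g = TG_gen[OF M bimodD(2)[OF 3(1,2)] 3(3)] TG_gen[OF M 3(1) M_closed(2)[OF M 3(2,3)]]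
  show ?thesis
   unfolding 3(4) fd[OF g] fg[OF bimodD(2)[OF 3(1,2)] 3(3)] fg[OF 3(1) M_closed(2)[OF M 3(2,3)]]
    bimodD(3)[OF 3(1,2) a]
   by (rule tensor_relsI(3)[OF M]) (use a 3 in auto)
 qed
 then have "free_map \<Z> ?S ?k r \<in> tensor_null R E M" if "r \<in> tensor_rels R E M" for r
  using TN(2)[OF M] that by blast
 from tensor_induced[OF M M k this c] show ?thesis by (simp add: tensor_def Let_def)
qed

lemma tensor_smult_tens:
 assumes M: "lmod R M" and "a .: R" "e .: E" "x .: M"
 shows "a \<odot>\<^sub>(tensor R E M) tens R E M e x = tens R E M (a \<odot>\<^sub>E e) x"
proof -
 have k: "(%(e, x). (a \<odot>\<^sub>E e, x)) \<in> el E \<times> el M -> el E \<times> el M"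
  using E_smult_closed[OF assms(2)] by auto
 show ?thesis
  unfolding tens_def tensor_smult[OF M assms(2) TG_gen[OF M assms(3,4)]]
  using free_map_free_gen[OF ring_int k, of "(e, x)"] assms by simp
qed

end

context
 fixes R :: "('a, 'r) ring_scheme" and E :: "('a, 'e, 'l) bimodule_scheme"
 assumes bi: "bimod R E"
begin

lemma tensor_additive_eq:
 fixes M :: "('a, 'b, 'm) ms" and Z :: "('z, 'o) ring_scheme"
 assumes M: "lmod R M" and Z: "abelian_group Z"
  and f: "!!t. t .: (tensor R E M) ==> f t .: Z"
   "!!s t. s .: (tensor R E M) ==> t .: (tensor R E M) ==> f (s \<oplus>\<^sub>(tensor R E M) t) = f s \<oplus>\<^sub>Z f t"
  and g: "!!t. t .: (tensor R E M) ==> g t .: Z"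
   "!!s t. s .: (tensor R E M) ==> t .: (tensor R E M) ==> g (s \<oplus>\<^sub>(tensor R E M) t) = g s \<oplus>\<^sub>Z g t"
  and eq: "!!e x. e .: E ==> x .: M ==> f (tens R E M e x) = g (tens R E M e x)"
  and t: "t .: (tensor R E M)"
 shows "f t = g t"
proof -
 interpret Z: abelian_group Z by (rule Z)
 interpret T: abelian_group "tensor R E M" by (rule abelian_group_tensor[OF bi M])
 let ?H = "{t \<in> el (tensor R E M). f t = g t}"
 have z: "h \<zero>\<^sub>(tensor R E M) = \<zero>\<^sub>Z"
  if "!!t. t .: (tensor R E M) ==> h t .: Z"
   "!!s t. s .: (tensor R E M) ==> t .: (tensor R E M) ==> h (s \<oplus>\<^sub>(tensor R E M) t) = h s \<oplus>\<^sub>Z h t" for h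
  using that(1)[OF T.zero_closed] that(2)[OF T.zero_closed T.zero_closed]
  by (metis T.l_zero T.zero_closed Z.add.l_cancel_one')
 have m: "h (\<ominus>\<^sub>(tensor R E M) t) = \<ominus>\<^sub>Z h t"
  if "!!t. t .: (tensor R E M) ==> h t .: Z"
   "!!s t. s .: (tensor R E M) ==> t .: (tensor R E M) ==> h (s \<oplus>\<^sub>(tensor R E M) t) = h s \<oplus>\<^sub>Z h t"
   and t: "t .: (tensor R E M)" for h t
 proof -
  have "h (\<ominus>\<^sub>(tensor R E M) t) \<oplus>\<^sub>Z h t = \<zero>\<^sub>Z"
   using that(2)[OF T.a_inv_closed[OF t] t] T.l_neg[OF t] z[of h] that(1,2) by simp
  then show ?thesis
   using Z.minus_equality that(1)[OF t] that(1)[OF T.a_inv_closed[OF t]] by simp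
 qed
 have "t \<in> ?H"
 proof (rule tensor_induct[OF bi M t])
  show "\<zero>\<^sub>(tensor R E M) \<in> ?H" using z[of f] z[of g] f g by simp
  show "s \<oplus>\<^sub>(tensor R E M) t \<in> ?H" if "s \<in> ?H" "t \<in> ?H" for s t using that f g by simp
  show "\<ominus>\<^sub>(tensor R E M) t \<in> ?H" if "t \<in> ?H" for t
  proof -
   have t: "t .: (tensor R E M)" "f t = g t" using that by auto
   show ?thesis using m[of f t, OF f t(1)] m[of g t, OF g t(1)] t by simp
  qed
  show "tens R E M e x \<in> ?H" if "e .: E" "x .: M" for e x
   using eq[OF that] tens_closed[OF bi M that] by simp
 qed auto
 then show ?thesis by simp
qed

lemma lm_tensor:
 fixes M :: "('a, 'b, 'm) ms"
 assumes M: "lmod R M"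
 shows "lmod R (tensor R E M)"
proof -
 interpret M: left_module R M by (rule M)
 interpret E: left_module R E by (rule bimodD[OF bi])
 let ?T = "tensor R E M" let ?S = "el E \<times> el M" let ?G = "free_module \<Z> ?S"
 interpret T: abelian_group ?T by (rule abelian_group_tensor[OF bi M])
 note tc = tens_closed[OF bi M] and ts = tensor_smult_tens[OF bi M]
 have fl: "lin \<Z> ?G ?G (free_map \<Z> ?S (%(e, x). (a \<odot>\<^sub>E e, x)))" if "a .: R" for a
  by (rule lin_free_map[OF ring_int]) (use that in auto)
 have cl: "a \<odot>\<^sub>?T t .: ?T" if a: "a .: R" and t: "t .: ?T" for a t
 proof -
  obtain c where c: "c .: ?G" "t = tensor_null R E M +>\<^bsub>?G\<^esub> c" using t unfolding tensor_carrier[OF bi M] by blast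
  show ?thesis unfolding c(2) tensor_smult[OF bi M a c(1)] using lin_cl[OF fl[OF a] c(1)] tensor_carrier[OF bi M] by blast
 qed
 have ad: "a \<odot>\<^sub>?T (s \<oplus>\<^sub>?T t) = a \<odot>\<^sub>?T s \<oplus>\<^sub>?T a \<odot>\<^sub>?T t"
  if a: "a .: R" and st: "s .: ?T" "t .: ?T" for a s t
 proof -
  obtain c where c: "c .: ?G" "s = tensor_null R E M +>\<^bsub>?G\<^esub> c" using st(1) unfolding tensor_carrier[OF bi M] by blast
  obtain d where d: "d .: ?G" "t = tensor_null R E M +>\<^bsub>?G\<^esub> d" using st(2) unfolding tensor_carrier[OF bi M] by blast
  show ?thesis
   unfolding c(2) d(2) tensor_proj_add[OF bi M c(1) d(1), symmetric] tensor_smult[OF bi M a c(1)]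
    tensor_smult[OF bi M a d(1)] tensor_smult[OF bi M a TG_closed(2)[OF bi M c(1) d(1)]]
    lin_add[OF fl[OF a] c(1) d(1)]
   by (rule tensor_proj_add[OF bi M lin_cl[OF fl[OF a] c(1)] lin_cl[OF fl[OF a] d(1)]])
 qed
 show ?thesis
 proof (rule left_moduleI[OF M.R.ring_axioms T.abelian_group_axioms cl _ ad])
  show "(a \<oplus>\<^sub>R b) \<odot>\<^sub>?T t = a \<odot>\<^sub>?T t \<oplus>\<^sub>?T b \<odot>\<^sub>?T t"
   if ab: "a .: R" "b .: R" and t: "t .: ?T" for a b t
   by (rule tensor_additive_eq[OF M T.abelian_group_axioms _ _ _ _ _ t])
    (use ab in "auto simp: cl ad T.a_ac ts E.smult_l_distr tens_add_left[OF bi M]")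
  show "(a \<otimes>\<^sub>R b) \<odot>\<^sub>?T t = a \<odot>\<^sub>?T (b \<odot>\<^sub>?T t)"
   if ab: "a .: R" "b .: R" and t: "t .: ?T" for a b t
   by (rule tensor_additive_eq[OF M T.abelian_group_axioms _ _ _ _ _ t])
    (use ab in "auto simp: cl ad ts E.smult_assoc1")
  show "\<one>\<^sub>R \<odot>\<^sub>?T t = t" if t: "t .: ?T" for t
   by (rule tensor_additive_eq[OF M T.abelian_group_axioms _ _ _ _ _ t]) (auto simp: cl ad ts)
 qed
qed

lemma tensor_map:
 fixes M :: "('a, 'b, 'm) ms" and N :: "('a, 'c, 'n) ms"
 assumes M: "lmod R M" and N: "lmod R N" and f: "lin R M N f"
 shows lin_tensor_map: "lin R (tensor R E M) (tensor R E N) (tensor_map R E M N f)"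
  and tensor_map_tens: "!!e x. e .: E ==> x .: M ==>
   tensor_map R E M N f (tens R E M e x) = tens R E N e (f x)"
proof -
 interpret M: left_module R M by (rule M)
 interpret N: left_module R N by (rule N)
 interpret E: left_module R E by (rule bimodD[OF bi])
 let ?T = "tensor R E M" and ?T' = "tensor R E N" and ?t = "tensor_map R E M N f"
 let ?S = "el E \<times> el M" let ?S' = "el E \<times> el N"
 let ?G = "free_module \<Z> ?S" and ?G' = "free_module \<Z> ?S'" and ?k = "%(e, x). (e, f x)"
 interpret T: left_module R ?T by (rule lm_tensor[OF M])
 interpret T': left_module R ?T' by (rule lm_tensor[OF N])
 have fc: "f x .: N" if "x .: M" for x using lin_cl[OF f that] .
 have k: "?k \<in> ?S -> ?S'" using fc by auto
 have l: "lin \<Z> ?G ?G' (free_map \<Z> ?S ?k)" by (rule lin_free_map[OF ring_int k])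
 have fg: "free_map \<Z> ?S ?k (free_gen \<Z> (e, x)) = free_gen \<Z> (e, f x)" if "e .: E" "x .: M" for e x
  using free_map_free_gen[OF ring_int k, of "(e, x)"] that by simp
 note fd = lin_diff[OF TG_ag[OF bi M] TG_ag[OF bi N] l] and fa = lin_add[OF l]
 have r: "free_map \<Z> ?S ?k r \<in> tensor_rels R E N" if "r \<in> tensor_rels R E M" for r
  using that
 proof (cases rule: tensor_rels_cases[OF bi M, consumes 1])
  case (1 e e' x)
  note g = TG_gen[OF bi M E_add_closed[OF bi 1(1,2)] 1(3)] TG_gen[OF bi M 1(1,3)] TG_gen[OF bi M 1(2,3)]
  show ?thesis
   unfolding 1(4) fd[OF g(1) TG_closed(2)[OF bi M g(2,3)]] fa[OF g(2,3)]
    fg[OF E_add_closed[OF bi 1(1,2)] 1(3)] fg[OF 1(1,3)] fg[OF 1(2,3)]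
   by (rule tensor_relsI(1)[OF bi N]) (use fc 1 in auto)
 next
  case (2 e x x')
  note g = TG_gen[OF bi M 2(1) M_closed(1)[OF bi M 2(2,3)]] TG_gen[OF bi M 2(1,2)] TG_gen[OF bi M 2(1,3)]
  show ?thesis
   unfolding 2(4) fd[OF g(1) TG_closed(2)[OF bi M g(2,3)]] fa[OF g(2,3)]
    fg[OF 2(1) M_closed(1)[OF bi M 2(2,3)]] fg[OF 2(1,2)] fg[OF 2(1,3)] lin_add[OF f 2(2,3)]
   by (rule tensor_relsI(2)[OF bi N]) (use fc 2 in auto)
 next
  case (3 e b x)
  note g = TG_gen[OF bi M bimodD(2)[OF bi 3(1,2)] 3(3)] TG_gen[OF bi M 3(1) M_closed(2)[OF bi M 3(2,3)]]
  show ?thesis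
   unfolding 3(4) fd[OF g] fg[OF bimodD(2)[OF bi 3(1,2)] 3(3)] fg[OF 3(1) M_closed(2)[OF bi M 3(2,3)]]
    lin_smult[OF f 3(2,3)]
   by (rule tensor_relsI(3)[OF bi N]) (use fc 3 in auto)
 qed
 then have rn: "free_map \<Z> ?S ?k r \<in> tensor_null R E N" if "r \<in> tensor_rels R E M" for r
  using TN(2)[OF bi N] that by blast
 have val: "?t (tensor_null R E M +>\<^bsub>?G\<^esub> c) = tensor_null R E N +>\<^bsub>?G'\<^esub> free_map \<Z> ?S ?k c"
  if c: "c .: ?G" for c
 proof -
  have m: "tensor_null R E M +>\<^bsub>?G\<^esub> c .: ?T" using c tensor_carrier[OF bi M] by blast
  show ?thesis
   using tensor_induced[OF bi M N k rn c] m by (simp add: tensor_map_def)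
 qed
 show tt: "?t (tens R E M e x) = tens R E N e (f x)" if "e .: E" "x .: M" for e x
  unfolding tens_def val[OF TG_gen[OF bi M that]] fg[OF that] ..
 have cl: "?t t .: ?T'" if t: "t .: ?T" for t
 proof -
  obtain c where c: "c .: ?G" "t = tensor_null R E M +>\<^bsub>?G\<^esub> c" using t unfolding tensor_carrier[OF bi M] by blast
  show ?thesis unfolding c(2) val[OF c(1)] using lin_cl[OF l c(1)] tensor_carrier[OF bi N] by blast
 qed
 have ad: "?t (s \<oplus>\<^sub>?T t) = ?t s \<oplus>\<^sub>?T' ?t t" if st: "s .: ?T" "t .: ?T" for s t
 proof -
  obtain c where c: "c .: ?G" "s = tensor_null R E M +>\<^bsub>?G\<^esub> c" using st(1) unfolding tensor_carrier[OF bi M] by blast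
  obtain d where d: "d .: ?G" "t = tensor_null R E M +>\<^bsub>?G\<^esub> d" using st(2) unfolding tensor_carrier[OF bi M] by blast
  show ?thesis
   unfolding c(2) d(2) tensor_proj_add[OF bi M c(1) d(1), symmetric] val[OF c(1)] val[OF d(1)]
    val[OF TG_closed(2)[OF bi M c(1) d(1)]] lin_add[OF l c(1) d(1)]
   by (rule tensor_proj_add[OF bi N lin_cl[OF l c(1)] lin_cl[OF l d(1)]])
 qed
 show "lin R ?T ?T' ?t"
 proof (rule linI[OF cl ad])
  show "?t (a \<odot>\<^sub>?T t) = a \<odot>\<^sub>?T' ?t t" if a: "a .: R" and t: "t .: ?T" for a t
   by (rule tensor_additive_eq[OF M T'.ag _ _ _ _ _ t])
    (use a fc in "auto simp: cl ad T.smult_r_distr T'.smult_r_distr tensor_smult_tens[OF bi M]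
     tensor_smult_tens[OF bi N] tt tens_closed[OF bi M]")
 qed
qed

text \<open>Pure tensors with a fixed finite generating family of \<open>M\<close> suffice, as coefficients move across the tensor sign.\<close>

lemma tensor_standard_form:
 fixes M :: "('a, 'b, 'm) ms" and y :: "nat => 'b"
 assumes M: "lmod R M" and y: "y \<in> {..<n} -> el M"
  and im: "(%c. lcomb R M {..<n} c y) ` el (free_module R {..<n}) = el M"
  and t: "t .: (tensor R E M)"
 obtains ep where "ep \<in> {..<n} -> el E" "t = (\<Oplus>\<^bsub>tensor R E M\<^esub>k \<in> {..<n}. tens R E M (ep k) (y k))"
proof -
 interpret M: left_module R M by (rule M)
 interpret E: left_module R E by (rule bimodD[OF bi])
 let ?T = "tensor R E M"
 interpret T: left_module R ?T by (rule lm_tensor[OF M])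
 note tc = tens_closed[OF bi M]
 let ?f = "%ep. \<Oplus>\<^bsub>?T\<^esub>k \<in> {..<n}. tens R E M (ep k) (y k)"
 let ?H = "{?f ep | ep. ep \<in> {..<n} -> el E}"
 have tn: "(%k. tens R E M (ep k) (y k)) \<in> {..<n} -> el ?T" if "ep \<in> {..<n} -> el E" for ep
  using that y tc by (auto simp: Pi_def)
 have fc: "?f ep .: ?T" if "ep \<in> {..<n} -> el E" for ep by (rule T.M.finsum_closed[OF tn[OF that]])
 have fadd: "?f (%k. ep k \<oplus>\<^sub>E \<delta> k) = ?f ep \<oplus>\<^sub>?T ?f \<delta>"
  if "ep \<in> {..<n} -> el E" "\<delta> \<in> {..<n} -> el E" for ep \<delta>
 proof -
  have "?f (%k. ep k \<oplus>\<^sub>E \<delta> k) = (\<Oplus>\<^bsub>?T\<^esub>k \<in> {..<n}. tens R E M (ep k) (y k) \<oplus>\<^sub>?T tens R E M (\<delta> k) (y k))"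
   using that y tc by (intro T.M.finsum_cong') (auto simp: tens_add_left[OF bi M] Pi_def)
  also have "... = ?f ep \<oplus>\<^sub>?T ?f \<delta>" by (rule T.M.finsum_addf[OF tn[OF that(1)] tn[OF that(2)]])
  finally show ?thesis .
 qed
 have tz: "tens R E M \<zero>\<^sub>E x = \<zero>\<^sub>?T" if "x .: M" for x
  using tens_add_left[OF bi M E.M.zero_closed E.M.zero_closed that] tc[OF E.M.zero_closed that] by simp
 have f0: "?f (%_. \<zero>\<^sub>E) = \<zero>\<^sub>?T"
 proof -
  have "?f (%_. \<zero>\<^sub>E) = (\<Oplus>\<^bsub>?T\<^esub>k \<in> {..<n}. \<zero>\<^sub>?T)"
   using y tz by (intro T.M.finsum_cong') (auto simp: Pi_def)
  then show ?thesis by simp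
 qed
 have "t \<in> ?H"
 proof (rule tensor_induct[OF bi M t])
  show "?H <= el ?T" using fc by auto
  show "\<zero>\<^sub>?T \<in> ?H" using f0 by (auto intro!: exI[of _ "%_. \<zero>\<^sub>E"])
  show "s \<oplus>\<^sub>?T t \<in> ?H" if st: "s \<in> ?H" "t \<in> ?H" for s t
  proof -
   obtain ep \<delta> where e: "ep \<in> {..<n} -> el E" "s = ?f ep" and d: "\<delta> \<in> {..<n} -> el E" "t = ?f \<delta>"
    using st by auto
   have "s \<oplus>\<^sub>?T t = ?f (%k. ep k \<oplus>\<^sub>E \<delta> k)" unfolding e(2) d(2) by (rule fadd[OF e(1) d(1), symmetric])
   moreover have "(%k. ep k \<oplus>\<^sub>E \<delta> k) \<in> {..<n} -> el E" using e(1) d(1) by (auto simp: Pi_def)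
   ultimately show ?thesis by (intro CollectI exI[of _ "%k. ep k \<oplus>\<^sub>E \<delta> k"] conjI)
  qed
  show "\<ominus>\<^sub>?T t \<in> ?H" if tH: "t \<in> ?H" for t
  proof -
   obtain ep where e: "ep \<in> {..<n} -> el E" "t = ?f ep" using tH by auto
   let ?\<delta> = "%k. \<ominus>\<^sub>E ep k"
   have d: "?\<delta> \<in> {..<n} -> el E" using e(1) by (auto simp: Pi_def)
   have "?f (%k. ?\<delta> k \<oplus>\<^sub>E ep k) = ?f (%_. \<zero>\<^sub>E)"
    using e(1) y tc by (intro T.M.finsum_cong') (auto simp: E.M.l_neg Pi_def)
   then have "?f ?\<delta> \<oplus>\<^sub>?T t = \<zero>\<^sub>?T" using fadd[OF d e(1)] f0 e(2) by simp
   then have "\<ominus>\<^sub>?T t = ?f ?\<delta>" using T.M.minus_equality fc[OF d] fc[OF e(1)] e(2) by simp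
   then show ?thesis using d by (intro CollectI exI[of _ ?\<delta>] conjI)
  qed
  show "tens R E M e x \<in> ?H" if e: "e .: E" and x: "x .: M" for e x
  proof -
   obtain c where c: "c .: (free_module R {..<n})" "x = lcomb R M {..<n} c y" using im x by blast
   have cc: "c k .: R" for k by (rule free_coeff[OF M.R.ring_axioms c(1)])
   have yc: "y k .: M" if "k < n" for k using y that by auto
   have "x = (\<Oplus>\<^bsub>M\<^esub>k \<in> {..<n}. c k \<odot>\<^sub>M y k)" unfolding c(2) by (rule M.lcomb_super[OF c(1) y]) auto
   then have "tens R E M e x = (\<Oplus>\<^bsub>?T\<^esub>k \<in> {..<n}. tens R E M e (c k \<odot>\<^sub>M y k))"
    using add_finsum[OF M.ag T.ag, of "tens R E M e" "%k. c k \<odot>\<^sub>M y k" "{..<n}"]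
     tc e tens_add_right[OF bi M e] cc yc by auto
   also have "... = ?f (%k. rsmult E e (c k))"
    using tens_balanced[OF bi M e cc] tc e cc yc bimodD(2)[OF bi e cc] by (intro T.M.finsum_cong') auto
   finally show ?thesis using bimodD(2)[OF bi e cc] by (intro CollectI exI[of _ "%k. rsmult E e (c k)"] conjI) auto
  qed
 qed
 then obtain ep where "t = ?f ep" "ep \<in> {..<n} -> el E" by auto
 then show ?thesis by (intro that)
qed

lemma fg_module_tensor:
 fixes M :: "('a, 'b, 'm) ms"
 assumes M: "fg_module R M" and E: "fin_gen R E"
 shows "fg_module R (tensor R E M)"
proof -
 note Mm = fgD(1)[OF M]
 interpret M: left_module R M by (rule Mm)
 interpret E: left_module R E by (rule bimodD[OF bi])
 let ?T = "tensor R E M"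
 note T = lm_tensor[OF Mm] and tc = tens_closed[OF bi Mm]
 obtain n y where y: "y \<in> {..<n::nat} -> el M"
  and im: "(%c. lcomb R M {..<n} c y) ` el (free_module R {..<n}) = el M"
  by (rule fin_gen_lcomb[OF fgD[OF M]])
 obtain S where S: "finite S" "S <= el E" "gen_submodule R E S = el E"
  using E by (auto simp: fin_gen_def)
 let ?U = "(%(s, k). tens R E M s (y k)) ` (S \<times> {..<n})"
 have yc: "y k .: M" if "k < n" for k using y that by auto
 have U: "?U <= el ?T" using S(2) yc tc by auto
 note W = gen_submod[OF T U]
 have in_W: "tens R E M e (y k) \<in> gen_submodule R ?T ?U" if k: "k < n" and e: "e .: E" for e k
 proof -
  have l: "lin R E ?T (%e. tens R E M e (y k))"
   by (rule linI) (use yc[OF k] in "auto simp: tc tens_add_left[OF bi Mm] tensor_smult_tens[OF bi Mm]")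
  have "gen_submodule R E S <= {e \<in> el E. tens R E M e (y k) \<in> gen_submodule R ?T ?U}"
   using W(2) S(2) k
   by (intro gen_submod(3)[OF E.left_module_axioms S(2)] submodule_vimage[OF E.left_module_axioms T l W(1)]) auto
  then show ?thesis using e S(3) by auto
 qed
 have "t \<in> gen_submodule R ?T ?U" if t: "t .: ?T" for t
 proof -
  obtain ep where e: "ep \<in> {..<n} -> el E" "t = (\<Oplus>\<^bsub>?T\<^esub>k \<in> {..<n}. tens R E M (ep k) (y k))"
   by (rule tensor_standard_form[OF Mm y im t])
  have "(%k. tens R E M (ep k) (y k)) \<in> {..<n} -> gen_submodule R ?T ?U" using in_W e(1) by auto
  from finsum_submodule(2)[OF T W(1) this] show ?thesis using e(2) by simp
 qed
 then have "gen_submodule R ?T ?U = el ?T" using submod_sub[OF W(1)] by auto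
 then have "fin_gen R ?T" unfolding fin_gen_def using U S(1) by (intro exI[of _ ?U]) auto
 then show ?thesis using T by (simp add: fg_module_def)
qed

end

section \<open>The tensor product inside \<open>Ext\<^sup>1\<close>\<close>

lemma (in abelian_group) finsum_swap:
 assumes "finite I" "finite J" "!!i j. i \<in> I ==> j \<in> J ==> f i j .: G"
 shows "(\<Oplus>i \<in> I. \<Oplus>j \<in> J. f i j) = (\<Oplus>j \<in> J. \<Oplus>i \<in> I. f i j)"
 using assms(1,3)
proof (induction I)
 case empty
 then show ?case by simp
next
 case (insert k I)
 have c: "(%j. \<Oplus>i \<in> I. f i j) \<in> J -> el G" using insert by (auto intro!: finsum_closed)
 have c2: "f k \<in> J -> el G" using insert by auto
 have "(\<Oplus>i \<in> insert k I. \<Oplus>j \<in> J. f i j) = (\<Oplus>j \<in> J. f k j) \<oplus> (\<Oplus>i \<in> I. \<Oplus>j \<in> J. f i j)"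
  using insert by (intro finsum_insert) (auto intro!: finsum_closed)
 also have "... = (\<Oplus>j \<in> J. f k j) \<oplus> (\<Oplus>j \<in> J. \<Oplus>i \<in> I. f i j)" using insert by simp
 also have "... = (\<Oplus>j \<in> J. f k j \<oplus> (\<Oplus>i \<in> I. f i j))" by (rule finsum_addf[OF c2 c, symmetric])
 also have "... = (\<Oplus>j \<in> J. \<Oplus>i \<in> insert k I. f i j)"
 proof (rule finsum_cong')
  fix j assume j: "j \<in> J"
  show "f k j \<oplus> (\<Oplus>i \<in> I. f i j) = (\<Oplus>i \<in> insert k I. f i j)"
   using insert j by (intro finsum_insert[symmetric]) auto
 qed (use insert in "auto intro!: finsum_closed")
 finally show ?case .
qed

lemma ext_class_finsum:
 assumes X: "lmod R X" and Y: "lmod R Y" and "finite I" "!!i. i \<in> I ==> lin R (syzygy R X) Y (h i)"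
 shows "ext_class R X Y (%c. \<Oplus>\<^bsub>Y\<^esub>i \<in> I. h i c) = (\<Oplus>\<^bsub>Ext1 R X Y\<^esub>i \<in> I. ext_class R X Y (h i))"
 using assms(3,4)
proof (induction I)
 interpret Y: left_module R Y by (rule Y)
 interpret Ex: abelian_group "Ext1 R X Y" by (rule abelian_group_Ext1[OF X Y])
 {
  case empty
  show ?case using ext_class_zero[OF X Y] by simp
 next
  case (insert k I)
  have l: "lin R (syzygy R X) Y (%c. \<Oplus>\<^bsub>Y\<^esub>i \<in> I. h i c)"
   by (rule lin_finsum_pt[OF lm_SX[OF X] Y]) (use insert in auto)
  have eq: "(\<Oplus>\<^bsub>Y\<^esub>i \<in> insert k I. h i c) = h k c \<oplus>\<^sub>Y (\<Oplus>\<^bsub>Y\<^esub>i \<in> I. h i c)" if "c .: (syzygy R X)" for c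
  proof (rule Y.M.finsum_insert)
   show "(%i. h i c) \<in> I -> el Y" "h k c .: Y" using lin_cl[OF insert(4) that] by auto
  qed (use insert in auto)
  have "restrict (%c. \<Oplus>\<^bsub>Y\<^esub>i \<in> insert k I. h i c) (el (syzygy R X)) =
    restrict (%c. h k c \<oplus>\<^sub>Y (\<Oplus>\<^bsub>Y\<^esub>i \<in> I. h i c)) (el (syzygy R X))"
   by (rule restrict_ext) (rule eq)
  then have "ext_class R X Y (%c. \<Oplus>\<^bsub>Y\<^esub>i \<in> insert k I. h i c) =
    ext_class R X Y (%c. h k c \<oplus>\<^sub>Y (\<Oplus>\<^bsub>Y\<^esub>i \<in> I. h i c))" by (simp add: ext_class_def)
  also have "... = ext_class R X Y (h k) \<oplus>\<^sub>(Ext1 R X Y) ext_class R X Y (%c. \<Oplus>\<^bsub>Y\<^esub>i \<in> I. h i c)"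
   using insert l by (intro ext_class_add[OF X Y, symmetric]) auto
  also have "... = (\<Oplus>\<^bsub>Ext1 R X Y\<^esub>i \<in> insert k I. ext_class R X Y (h i))"
   using insert ext_class_closed[OF X Y] by (subst Ex.finsum_insert) auto
  finally show ?case .
 }
qed

locale hereditary_algebra = fin_dim_algebra F A
 for F :: "('f, 'p) ring_scheme" (structure) and A :: "('f, 'a, 'm) ms" (structure) +
 assumes her: "hereditary A"
begin

lemma lm_ext: "fg_module A Y ==> lmod A (ext_mod Y)"
 by (rule inj_pres_exists) (auto intro: lm_ext_mod)

lemma push_class:
 assumes "lmod A Y" "y .: Y" "lin A (syzygy A D) L h"
 shows "push Y y (ext_class A D L h) = ext_class A D Y (%c. act Y y (h c))"
 by (rule Ext1_push_class[OF lm_D lm_L assms(1,3) act_lin[OF assms(1,2)]])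

lemma E_class:
 assumes "e .: E"
 obtains h where "lin A (syzygy A D) L h" "e = ext_class A D L h"
 using assms unfolding E_simps ext_mod_simps Ext1_carrier[OF lm_D lm_L] by blast

lemma push_smult:
 assumes "lmod A Y" "y .: Y" "e .: E" "a .: A"
 shows "push Y y (a \<odot>\<^sub>E e) = a \<odot>\<^sub>(ext_mod Y) push Y y e"
proof -
 obtain h where h: "lin A (syzygy A D) L h" "e = ext_class A D L h" by (rule E_class[OF assms(3)])
 note r = rho_lin[OF assms(4)]
 note fm = lin_comp[OF lin_free_map_syzygy[OF lm_D r]]
 have "a \<odot>\<^sub>E e = ext_class A D L (%c. h (free_map A (el D) (rho a) c))"
  unfolding h(2) E_simps ext_mod_simps by (rule Ext1_pull_class[OF lm_D lm_L h(1) r])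
 then have "push Y y (a \<odot>\<^sub>E e) = ext_class A D Y (%c. act Y y (h (free_map A (el D) (rho a) c)))"
  using push_class[OF assms(1,2) fm[OF h(1)]] by simp
 also have "... = a \<odot>\<^sub>(ext_mod Y) push Y y e"
  unfolding h(2) push_class[OF assms(1,2) h(1)] ext_mod_simps
  by (rule Ext1_pull_class[OF lm_D assms(1) lin_comp[OF h(1) act_lin[OF assms(1,2)]] r, symmetric])
 finally show ?thesis .
qed

lemma push_closed:
 assumes "lmod A Y" "y .: Y" "e .: E"
 shows "push Y y e .: (ext_mod Y)"
proof -
 obtain h where h: "lin A (syzygy A D) L h" "e = ext_class A D L h" by (rule E_class[OF assms(3)])
 show ?thesis
  unfolding h(2) push_class[OF assms(1,2) h(1)] ext_mod_simps
  by (rule ext_class_closed[OF lm_D assms(1) lin_comp[OF h(1) act_lin[OF assms(1,2)]]])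
qed

lemma lm_E: "lmod A E"
proof -
 have l: "lmod A (ext_mod L)" by (rule fgD(1)[OF fg_module_ext_L[OF her]])
 show ?thesis by (rule lm_image[where p = "%x. x", OF l]) (simp_all add: E_simps)
qed

lemma fg_module_E: "fg_module A E"
 by (rule fg_module_image[where f = "%x. x", OF fg_module_ext_L[OF her] lm_E])
  (simp_all add: lin_def E_simps left_module.smult_closed[OF fgD(1)[OF fg_module_ext_L[OF her]]])

lemma bimod_E: "bimod A E"
proof -
 have c: "rsmult E e a .: E" if "e .: E" "a .: A" for e a
  using push_closed[OF lm_L, of a e] that unfolding rsmult_push by (simp add: E_simps(1))
 have "b \<odot>\<^sub>E rsmult E e a = rsmult E (b \<odot>\<^sub>E e) a" if "e .: E" "a .: A" "b .: A" for e a b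
  using push_smult[OF lm_L, of a e b] that unfolding rsmult_push by (simp add: E_simps(4))
 then show ?thesis using c lm_E by (simp add: bimod_def)
qed

lemma push_add_left:
 assumes "lmod A Y" "y .: Y" "e .: E" "e' .: E"
 shows "push Y y (e \<oplus>\<^sub>E e') = push Y y e \<oplus>\<^sub>(ext_mod Y) push Y y e'"
proof -
 interpret Y: left_module A Y by fact
 obtain h where h: "lin A (syzygy A D) L h" "e = ext_class A D L h" by (rule E_class[OF assms(3)])
 obtain h' where h': "lin A (syzygy A D) L h'" "e' = ext_class A D L h'" by (rule E_class[OF assms(4)])
 note a = act_lin[OF assms(1,2)]
 have "e \<oplus>\<^sub>E e' = ext_class A D L (%c. h c \<oplus>\<^sub>L h' c)"
  unfolding h(2) h'(2) E_simps ext_mod_simps by (rule ext_class_add[OF lm_D lm_L h(1) h'(1)])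
 then have "push Y y (e \<oplus>\<^sub>E e') = ext_class A D Y (%c. act Y y (h c \<oplus>\<^sub>L h' c))"
  using push_class[OF assms(1,2) lin_add_pt[OF lm_L h(1) h'(1)]] by simp
 also have "... = ext_class A D Y (%c. act Y y (h c) \<oplus>\<^sub>Y act Y y (h' c))"
  unfolding ext_class_def
  by (rule arg_cong[where f = "a_r_coset _ _"], rule restrict_ext)
   (rule lin_add[OF a lin_cl[OF h(1)] lin_cl[OF h'(1)]])
 also have "... = push Y y e \<oplus>\<^sub>(ext_mod Y) push Y y e'"
  unfolding h(2) h'(2) push_class[OF assms(1,2) h(1)] push_class[OF assms(1,2) h'(1)] ext_mod_simps
  by (rule ext_class_add[OF lm_D assms(1) lin_comp[OF h(1) a] lin_comp[OF h'(1) a], symmetric])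
 finally show ?thesis .
qed

lemma push_add_right:
 assumes "lmod A Y" "y .: Y" "y' .: Y" "e .: E"
 shows "push Y (y \<oplus>\<^sub>Y y') e = push Y y e \<oplus>\<^sub>(ext_mod Y) push Y y' e"
proof -
 interpret Y: left_module A Y by fact
 obtain h where h: "lin A (syzygy A D) L h" "e = ext_class A D L h" by (rule E_class[OF assms(4)])
 have "push Y (y \<oplus>\<^sub>Y y') e = ext_class A D Y (%c. act Y (y \<oplus>\<^sub>Y y') (h c))"
  unfolding h(2) by (rule push_class[OF assms(1) _ h(1)]) (use assms in simp)
 also have "... = ext_class A D Y (%c. act Y y (h c) \<oplus>\<^sub>Y act Y y' (h c))"
  unfolding ext_class_def
 proof (rule arg_cong[where f = "a_r_coset _ _"], rule restrict_ext)
  fix c assume "c .: (syzygy A D)"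
  then have "h c .: A" using lin_cl[OF h(1)] by simp
  then show "act Y (y \<oplus>\<^sub>Y y') (h c) = act Y y (h c) \<oplus>\<^sub>Y act Y y' (h c)"
   using assms by (simp add: act_def Y.smult_r_distr)
 qed
 also have "... = push Y y e \<oplus>\<^sub>(ext_mod Y) push Y y' e"
  unfolding h(2) push_class[OF assms(1,2) h(1)] push_class[OF assms(1,3) h(1)] ext_mod_simps
  by (rule ext_class_add[OF lm_D assms(1) lin_comp[OF h(1) act_lin[OF assms(1,2)]]
     lin_comp[OF h(1) act_lin[OF assms(1,3)]], symmetric])
 finally show ?thesis .
qed

lemma push_balanced:
 assumes "lmod A Y" "y .: Y" "a .: A" "e .: E"
 shows "push Y y (rsmult E e a) = push Y (a \<odot>\<^sub>Y y) e"
proof -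
 interpret Y: left_module A Y by fact
 obtain h where h: "lin A (syzygy A D) L h" "e = ext_class A D L h" by (rule E_class[OF assms(4)])
 have aL: "a .: L" using assms by simp
 have "push Y y (rsmult E e a) = ext_class A D Y (%c. act Y y (act L a (h c)))"
  unfolding h(2) rsmult_push push_class[OF lm_L aL h(1)]
  by (rule push_class[OF assms(1,2) lin_comp[OF h(1) act_lin[OF lm_L aL]]])
 also have "... = ext_class A D Y (%c. act Y (a \<odot>\<^sub>Y y) (h c))"
  unfolding ext_class_def
 proof (rule arg_cong[where f = "a_r_coset _ _"], rule restrict_ext)
  fix c assume "c .: (syzygy A D)"
  then have "h c .: A" using lin_cl[OF h(1)] by simp
  then show "act Y y (act L a (h c)) = act Y (a \<odot>\<^sub>Y y) (h c)"
   using assms by (simp add: act_def Y.smult_assoc1 monoid.m_closed[OF monoidA])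
 qed
 also have "... = push Y (a \<odot>\<^sub>Y y) e"
  unfolding h(2) by (rule push_class[OF assms(1) _ h(1), symmetric]) (use assms in simp)
 finally show ?thesis .
qed

text \<open>Write an element of the kernel as a sum of \<open>ep k \<otimes> y k\<close> with \<open>y\<close> generating \<open>Y\<close>.  That the class of \<open>\<Sum> h\<^sub>k y\<^sub>k\<close> vanishes allows to change the representatives \<open>h\<^sub>k\<close> so that they take values in the kernel \<open>K\<close> of \<open>A\<^sup>n \<rightarrow> Y\<close>.  As \<open>K\<close> is projective, they factor through generators \<open>q\<^sub>l\<close> of \<open>K\<close>, and the relations \<open>\<Sum> q\<^sub>l\<^sub>k y\<^sub>k = 0\<close> kill the tensor.\<close>

lemma tensor_to_ext:
 fixes Y :: "('a, 'y, 'n) ms"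
 assumes Y: "fg_module A Y"
 obtains \<mu> where "lin A (tensor A E Y) (ext_mod Y) \<mu>" "inj_on \<mu> (el (tensor A E Y))"
  "!!e y. e .: E ==> y .: Y ==> \<mu> (tens A E Y e y) = push Y y e"
proof -
 note Ym = fgD(1)[OF Y]
 note X = lm_ext[OF Y]
 interpret Y: left_module A Y by (rule Ym)
 interpret X: left_module A "ext_mod Y" by (rule X)
 let ?T = "tensor A E Y" and ?S = "syzygy A D"
 interpret T: left_module A ?T by (rule lm_tensor[OF bimod_E Ym])
 obtain \<mu> where m: "!!t. t .: ?T ==> \<mu> t .: (ext_mod Y)"
  "!!s t. s .: ?T ==> t .: ?T ==> \<mu> (s \<oplus>\<^sub>?T t) = \<mu> s \<oplus>\<^sub>(ext_mod Y) \<mu> t"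
  "!!e y. e .: E ==> y .: Y ==> \<mu> (tens A E Y e y) = push Y y e"
  by (rule tensor_lift[where b = "%e y. push Y y e", OF bimod_E Ym X.ag
     push_closed[OF Ym] push_add_left[OF Ym] push_add_right[OF Ym] push_balanced[OF Ym]]) auto
 have "lin A ?T (ext_mod Y) \<mu>"
 proof (rule linI[OF m(1,2)])
  fix a t assume a: "a .: A" and t: "t .: ?T"
  show "\<mu> (a \<odot>\<^sub>?T t) = a \<odot>\<^sub>(ext_mod Y) \<mu> t"
  proof (rule tensor_additive_eq[OF bimod_E Ym X.ag _ _ _ _ _ t])
   fix e y assume e: "e .: E" and y: "y .: Y"
   show "\<mu> (a \<odot>\<^sub>?T tens A E Y e y) = a \<odot>\<^sub>(ext_mod Y) \<mu> (tens A E Y e y)"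
    unfolding tensor_smult_tens[OF bimod_E Ym a e y] m(3)[OF e y] m(3)[OF E_smult_closed[OF bimod_E a e] y]
    by (rule push_smult[OF Ym y e a])
  qed (use a m(1,2) in "auto simp: T.smult_r_distr X.smult_r_distr")
 qed
 moreover have "inj_on \<mu> (el ?T)"
  unfolding lin_inj_iff[OF T.ag X.ag \<open>lin A ?T (ext_mod Y) \<mu>\<close>]
 proof (intro ballI impI)
  fix t assume t: "t .: ?T" and z: "\<mu> t = \<zero>\<^sub>(ext_mod Y)"
  obtain n y where y: "y \<in> {..<n::nat} -> el Y"
   and im: "(%c. lcomb A Y {..<n} c y) ` el (free_module A {..<n}) = el Y"
   by (rule fin_gen_lcomb[OF fgD[OF Y]])
  let ?P = "free_module A {..<n}" and ?p = "%c. lcomb A Y {..<n} c y"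
  note P = lm_free[OF ringA, of "{..<n}"] and p = Y.lin_lcomb[OF y]
  interpret P: left_module A ?P by (rule P)
  interpret LL: left_module A L by (rule lm_L)
  interpret Ex: abelian_group "Ext1 A D Y" by (rule abelian_group_Ext1[OF lm_D Ym])
  interpret ExL: abelian_group "Ext1 A D L" by (rule abelian_group_Ext1[OF lm_D lm_L])
  have yc: "y k .: Y" if "k < n" for k using y that by auto
  obtain ep where eps: "ep \<in> {..<n} -> el E" "t = (\<Oplus>\<^bsub>?T\<^esub>k \<in> {..<n}. tens A E Y (ep k) (y k))"
   by (rule tensor_standard_form[OF bimod_E Ym y im t])
  have ec: "ep k .: E" if "k < n" for k using eps(1) that by auto
  have "\<forall>k. \<exists>h. k < n --> lin A ?S L h & ep k = ext_class A D L h"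
   using E_class[OF ec] by metis
  then obtain h where "!!k. k < n --> lin A ?S L (h k) & ep k = ext_class A D L (h k)" by metis
  then have h: "!!k. k < n ==> lin A ?S L (h k)" "!!k. k < n ==> ep k = ext_class A D L (h k)" by auto
  have hc: "h k c .: A" if "k < n" "c .: ?S" for k c using lin_cl[OF h(1)[OF that(1)] that(2)] by simp
  have hy: "lin A ?S Y (%c. act Y (y k) (h k c))" if "k < n" for k
   by (rule lin_comp[OF h(1)[OF that] act_lin[OF Ym yc[OF that]]])
  have "\<mu> t = (\<Oplus>\<^bsub>ext_mod Y\<^esub>k \<in> {..<n}. \<mu> (tens A E Y (ep k) (y k)))"
   unfolding eps(2) using tens_closed[OF bimod_E Ym] ec yc
   by (intro add_finsum[OF T.ag X.ag m(1,2)]) auto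
  also have "... = (\<Oplus>\<^bsub>ext_mod Y\<^esub>k \<in> {..<n}. ext_class A D Y (%c. act Y (y k) (h k c)))"
   using ec yc h push_closed[OF Ym]
   by (intro X.M.finsum_cong') (auto simp: m(3) push_class[OF Ym] intro!: ext_class_closed[OF lm_D Ym hy, folded ext_mod_simps])
  also have "... = (\<Oplus>\<^bsub>Ext1 A D Y\<^esub>k \<in> {..<n}. ext_class A D Y (%c. act Y (y k) (h k c)))"
   by (rule finsum_ext_mod[OF Ym _ X.ag]) (use ext_class_closed[OF lm_D Ym hy] in auto)
  also have "... = ext_class A D Y (%c. \<Oplus>\<^bsub>Y\<^esub>k \<in> {..<n}. act Y (y k) (h k c))"
   by (rule ext_class_finsum[OF lm_D Ym, symmetric]) (use hy in auto)
  finally have zero: "ext_class A D Y (%c. \<Oplus>\<^bsub>Y\<^esub>k \<in> {..<n}. act Y (y k) (h k c)) = \<zero>\<^sub>(Ext1 A D Y)"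
   using z by (simp add: ext_mod_simps)
  have lsum: "lin A ?S Y (%c. \<Oplus>\<^bsub>Y\<^esub>k \<in> {..<n}. act Y (y k) (h k c))"
   by (rule lin_finsum_pt[OF lm_SX[OF lm_D] Ym]) (use hy in auto)
  obtain g where g: "g \<in> el D -> el Y"
   "!!c. c .: ?S ==> (\<Oplus>\<^bsub>Y\<^esub>k \<in> {..<n}. act Y (y k) (h k c)) = lcomb A Y (el D) c g"
   using iffD1[OF ext_class_eq_zero_iff[OF lm_D Ym lsum] zero] by (elim bexE) simp
  define r where "r d = inv_into (el ?P) ?p (g d)" for d
  have r: "r d .: ?P" "?p (r d) = g d" if "d .: D" for d
  proof -
   have "g d \<in> ?p ` el ?P" using im g(1) that by auto
   then show "r d .: ?P" "?p (r d) = g d" unfolding r_def by (rule inv_into_into, rule f_inv_into_f)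
  qed
  have rP: "r \<in> el D -> el ?P" using r by auto
  define hh where "hh c = (%k. if k < n then h k c else \<zero>\<^sub>A)" for c
  have hhl: "lin A ?S ?P hh"
  proof (rule linI)
   show "hh c .: ?P" if "c .: ?S" for c using hc that by (auto simp: hh_def free_simps)
   show "hh (c \<oplus>\<^sub>?S c') = hh c \<oplus>\<^sub>?P hh c'" if "c .: ?S" "c' .: ?S" for c c'
    using that LL.M.zero_closed LL.M.l_zero[of "\<zero>\<^sub>A"] by (auto simp: hh_def free_simps(2) lin_add[OF h(1)])
   show "hh (a \<odot>\<^sub>?S c) = a \<odot>\<^sub>?P hh c" if "a .: A" "c .: ?S" for a c
    using that LL.smult_r_null[of a] by (auto simp: hh_def free_simps(4) lin_smult[OF h(1)])
  qed
  have lr: "lin A ?S ?P (%c. lcomb A ?P (el D) c r)" by (rule lin_lcomb_SX[OF lm_D P rP])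
  define h' where "h' c = hh c \<ominus>\<^sub>?P lcomb A ?P (el D) c r" for c
  have h'l: "lin A ?S ?P h'" unfolding h'_def by (rule lin_diff_pt[OF P hhl lr])
  define K where "K = {c \<in> el ?P. ?p c = \<zero>\<^sub>Y}"
  have K: "submodule K A ?P" unfolding K_def by (rule submodule_kernel[OF P Ym p])
  have phh: "?p (hh c) = (\<Oplus>\<^bsub>Y\<^esub>k \<in> {..<n}. act Y (y k) (h k c))" if c: "c .: ?S" for c
  proof -
   have "?p (hh c) = (\<Oplus>\<^bsub>Y\<^esub>k \<in> {..<n}. hh c k \<odot>\<^sub>Y y k)"
    by (rule Y.lcomb_super[OF lin_cl[OF hhl c] y]) auto
   also have "... = (\<Oplus>\<^bsub>Y\<^esub>k \<in> {..<n}. act Y (y k) (h k c))"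
    using hc[OF _ c] yc by (intro Y.M.finsum_cong') (auto simp: hh_def act_def)
   finally show ?thesis .
  qed
  have h'K: "h' c \<in> K" if c: "c .: ?S" for c
  proof -
   have "?p (lcomb A ?P (el D) c r) = lcomb A Y (el D) c (%d. ?p (r d))"
    by (rule Y.lin_lcomb_comp[OF P p rP syzygy_FX[OF lm_D c]])
   also have "... = lcomb A Y (el D) c g"
    using r g(1) by (intro Y.lcomb_cong syzygy_FX[OF lm_D c]) auto
   finally have "?p (h' c) = \<zero>\<^sub>Y"
    using lin_diff[OF P.ag Y.ag p lin_cl[OF hhl c] lin_cl[OF lr c]]
     phh[OF c] g(2)[OF c] Y.M.diff_eq_zero lin_cl[OF p lin_cl[OF hhl c]] by (simp add: h'_def)
   then show ?thesis using lin_cl[OF h'l c] by (simp add: K_def)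
  qed
  let ?K = "?P .| K"
  have fgK: "fg_module A ?K" by (rule hereditary_fg[OF her ringA K])
  interpret K: left_module A ?K by (rule fgD(1)[OF fgK])
  obtain m q where q: "q \<in> {..<m::nat} -> el ?K"
   and imq: "(%c. lcomb A ?K {..<m} c q) ` el (free_module A {..<m}) = el ?K"
   by (rule fin_gen_lcomb[OF fgD[OF fgK]])
  let ?M = "free_module A {..<m}" and ?q = "%c. lcomb A ?K {..<m} c q"
  obtain s where s: "lin A ?K ?M s" "!!x. x \<in> K ==> ?q (s x) = x"
   using hereditary_lift[OF her ringA K fg_module_free[OF ringA] fgK K.lin_lcomb[OF q] imq lin_id] by blast
  have h'lK: "lin A ?S ?K h'" using h'K by (intro lin_corestrict[OF h'l]) auto
  have ql: "q l \<in> K" if "l < m" for l using q that by auto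
  have qP: "q l .: ?P" if "l < m" for l using ql[OF that] submod_sub[OF K] by auto
  have qA: "q l k .: A" if "l < m" for l k by (rule free_coeff[OF ringA qP[OF that]])
  define g' where "g' l c = s (h' c) l" for l c
  have ev: "lin A ?M L (%c. c l)" for l
   using free_coeff[OF ringA] by (intro linI) (auto simp: free_simps(2,4))
  have g'l: "lin A ?S L (g' l)" for l
   unfolding g'_def by (rule lin_comp[OF lin_comp[OF h'lK s(1)] ev])
  have g'c: "g' l c .: A" if "c .: ?S" for l c using lin_cl[OF g'l that] by simp
  define e' where "e' l = ext_class A D L (g' l)" for l
  have e'c: "e' l .: E" for l
   unfolding e'_def E_simps ext_mod_simps by (rule ext_class_closed[OF lm_D lm_L g'l])
  have h'v: "h' c k = (\<Oplus>\<^bsub>L\<^esub>l \<in> {..<m}. act L (q l k) (g' l c))" if c: "c .: ?S" for c k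
  proof -
   have sm: "s (h' c) .: ?M" using lin_cl[OF s(1)] h'K[OF c] by simp
   have "h' c = lcomb A ?K {..<m} (s (h' c)) q" using s(2)[OF h'K[OF c]] by simp
   also have "... = lcomb A ?P {..<m} (s (h' c)) q" by (rule lcomb_submodule(1)[OF P K _ sm]) (use ql in auto)
   also have "... = (\<Oplus>\<^bsub>?P\<^esub>l \<in> {..<m}. s (h' c) l \<odot>\<^sub>?P q l)"
    by (rule P.lcomb_super[OF sm]) (use qP in auto)
   finally have "h' c k = (\<Oplus>\<^bsub>A\<^esub>l \<in> {..<m}. (s (h' c) l \<odot>\<^sub>?P q l) k)"
    using finsum_free_module[OF ringA, of "%l. s (h' c) l \<odot>\<^sub>?P q l" "{..<m}" "{..<n}" k]
     P.smult_closed free_coeff[OF ringA sm] qP by auto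
   also have "... = (\<Oplus>\<^bsub>A\<^esub>l \<in> {..<m}. act L (q l k) (g' l c))"
    using qA g'c[OF c]
    by (intro A_finsum_cong') (auto simp: act_def g'_def free_simps(4) monoid.m_closed[OF monoidA])
   also have "... = (\<Oplus>\<^bsub>L\<^esub>l \<in> {..<m}. act L (q l k) (g' l c))"
    by (rule finsum_regular_module[OF ringA, symmetric]) (use qA g'c[OF c] in "auto simp: act_def monoid.m_closed[OF monoidA]")
   finally show ?thesis .
  qed
  have aq: "lin A ?S L (%c. act L (q l k) (g' l c))" if "l < m" for l k
   by (rule lin_comp[OF g'l act_lin[OF lm_L]]) (use qA[OF that] in simp)
  have eps': "ep k = (\<Oplus>\<^bsub>Ext1 A D L\<^esub>l \<in> {..<m}. rsmult E (e' l) (q l k))" if k: "k < n" for k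
  proof -
   let ?u = "%c. \<Oplus>\<^bsub>L\<^esub>l \<in> {..<m}. act L (q l k) (g' l c)"
   have u: "lin A ?S L ?u" by (rule lin_finsum_pt[OF lm_SX[OF lm_D] lm_L]) (use aq in auto)
   have "ext_class A D L (h k) = ext_class A D L ?u"
    unfolding ext_class_eq_iff[OF lm_D lm_L h(1)[OF k] u]
   proof (intro bexI[of _ "%d. r d k"] ballI)
    show "(%d. r d k) \<in> el D -> el L" using free_coeff[OF ringA r(1)] by simp
    fix c assume c: "c .: ?S"
    have evP: "lin A ?P L (%c. c k)"
     using free_coeff[OF ringA] by (intro linI) (auto simp: free_simps(2,4))
    have "h' c \<oplus>\<^sub>?P lcomb A ?P (el D) c r = hh c"
     unfolding h'_def by (rule P.M.diff_add[OF lin_cl[OF hhl c] lin_cl[OF lr c]])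
    then have "h' c k \<oplus>\<^sub>A (lcomb A ?P (el D) c r) k = h k c"
     using k by (simp add: free_simps(2) hh_def fun_eq_iff)
    moreover have "(lcomb A ?P (el D) c r) k = lcomb A L (el D) c (%d. r d k)"
     by (rule LL.lin_lcomb_comp[OF P evP rP syzygy_FX[OF lm_D c]])
    moreover have "h' c k .: L" "(lcomb A ?P (el D) c r) k .: L"
     using lin_cl[OF evP] lin_cl[OF h'l c] lin_cl[OF lr c] by blast+
    ultimately show "h k c = lcomb A L (el D) c (%d. r d k) \<oplus>\<^sub>L ?u c"
     using h'v[OF c, of k] LL.M.a_comm by simp
   qed
   also have "... = (\<Oplus>\<^bsub>Ext1 A D L\<^esub>l \<in> {..<m}. ext_class A D L (%c. act L (q l k) (g' l c)))"
    by (rule ext_class_finsum[OF lm_D lm_L]) (use aq in auto)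
   also have "... = (\<Oplus>\<^bsub>Ext1 A D L\<^esub>l \<in> {..<m}. rsmult E (e' l) (q l k))"
   proof (rule ExL.finsum_cong')
    show "(%l. rsmult E (e' l) (q l k)) \<in> {..<m} -> el (Ext1 A D L)"
     using bimodD(2)[OF bimod_E e'c qA] by (auto simp: E_simps(1) ext_mod_simps)
    show "ext_class A D L (%c. act L (q l k) (g' l c)) = rsmult E (e' l) (q l k)" if "l \<in> {..<m}" for l
     unfolding e'_def rsmult_push using push_class[OF lm_L _ g'l, of "q l k" l] qA that by simp
   qed simp
   finally show ?thesis using h(2)[OF k] by simp
  qed
  have tc: "tens A E Y e x .: ?T" if "e .: E" "x .: Y" for e x by (rule tens_closed[OF bimod_E Ym that])
  have rs: "rsmult E (e' l) (q l k) .: E" if "l < m" for l k by (rule bimodD(2)[OF bimod_E e'c qA[OF that]])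
  have tk: "tens A E Y (ep k) (y k) = (\<Oplus>\<^bsub>?T\<^esub>l \<in> {..<m}. tens A E Y (e' l) (q l k \<odot>\<^sub>Y y k))" if k: "k < n" for k
  proof -
   have "tens A E Y (ep k) (y k) = (\<Oplus>\<^bsub>?T\<^esub>l \<in> {..<m}. tens A E Y (rsmult E (e' l) (q l k)) (y k))"
    unfolding eps'[OF k]
    using rs tc yc[OF k] tens_add_left[OF bimod_E Ym _ _ yc[OF k]]
    by (intro add_finsum[OF ExL.abelian_group_axioms T.ag, of "%e. tens A E Y e (y k)"])
     (auto simp: E_simps(1,3) ext_mod_simps)
   also have "... = (\<Oplus>\<^bsub>?T\<^esub>l \<in> {..<m}. tens A E Y (e' l) (q l k \<odot>\<^sub>Y y k))"
    using tens_balanced[OF bimod_E Ym e'c qA yc[OF k]] tc[OF e'c] qA yc[OF k] by (intro T.M.finsum_cong') auto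
   finally show ?thesis .
  qed
  have "t = (\<Oplus>\<^bsub>?T\<^esub>k \<in> {..<n}. \<Oplus>\<^bsub>?T\<^esub>l \<in> {..<m}. tens A E Y (e' l) (q l k \<odot>\<^sub>Y y k))"
   unfolding eps(2) using tk tc[OF e'c] qA yc by (intro T.M.finsum_cong') (auto intro!: T.M.finsum_closed)
  also have "... = (\<Oplus>\<^bsub>?T\<^esub>l \<in> {..<m}. \<Oplus>\<^bsub>?T\<^esub>k \<in> {..<n}. tens A E Y (e' l) (q l k \<odot>\<^sub>Y y k))"
   by (rule T.M.finsum_swap) (use tc[OF e'c] qA yc in auto)
  also have "... = (\<Oplus>\<^bsub>?T\<^esub>l \<in> {..<m}. \<zero>\<^sub>?T)"
  proof (rule T.M.finsum_cong')
   fix l assume "l \<in> {..<m}"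
   then have l: "l < m" by simp
   have "(\<Oplus>\<^bsub>?T\<^esub>k \<in> {..<n}. tens A E Y (e' l) (q l k \<odot>\<^sub>Y y k)) = tens A E Y (e' l) (\<Oplus>\<^bsub>Y\<^esub>k \<in> {..<n}. q l k \<odot>\<^sub>Y y k)"
    using tc[OF e'c] qA[OF l] yc tens_add_right[OF bimod_E Ym e'c]
    by (intro add_finsum[OF Y.ag T.ag, of "tens A E Y (e' l)", symmetric]) auto
   also have "(\<Oplus>\<^bsub>Y\<^esub>k \<in> {..<n}. q l k \<odot>\<^sub>Y y k) = ?p (q l)"
    by (rule Y.lcomb_super[OF qP[OF l] y, symmetric]) auto
   also have "?p (q l) = \<zero>\<^sub>Y" using ql[OF l] by (simp add: K_def)
   also have "tens A E Y (e' l) \<zero>\<^sub>Y = \<zero>\<^sub>?T"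
    using tens_add_right[OF bimod_E Ym e'c[of l] Y.M.zero_closed Y.M.zero_closed] tc[OF e'c[of l] Y.M.zero_closed] by simp
   finally show "(\<Oplus>\<^bsub>?T\<^esub>k \<in> {..<n}. tens A E Y (e' l) (q l k \<odot>\<^sub>Y y k)) = \<zero>\<^sub>?T" .
  qed auto
  finally show "t = \<zero>\<^sub>?T" by simp
 qed
 ultimately show ?thesis using m(3) by (rule that)
qed

end

section \<open>The functor \<open>\<tau>\<^sup>-\<close>\<close>

context hereditary_algebra
begin

abbreviation "T M \<equiv> tau_inv F A M"
abbreviation "Tm M N f \<equiv> tau_inv_map F A M N f"

definition pure :: "'a fgmod => ((('a => 'f) => 'a) => 'a) set => (nat => 'a) set => (nat => 'a) set"
 where "pure M e x = fg_copy_iso A (tensor A E M) (tens A E M e x)"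

lemma fg_tensor: "fg_module A M ==> fg_module A (tensor A E M)"
 by (rule fg_module_tensor[OF bimod_E _ fgD(2)[OF fg_module_E]])

lemma T_iso:
 assumes "fg_module A M"
 shows "lin A (tensor A E M) (T M) (fg_copy_iso A (tensor A E M))"
  "bij_betw (fg_copy_iso A (tensor A E M)) (el (tensor A E M)) (el (T M))"
 using fg_copy(3,4)[OF fg_tensor[OF assms]] by (simp_all add: tau_inv_def)

lemma fg_T: "fg_module A M ==> fg_module A (T M)"
 unfolding tau_inv_def by (rule fg_copy(1)[OF fg_tensor])

context
 fixes M :: "'a fgmod"
 assumes M: "fg_module A M"
begin

lemmas Mlm = fgD(1)[OF M]

lemma pure_closed: "e .: E ==> x .: M ==> pure M e x .: (T M)"
 unfolding pure_def by (rule lin_cl[OF T_iso(1)[OF M] tens_closed[OF bimod_E Mlm]])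

lemma pure_add_right:
 assumes "e .: E" "x .: M" "x' .: M"
 shows "pure M e (x \<oplus>\<^sub>M x') = pure M e x \<oplus>\<^sub>(T M) pure M e x'"
 unfolding pure_def tens_add_right[OF bimod_E Mlm assms]
 by (rule lin_add[OF T_iso(1)[OF M]]) (use assms in "auto intro: tens_closed[OF bimod_E Mlm]")

lemma pure_add_left:
 assumes "e .: E" "e' .: E" "x .: M"
 shows "pure M (e \<oplus>\<^sub>E e') x = pure M e x \<oplus>\<^sub>(T M) pure M e' x"
 unfolding pure_def tens_add_left[OF bimod_E Mlm assms]
 by (rule lin_add[OF T_iso(1)[OF M]]) (use assms in "auto intro: tens_closed[OF bimod_E Mlm]")

lemma pure_smult:
 assumes "a .: A" "e .: E" "x .: M"
 shows "a \<odot>\<^sub>(T M) pure M e x = pure M (a \<odot>\<^sub>E e) x"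
 unfolding pure_def tensor_smult_tens[OF bimod_E Mlm assms, symmetric]
 by (rule lin_smult[OF T_iso(1)[OF M], symmetric]) (use assms in "auto intro: tens_closed[OF bimod_E Mlm]")

lemma pure_balanced:
 assumes "e .: E" "a .: A" "x .: M"
 shows "pure M (rsmult E e a) x = pure M e (a \<odot>\<^sub>M x)"
 unfolding pure_def tens_balanced[OF bimod_E Mlm assms] ..

lemma pure_lin_left: "x .: M ==> lin A E (T M) (%e. pure M e x)"
 by (rule linI) (simp_all add: pure_closed pure_add_left pure_smult)

lemma pure_zero_right:
 assumes "e .: E" shows "pure M e \<zero>\<^sub>M = \<zero>\<^sub>(T M)"
proof -
 interpret M: left_module A M by (rule Mlm)
 interpret TM: left_module A "T M" by (rule fgD(1)[OF fg_T[OF M]])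
 show ?thesis using pure_add_right[OF assms M.M.zero_closed M.M.zero_closed] pure_closed[OF assms M.M.zero_closed] by simp
qed

text \<open>The pure tensors generate, so a homomorphism is determined by its values on them; every functoriality statement below rests on this.\<close>

lemma T_hom_eq:
 fixes Z :: "('a, 'z, 'o) ms"
 assumes Z: "lmod A Z" and "lin A (T M) Z f" "lin A (T M) Z g"
  and eq: "!!e x. e .: E ==> x .: M ==> f (pure M e x) = g (pure M e x)"
  and t: "t .: (T M)"
 shows "f t = g t"
proof -
 let ?c = "fg_copy_iso A (tensor A E M)"
 note c = T_iso[OF M]
 have fc: "lin A (tensor A E M) Z (%s. f (?c s))" and gc: "lin A (tensor A E M) Z (%s. g (?c s))"
  using lin_comp[OF c(1)] assms(2,3) by auto
 obtain s where s: "s .: (tensor A E M)" "t = ?c s" using c(2) t by (auto simp: bij_betw_def)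
 show ?thesis unfolding s(2)
  by (rule tensor_additive_eq[OF bimod_E Mlm left_module.axioms(2)[OF Z] lin_cl[OF fc] lin_add[OF fc]
     lin_cl[OF gc] lin_add[OF gc] _ s(1)])
   (use eq in "auto simp: pure_def")
qed

lemma T_zero: "el M = {\<zero>\<^sub>M} ==> el (T M) = {\<zero>\<^sub>(T M)}"
proof -
 assume z: "el M = {\<zero>\<^sub>M}"
 note T = fgD(1)[OF fg_T[OF M]]
 interpret TM: left_module A "T M" by (rule T)
 have "t = \<zero>\<^sub>(T M)" if "t .: (T M)" for t
  by (rule T_hom_eq[OF T lin_id lin_zero_pt[OF T] _ that]) (use z pure_zero_right in auto)
 then show ?thesis by auto
qed

text \<open>\<open>tensor_to_ext\<close> transported to the copy in the universe.\<close>

lemma T_to_ext: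
 obtains \<mu> where "lin A (T M) (ext_mod M) \<mu>" "inj_on \<mu> (el (T M))"
  "!!e x. e .: E ==> x .: M ==> \<mu> (pure M e x) = push M x e"
proof -
 let ?c = "fg_copy_iso A (tensor A E M)" and ?T = "tensor A E M"
 note c = T_iso[OF M]
 note Tlm = fgD(1)[OF fg_tensor[OF M]]
 obtain \<mu> where m: "lin A ?T (ext_mod M) \<mu>" "inj_on \<mu> (el ?T)"
  "!!e y. e .: E ==> y .: M ==> \<mu> (tens A E M e y) = push M y e"
  by (rule tensor_to_ext[OF M]) (rule that)
 note inv = bij_inv[OF c(2)]
 show ?thesis
 proof (rule that[of "%t. \<mu> (inv_into (el ?T) ?c t)"])
  show "lin A (T M) (ext_mod M) (%t. \<mu> (inv_into (el ?T) ?c t))"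
   by (rule lin_comp[OF lin_inv_into[OF Tlm c] m(1)])
  show "inj_on (%t. \<mu> (inv_into (el ?T) ?c t)) (el (T M))"
  proof (rule inj_onI)
   fix s t assume st: "s .: (T M)" "t .: (T M)"
    "\<mu> (inv_into (el ?T) ?c s) = \<mu> (inv_into (el ?T) ?c t)"
   have "inv_into (el ?T) ?c s = inv_into (el ?T) ?c t"
    by (rule inj_onD[OF m(2) st(3)]) (use st inv(3) in auto)
   then show "s = t" using inv(2) st(1,2) by metis
  qed
  show "\<mu> (inv_into (el ?T) ?c (pure M e x)) = push M x e" if "e .: E" "x .: M" for e x
   unfolding pure_def inv(1)[OF tens_closed[OF bimod_E Mlm that]] by (rule m(3)[OF that])
 qed
qed

lemma pure_zero_imp_injective_image:
 assumes "x .: M" "!!e. e .: E ==> pure M e x = \<zero>\<^sub>(T M)"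
 shows "\<exists>n N. lin A (pow_mod D n) M N & x \<in> N ` el (pow_mod D n)"
proof (rule push_zero_imp_injective_image[OF her M assms(1)])
 fix e assume e: "e .: E"
 interpret TM: left_module A "T M" by (rule fgD(1)[OF fg_T[OF M]])
 interpret X: left_module A "ext_mod M" by (rule lm_ext[OF M])
 obtain \<mu> where m: "lin A (T M) (ext_mod M) \<mu>" "inj_on \<mu> (el (T M))"
  "!!e x. e .: E ==> x .: M ==> \<mu> (pure M e x) = push M x e"
  by (rule T_to_ext) (rule that)
 show "push M x e = \<zero>\<^sub>(ext_mod M)"
  using m(3)[OF e assms(1)] assms(2)[OF e] lin_zero[OF TM.ag X.ag m(1)] by simp
qed

lemma T_injective_zero:
 assumes "injmod A M" "t .: (T M)" shows "t = \<zero>\<^sub>(T M)"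
proof -
 interpret TM: left_module A "T M" by (rule fgD(1)[OF fg_T[OF M]])
 interpret X: left_module A "ext_mod M" by (rule lm_ext[OF M])
 obtain \<mu> where m: "lin A (T M) (ext_mod M) \<mu>" "inj_on \<mu> (el (T M))"
  "!!e x. e .: E ==> x .: M ==> \<mu> (pure M e x) = push M x e"
  by (rule T_to_ext) (rule that)
 show ?thesis
  using ext_injective_zero[OF M assms(1) lin_cl[OF m(1) assms(2)]] assms(2) m(2)
   lin_inj_iff[OF TM.ag X.ag m(1)] by blast
qed

lemma T_hom_regular_zero:
 assumes "lin A (T M) L h" "t .: (T M)" shows "h t = \<zero>\<^sub>A"
proof -
 have "h t = (%_. \<zero>\<^sub>L) t"
 proof (rule T_hom_eq[OF lm_L assms(1) lin_zero_pt[OF lm_L] _ assms(2)])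
  fix e x assume e: "e .: E" and x: "x .: M"
  show "h (pure M e x) = \<zero>\<^sub>L"
   using ext_hom_to_regular_zero[OF her lin_comp[OF pure_lin_left[OF x] assms(1)] e] by simp
 qed
 then show ?thesis by simp
qed

end

lemma Tm_lin_pure:
 assumes M: "fg_module A M" and N: "fg_module A N" and f: "lin A M N f"
 shows Tm_lin: "lin A (T M) (T N) (Tm M N f)"
  and Tm_pure: "!!e x. e .: E ==> x .: M ==> Tm M N f (pure M e x) = pure N e (f x)"
proof -
 note Ml = fgD(1)[OF M] and Nl = fgD(1)[OF N]
 let ?c = "fg_copy_iso A (tensor A E M)" and ?d = "fg_copy_iso A (tensor A E N)" and ?TM = "tensor A E M"
 note c = T_iso[OF M] and d = T_iso[OF N]
 note Tl = fgD(1)[OF fg_tensor[OF M]]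
 note inv = bij_inv[OF c(2)]
 have eq: "Tm M N f t = ?d (tensor_map A E M N f (inv_into (el ?TM) ?c t))" if "t .: (T M)" for t
  using that by (simp add: tau_inv_map_def Let_def)
 show "lin A (T M) (T N) (Tm M N f)"
  by (rule lin_congI[OF fgD(1)[OF fg_T[OF M]]
     lin_comp[OF lin_comp[OF lin_inv_into[OF Tl c] lin_tensor_map[OF bimod_E Ml Nl f]] d(1)] eq])
 show "Tm M N f (pure M e x) = pure N e (f x)" if "e .: E" "x .: M" for e x
  unfolding eq[OF pure_closed[OF M that]]
  unfolding pure_def inv(1)[OF tens_closed[OF bimod_E Ml that]] tensor_map_tens[OF bimod_E Ml Nl f that] ..
qed

lemma Tm_extensional: "Tm M N f \<in> extensional (el (T M))"
 by (simp add: tau_inv_map_def Let_def)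

lemma Tm_unique:
 assumes M: "fg_module A M" and N: "fg_module A N" and f: "lin A M N f" and h: "lin A (T M) (T N) h"
  and "!!e x. e .: E ==> x .: M ==> h (pure M e x) = pure N e (f x)"
  and t: "t .: (T M)"
 shows "Tm M N f t = h t"
 by (rule T_hom_eq[OF M fgD(1)[OF fg_T[OF N]] Tm_lin[OF M N f] h _ t]) (simp add: Tm_pure[OF M N f] assms(5))

lemma Tm_cong:
 assumes "fg_module A M" "fg_module A N" "lin A M N f" "!!x. x .: M ==> f x = g x"
 shows "Tm M N f = Tm M N g"
proof (rule extensionalityI[OF Tm_extensional Tm_extensional])
 have g: "lin A M N g" using lin_cong[OF fgD(1)[OF assms(1)], of f g N] assms(3,4) by simp
 fix t assume t: "t .: (T M)"
 show "Tm M N f t = Tm M N g t"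
  by (rule Tm_unique[OF assms(1-3) Tm_lin[OF assms(1,2) g] _ t]) (simp add: Tm_pure[OF assms(1,2) g] assms(4))
qed

lemma Tm_id: "fg_module A M ==> t .: (T M) ==> Tm M M (%x. x) t = t"
 by (rule Tm_unique[OF _ _ lin_id lin_id]) auto

lemma Tm_comp:
 assumes "fg_module A M" "fg_module A N" "fg_module A K" "lin A M N f" "lin A N K g" "t .: (T M)"
 shows "Tm N K g (Tm M N f t) = Tm M K (%x. g (f x)) t"
 by (rule Tm_unique[OF assms(1,3) lin_comp[OF assms(4,5)] lin_comp[OF Tm_lin[OF assms(1,2,4)] Tm_lin[OF assms(2,3,5)]] _ assms(6), symmetric])
  (simp add: Tm_pure[OF assms(1,2,4)] Tm_pure[OF assms(2,3,5)] lin_cl[OF assms(4)])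

lemma Tm_finsum:
 assumes M: "fg_module A M" and N: "fg_module A N" and "finite I" and f: "!!i. i \<in> I ==> lin A M N (f i)"
  and t: "t .: (T M)"
 shows "Tm M N (%x. \<Oplus>\<^bsub>N\<^esub>i \<in> I. f i x) t = (\<Oplus>\<^bsub>T N\<^esub>i \<in> I. Tm M N (f i) t)"
proof (rule Tm_unique[OF M N _ _ _ t])
 note Ml = fgD(1)[OF M] and Nl = fgD(1)[OF N]
 note TM = fgD(1)[OF fg_T[OF M]] and TN = fgD(1)[OF fg_T[OF N]]
 interpret N: left_module A N by (rule Nl)
 interpret TN: left_module A "T N" by (rule TN)
 show "lin A M N (%x. \<Oplus>\<^bsub>N\<^esub>i \<in> I. f i x)" by (rule lin_finsum_pt[OF Ml Nl]) (use assms in auto)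
 show "lin A (T M) (T N) (%t. \<Oplus>\<^bsub>T N\<^esub>i \<in> I. Tm M N (f i) t)"
  by (rule lin_finsum_pt[OF TM TN]) (use assms Tm_lin[OF M N] in auto)
 fix e x assume e: "e .: E" and x: "x .: M"
 have fx: "f i x .: N" if "i \<in> I" for i using lin_cl[OF f[OF that] x] .
 have "(\<Oplus>\<^bsub>T N\<^esub>i \<in> I. Tm M N (f i) (pure M e x)) = (\<Oplus>\<^bsub>T N\<^esub>i \<in> I. pure N e (f i x))"
  by (rule TN.M.finsum_cong') (use fx e x pure_closed[OF N] Tm_pure[OF M N f] in auto)
 also have "... = pure N e (\<Oplus>\<^bsub>N\<^esub>i \<in> I. f i x)"
  using add_finsum[OF N.ag TN.ag, of "pure N e" "%i. f i x" I]
   pure_closed[OF N e] pure_add_right[OF N e] fx by auto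
 finally show "(\<Oplus>\<^bsub>T N\<^esub>i \<in> I. Tm M N (f i) (pure M e x)) = pure N e (\<Oplus>\<^bsub>N\<^esub>i \<in> I. f i x)" .
qed

lemma scalar_central: "c .: F ==> a .: A ==> (c \<odot>\<^sub>A \<one>\<^sub>A) \<otimes>\<^sub>A a = a \<otimes>\<^sub>A (c \<odot>\<^sub>A \<one>\<^sub>A)"
 by (simp add: scalar_mult mult_scalar)

lemma scalar_closed: "c .: F ==> c \<odot>\<^sub>A \<one>\<^sub>A .: A"
 by simp

lemma lin_scalar:
 assumes "lmod A M" "c .: F" shows "lin A M M (%x. (c \<odot>\<^sub>A \<one>\<^sub>A) \<odot>\<^sub>M x)"
proof -
 interpret M: left_module A M by fact
 note c = scalar_closed[OF assms(2)]
 show ?thesis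
  by (rule linI) (use c scalar_central[OF assms(2)] in "auto simp: M.smult_r_distr M.smult_assoc1[symmetric]")
qed

text \<open>Both actions multiply representatives by the scalar, up to a map that factors through the free module: \<open>[cd] - c[d]\<close> is in the syzygy for every \<open>d\<close>.\<close>

lemma E_central:
 assumes c: "c .: F" and e: "e .: E"
 shows "rsmult E e (c \<odot>\<^sub>A \<one>\<^sub>A) = (c \<odot>\<^sub>A \<one>\<^sub>A) \<odot>\<^sub>E e"
proof -
 define k where k: "k = c \<odot>\<^sub>A \<one>\<^sub>A"
 let ?P = "free_module A (el D)" and ?S = "syzygy A D"
 note cA = scalar_closed[OF c, folded k] and cen = scalar_central[OF c, folded k]
 note lsc = lin_scalar[OF _ c, folded k]
 have cL: "k .: L" using cA by simp
 note r = rho_lin[OF cA]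
 have rD: "rho k \<in> el D -> el D" by (rule Pi_I) (rule lin_cl[OF r])
 have P: "lmod A ?P" by (rule lm_free[OF ringA])
 interpret P: left_module A ?P by (rule P)
 interpret LL: left_module A L by (rule lm_L)
 interpret DD: left_module A D by (rule lm_D)
 obtain h where h: "lin A ?S L h" "e = ext_class A D L h" by (rule E_class[OF e])
 let ?fm = "free_map A (el D) (rho k)"
 define u where "u x = ?fm x \<ominus>\<^sub>?P (k \<odot>\<^sub>?P x)" for x
 have fml: "lin A ?P ?P ?fm" by (rule lin_free_map[OF ringA rD])
 have ul: "lin A ?P ?P u" unfolding u_def by (rule lin_diff_pt[OF P fml lsc[OF P]])
 have vl: "lin A ?P D (%s. lcomb A D (el D) s (%x. x))" by (rule lin_value[OF lm_D])
 have rc: "rho k d = k \<odot>\<^sub>D d" if "d .: D" for d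
  using that cA cen by (auto simp: dual_simps dual_rmult_def intro!: restrict_ext)
 have uS: "u x .: ?S" if x: "x .: ?P" for x
 proof -
  let ?v = "%s. lcomb A D (el D) s (%x. x)"
  have "?v (?fm x) = lcomb A D (el D) x (rho k)" by (rule DD.lcomb_free_map[OF x rD]) auto
  also have "... = lcomb A D (el D) x (%d. k \<odot>\<^sub>D d)"
   by (rule DD.lcomb_cong[OF _ _ x]) (use rc cA in auto)
  also have "... = k \<odot>\<^sub>D ?v x"
   by (rule DD.lin_lcomb_comp[OF lm_D lsc[OF lm_D] _ x, symmetric]) auto
  also have "... = ?v (k \<odot>\<^sub>?P x)" by (rule lin_smult[OF vl cA x, symmetric])
  finally have "?v (u x) = \<zero>\<^sub>D"
   unfolding u_def
   using lin_diff[OF P.ag DD.ag vl lin_cl[OF fml x] P.smult_closed[OF cA x]]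
    DD.M.diff_eq_zero lin_cl[OF vl P.smult_closed[OF cA x]] by simp
  then show ?thesis using lin_cl[OF ul x] by (simp add: syzygy_carrier[OF lm_D])
 qed
 have uSl: "lin A ?P ?S u"
  by (subst syzygy_eq[OF lm_D], rule lin_corestrict[OF ul]) (use uS in auto)
 note hu = lin_comp[OF uSl h(1)]
 have fS: "lin A ?S L (%s. h (?fm s))" by (rule lin_comp[OF lin_free_map_syzygy[OF lm_D r] h(1)])
 have gS: "lin A ?S L (%s. act L k (h s))" by (rule lin_comp[OF h(1) act_lin[OF lm_L cL]])
 have "k \<odot>\<^sub>E e = ext_class A D L (%s. h (?fm s))"
  unfolding h(2) E_simps ext_mod_simps by (rule Ext1_pull_class[OF lm_D lm_L h(1) r])
 also have "... = ext_class A D L (%s. act L k (h s))"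
  unfolding ext_class_eq_iff[OF lm_D lm_L fS gS]
 proof (intro bexI ballI)
  let ?g = "%d. h (u (free_gen A d))"
  show "?g \<in> el D -> el L" by (rule Pi_I) (rule lin_cl[OF hu free_gen_cl[OF ringA]])
  fix s assume s: "s .: ?S"
  note sP = syzygy_FX[OF lm_D s]
  interpret S: left_module A ?S by (rule lm_SX[OF lm_D])
  have "h (u s) = lcomb A L (el D) s ?g" by (rule lin_free_expand[OF lm_L hu sP])
  moreover have "h (?fm s) = h (u s) \<oplus>\<^sub>L h (k \<odot>\<^sub>?S s)"
  proof -
   have "u s \<oplus>\<^sub>?P (k \<odot>\<^sub>?P s) = ?fm s"
    unfolding u_def by (rule P.M.diff_add[OF lin_cl[OF fml sP] P.smult_closed[OF cA sP]])
   then have "?fm s = u s \<oplus>\<^sub>?S k \<odot>\<^sub>?S s" by (simp add: syzygy_def free_cover_def)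
   then show ?thesis using lin_add[OF h(1) uS[OF sP] S.smult_closed[OF cA s]] by simp
  qed
  moreover have "h (k \<odot>\<^sub>?S s) = act L k (h s)"
   using lin_smult[OF h(1) cA s] lin_cl[OF h(1) s] cen by (simp add: act_def)
  ultimately show "h (?fm s) = lcomb A L (el D) s ?g \<oplus>\<^sub>L act L k (h s)" by simp
 qed
 also have "... = rsmult E e k" unfolding h(2) rsmult_push push_class[OF lm_L cL h(1)] ..
 finally show ?thesis unfolding k ..
qed

lemma pure_scalar:
 assumes "fg_module A M" "c .: F" "e .: E" "x .: M"
 shows "pure M e ((c \<odot>\<^sub>A \<one>\<^sub>A) \<odot>\<^sub>M x) = (c \<odot>\<^sub>A \<one>\<^sub>A) \<odot>\<^sub>(T M) pure M e x"
 unfolding pure_balanced[OF assms(1,3) scalar_closed[OF assms(2)] assms(4), symmetric] E_central[OF assms(2,3)]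
 by (rule pure_smult[OF assms(1) scalar_closed[OF assms(2)] assms(3,4), symmetric])

lemma Tm_scalar:
 assumes M: "fg_module A M" and N: "fg_module A N" and f: "lin A M N f" and c: "c .: F" and t: "t .: (T M)"
 shows "Tm M N (%x. (c \<odot>\<^sub>A \<one>\<^sub>A) \<odot>\<^sub>N f x) t = (c \<odot>\<^sub>A \<one>\<^sub>A) \<odot>\<^sub>(T N) Tm M N f t"
 by (rule Tm_unique[OF M N lin_comp[OF f lin_scalar[OF fgD(1)[OF N] c]]
    lin_comp[OF Tm_lin[OF M N f] lin_scalar[OF fgD(1)[OF fg_T[OF N]] c]] _ t])
  (simp add: Tm_pure[OF M N f] pure_scalar[OF N c] lin_cl[OF f])

end

section \<open>Indecomposable modules under the functor\<close>

context fin_dim_algebra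
begin

text \<open>By Fitting \<open>gf\<close> is bijective; \<open>fg\<close> is not nilpotent either, since \<open>(gf)\<^sup>n\<^sup>+\<^sup>1 = g (fg)\<^sup>n f\<close>.\<close>

lemma round_trip_iso:
 fixes X :: "('a, 'x, 'k) ms" and Y :: "('a, 'y, 'l) ms"
 assumes X: "fg_module A X" "indecomposable A X" and Y: "fg_module A Y" "indecomposable A Y"
  and f: "lin A X Y f" and g: "lin A Y X g"
  and nn: "!!n. \<exists>x \<in> el X. ((%x. g (f x)) ^^ n) x ~= \<zero>\<^sub>X"
 shows "bij_betw f (el X) (el Y)"
proof -
 interpret X: left_module A X by (rule fgD(1)[OF X(1)])
 interpret Y: left_module A Y by (rule fgD(1)[OF Y(1)])
 have shift: "((%x. g (f x)) ^^ Suc n) x = g (((%y. f (g y)) ^^ n) (f x))" for n x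
  by (induction n) simp_all
 have gf: "bij_betw (%x. g (f x)) (el X) (el X)"
  using indecomposable_endo[OF X lin_comp[OF f g]] nn by blast
 have "~ (\<forall>y \<in> el Y. ((%y. f (g y)) ^^ n) y = \<zero>\<^sub>Y)" for n
 proof
  assume z: "\<forall>y \<in> el Y. ((%y. f (g y)) ^^ n) y = \<zero>\<^sub>Y"
  have "((%x. g (f x)) ^^ Suc n) x = \<zero>\<^sub>X" if "x .: X" for x
   unfolding shift using z lin_cl[OF f that] lin_zero[OF Y.ag X.ag g] by simp
  then show False using nn[of "Suc n"] by blast
 qed
 then have fg: "bij_betw (%y. f (g y)) (el Y) (el Y)"
  using indecomposable_endo[OF Y lin_comp[OF g f]] by blast
 have "inj_on f (el X)"
  using bij_betw_imp_inj_on[OF gf] by (auto simp: inj_on_def)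
 moreover have "f ` el X = el Y"
 proof
  show "f ` el X <= el Y" using lin_cl[OF f] by auto
  show "el Y <= f ` el X"
  proof
   fix y assume "y .: Y"
   then obtain z where "z .: Y" "y = f (g z)" using fg by (auto simp: bij_betw_def)
   then show "y \<in> f ` el X" using lin_cl[OF g] by auto
  qed
 qed
 ultimately show ?thesis by (simp add: bij_betw_def)
qed

lemma funpow_fixed: "f x = x ==> (f ^^ n) x = x"
 by (induction n) simp_all

lemma indecomposable_idempotent:
 fixes M :: "('a, 'x, 'k) ms"
 assumes "fg_module A M" "indecomposable A M" "lin A M M p" "!!x. x .: M ==> p (p x) = p x"
 shows "(\<forall>x \<in> el M. p x = x) \<or> (\<forall>x \<in> el M. p x = \<zero>\<^sub>M)"
 using indecomposable_endo[OF assms(1-3)]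
proof
 assume b: "bij_betw p (el M) (el M)"
 have "p x = x" if "x .: M" for x
  using inj_onD[OF bij_betw_imp_inj_on[OF b] assms(4)[OF that] lin_cl[OF assms(3) that] that] .
 then show ?thesis by blast
next
 assume "\<exists>n. \<forall>x \<in> el M. (p ^^ n) x = \<zero>\<^sub>M"
 then obtain n where n: "!!x. x .: M ==> (p ^^ n) x = \<zero>\<^sub>M" by blast
 have "p x = \<zero>\<^sub>M" if x: "x .: M" for x
  using n[OF lin_cl[OF assms(3) x]] funpow_fixed[of p "p x" n] assms(4)[OF x] by simp
 then show ?thesis by blast
qed

text \<open>If \<open>U \<inter> V = 0\<close>, the projection \<open>U + V \<rightarrow> U\<close> extends to an endomorphism of \<open>X\<close> that is neither bijective nor nilpotent.\<close>

lemma injective_uniform: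
 fixes X :: "('a, 'x, 'k) ms"
 assumes X: "fg_module A X" "indecomposable A X" "injmod A X"
  and U: "submodule U A X" "u \<in> U" "u ~= \<zero>\<^sub>X" and V: "submodule V A X" "v \<in> V" "v ~= \<zero>\<^sub>X"
 shows "\<exists>w \<in> U \<inter> V. w ~= \<zero>\<^sub>X"
proof (rule ccontr)
 note Xl = fgD(1)[OF X(1)]
 interpret X: left_module A X by (rule Xl)
 assume "~ ?thesis"
 moreover have "\<zero>\<^sub>X \<in> U \<inter> V" using submodule_zero[OF U(1)] submodule_zero[OF V(1)] by simp
 ultimately have z: "U \<inter> V = {\<zero>\<^sub>X}" by blast
 let ?W = "U <+>\<^bsub>X\<^esub> V"
 let ?X = "X .| ?W"
 note W = submodule_set_add[OF Xl U(1) V(1)]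
 note Wl = submodule_left_module[OF Xl W(1)]
 have sub: "submodule U A ?X" "submodule V A ?X"
  using U(1) V(1) W(2,3) by (simp_all add: submodule_submodule[OF Xl W(1)])
 have sum: "U <+>\<^bsub>?X\<^esub> V = el ?X" by (simp add: set_add_def set_mult_def)
 obtain p where p: "lin A ?X ?X p" "!!u. u \<in> U ==> p u = u" "!!v. v \<in> V ==> p v = \<zero>\<^sub>?X"
  by (rule projection_exists[OF Wl sub sum]) (use z in simp_all)
 have "lin A ?X X p" by (rule lin_comp[OF p(1) lin_incl[OF submod_sub[OF W(1)]]])
 from injmod_extend[OF X(3) Xl X(1) W(1) this]
 obtain q where q: "lin A X X q" "!!x. x \<in> ?W ==> q x = p x" by blast
 have qu: "q u = u" and qv: "q v = \<zero>\<^sub>X" using q(2) p(2,3) U(2) V(2) W(2,3) by (auto simp: subset_iff)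
 have uv: "u .: X" "v .: X" using submod_sub[OF U(1)] submod_sub[OF V(1)] U(2) V(2) by auto
 from indecomposable_endo[OF X(1,2) q(1)] show False
 proof
  assume "bij_betw q (el X) (el X)"
  then show False
   using lin_inj_iff[OF X.ag X.ag q(1)] uv V(3) qv
   by (simp add: bij_betw_def)
 next
  assume "\<exists>n. \<forall>x \<in> el X. (q ^^ n) x = \<zero>\<^sub>X"
  then show False using funpow_fixed[of q, OF qu] uv(1) U(3) by auto
 qed
qed

end

context hereditary_algebra
begin

text \<open>The image of the injective is injective, hence a summand of \<open>M\<close>.\<close>

lemma pure_zero_imp_injective:
 assumes M: "fg_module A M" "indecomposable A M"
  and x: "x .: M" "x ~= \<zero>\<^sub>M" "!!e. e .: E ==> pure M e x = \<zero>\<^sub>(T M)"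
 shows "injmod A M"
proof -
 note Ml = fgD(1)[OF M(1)]
 interpret M: left_module A M by (rule Ml)
 obtain n N where N: "lin A (pow_mod D n) M N" "x \<in> N ` el (pow_mod D n)"
  using pure_zero_imp_injective_image[OF M(1) x(1,3)] by auto
 let ?P = "pow_mod D n" and ?U = "N ` el (pow_mod D n)"
 let ?M = "M .| ?U"
 have fgP: "fg_module A ?P" by (rule fg_module_pow[OF fg_module_D])
 note Pl = fgD(1)[OF fgP]
 have U: "submodule ?U A M" by (rule submodule_image[OF Pl Ml N(1) submodule_carrier[OF Pl]])
 note Ul = submodule_left_module[OF Ml U]
 have NU: "lin A ?P ?M N" by (rule lin_corestrict[OF N(1)]) simp
 have fgU: "fg_module A ?M" by (rule fg_module_image[OF fgP Ul NU]) simp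
 have iU: "injmod A ?M" by (rule injmod_image[OF her ringA injmod_pow[OF injmod_D] fgP fgU NU]) simp
 have incl: "lin A ?M M (%x. x)" by (rule lin_incl[OF submod_sub[OF U]])
 from injmod_summand[OF iU Ul M(1) incl]
 obtain w where w: "lin A M ?M w" "!!x. x \<in> ?U ==> w x = x" by (auto simp: inj_on_def)
 have wU: "w y \<in> ?U" if "y .: M" for y using lin_cl[OF w(1) that] by simp
 have "(\<forall>x \<in> el M. w x = x) \<or> (\<forall>x \<in> el M. w x = \<zero>\<^sub>M)"
  by (rule indecomposable_idempotent[OF M lin_comp[OF w(1) incl]]) (use w(2) wU in blast)
 moreover have "w x ~= \<zero>\<^sub>M" using w(2)[OF N(2)] x(2) by simp
 ultimately have "!!y. y .: M ==> y \<in> ?U" using wU x(1) by metis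
 then have "?U = el M" using submod_sub[OF U] by blast
 then have "lin A ?P M N & N ` el ?P = el M" using N(1) by blast
 then show ?thesis using injmod_image[OF her ringA injmod_pow[OF injmod_D] fgP M(1)] by blast
qed

text \<open>For fixed \<open>x\<close>, the map \<open>e \<mapsto> h(e \<otimes> x)\<close> is \<open>e \<mapsto> e \<otimes> y\<close> for some \<open>y\<close>.  If \<open>Y\<close> is not injective, then \<open>y\<close> is unique, so \<open>x \<mapsto> y\<close> is linear; otherwise \<open>T Y = 0\<close>.\<close>

lemma T_full:
 assumes X: "fg_module A X" and Y: "fg_module A Y" "indecomposable A Y" and h: "lin A (T X) (T Y) h"
 shows "\<exists>f. lin A X Y f & (\<forall>x \<in> el X. \<forall>e \<in> el E. h (pure X e x) = pure Y e (f x))"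
proof -
 note Xl = fgD(1)[OF X(1)] and Yl = fgD(1)[OF Y(1)]
 note TXl = fgD(1)[OF fg_T[OF X(1)]] and TYl = fgD(1)[OF fg_T[OF Y(1)]]
 interpret X: left_module A X by (rule Xl)
 interpret Y: left_module A Y by (rule Yl)
 interpret TY: left_module A "T Y" by (rule TYl)
 note hp = lin_cl[OF h pure_closed[OF X]]
 show ?thesis
 proof (cases "injmod A Y")
  case True
  have "h (pure X e x) = pure Y e \<zero>\<^sub>Y" if "e .: E" "x .: X" for e x
   using T_injective_zero[OF Y(1) True hp[OF that]] pure_zero_right[OF Y(1) that(1)] by simp
  then show ?thesis using lin_zero_pt[OF Yl] by blast
 next
  case False
  have unique: "y = y'" if y: "y .: Y" "y' .: Y" and eq: "!!e. e .: E ==> pure Y e y = pure Y e y'" for y y'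
  proof (rule ccontr)
   assume "y ~= y'"
   then have nz: "y \<ominus>\<^sub>Y y' ~= \<zero>\<^sub>Y" using Y.M.diff_eq_zero[OF y] by simp
   have "pure Y e (y \<ominus>\<^sub>Y y') = \<zero>\<^sub>(T Y)" if e: "e .: E" for e
   proof -
    have "pure Y e (y \<ominus>\<^sub>Y y') \<oplus>\<^sub>(T Y) pure Y e y' = pure Y e y"
     using pure_add_right[OF Y(1) e Y.M.minus_closed[OF y] y(2)] Y.M.diff_add[OF y] by simp
    then show ?thesis
     using eq[OF e] TY.M.add.r_cancel_one[of "pure Y e y'" "pure Y e (y \<ominus>\<^sub>Y y')"] pure_closed[OF Y(1) e] y by simp
   qed
   then show False using pure_zero_imp_injective[OF Y _ nz] False Y.M.minus_closed[OF y] by blast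
  qed
  obtain \<mu> where m: "lin A (T Y) (ext_mod Y) \<mu>" "inj_on \<mu> (el (T Y))"
   "!!e x. e .: E ==> x .: Y ==> \<mu> (pure Y e x) = push Y x e"
   by (rule T_to_ext[OF Y(1)]) (rule that)
  have "\<exists>y \<in> el Y. \<forall>e \<in> el E. h (pure X e x) = pure Y e y" if x: "x .: X" for x
  proof -
   have "lin A E (ext_mod Y) (%e. \<mu> (h (pure X e x)))"
    by (rule lin_comp[OF lin_comp[OF pure_lin_left[OF X x] h] m(1)])
   from ext_hom_is_push[OF her Y(1) this]
   obtain y where y: "y .: Y" "\<forall>e \<in> el E. \<mu> (h (pure X e x)) = push Y y e" by (rule bexE)
   have "h (pure X e x) = pure Y e y" if e: "e .: E" for e
    by (rule inj_onD[OF m(2) _ hp[OF e x] pure_closed[OF Y(1) e y(1)]]) (simp add: y(2) m(3)[OF e y(1)] e)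
   then show ?thesis using y(1) by blast
  qed
  then obtain f where f: "!!x. x .: X ==> f x .: Y"
   "!!x e. x .: X ==> e .: E ==> h (pure X e x) = pure Y e (f x)"
   by metis
  have "lin A X Y f"
  proof (rule linI)
   fix x assume x: "x .: X"
   show "f x .: Y" by (rule f(1)[OF x])
  next
   fix x x' assume x: "x .: X" "x' .: X"
   show "f (x \<oplus>\<^sub>X x') = f x \<oplus>\<^sub>Y f x'"
   proof (rule unique)
    fix e assume e: "e .: E"
    show "pure Y e (f (x \<oplus>\<^sub>X x')) = pure Y e (f x \<oplus>\<^sub>Y f x')"
     unfolding f(2)[OF X.M.a_closed[OF x] e, symmetric] pure_add_right[OF X e x] pure_add_right[OF Y(1) e f(1)[OF x(1)] f(1)[OF x(2)]]
      f(2)[OF x(1) e, symmetric] f(2)[OF x(2) e, symmetric]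
     by (rule lin_add[OF h pure_closed[OF X e x(1)] pure_closed[OF X e x(2)]])
   qed (use f(1) x in auto)
  next
   fix a x assume a: "a .: A" and x: "x .: X"
   show "f (a \<odot>\<^sub>X x) = a \<odot>\<^sub>Y f x"
   proof (rule unique)
    fix e assume e: "e .: E"
    note r = bimodD(2)[OF bimod_E e a]
    have "pure Y e (f (a \<odot>\<^sub>X x)) = h (pure X (rsmult E e a) x)"
     using f(2)[OF X.smult_closed[OF a x] e] pure_balanced[OF X e a x] by simp
    also have "... = pure Y e (a \<odot>\<^sub>Y f x)"
     using f(2)[OF x r] pure_balanced[OF Y(1) e a f(1)[OF x]] by simp
    finally show "pure Y e (f (a \<odot>\<^sub>X x)) = pure Y e (a \<odot>\<^sub>Y f x)" .
   qed (use f(1) a x in auto)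
  qed
  then show ?thesis using f(2) by blast
 qed
qed

lemma T_funpow:
 assumes X: "fg_module A X" and f: "lin A X X f" and p: "!!x e. x .: X ==> e .: E ==> p (pure X e x) = pure X e (f x)"
  and xe: "x .: X" "e .: E"
 shows "(p ^^ n) (pure X e x) = pure X e ((f ^^ n) x)"
 by (induction n) (simp_all add: p[OF lin_cl[OF lin_funpow[OF f] xe(1)] xe(2)])

lemma T_nilpotent:
 assumes X: "fg_module A X" and f: "lin A X X f" and p: "lin A (T X) (T X) p"
  and eq: "!!x e. x .: X ==> e .: E ==> p (pure X e x) = pure X e (f x)"
  and n: "!!x. x .: X ==> (f ^^ n) x = \<zero>\<^sub>X" and t: "t .: (T X)"
 shows "(p ^^ n) t = \<zero>\<^sub>(T X)"
 by (rule T_hom_eq[OF X fgD(1)[OF fg_T[OF X]] lin_funpow[OF p] lin_zero_pt[OF fgD(1)[OF fg_T[OF X]]] _ t])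
  (simp add: T_funpow[OF X f eq] n pure_zero_right[OF X])

text \<open>A projection of \<open>T X\<close> is induced by an endomorphism of \<open>X\<close>, which is bijective or nilpotent, and so is the projection.\<close>

lemma T_indecomposable:
 assumes X: "fg_module A X" "indecomposable A X" and nz: "el (T X) ~= {\<zero>\<^sub>(T X)}"
 shows "indecomposable A (T X)"
 unfolding indecomposable_def
proof (intro conjI allI impI nz)
 note Xl = fgD(1)[OF X(1)] and Tl = fgD(1)[OF fg_T[OF X(1)]]
 interpret X: left_module A X by (rule Xl)
 interpret TX: left_module A "T X" by (rule Tl)
 fix U V assume UV: "submodule U A (T X)" "submodule V A (T X)" "U <+>\<^bsub>T X\<^esub> V = el (T X)" "U \<inter> V = {\<zero>\<^sub>(T X)}"
 obtain p where p: "lin A (T X) (T X) p" "!!x. x .: (T X) ==> p x \<in> U" "!!u. u \<in> U ==> p u = u"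
  "!!v. v \<in> V ==> p v = \<zero>\<^sub>(T X)" by (rule projection_exists[OF Tl UV]) (rule that)
 have zU: "\<zero>\<^sub>(T X) \<in> U" "\<zero>\<^sub>(T X) \<in> V" using UV(4) by auto
 have sub: "U <= el (T X)" "V <= el (T X)" using UV(1,2) submod_sub by blast+
 obtain f where f: "lin A X X f" "!!x e. x .: X ==> e .: E ==> p (pure X e x) = pure X e (f x)"
  using T_full[OF X(1) X p(1)] by blast
 from indecomposable_endo[OF X f(1)] show "U = {\<zero>\<^sub>(T X)} \<or> V = {\<zero>\<^sub>(T X)}"
 proof
  assume b: "bij_betw f (el X) (el X)"
  let ?g = "inv_into (el X) f"
  note g = lin_inv_into[OF Xl f(1) b] and inv = bij_inv[OF b]
  have "Tm X X ?g (p t) = t" if "t .: (T X)" for t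
   by (rule T_hom_eq[OF X(1) Tl lin_comp[OF p(1) Tm_lin[OF X(1) X(1) g]] lin_id _ that])
    (simp add: f(2) Tm_pure[OF X(1) X(1) g] lin_cl[OF f(1)] inv(1))
  note id = this
  have "v = \<zero>\<^sub>(T X)" if v: "v \<in> V" for v
  proof -
   have "Tm X X ?g (p v) = \<zero>\<^sub>(T X)"
    unfolding p(4)[OF v] by (rule lin_zero[OF TX.ag TX.ag Tm_lin[OF X(1) X(1) g]])
   then show ?thesis using id[OF subsetD[OF sub(2) v]] by simp
  qed
  then have "V = {\<zero>\<^sub>(T X)}" using zU(2) by blast
  then show ?thesis by simp
 next
  assume "\<exists>n. \<forall>x \<in> el X. (f ^^ n) x = \<zero>\<^sub>X"
  then obtain n where n: "!!x. x .: X ==> (f ^^ n) x = \<zero>\<^sub>X" by blast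
  have "u = \<zero>\<^sub>(T X)" if u: "u \<in> U" for u
   using T_nilpotent[OF X(1) f(1) p(1) f(2) n subsetD[OF sub(1) u]] funpow_fixed[of p u n, OF p(3)[OF u]] by simp
  then have "U = {\<zero>\<^sub>(T X)}" using zU(1) by blast
  then show ?thesis by simp
 qed
qed

lemma T_reflects_iso:
 assumes X: "fg_module A X" "indecomposable A X" and Y: "fg_module A Y" "indecomposable A Y"
  and iso: "isomorphic A (T X) (T Y)" and nz: "el (T X) ~= {\<zero>\<^sub>(T X)}"
 shows "isomorphic A X Y"
proof -
 note Xl = fgD(1)[OF X(1)] and Tl = fgD(1)[OF fg_T[OF X(1)]]
 interpret TX: left_module A "T X" by (rule Tl)
 obtain h where h: "lin A (T X) (T Y) h" "bij_betw h (el (T X)) (el (T Y))" using iso by (rule isomorphicE)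
 let ?k = "inv_into (el (T X)) h"
 note k = lin_inv_into[OF Tl h] and inv = bij_inv[OF h(2)]
 obtain f where f: "lin A X Y f" "!!x e. x .: X ==> e .: E ==> h (pure X e x) = pure Y e (f x)"
  using T_full[OF X(1) Y h(1)] by blast
 obtain g where g: "lin A Y X g" "!!x e. x .: Y ==> e .: E ==> ?k (pure Y e x) = pure X e (g x)"
  using T_full[OF Y(1) X k] by blast
 obtain t where t: "t .: (T X)" "t ~= \<zero>\<^sub>(T X)" using nz by auto
 have "bij_betw f (el X) (el Y)"
 proof (rule round_trip_iso[OF X Y f(1) g(1)], rule ccontr)
  fix n assume n: "~ (\<exists>x \<in> el X. ((%x. g (f x)) ^^ n) x ~= \<zero>\<^sub>X)"
  have "((%t. ?k (h t)) ^^ n) t = \<zero>\<^sub>(T X)"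
   by (rule T_nilpotent[OF X(1) lin_comp[OF f(1) g(1)] lin_comp[OF h(1) k] _ _ t(1)])
    (use n in "auto simp: f(2) g(2) lin_cl[OF f(1)]")
  then show False using funpow_fixed[of "%t. ?k (h t)" t n] inv(1)[OF t(1)] t(2) by simp
 qed
 then show ?thesis by (rule isomorphicI[OF Xl f(1)])
qed

abbreviation "Tp r M \<equiv> tau_inv_pow F A r M"
abbreviation "Tpm r M N f \<equiv> tau_inv_pow_map F A r M N f"

lemma fg_Tp: "fg_module A M ==> fg_module A (Tp r M)"
 by (induction r) (simp_all add: fg_T)

lemma Tp_Tp: "Tp r (Tp s M) = Tp (r + s) M"
 by (induction r) simp_all

lemma Tpm_Tpm: "Tpm r (Tp s M) (Tp s N) (Tpm s M N f) = Tpm (r + s) M N f"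
 by (induction r) (simp_all add: Tp_Tp)

lemma Tpm_lin:
 assumes "fg_module A M" "fg_module A N" "lin A M N f" shows "lin A (Tp r M) (Tp r N) (Tpm r M N f)"
 by (induction r) (simp_all add: assms Tm_lin fg_Tp)

lemma Tpm_cong:
 assumes "fg_module A M" "fg_module A N" "lin A M N f" "!!x. x .: M ==> f x = g x" "t .: (Tp r M)"
 shows "Tpm r M N f t = Tpm r M N g t"
 using assms(5)
proof (induction r arbitrary: t)
 case 0
 then show ?case using assms(4) by simp
next
 case (Suc r)
 show ?case using Tm_cong[OF fg_Tp[OF assms(1)] fg_Tp[OF assms(2)] Tpm_lin[OF assms(1-3)] Suc.IH] by simp
qed

lemma Tpm_id: "fg_module A M ==> t .: (Tp r M) ==> Tpm r M M (%x. x) t = t"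
proof (induction r arbitrary: t)
 case (Suc r)
 note M = Suc.prems(1)
 show ?case
  using Tm_cong[OF fg_Tp[OF M] fg_Tp[OF M] Tpm_lin[OF M M lin_id] Suc.IH[OF M]] Tm_id[OF fg_Tp[OF M]] Suc.prems(2) by simp
qed simp

lemma Tpm_comp:
 assumes M: "fg_module A M" and N: "fg_module A N" and K: "fg_module A K" and f: "lin A M N f" and g: "lin A N K g"
 shows "t .: (Tp r M) ==> Tpm r N K g (Tpm r M N f t) = Tpm r M K (%x. g (f x)) t"
proof (induction r arbitrary: t)
 case (Suc r)
 note l = Tpm_lin[OF M N f, of r] Tpm_lin[OF N K g, of r] Tpm_lin[OF M K lin_comp[OF f g], of r]
 note fg = fg_Tp[OF M, of r] fg_Tp[OF N, of r] fg_Tp[OF K, of r]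
 show ?case
  using Tm_comp[OF fg l(1,2), of t] Suc.prems Tm_cong[OF fg(1,3) lin_comp[OF l(1,2)] Suc.IH] by simp
qed simp

lemma Tpm_finsum:
 assumes M: "fg_module A M" and N: "fg_module A N" and I: "finite I" and f: "!!i. i \<in> I ==> lin A M N (f i)"
 shows "t .: (Tp r M) ==> Tpm r M N (%x. \<Oplus>\<^bsub>N\<^esub>i \<in> I. f i x) t = (\<Oplus>\<^bsub>Tp r N\<^esub>i \<in> I. Tpm r M N (f i) t)"
proof (induction r arbitrary: t)
 case (Suc r)
 have l: "lin A M N (%x. \<Oplus>\<^bsub>N\<^esub>i \<in> I. f i x)"
  by (rule lin_finsum_pt[OF fgD(1)[OF M] fgD(1)[OF N]]) (use I f in auto)
 have "Tpm (Suc r) M N (%x. \<Oplus>\<^bsub>N\<^esub>i \<in> I. f i x) t = Tm (Tp r M) (Tp r N) (%t. \<Oplus>\<^bsub>Tp r N\<^esub>i \<in> I. Tpm r M N (f i) t) t"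
  using Tm_cong[OF fg_Tp[OF M] fg_Tp[OF N] Tpm_lin[OF M N l] Suc.IH] by simp
 also have "... = (\<Oplus>\<^bsub>Tp (Suc r) N\<^esub>i \<in> I. Tpm (Suc r) M N (f i) t)"
  using Tm_finsum[OF fg_Tp[OF M, of r] fg_Tp[OF N, of r] I, where f = "%i. Tpm r M N (f i)" and t = t] Tpm_lin[OF M N f] Suc.prems by simp
 finally show ?case .
qed simp

lemma Tpm_scalar:
 assumes M: "fg_module A M" and N: "fg_module A N" and f: "lin A M N f" and c: "c .: F"
 shows "t .: (Tp r M) ==> Tpm r M N (%x. (c \<odot>\<^sub>A \<one>\<^sub>A) \<odot>\<^sub>N f x) t = (c \<odot>\<^sub>A \<one>\<^sub>A) \<odot>\<^sub>(Tp r N) Tpm r M N f t"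
proof (induction r arbitrary: t)
 case (Suc r)
 note l = lin_comp[OF f lin_scalar[OF fgD(1)[OF N] c]]
 show ?case
  using Tm_cong[OF fg_Tp[OF M] fg_Tp[OF N] Tpm_lin[OF M N l] Suc.IH]
   Tm_scalar[OF fg_Tp[OF M, of r] fg_Tp[OF N, of r] Tpm_lin[OF M N f] c, of t] Suc.prems by simp
qed simp

end

section \<open>The translates of the indecomposable projectives\<close>

lemma internal_direct_sum_projections:
 assumes M: "lmod R M" and ds: "internal_direct_sum R M I N"
 obtains pr where "!!i. i \<in> I ==> lin R M (M .| (N i)) (pr i)"
  "!!x. x .: M ==> (\<Oplus>\<^bsub>M\<^esub>i \<in> I. pr i x) = x"
  "!!i x. i \<in> I ==> x \<in> N i ==> pr i x = x"
proof -
 interpret M: left_module R M by (rule M)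
 have fin: "finite I" and sub: "!!i. i \<in> I ==> submodule (N i) R M"
  and ex: "!!x. x .: M ==> \<exists>!p. p \<in> (\<Pi>\<^sub>E i \<in> I. N i) & x = (\<Oplus>\<^bsub>M\<^esub>i \<in> I. p i)"
  using ds by (auto simp: internal_direct_sum_def)
 have NM: "y .: M" if "i \<in> I" "y \<in> N i" for i y using submod_sub[OF sub] that by blast
 define P where "P x = (THE p. p \<in> (\<Pi>\<^sub>E i \<in> I. N i) & x = (\<Oplus>\<^bsub>M\<^esub>i \<in> I. p i))" for x
 have P: "P x \<in> (\<Pi>\<^sub>E i \<in> I. N i)" "x = (\<Oplus>\<^bsub>M\<^esub>i \<in> I. P x i)" if "x .: M" for x
  using theI'[OF ex[OF that]] unfolding P_def by blast+
 have unique: "p i = P x i" if "x .: M" "!!i. i \<in> I ==> p i \<in> N i" "x = (\<Oplus>\<^bsub>M\<^esub>i \<in> I. p i)" "i \<in> I" for x p i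
 proof -
  have "(\<Oplus>\<^bsub>M\<^esub>i \<in> I. p i) = (\<Oplus>\<^bsub>M\<^esub>i \<in> I. restrict p I i)"
   using that(2) NM by (intro M.M.finsum_cong') auto
  then have "restrict p I \<in> (\<Pi>\<^sub>E i \<in> I. N i) & x = (\<Oplus>\<^bsub>M\<^esub>i \<in> I. restrict p I i)" using that(2,3) by auto
  then have "restrict p I = P x" using ex[OF that(1)] P[OF that(1)] by blast
  then show ?thesis using that(4) by (metis restrict_apply')
 qed
 have PN: "P x i \<in> N i" if "x .: M" "i \<in> I" for x i using P(1)[OF that(1)] that(2) by auto
 have PM: "(%i. P x i) \<in> I -> el M" if "x .: M" for x using NM PN that by auto
 show ?thesis
 proof (rule that[of "%i x. P x i"])
  fix i assume i: "i \<in> I"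
  show "lin R M (M .| (N i)) (%x. P x i)"
  proof (rule linI)
   fix x assume x: "x .: M"
   then show "P x i .: (M .| (N i))" using PN i by simp
  next
   fix x y assume x: "x .: M" and y: "y .: M"
   have "x \<oplus>\<^sub>M y = (\<Oplus>\<^bsub>M\<^esub>i \<in> I. P x i \<oplus>\<^sub>M P y i)"
    using M.M.finsum_addf[OF PM[OF x] PM[OF y]] P(2)[OF x] P(2)[OF y] by simp
   then have "P x i \<oplus>\<^sub>M P y i = P (x \<oplus>\<^sub>M y) i"
    using unique[of "x \<oplus>\<^sub>M y" "%i. P x i \<oplus>\<^sub>M P y i" i] M.M.a_closed[OF x y] i
     submodule_add[OF sub] PN[OF x] PN[OF y] by blast
   then show "P (x \<oplus>\<^sub>M y) i = P x i \<oplus>\<^bsub>M .| (N i)\<^esub> P y i" by simp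
  next
   fix a x assume a: "a .: R" and x: "x .: M"
   have "a \<odot>\<^sub>M (\<Oplus>\<^bsub>M\<^esub>i \<in> I. P x i) = (\<Oplus>\<^bsub>M\<^esub>i \<in> I. a \<odot>\<^sub>M P x i)"
    by (rule add_finsum[OF M.ag M.ag _ _ PM[OF x]])
     (use a in "auto simp: M.smult_r_distr")
   then have eq: "a \<odot>\<^sub>M x = (\<Oplus>\<^bsub>M\<^esub>i \<in> I. a \<odot>\<^sub>M P x i)" using P(2)[OF x] by simp
   have "a \<odot>\<^sub>M P x i = P (a \<odot>\<^sub>M x) i"
    by (rule unique[OF M.smult_closed[OF a x] submodule_smult[OF sub a PN[OF x]] eq i])
   then show "P (a \<odot>\<^sub>M x) i = a \<odot>\<^bsub>M .| (N i)\<^esub> P x i" by simp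
  qed
  fix x assume x: "x \<in> N i"
  let ?p = "%j. if i = j then x else \<zero>\<^sub>M"
  have "x = (\<Oplus>\<^bsub>M\<^esub>j \<in> I. ?p j)"
   using M.M.finsum_singleton[OF i fin, of "%_. x"] NM[OF i x] by simp
  then have "?p i = P x i"
   using x submodule_zero[OF sub] NM[OF i x] by (intro unique[OF _ _ _ i]) auto
  then show "P x i = x" by simp
 qed (rule P(2)[symmetric])
qed

lemma isomorphic_zero:
 assumes "lmod R M" "lmod R N" "isomorphic R M N" "el N = {\<zero>\<^sub>N}"
 shows "el M = {\<zero>\<^sub>M}"
proof -
 interpret M: left_module R M by fact
 interpret N: left_module R N by fact
 obtain f where f: "lin R M N f" "bij_betw f (el M) (el N)" using assms(3) by (rule isomorphicE)
 have "x = \<zero>\<^sub>M" if x: "x .: M" for x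
  using f(2) lin_inj_iff[OF M.ag N.ag f(1)] lin_cl[OF f(1) x] assms(4) x
  by (simp add: bij_betw_def)
 then show ?thesis by auto
qed

lemma indecomposable_isomorphic:
 assumes M: "lmod R M" and N: "lmod R N" and iso: "isomorphic R M N" and ind: "indecomposable R M"
 shows "indecomposable R N"
 unfolding indecomposable_def
proof (intro conjI allI impI notI)
 interpret M: left_module R M by (rule M)
 interpret N: left_module R N by (rule N)
 {
  assume "el N = {\<zero>\<^sub>N}"
  then show False using isomorphic_zero[OF M N iso] ind by (simp add: indecomposable_def)
 }
 fix U V assume UV: "submodule U R N" "submodule V R N" "U <+>\<^bsub>N\<^esub> V = el N" "U \<inter> V = {\<zero>\<^sub>N}"
 obtain f where f: "lin R M N f" "bij_betw f (el M) (el N)" using iso by (rule isomorphicE)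
 let ?g = "inv_into (el M) f"
 note g = lin_inv_into[OF M f] and inv = bij_inv[OF f(2)]
 have g0: "?g \<zero>\<^sub>N = \<zero>\<^sub>M" by (rule lin_zero[OF N.ag M.ag g])
 have f0: "f \<zero>\<^sub>M = \<zero>\<^sub>N" by (rule lin_zero[OF M.ag N.ag f(1)])
 have sub: "U <= el N" "V <= el N" using submod_sub UV(1,2) by blast+
 have z: "U = {\<zero>\<^sub>N}" if eq: "?g ` U = {\<zero>\<^sub>M}" and "submodule U R N" for U
 proof -
  have "u = \<zero>\<^sub>N" if u: "u \<in> U" for u
  proof -
   have "?g u = \<zero>\<^sub>M" using eq u by blast
   then show ?thesis using inv(2)[of u] u submod_sub[OF \<open>submodule U R N\<close>] f0 by auto
  qed
  then show ?thesis using submodule_zero[OF \<open>submodule U R N\<close>] by blast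
 qed
 have "?g ` U = {\<zero>\<^sub>M} \<or> ?g ` V = {\<zero>\<^sub>M}"
 proof -
  have "el M <= ?g ` U <+>\<^bsub>M\<^esub> ?g ` V"
  proof
   fix x assume x: "x .: M"
   have "f x \<in> U <+>\<^bsub>N\<^esub> V" using lin_cl[OF f(1) x] UV(3) by simp
   then obtain u v where uv: "u \<in> U" "v \<in> V" "f x = u \<oplus>\<^sub>N v" by (auto simp: set_add_iff)
   have "x = ?g u \<oplus>\<^sub>M ?g v" using inv(1)[OF x] lin_add[OF g, of u v] uv sub by auto
   then show "x \<in> ?g ` U <+>\<^bsub>M\<^esub> ?g ` V" using uv(1,2) by (auto simp: set_add_iff)
  qed
  note gU = submodule_image[OF N M g UV(1)] and gV = submodule_image[OF N M g UV(2)]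
  have "?g ` U <+>\<^bsub>M\<^esub> ?g ` V = el M"
   using \<open>el M <= _\<close> submod_sub[OF submodule_set_add(1)[OF M gU gV]] by blast
  moreover have "?g ` U \<inter> ?g ` V = {\<zero>\<^sub>M}"
  proof -
   have "w = \<zero>\<^sub>M" if w: "w \<in> ?g ` U" "w \<in> ?g ` V" for w
   proof -
    obtain u v where uv: "u \<in> U" "v \<in> V" "w = ?g u" "w = ?g v" using w by auto
    have "u = v" using inv(2)[of u] inv(2)[of v] uv sub by (metis subsetD)
    then have "u \<in> U \<inter> V" using uv by simp
    then show ?thesis using uv(3) UV(4) g0 by simp
   qed
   then show ?thesis using submodule_zero[OF gU] submodule_zero[OF gV] by blast
  qed
  ultimately show ?thesis using ind gU gV unfolding indecomposable_def by blast
 qed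
 then show "U = {\<zero>\<^sub>N} \<or> V = {\<zero>\<^sub>N}" using z UV(1,2) by blast
qed

text \<open>The decomposition of the regular module is recorded by maps \<open>a i\<close>, \<open>b i\<close> in the universe of modules, to which functors can be applied.\<close>

locale basic_hereditary_algebra = hereditary_algebra F A
 for F :: "('f, 'p) ring_scheme" (structure) and A :: "('f, 'a, 'm) ms" (structure) +
 fixes n :: nat and Q :: "nat => 'a fgmod" and a b :: "nat => (nat => 'a) set => (nat => 'a) set"
 assumes Q: "!!i. i < n ==> fg_module A (Q i)" "!!i. i < n ==> indecomposable A (Q i)"
   "!!i j. i < n ==> j < n ==> isomorphic A (Q i) (Q j) ==> i = j"
  and a: "!!i. i < n ==> lin A (Q i) (fg_copy A (regular_module A)) (a i)"
  and b: "!!i. i < n ==> lin A (fg_copy A (regular_module A)) (Q i) (b i)"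
  and ba: "!!i x. i < n ==> x .: (Q i) ==> b i (a i x) = x"
  and ab: "!!x. x .: (fg_copy A (regular_module A)) ==>
   (\<Oplus>\<^bsub>fg_copy A (regular_module A)\<^esub>i \<in> {..<n}. a i (b i x)) = x"
  and fin_rep: "rep_finite A"

context hereditary_algebra
begin

lemma basic_decomposition:
 assumes basic: "basic_ring A" and "rep_finite A"
 obtains n Q a b where "basic_hereditary_algebra F A n Q a b"
proof -
 let ?L = "fg_copy A L"
 obtain n :: nat and P where ds: "internal_direct_sum A L {..<n} P"
  and P: "!!i. i < n ==> indecomposable A (L .| (P i))" "!!i. i < n ==> fg_projective A (L .| (P i))"
  "!!i j. i < n ==> j < n ==> i ~= j ==> ~ isomorphic A (L .| (P i)) (L .| (P j))"
  using basic unfolding basic_ring_def by blast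
 let ?P = "%i. L .| (P i)"
 obtain pr where pr: "!!i. i \<in> {..<n} ==> lin A L (?P i) (pr i)"
  "!!x. x .: L ==> (\<Oplus>\<^bsub>L\<^esub>i \<in> {..<n}. pr i x) = x" "!!i x. i \<in> {..<n} ==> x \<in> P i ==> pr i x = x"
  by (rule internal_direct_sum_projections[OF lm_L ds]) (rule that)
 have fgP: "fg_module A (?P i)" if "i < n" for i using P(2)[OF that] by (simp add: fg_projective_def)
 note Pl = fgD(1)[OF fgP]
 have subP: "P i <= el L" if "i < n" for i
  using ds that submod_sub unfolding internal_direct_sum_def by blast
 note cL = fg_copy[OF fg_module_L]
 note cLl = fgD(1)[OF cL(1)]
 interpret LL: left_module A L by (rule lm_L)
 interpret cL: left_module A ?L by (rule cLl)
 let ?\<iota> = "fg_copy_iso A L" and ?\<kappa> = "%i. fg_copy_iso A (?P i)"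
 let ?\<iota>' = "inv_into (el L) ?\<iota>" and ?\<kappa>' = "%i. inv_into (el (?P i)) (?\<kappa> i)"
 note io = lin_inv_into[OF lm_L cL(3,4)] and ioinv = bij_inv[OF cL(4)]
 note cP = fg_copy[OF fgP]
 note kinv = bij_inv[OF cP(4)]
 let ?Q = "%i. fg_copy A (?P i)"
 let ?a = "%i x. ?\<iota> (?\<kappa>' i x)" and ?b = "%i x. ?\<kappa> i (pr i (?\<iota>' x))"
 have kL: "?\<kappa>' i x .: L" if "i < n" "x .: (?Q i)" for i x
  using kinv(3)[OF that] subP[OF that(1)] by auto
 have "basic_hereditary_algebra F A n ?Q ?a ?b"
 proof unfold_locales
  fix i assume i: "i < n"
  show "fg_module A (?Q i)" by (rule cP(1)[OF i])
  show "indecomposable A (?Q i)"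
   by (rule indecomposable_isomorphic[OF Pl[OF i] fgD(1)[OF cP(1)[OF i]] cP(2)[OF i] P(1)[OF i]])
  show "lin A (?Q i) ?L (?a i)"
   by (rule lin_comp[OF lin_comp[OF lin_inv_into[OF Pl[OF i] cP(3,4)[OF i]] lin_incl[OF subP[OF i]]] cL(3)])
  show "lin A ?L (?Q i) (?b i)"
   by (rule lin_comp[OF lin_comp[OF io pr(1)] cP(3)]) (use i in auto)
  show "?b i (?a i x) = x" if x: "x .: (?Q i)" for x
   using ioinv(1)[OF kL[OF i x]] pr(3)[of i "?\<kappa>' i x"] kinv(2,3)[OF i x] i by simp
 next
  fix i j assume i: "i < n" and j: "j < n" and iso: "isomorphic A (?Q i) (?Q j)"
  note Ql = fgD(1)[OF cP(1)]
  have "isomorphic A (?P i) (?P j)"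
   by (rule isomorphic_trans[OF Pl[OF i] isomorphic_trans[OF Pl[OF i] cP(2)[OF i] iso] isomorphic_sym[OF Pl[OF j] Ql[OF j] cP(2)[OF j]]])
  then show "i = j" using P(3)[OF i j] by blast
 next
  fix x assume x: "x .: ?L"
  have pc: "pr i (?\<iota>' x) \<in> P i" if "i < n" for i using lin_cl[OF lin_comp[OF io pr(1)] x, of i] that by simp
  have pL: "pr i (?\<iota>' x) .: L" if "i < n" for i using pc[OF that] subP[OF that] by blast
  have "(\<Oplus>\<^bsub>?L\<^esub>i \<in> {..<n}. ?a i (?b i x)) = (\<Oplus>\<^bsub>?L\<^esub>i \<in> {..<n}. ?\<iota> (pr i (?\<iota>' x)))"
   using pc kinv(1) lin_cl[OF cL(3) pL] by (intro cL.M.finsum_cong') auto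
  also have "... = ?\<iota> (\<Oplus>\<^bsub>L\<^esub>i \<in> {..<n}. pr i (?\<iota>' x))"
   using pc subP by (intro lin_finsum[OF LL.ag cL.ag cL(3), symmetric]) auto
  also have "... = x" using pr(2)[OF lin_cl[OF io x]] ioinv(2)[OF x] by simp
  finally show "(\<Oplus>\<^bsub>?L\<^esub>i \<in> {..<n}. ?a i (?b i x)) = x" .
 qed (rule assms(2))
 then show ?thesis by (rule that)
qed

end

context basic_hereditary_algebra
begin

abbreviation "Lc \<equiv> fg_copy A (regular_module A)"
abbreviation "X r i \<equiv> Tp r (Q i)"
abbreviation "V r \<equiv> Tp r Lc"
abbreviation "be r i \<equiv> Tpm r Lc (Q i) (b i)"
abbreviation "al r i \<equiv> Tpm r (Q i) Lc (a i)"

lemmas Lc = fg_copy[OF fg_module_L]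
lemmas fg_V = fg_Tp[OF Lc(1)]
lemmas Vl = fgD(1)[OF fg_V]
lemmas fg_X = fg_Tp[OF Q(1)]
lemmas Xl = fgD(1)[OF fg_X]

lemma be_lin: "i < n ==> lin A (V r) (X r i) (be r i)" by (rule Tpm_lin[OF Lc(1) Q(1) b])
lemma al_lin: "i < n ==> lin A (X r i) (V r) (al r i)" by (rule Tpm_lin[OF Q(1) Lc(1) a])

lemma al_be_sum:
 assumes v: "v .: (V r)" shows "(\<Oplus>\<^bsub>V r\<^esub>i \<in> {..<n}. al r i (be r i v)) = v"
proof -
 interpret V: left_module A "V r" by (rule Vl)
 have ab': "lin A Lc Lc (%x. a i (b i x))" if "i < n" for i by (rule lin_comp[OF b[OF that] a[OF that]])
 have "(\<Oplus>\<^bsub>V r\<^esub>i \<in> {..<n}. al r i (be r i v)) = (\<Oplus>\<^bsub>V r\<^esub>i \<in> {..<n}. Tpm r Lc Lc (%x. a i (b i x)) v)"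
  using lin_cl[OF Tpm_lin[OF Lc(1) Lc(1) ab'] v]
  by (intro V.M.finsum_cong') (auto simp: Tpm_comp[OF Lc(1) Q(1) Lc(1) b a v])
 also have "... = Tpm r Lc Lc (%x. \<Oplus>\<^bsub>Lc\<^esub>i \<in> {..<n}. a i (b i x)) v"
  by (rule Tpm_finsum[OF Lc(1) Lc(1) _ _ v, symmetric]) (use ab' in auto)
 also have "... = Tpm r Lc Lc (%x. x) v"
  by (rule Tpm_cong[OF Lc(1) Lc(1) lin_id _ v, symmetric]) (simp add: ab)
 also have "... = v" by (rule Tpm_id[OF Lc(1) v])
 finally show ?thesis .
qed

lemma be_zero_imp_zero:
 assumes v: "v .: (V r)" and z: "!!i. i < n ==> be r i v = \<zero>\<^sub>(X r i)"
 shows "v = \<zero>\<^sub>(V r)"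
proof -
 interpret V: left_module A "V r" by (rule Vl)
 have "al r i (be r i v) = \<zero>\<^sub>(V r)" if i: "i < n" for i
  using lin_zero[OF left_module.axioms(2)[OF Xl[OF i]] V.ag al_lin[OF i]] z[OF i] by simp
 then have "(\<Oplus>\<^bsub>V r\<^esub>i \<in> {..<n}. al r i (be r i v)) = (\<Oplus>\<^bsub>V r\<^esub>i \<in> {..<n}. \<zero>\<^sub>(V r))"
  by (intro V.M.finsum_cong') auto
 then show ?thesis using al_be_sum[OF v] by simp
qed

lemma X_indecomposable:
 assumes i: "i < n" shows "el (X r i) ~= {\<zero>\<^sub>(X r i)} ==> indecomposable A (X r i)"
proof (induction r)
 case 0
 then show ?case using Q(2)[OF i] by simp
next
 case (Suc r)
 then have "el (X r i) ~= {\<zero>\<^sub>(X r i)}" using T_zero[OF fg_X[OF i]] by auto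
 then show ?case using T_indecomposable[OF fg_X[OF i] Suc.IH] Suc.prems by simp
qed

lemma T_not_isomorphic_projective:
 assumes Y: "fg_module A Y" and i: "i < n" and iso: "isomorphic A (T Y) (Q i)" shows False
proof -
 interpret Qi: left_module A "Q i" by (rule fgD(1)[OF Q(1)[OF i]])
 interpret Lc: left_module A Lc by (rule fgD(1)[OF Lc(1)])
 interpret LL: left_module A L by (rule lm_L)
 obtain h where h: "lin A (T Y) (Q i) h" "bij_betw h (el (T Y)) (el (Q i))" using iso by (rule isomorphicE)
 let ?\<iota>' = "inv_into (el L) (fg_copy_iso A L)"
 note io = lin_inv_into[OF lm_L Lc(3,4)] and inv = bij_inv[OF Lc(4)]
 have "q = \<zero>\<^sub>(Q i)" if q: "q .: (Q i)" for q
 proof -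
  obtain t where t: "t .: (T Y)" "q = h t" using h(2) q by (auto simp: bij_betw_def)
  have "?\<iota>' (a i (h t)) = \<zero>\<^sub>A"
   by (rule T_hom_regular_zero[OF Y lin_comp[OF lin_comp[OF h(1) a[OF i]] io] t(1)])
  then have "?\<iota>' (a i q) = \<zero>\<^sub>L" using t(2) by simp
  then have "a i q = \<zero>\<^sub>Lc"
   using inv(2)[OF lin_cl[OF a[OF i] q]] lin_zero[OF LL.ag Lc.ag Lc(3)] by simp
  then show ?thesis
   using ba[OF i q] lin_zero[OF Lc.ag Qi.ag b[OF i]] by simp
 qed
 then have "el (Q i) = {\<zero>\<^sub>(Q i)}" using Qi.M.zero_closed by blast
 then show False using Q(2)[OF i] by (simp add: indecomposable_def)
qed

text \<open>Cancel \<open>T\<close> on both sides; a module \<open>T Y\<close> is not isomorphic to any \<open>Q j\<close>, for want of maps to \<open>L\<close>.\<close>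

lemma X_isomorphic_imp_eq:
 assumes i: "i < n" and j: "j < n"
 shows "el (X r i) ~= {\<zero>\<^sub>(X r i)} ==> isomorphic A (X r i) (X s j) ==> r = s & i = j"
proof (induction r arbitrary: s)
 case 0
 show ?case
 proof (cases s)
  case 0
  then show ?thesis using 0 \<open>isomorphic A (X 0 i) (X s j)\<close> Q(3)[OF i j] by simp
 next
  case (Suc s')
  have "isomorphic A (T (X s' j)) (Q i)"
   using isomorphic_sym[OF Xl[OF i, of 0] Xl[OF j, of s]] "0.prems"(2) Suc by simp
  then show ?thesis using T_not_isomorphic_projective[OF fg_X[OF j] i] by blast
 qed
next
 case (Suc r)
 show ?case
 proof (cases s)
  case 0
  then have "isomorphic A (T (X r i)) (Q j)" using Suc.prems(2) by simp
  then show ?thesis using T_not_isomorphic_projective[OF fg_X[OF i] j] by blast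
 next
  case (Suc s')
  have nz: "el (T (X r i)) ~= {\<zero>\<^bsub>T (X r i)\<^esub>}" and iso: "isomorphic A (T (X r i)) (T (X s' j))"
   using Suc.prems Suc by simp_all
  have nz': "el (T (X s' j)) ~= {\<zero>\<^bsub>T (X s' j)\<^esub>}"
   using isomorphic_zero[OF fgD(1)[OF fg_T[OF fg_X[OF i]]] fgD(1)[OF fg_T[OF fg_X[OF j]]] iso] nz by blast
  have z: "el (X r i) ~= {\<zero>\<^sub>(X r i)}" "el (X s' j) ~= {\<zero>\<^sub>(X s' j)}"
   using nz nz' T_zero[OF fg_X[OF i]] T_zero[OF fg_X[OF j]] by auto
  have "isomorphic A (X r i) (X s' j)"
   by (rule T_reflects_iso[OF fg_X[OF i] X_indecomposable[OF i z(1)] fg_X[OF j] X_indecomposable[OF j z(2)] iso nz])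
  then show ?thesis using Suc.IH[OF z(1)] Suc by simp
 qed
qed

text \<open>Finite representation type leaves room for finitely many nonzero \<open>X r i\<close> only.\<close>

lemma V_vanishes: "\<exists>R. \<forall>r \<ge> R. el (V r) = {\<zero>\<^sub>(V r)}"
proof -
 let ?rel = "{(M, N). M \<in> indecomposables A & N \<in> indecomposables A & isomorphic A M N}"
 let ?S = "{(r, i). i < n & el (X r i) ~= {\<zero>\<^sub>(X r i)}}"
 let ?k = "%(r, i). ?rel `` {X r i}"
 have ind: "X r i \<in> indecomposables A" if "(r, i) \<in> ?S" for r i
  using that X_indecomposable fg_X by (simp add: indecomposables_def)
 have inj: "inj_on ?k ?S"
 proof (rule inj_onI, clarify)
  fix r i s j
  assume i: "i < n" "el (X r i) ~= {\<zero>\<^sub>(X r i)}" and j: "j < n" "el (X s j) ~= {\<zero>\<^sub>(X s j)}"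
   and eq: "?rel `` {X r i} = ?rel `` {X s j}"
  have "X s j \<in> ?rel `` {X s j}" using ind[of s j] j isomorphic_refl[OF Xl[OF j(1)]] by simp
  then have "X s j \<in> ?rel `` {X r i}" unfolding eq .
  then have "isomorphic A (X r i) (X s j)" by simp
  then show "r = s & i = j" by (rule X_isomorphic_imp_eq[OF i(1) j(1) i(2)])
 qed
 have "?k p \<in> indecomposables A // ?rel" if p: "p \<in> ?S" for p
 proof -
  obtain r i where ri: "p = (r, i)" by (cases p)
  have "X r i \<in> indecomposables A" by (rule ind) (use p ri in simp)
  then show ?thesis unfolding ri case_prod_conv by (rule quotientI)
 qed
 then have sub: "?k ` ?S <= indecomposables A // ?rel" by (rule image_subsetI)
 have "finite (indecomposables A // ?rel)" using fin_rep by (simp add: rep_finite_def)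
 with inj sub have "finite ?S" by (rule inj_on_finite)
 then have "finite (fst ` ?S)" by (rule finite_imageI)
 then have "\<exists>m. \<forall>r \<in> fst ` ?S. r \<le> m" by (simp only: finite_nat_set_iff_bounded_le)
 then obtain m where "\<forall>r \<in> fst ` ?S. r \<le> m" by (rule exE)
 note m = this[rule_format]
 have "el (V r) = {\<zero>\<^sub>(V r)}" if r: "r \<ge> Suc m" for r
 proof -
  interpret V: left_module A "V r" by (rule Vl)
  have "el (X r i) = {\<zero>\<^sub>(X r i)}" if i: "i < n" for i
  proof (rule ccontr)
   assume "el (X r i) ~= {\<zero>\<^sub>(X r i)}"
   then have "r \<in> fst ` ?S" using i by force
   then show False using m r by fastforce
  qed
  then have "v = \<zero>\<^sub>(V r)" if "v .: (V r)" for v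
   using be_zero_imp_zero[OF that] lin_cl[OF be_lin that] by blast
  then show ?thesis by auto
 qed
 then show ?thesis by blast
qed

end

section \<open>Nondegenerate forms and socles\<close>

text \<open>Otherwise the images of the powers of \<open>f\<close> would form an infinite strictly descending chain.\<close>

lemma injective_endo_surjective:
 assumes F: "field F" and V: "lmod F V" and fg: "fin_gen F V" and f: "lin F V V f" and inj: "inj_on f (el V)"
 shows "f ` el V = el V"
proof (rule ccontr)
 assume ne: "f ` el V ~= el V"
 interpret V: left_module F V by (rule V)
 obtain rk n where rk: "!!U. rk U \<le> (n::nat)"
  "!!U U'. submodule U F V ==> submodule U' F V ==> U \<subset> U' ==> rk U < rk U'"
  by (rule rank_exists[OF F V fg]) (rule that)
 let ?U = "%k. (f ^^ k) ` el V"
 have fl: "lin F V V (f ^^ k)" for k by (induction k) (auto simp: lin_def f lin_cl[OF f] lin_add[OF f] lin_smult[OF f])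
 have U: "submodule (?U k) F V" for k by (rule submodule_image[OF V V fl submodule_carrier[OF V]])
 have cl: "(f ^^ k) x .: V" if "x .: V" for k x by (rule lin_cl[OF fl that])
 have strict: "?U (Suc k) \<subset> ?U k" for k
 proof (induction k)
  case 0
  show ?case using ne lin_cl[OF f] by auto
 next
  case (Suc k)
  have eq: "?U (Suc j) = f ` ?U j" for j by (auto simp: image_image)
  have sub: "?U j <= el V" for j using cl by blast
  have "f ` ?U (Suc k) \<subset> f ` ?U k"
   using Suc inj_on_image_eq_iff[OF inj sub[of "Suc k"] sub[of k]] by blast
  then show ?case unfolding eq[of "Suc k"] eq[of k, symmetric] .
 qed
 have "rk (?U k) + k \<le> rk (?U 0)" for k
 proof (induction k)
  case (Suc k)
  show ?case using rk(2)[OF U U strict[of k]] Suc by linarith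
 qed simp
 from this[of "Suc (rk (?U 0))"] show False by linarith
qed

text \<open>By the basis \<open>b\<close>, the map \<open>x \<mapsto> (B x b\<^sub>i)\<^sub>i\<close> becomes an injective endomorphism of \<open>V\<close>, hence a surjective one.\<close>

lemma nondegenerate_form_represents:
 assumes F: "field F" and V: "lmod F V" and fg: "fin_gen F V"
  and B1: "!!y. y .: V ==> lin F V (regular_module F) (%x. B x y)"
  and B2: "!!x. x .: V ==> lin F V (regular_module F) (B x)"
  and nd: "!!x. x .: V ==> (!!y. y .: V ==> B x y = \<zero>\<^sub>F) ==> x = \<zero>\<^sub>V"
  and l: "lin F V (regular_module F) l"
 shows "\<exists>x \<in> el V. \<forall>y \<in> el V. B x y = l y"
proof -
 interpret F: field F by (rule F)
 interpret V: left_module F V by (rule V)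
 let ?F = "regular_module F"
 interpret RF: left_module F ?F by (rule lm_regular[OF F.ring_axioms])
 obtain n b ps where b: "b \<in> {..<n::nat} -> el V"
  and psi: "!!i. i < n ==> lin F V ?F (ps i)"
  and ex: "!!v. v .: V ==> (\<Oplus>\<^bsub>V\<^esub>i \<in> {..<n}. ps i v \<odot>\<^sub>V b i) = v"
  and dual: "!!i j. i < n ==> j < n ==> ps i (b j) = (if i = j then \<one>\<^sub>F else \<zero>\<^sub>F)"
  by (rule coordinates_exist[OF F V fg]) (rule that)
 have bV: "b i .: V" if "i < n" for i using b that by auto
 have coord: "ps j (\<Oplus>\<^bsub>V\<^esub>i \<in> {..<n}. c i \<odot>\<^sub>V b i) = c j" if c: "!!i. i < n ==> c i .: F" and j: "j < n" for c j
 proof -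
  have "ps j (\<Oplus>\<^bsub>V\<^esub>i \<in> {..<n}. c i \<odot>\<^sub>V b i) = (\<Oplus>\<^bsub>?F\<^esub>i \<in> {..<n}. ps j (c i \<odot>\<^sub>V b i))"
   using c bV by (intro lin_finsum[OF V.ag RF.ag psi[OF j]]) auto
  also have "... = (\<Oplus>\<^bsub>?F\<^esub>i \<in> {..<n}. if j = i then c i else \<zero>\<^sub>?F)"
   using c bV j by (intro RF.M.finsum_cong') (auto simp: lin_smult[OF psi[OF j]] dual)
  also have "... = c j" by (rule RF.M.finsum_singleton) (use c j in auto)
  finally show ?thesis .
 qed
 have value_at: "h v = (\<Oplus>\<^bsub>?F\<^esub>i \<in> {..<n}. ps i v \<otimes>\<^sub>F h (b i))" if h: "lin F V ?F h" and v: "v .: V" for h v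
 proof -
  have pc: "ps i v .: F" if "i < n" for i using lin_cl[OF psi[OF that] v] by simp
  have "h v = h (\<Oplus>\<^bsub>V\<^esub>i \<in> {..<n}. ps i v \<odot>\<^sub>V b i)" by (simp add: ex[OF v])
  also have "... = (\<Oplus>\<^bsub>?F\<^esub>i \<in> {..<n}. h (ps i v \<odot>\<^sub>V b i))"
   using pc bV by (intro lin_finsum[OF V.ag RF.ag h]) auto
  also have "... = (\<Oplus>\<^bsub>?F\<^esub>i \<in> {..<n}. ps i v \<otimes>\<^sub>F h (b i))"
   using pc bV lin_cl[OF h] by (intro RF.M.finsum_cong') (auto simp: lin_smult[OF h])
  finally show ?thesis .
 qed
 define f where "f x = (\<Oplus>\<^bsub>V\<^esub>i \<in> {..<n}. B x (b i) \<odot>\<^sub>V b i)" for x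
 have Bc: "B x y .: F" if "x .: V" "y .: V" for x y using lin_cl[OF B2[OF that(1)] that(2)] by simp
 have fl: "lin F V V f"
  unfolding f_def
 proof (rule lin_finsum_pt[OF V V])
  fix i assume "i \<in> {..<n}"
  then have i: "i < n" by simp
  show "lin F V V (%x. B x (b i) \<odot>\<^sub>V b i)"
   by (rule linI)
    (use bV[OF i] Bc lin_add[OF B1[OF bV[OF i]]] lin_smult[OF B1[OF bV[OF i]]] in
     \<open>auto simp: V.smult_l_distr V.smult_assoc1\<close>)
 qed simp
 have "inj_on f (el V)"
  unfolding lin_inj_iff[OF V.ag V.ag fl]
 proof (intro ballI impI)
  fix x assume x: "x .: V" and z: "f x = \<zero>\<^sub>V"
  have "B x (b j) = \<zero>\<^sub>?F" if j: "j < n" for j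
   using coord[of "%i. B x (b i)", OF _ j] Bc[OF x bV] z lin_zero[OF V.ag RF.ag psi[OF j]]
   by (simp add: f_def)
  then have "B x y = (\<Oplus>\<^bsub>?F\<^esub>i \<in> {..<n}. \<zero>\<^sub>?F)" if y: "y .: V" for y
   unfolding value_at[OF B2[OF x] y]
   using lin_cl[OF psi y] by (intro RF.M.finsum_cong') auto
  then have "B x y = \<zero>\<^sub>F" if "y .: V" for y
   using that RF.M.finsum_zero[of "{..<n}"] by simp
  then show "x = \<zero>\<^sub>V" by (rule nd[OF x])
 qed
 then have surj: "f ` el V = el V" by (rule injective_endo_surjective[OF F V fg fl])
 have lb: "l (b i) .: F" if "i < n" for i using lin_cl[OF l bV[OF that]] by simp
 have "(\<Oplus>\<^bsub>V\<^esub>i \<in> {..<n}. l (b i) \<odot>\<^sub>V b i) \<in> f ` el V"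
  unfolding surj using lb bV by (intro V.M.finsum_closed) auto
 then obtain x where x: "x .: V" "f x = (\<Oplus>\<^bsub>V\<^esub>i \<in> {..<n}. l (b i) \<odot>\<^sub>V b i)" by auto
 have "B x (b j) = l (b j)" if j: "j < n" for j
  using coord[of "%i. B x (b i)", OF _ j] coord[of "%i. l (b i)", OF _ j] Bc[OF x(1) bV] lb x(2) by (simp add: f_def)
 then have "B x y = l y" if y: "y .: V" for y
  unfolding value_at[OF B2[OF x(1)] y] value_at[OF l y]
  using lin_cl[OF psi y] lb by (intro RF.M.finsum_cong') auto
 then show ?thesis using x(1) by blast
qed

lemma functionals_separate:
 assumes F: "field F" and V: "lmod F V" and fg: "fin_gen F V" and v: "v .: V"
  and z: "!!l. lin F V (regular_module F) l ==> l v = \<zero>\<^sub>F"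
 shows "v = \<zero>\<^sub>V"
proof -
 interpret V: left_module F V by (rule V)
 obtain n b ps where b: "b \<in> {..<n::nat} -> el V"
  and psi: "!!i. i < n ==> lin F V (regular_module F) (ps i)"
  and ex: "!!v. v .: V ==> (\<Oplus>\<^bsub>V\<^esub>i \<in> {..<n}. ps i v \<odot>\<^sub>V b i) = v"
  and "!!i j. i < n ==> j < n ==> ps i (b j) = (if i = j then \<one>\<^sub>F else \<zero>\<^sub>F)"
  by (rule coordinates_exist[OF F V fg]) (rule that)
 have "(\<Oplus>\<^bsub>V\<^esub>i \<in> {..<n}. ps i v \<odot>\<^sub>V b i) = (\<Oplus>\<^bsub>V\<^esub>i \<in> {..<n}. \<zero>\<^sub>V)"
  using b z[OF psi] V.smult_l_null[of "b _"] by (intro V.M.finsum_cong') (auto simp: Pi_def)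
 then show ?thesis using ex[OF v] by simp
qed

context fin_dim_algebra
begin

lemma cyclic_extend:
 fixes X :: "('a, 'x, 'k) ms" and Y :: "('a, 'y, 'l) ms"
 assumes X: "fg_module A X" and Y: "lmod A Y" "injmod A Y" and x: "x .: X" and y: "y .: Y"
  and ann: "!!c. c .: A ==> c \<odot>\<^sub>X x = \<zero>\<^sub>X ==> c \<odot>\<^sub>Y y = \<zero>\<^sub>Y"
 shows "\<exists>f. lin A X Y f & f x = y"
proof -
 note Xl = fgD(1)[OF X]
 interpret X: left_module A X by (rule Xl)
 interpret Y: left_module A Y by (rule Y(1))
 let ?U = "act X x ` el L"
 have U: "submodule ?U A X"
  by (rule submodule_image[OF lm_L Xl act_lin[OF Xl x] submodule_carrier[OF lm_L]])
 let ?X = "X .| ?U"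
 note Ul = submodule_left_module[OF Xl U]
 have q: "lin A L ?X (act X x)" by (rule lin_corestrict[OF act_lin[OF Xl x]]) simp
 have "\<exists>g. lin A ?X Y g & (\<forall>c \<in> el L. g (act X x c) = act Y y c)"
  by (rule lin_factor[OF lm_L Ul Y(1) q _ act_lin[OF Y(1) y]]) (use ann in "auto simp: act_def")
 then obtain g where g: "lin A ?X Y g" "!!c. c .: A ==> g (c \<odot>\<^sub>X x) = c \<odot>\<^sub>Y y"
  by (auto simp: act_def)
 from injmod_extend[OF Y(2,1) X U g(1)]
 obtain f where f: "lin A X Y f" "!!x. x \<in> ?U ==> f x = g x" by blast
 have one: "\<one>\<^sub>A .: A" by simp
 have "\<one>\<^sub>A \<odot>\<^sub>X x \<in> ?U" by (rule image_eqI[of _ _ "\<one>\<^sub>A"]) (simp_all add: act_def)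
 then have "f x = g x" using f(2) X.smult_one[OF x] by simp
 then show ?thesis using f(1) g(2)[OF one] X.smult_one[OF x] Y.smult_one[OF y] by auto
qed

text \<open>The assumption gives an isomorphism between the cyclic submodules generated by \<open>x\<close> and \<open>y\<close>; extend it and its inverse.\<close>

lemma injective_isomorphic_of_cyclic:
 fixes X :: "('a, 'x, 'k) ms" and Y :: "('a, 'y, 'l) ms"
 assumes X: "fg_module A X" "indecomposable A X" "injmod A X" and Y: "fg_module A Y" "indecomposable A Y" "injmod A Y"
  and x: "x .: X" "x ~= \<zero>\<^sub>X" and y: "y .: Y"
  and ann: "!!c. c .: A ==> c \<odot>\<^sub>X x = \<zero>\<^sub>X <-> c \<odot>\<^sub>Y y = \<zero>\<^sub>Y"
 shows "isomorphic A X Y"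
proof -
 note Xl = fgD(1)[OF X(1)] and Yl = fgD(1)[OF Y(1)]
 obtain f where f: "lin A X Y f" "f x = y" using cyclic_extend[OF X(1) Yl Y(3) x(1) y] ann by blast
 obtain g where g: "lin A Y X g" "g y = x" using cyclic_extend[OF Y(1) Xl X(3) y x(1)] ann by blast
 have "bij_betw f (el X) (el Y)"
 proof (rule round_trip_iso[OF X(1,2) Y(1,2) f(1) g(1)])
  fix n
  show "\<exists>x \<in> el X. ((%x. g (f x)) ^^ n) x ~= \<zero>\<^sub>X"
   by (rule bexI[of _ x]) (use funpow_fixed[of "%x. g (f x)" x n] f(2) g(2) x in simp_all)
 qed
 then show ?thesis by (rule isomorphicI[OF Xl f(1)])
qed

text \<open>A minimal nonzero submodule \<open>S\<close> is contained in every nonzero submodule by uniformity; take a functional that is not zero on \<open>S\<close>.\<close>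

lemma socle_functional:
 fixes X :: "('a, 'x, 'k) ms"
 assumes X: "fg_module A X" "indecomposable A X" "injmod A X"
 shows "\<exists>ph. lin F (rs A X) (regular_module F) ph &
  (\<forall>U. submodule U A X --> (\<exists>u \<in> U. u ~= \<zero>\<^sub>X) --> (\<exists>u \<in> U. ph u ~= \<zero>\<^sub>F))"
proof -
 note Xl = fgD(1)[OF X(1)]
 interpret X: left_module A X by (rule Xl)
 obtain rk :: "'x set => nat" and n where rk: "!!U. rk U \<le> n"
  "!!U U'. submodule U A X ==> submodule U' A X ==> U \<subset> U' ==> rk U < rk U'"
  by (rule module_rank_exists[OF X(1)]) (rule that)
 let ?nz = "%U. submodule U A X & (\<exists>u \<in> U. u ~= \<zero>\<^sub>X)"
 have "?nz (el X)" using X(2) submodule_carrier[OF Xl] X.M.zero_closed by (auto simp: indecomposable_def)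
 then obtain S where S: "?nz S" "!!U. ?nz U ==> rk S \<le> rk U"
  using ex_has_least_nat[of ?nz "el X" rk] by blast
 obtain s where s: "s \<in> S" "s ~= \<zero>\<^sub>X" using S(1) by blast
 have sX: "s .: X" using S(1) s(1) submod_sub by blast
 let ?X = "rs A X"
 have "\<exists>ph. lin F ?X (regular_module F) ph & ph s ~= \<zero>\<^sub>F"
  using functionals_separate[OF fieldF lm_rs[OF Xl] fin_gen_rs[OF X(1)], of s] sX s(2)
  by (auto simp: rs_def)
 then obtain ph where phi: "lin F ?X (regular_module F) ph" "ph s ~= \<zero>\<^sub>F" by blast
 have "\<exists>u \<in> U. ph u ~= \<zero>\<^sub>F" if U: "submodule U A X" "u \<in> U" "u ~= \<zero>\<^sub>X" for U u
 proof -
  have S1: "submodule S A X" using S(1) by blast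
  have I: "submodule (U \<inter> S) A X" by (rule submodule_Int[OF Xl U(1) S1])
  moreover have "\<exists>w \<in> U \<inter> S. w ~= \<zero>\<^sub>X" by (rule injective_uniform[OF X U S1 s])
  ultimately have "rk S \<le> rk (U \<inter> S)" using S(2) by blast
  then have "U \<inter> S = S" using rk(2)[OF I S1] by (metis Int_lower2 leD psubsetI)
  then show ?thesis using s(1) phi(2) by blast
 qed
 then show ?thesis using phi(1) by blast
qed

end

section \<open>The preprojective algebra\<close>

context basic_hereditary_algebra
begin

abbreviation "PA \<equiv> preprojective_algebra F A"
abbreviation "sc c \<equiv> c \<odot>\<^sub>A \<one>\<^sub>A"

text \<open>The copy of the unit: \<open>Lc\<close> is free on \<open>u\<close>, so homomorphisms out of it are given by their value at \<open>u\<close>.\<close>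

definition u :: "(nat => 'a) set"
 where "u = fg_copy_iso A (regular_module A) \<one>\<^sub>A"

text \<open>Degrees from \<open>R\<close> on vanish.\<close>

definition R :: nat
 where "R = (SOME R. \<forall>r \<ge> R. el (V r) = {\<zero>\<^sub>(V r)})"

lemma V_zero: "r \<ge> R ==> v .: (V r) ==> v = \<zero>\<^sub>(V r)"
 using someI_ex[OF V_vanishes] unfolding R_def by blast

lemma V_shift: "s \<le> m ==> Tp s (V (m - s)) = V m"
 by (simp add: Tp_Tp)

lemma u_closed: "u .: Lc"
 unfolding u_def by (rule lin_cl[OF Lc(3)]) simp

lemma Lc_expand: 
 assumes "x .: Lc"
 shows "\<exists>c \<in> el A. x = c \<odot>\<^sub>Lc u"
proof -
 let ?c = "inv_into (el L) (fg_copy_iso A L) x"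
 note inv = bij_inv[OF Lc(4)]
 have c: "?c .: L" by (rule inv(3)[OF assms])
 have "x = fg_copy_iso A L (?c \<odot>\<^sub>L \<one>\<^sub>A)" using inv(2)[OF assms] c by (simp add: monoid.r_one[OF monoidA])
 also have "... = ?c \<odot>\<^sub>Lc u" unfolding u_def by (rule lin_smult[OF Lc(3)]) (use c in simp_all)
 finally show ?thesis using c by auto
qed

lemma hom_from_Lc_exists:
 assumes M: "lmod A M" and v: "v .: M"
 shows "\<exists>h. lin A Lc M h & h u = v"
proof -
 interpret M: left_module A M by (rule M)
 note io = lin_inv_into[OF lm_L Lc(3,4)]
 have "lin A Lc M (%x. act M v (inv_into (el L) (fg_copy_iso A L) x))"
  by (rule lin_comp[OF io act_lin[OF M v]])
 moreover have "inv_into (el L) (fg_copy_iso A L) u = \<one>\<^sub>A"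
  unfolding u_def by (rule bij_inv(1)[OF Lc(4)]) simp
 ultimately show ?thesis using M.smult_one[OF v] by (auto simp: act_def)
qed

lemma hom_from_Lc_eq:
 assumes "lin A Lc M f" "lin A Lc M g" "f u = g u" "x .: Lc"
 shows "f x = g x"
proof -
 obtain c where c: "c .: A" "x = c \<odot>\<^sub>Lc u" using Lc_expand[OF assms(4)] by blast
 show ?thesis unfolding c(2) lin_smult[OF assms(1) c(1) u_closed] lin_smult[OF assms(2) c(1) u_closed] assms(3) ..
qed

lemma PA_zero: "\<zero>\<^sub>PA r = (\<lambda>x \<in> el Lc. \<zero>\<^sub>(V r))"
 by (simp add: preprojective_algebra_def Let_def hom_group_def)

text \<open>Finiteness of the support is automatic, as all large degrees vanish.\<close>

lemma PA_mem: "p .: PA <-> (\<forall>r. p r \<in> mod_hom A Lc (V r))"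
proof
 assume h: "\<forall>r. p r \<in> mod_hom A Lc (V r)"
 have "p r = (\<lambda>x \<in> el Lc. \<zero>\<^sub>(V r))" if r: "r \<ge> R" for r
 proof (rule extensionalityI)
  show "p r \<in> extensional (el Lc)" using h by (simp add: mod_hom_iff)
  fix x assume x: "x .: Lc"
  then show "p r x = (\<lambda>x \<in> el Lc. \<zero>\<^sub>(V r)) x"
   using V_zero[OF r lin_cl[OF mod_hom_lin[OF h[rule_format]] x]] by simp
 qed simp
 then have "{r. p r ~= (\<lambda>x \<in> el Lc. \<zero>\<^sub>(V r))} <= {..<R}" using not_less by blast
 then have "finite {r. p r ~= (\<lambda>x \<in> el Lc. \<zero>\<^sub>(V r))}" by (rule finite_subset) simp
 then show "p .: PA" using h by (simp add: preprojective_algebra_def Let_def hom_group_def)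
qed (simp add: preprojective_algebra_def Let_def hom_group_def)

lemma PA_lin: "p .: PA ==> lin A Lc (V r) (p r)"
 by (rule mod_hom_lin) (simp add: PA_mem)

lemma PA_closed: "p .: PA ==> x .: Lc ==> p r x .: (V r)"
 by (rule lin_cl[OF PA_lin])

lemma PA_memI: "(!!r. lin A Lc (V r) (p r)) ==> (%r. \<lambda>x \<in> el Lc. p r x) .: PA"
 unfolding PA_mem using restrict_mod_hom[OF fgD(1)[OF Lc(1)]] by blast

lemma PA_eqI:
 assumes "p .: PA" "q .: PA" "!!r. p r u = q r u" shows "p = q"
proof
 fix r
 show "p r = q r"
 proof (rule extensionalityI)
  show "p r \<in> extensional (el Lc)" "q r \<in> extensional (el Lc)"
   using assms(1,2) by (simp_all add: PA_mem mod_hom_iff)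
  show "p r x = q r x" if "x .: Lc" for x
   by (rule hom_from_Lc_eq[OF PA_lin[OF assms(1)] PA_lin[OF assms(2)] assms(3) that])
 qed
qed

lemma PA_add: "p \<oplus>\<^sub>PA q = (%r. \<lambda>x \<in> el Lc. p r x \<oplus>\<^sub>(V r) q r x)"
 by (simp add: preprojective_algebra_def Let_def hom_group_def)

lemma PA_smult: "c \<odot>\<^sub>PA p = (%r. \<lambda>x \<in> el Lc. sc c \<odot>\<^sub>(V r) p r x)"
 by (simp add: preprojective_algebra_def Let_def)

lemma PA_mult: "g \<otimes>\<^sub>PA f = (%m. \<lambda>x \<in> el Lc.
  \<Oplus>\<^bsub>V m\<^esub>r \<in> {..m}. Tpm r Lc (V (m - r)) (g (m - r)) (f r x))"
 by (simp add: preprojective_algebra_def Let_def)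

lemma PA_zero_closed: "\<zero>\<^sub>PA .: PA"
proof -
 have "\<zero>\<^sub>PA = (%r. \<lambda>x \<in> el Lc. \<zero>\<^sub>(V r))" by (rule ext) (rule PA_zero)
 then show ?thesis using PA_memI[OF lin_zero_pt[OF Vl]] by simp
qed

lemma PA_add_closed: "p .: PA ==> q .: PA ==> p \<oplus>\<^sub>PA q .: PA"
 unfolding PA_add by (rule PA_memI) (rule lin_add_pt[OF Vl PA_lin PA_lin])

lemma PA_smult_closed: "c .: F ==> p .: PA ==> c \<odot>\<^sub>PA p .: PA"
 unfolding PA_smult by (rule PA_memI) (rule lin_comp[OF PA_lin lin_scalar[OF Vl]])

lemma PA_val:
 "(p \<oplus>\<^sub>PA q) r u = p r u \<oplus>\<^sub>(V r) q r u" "\<zero>\<^sub>PA r u = \<zero>\<^sub>(V r)" "(c \<odot>\<^sub>PA p) r u = sc c \<odot>\<^sub>(V r) p r u"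
 by (simp_all add: PA_add PA_zero PA_smult u_closed)

lemma PA_val_cl: "p .: PA ==> p r u .: (V r)"
 by (rule PA_closed[OF _ u_closed])

lemma lm_PA: "lmod F PA"
proof (rule left_moduleI[OF ringF])
 interpret V: left_module A "V r" for r by (rule Vl)
 note cl = PA_val_cl PA_add_closed PA_zero_closed PA_smult_closed
 show "abelian_group PA"
 proof (rule abelian_groupI)
  fix x assume x: "x .: PA"
  let ?y = "%r. \<lambda>z \<in> el Lc. \<ominus>\<^sub>(V r) x r z"
  have y: "?y .: PA" by (rule PA_memI) (rule lin_minus_pt[OF Vl PA_lin[OF x]])
  have "?y \<oplus>\<^sub>PA x = \<zero>\<^sub>PA"
   by (rule PA_eqI[OF cl(2)[OF y x] cl(3)]) (simp add: PA_val u_closed V.M.l_neg cl(1)[OF x])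
  then show "\<exists>y \<in> el PA. y \<oplus>\<^sub>PA x = \<zero>\<^sub>PA" using y by blast
 next
  fix x y z assume "x .: PA" "y .: PA" "z .: PA"
  then show "x \<oplus>\<^sub>PA y \<oplus>\<^sub>PA z = x \<oplus>\<^sub>PA (y \<oplus>\<^sub>PA z)"
   by (intro PA_eqI cl(2)) (simp_all add: PA_val V.M.a_assoc cl(1))
 next
  fix x y assume "x .: PA" "y .: PA"
  then show "x \<oplus>\<^sub>PA y = y \<oplus>\<^sub>PA x"
   by (intro PA_eqI cl(2)) (simp_all add: PA_val V.M.a_comm cl(1))
 next
  fix x assume "x .: PA"
  then show "\<zero>\<^sub>PA \<oplus>\<^sub>PA x = x"
   by (intro PA_eqI cl(2) cl(3)) (simp_all add: PA_val cl(1))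
 qed (rule cl; assumption)+
 note A_ops = monoid.m_closed[OF monoidA]
 show "c \<odot>\<^sub>PA p .: PA" if "c .: F" "p .: PA" for c p using that by (rule cl(4))
 show "c \<odot>\<^sub>PA (p \<oplus>\<^sub>PA q) = c \<odot>\<^sub>PA p \<oplus>\<^sub>PA c \<odot>\<^sub>PA q" if "c .: F" "p .: PA" "q .: PA" for c p q
  using that scalar_closed[OF that(1)] by (intro PA_eqI cl) (simp_all add: PA_val V.smult_r_distr cl(1))
 show "(c \<oplus>\<^sub>F d) \<odot>\<^sub>PA p = c \<odot>\<^sub>PA p \<oplus>\<^sub>PA d \<odot>\<^sub>PA p" if c: "c .: F" "d .: F" and p: "p .: PA" for c d p
 proof (rule PA_eqI)
  have "sc (c \<oplus>\<^sub>F d) = sc c \<oplus>\<^sub>A sc d" using c by (simp add: smult_l_distr)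
  then show "((c \<oplus>\<^sub>F d) \<odot>\<^sub>PA p) r u = (c \<odot>\<^sub>PA p \<oplus>\<^sub>PA d \<odot>\<^sub>PA p) r u" for r
   unfolding PA_val using V.smult_l_distr[OF scalar_closed[OF c(1)] scalar_closed[OF c(2)] cl(1)[OF p]] by simp
 qed (use c p cl abelian_monoid.a_closed[OF abelian_group.axioms(1)[OF abelianF]] in auto)
 show "(c \<otimes>\<^sub>F d) \<odot>\<^sub>PA p = c \<odot>\<^sub>PA (d \<odot>\<^sub>PA p)" if c: "c .: F" "d .: F" and p: "p .: PA" for c d p
 proof (rule PA_eqI)
  have "sc (c \<otimes>\<^sub>F d) = sc c \<otimes>\<^sub>A sc d" using c scalar_mult[OF c(1) scalar_closed[OF c(2)]] by (simp add: smult_assoc1)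
  then show "((c \<otimes>\<^sub>F d) \<odot>\<^sub>PA p) r u = (c \<odot>\<^sub>PA (d \<odot>\<^sub>PA p)) r u" for r
   unfolding PA_val using V.smult_assoc1[OF scalar_closed[OF c(1)] scalar_closed[OF c(2)] cl(1)[OF p]] by simp
 qed (use c p cl monoid.m_closed[OF ring.is_monoid[OF ringF]] in auto)
 show "\<one>\<^sub>F \<odot>\<^sub>PA p = p" if p: "p .: PA" for p
 proof (rule PA_eqI)
  have "sc \<one>\<^sub>F = \<one>\<^sub>A" by simp
  then show "(\<one>\<^sub>F \<odot>\<^sub>PA p) r u = p r u" for r
   unfolding PA_val using V.smult_one[OF cl(1)[OF p]] by simp
 qed (use p cl monoid.one_closed[OF ring.is_monoid[OF ringF]] in auto)
qed

lemma PA_val_lin: "lin F PA (rs A (V r)) (%p. p r u)"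
 by (rule linI) (simp_all add: PA_val PA_val_cl rs_def)

text \<open>The element of degree \<open>k\<close> with value \<open>v\<close> at \<open>u\<close>.\<close>

definition homog :: "nat => (nat => 'a) set => nat => (nat => 'a) set => (nat => 'a) set"
 where "homog k v = (%r. if r = k then (\<lambda>x \<in> el Lc. (SOME h. lin A Lc (V k) h & h u = v) x)
  else (\<lambda>x \<in> el Lc. \<zero>\<^sub>(V r)))"

lemma homog:
 assumes "v .: (V k)"
 shows "homog k v .: PA" "homog k v r u = (if r = k then v else \<zero>\<^sub>(V r))"
proof -
 let ?h = "SOME h. lin A Lc (V k) h & h u = v"
 have h: "lin A Lc (V k) ?h & ?h u = v" by (rule someI_ex[OF hom_from_Lc_exists[OF Vl assms]])
 have "homog k v = (%r. \<lambda>x \<in> el Lc. (if r = k then ?h else (%x. \<zero>\<^sub>(V r))) x)"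
  by (auto simp: homog_def fun_eq_iff)
 moreover have "lin A Lc (V r) (if r = k then ?h else (%x. \<zero>\<^sub>(V r)))" for r
  by (cases "r = k") (simp_all add: h lin_zero_pt[OF Vl])
 ultimately show "homog k v .: PA" using PA_memI[of "%r. if r = k then ?h else (%x. \<zero>\<^sub>(V r))"] by simp
 show "homog k v r u = (if r = k then v else \<zero>\<^sub>(V r))" using h by (simp add: homog_def u_closed)
qed

lemma homog_lin: "lin F (rs A (V k)) PA (homog k)"
proof (rule linI)
 interpret V: left_module A "V r" for r by (rule Vl)
 fix v assume "v .: (rs A (V k))"
 then have v: "v .: (V k)" by (simp add: rs_def)
 show "homog k v .: PA" by (rule homog(1)[OF v])
 show "homog k (v \<oplus>\<^bsub>rs A (V k)\<^esub> w) = homog k v \<oplus>\<^sub>PA homog k w" if "w .: (rs A (V k))" for w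
 proof -
  have w: "w .: (V k)" using that by (simp add: rs_def)
  have "homog k (v \<oplus>\<^sub>(V k) w) = homog k v \<oplus>\<^sub>PA homog k w"
   by (rule PA_eqI) (simp_all add: PA_val homog PA_add_closed v w)
  then show ?thesis by (simp add: rs_def)
 qed
 show "homog k (c \<odot>\<^bsub>rs A (V k)\<^esub> v) = c \<odot>\<^sub>PA homog k v" if c: "c .: F" for c
 proof -
  have "homog k (sc c \<odot>\<^sub>(V k) v) = c \<odot>\<^sub>PA homog k v"
   using scalar_closed[OF c] by (intro PA_eqI) (simp_all add: PA_val homog PA_smult_closed v c)
  then show ?thesis by (simp add: rs_def)
 qed
qed

lemma fin_gen_PA: "fin_gen F PA"
proof -
 interpret V: left_module A "V r" for r by (rule Vl)
 let ?rs = "%r. rs A (V r)"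
 have rsc: "el (?rs r) = el (V r)" for r by (simp add: rs_def)
 have "\<forall>r. \<exists>G. finite G & G <= el (?rs r) & gen_submodule F (?rs r) G = el (?rs r)"
  using fin_gen_rs[OF fg_V] by (simp add: fin_gen_def)
 then obtain G where G: "!!r. finite (G r)" "!!r. G r <= el (?rs r)" "!!r. gen_submodule F (?rs r) (G r) = el (?rs r)"
  by metis
 let ?S = "\<Union>r \<in> {..<R}. homog r ` G r"
 have S: "?S <= el PA" using G(2) homog(1) rsc by blast
 let ?W = "gen_submodule F PA ?S"
 note W = gen_submod[OF lm_PA S]
 have hW: "homog r v \<in> ?W" if r: "r < R" and v: "v .: (V r)" for r v
 proof -
  have "gen_submodule F (?rs r) (G r) <= {v \<in> el (?rs r). homog r v \<in> ?W}"
  proof (rule gen_submod(3)[OF lm_rs[OF Vl] G(2)])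
   show "submodule {v \<in> el (?rs r). homog r v \<in> ?W} F (?rs r)"
    by (rule submodule_vimage[OF lm_rs[OF Vl] lm_PA homog_lin W(1)])
   show "G r <= {v \<in> el (?rs r). homog r v \<in> ?W}" using G(2) W(2) r by blast
  qed
  then show ?thesis using v G(3) rsc by auto
 qed
 have "p \<in> ?W" if p: "p .: PA" for p
 proof -
  define q where "q k = (%r. if r < k then p r else (\<lambda>x \<in> el Lc. \<zero>\<^sub>(V r)))" for k
  have qc: "q k .: PA" for k
   using p PA_zero_closed by (simp add: q_def PA_mem PA_zero)
  have "q k \<in> ?W" if "k \<le> R" for k
   using that
  proof (induction k)
   case 0
   have "q 0 = \<zero>\<^sub>PA" by (simp add: q_def PA_zero fun_eq_iff)
   then show ?case using submodule_zero[OF W(1)] by simp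
  next
   case (Suc k)
   note v = PA_val_cl[OF p, of k]
   have "q (Suc k) = q k \<oplus>\<^sub>PA homog k (p k u)"
    by (rule PA_eqI[OF qc PA_add_closed[OF qc homog(1)[OF v]]])
     (simp add: PA_val homog(2)[OF v] q_def u_closed PA_val_cl[OF p])
   then show ?case using submodule_add[OF W(1) Suc.IH hW[OF _ v]] Suc.prems by simp
  qed
  then have "q R \<in> ?W" by simp
  moreover have "q R = p"
  proof (rule PA_eqI[OF qc p])
   fix r show "q R r u = p r u"
    using V_zero[OF _ PA_val_cl[OF p], of r] by (cases "r < R") (simp_all add: q_def u_closed)
  qed
  ultimately show ?thesis by simp
 qed
 then have "?W = el PA" using submod_sub[OF W(1)] by blast
 then show ?thesis unfolding fin_gen_def using S G(1) by (intro exI[of _ ?S]) auto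
qed

abbreviation "S r s g \<equiv> Tpm r Lc (V s) (g s)"

lemma S_lin: "g .: PA ==> lin A (V r) (V (r + s)) (S r s g)"
 using Tpm_lin[OF Lc(1) fg_V PA_lin, of g r s] by (simp add: Tp_Tp)

lemma S_lin': "g .: PA ==> r \<le> m ==> lin A (V r) (V m) (S r (m - r) g)"
 using S_lin[of g r "m - r"] by simp

lemma S_add:
 assumes g: "g .: PA" "h .: PA" and v: "v .: (V r)"
 shows "S r s (g \<oplus>\<^sub>PA h) v = S r s g v \<oplus>\<^bsub>V (r + s)\<^esub> S r s h v"
proof -
 interpret V: left_module A "V k" for k by (rule Vl)
 let ?f = "%i. if i = (0::nat) then g s else h s"
 have f: "lin A Lc (V s) (?f i)" for i using PA_lin g by simp
 have eq: "(\<Oplus>\<^bsub>V s\<^esub>i \<in> {0, 1}. ?f i x) = (g \<oplus>\<^sub>PA h) s x" if "x .: Lc" for x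
  using that PA_closed[OF g(1) that] PA_closed[OF g(2) that] by (simp add: PA_add)
 have "S r s (g \<oplus>\<^sub>PA h) v = Tpm r Lc (V s) (%x. \<Oplus>\<^bsub>V s\<^esub>i \<in> {0, 1}. ?f i x) v"
  by (rule Tpm_cong[OF Lc(1) fg_V PA_lin[OF PA_add_closed[OF g]] eq[symmetric] v])
 also have "... = (\<Oplus>\<^bsub>Tp r (V s)\<^esub>i \<in> {0, 1}. Tpm r Lc (V s) (?f i) v)"
  by (rule Tpm_finsum[OF Lc(1) fg_V _ f v]) simp
 also have "... = S r s g v \<oplus>\<^bsub>V (r + s)\<^esub> S r s h v"
  using lin_cl[OF S_lin[OF g(1)] v] lin_cl[OF S_lin[OF g(2)] v] by (simp add: Tp_Tp)
 finally show ?thesis .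
qed

lemma S_scalar:
 assumes g: "g .: PA" and c: "c .: F" and v: "v .: (V r)"
 shows "S r s (c \<odot>\<^sub>PA g) v = sc c \<odot>\<^bsub>V (r + s)\<^esub> S r s g v"
proof -
 have "S r s (c \<odot>\<^sub>PA g) v = Tpm r Lc (V s) (%x. sc c \<odot>\<^sub>(V s) g s x) v"
  by (rule Tpm_cong[OF Lc(1) fg_V PA_lin[OF PA_smult_closed[OF c g]] _ v]) (simp add: PA_smult)
 then show ?thesis using Tpm_scalar[OF Lc(1) fg_V PA_lin[OF g] c v] by (simp add: Tp_Tp)
qed

lemma PA_mult_lin:
 assumes g: "g .: PA" and f: "f .: PA"
 shows "lin A Lc (V m) (%x. \<Oplus>\<^bsub>V m\<^esub>r \<in> {..m}. S r (m - r) g (f r x))"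
 by (rule lin_finsum_pt[OF fgD(1)[OF Lc(1)] Vl]) (auto intro: lin_comp[OF PA_lin[OF f] S_lin'[OF g]])

lemma PA_mult_cl: "g .: PA ==> f .: PA ==> g \<otimes>\<^sub>PA f .: PA"
 unfolding PA_mult by (rule PA_memI) (rule PA_mult_lin)

lemma PA_mult_val: "x .: Lc ==> (g \<otimes>\<^sub>PA f) m x = (\<Oplus>\<^bsub>V m\<^esub>r \<in> {..m}. S r (m - r) g (f r x))"
 by (simp add: PA_mult)

text \<open>Here \<open>\<tau>\<^sup>-\<^sup>r(\<tau>\<^sup>-\<^sup>s M) = \<tau>\<^sup>-\<^sup>(\<^sup>r\<^sup>+\<^sup>s\<^sup>) M\<close> is used on objects and on maps.\<close>

lemma S_mult:
 assumes h: "h .: PA" and g: "g .: PA" and v: "v .: (V r)"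
 shows "S r m (h \<otimes>\<^sub>PA g) v = (\<Oplus>\<^bsub>V (r + m)\<^esub>s \<in> {..m}. S (r + s) (m - s) h (S r s g v))"
proof -
 interpret V: left_module A "V k" for k by (rule Vl)
 have l: "lin A Lc (V m) (%x. S s (m - s) h (g s x))" if "s \<in> {..m}" for s
  using lin_comp[OF PA_lin[OF g] S_lin'[OF h]] that by simp
 have comp: "Tpm r Lc (V m) (%x. S s (m - s) h (g s x)) v = S (r + s) (m - s) h (S r s g v)" if s: "s \<in> {..m}" for s
 proof -
  have "Tpm r Lc (V m) (%x. S s (m - s) h (g s x)) v = Tpm r (V s) (V m) (S s (m - s) h) (S r s g v)"
   by (rule Tpm_comp[OF Lc(1) fg_V fg_V PA_lin[OF g] S_lin'[OF h] v, symmetric]) (use s in simp)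
  also have "Tpm r (V s) (V m) (S s (m - s) h) = Tpm r (V s) (Tp s (V (m - s))) (S s (m - s) h)"
   using V_shift[of s m] s by simp
  also have "... = S (r + s) (m - s) h" by (rule Tpm_Tpm)
  finally show ?thesis .
 qed
 have "S r m (h \<otimes>\<^sub>PA g) v = Tpm r Lc (V m) (%x. \<Oplus>\<^bsub>V m\<^esub>s \<in> {..m}. S s (m - s) h (g s x)) v"
  by (rule Tpm_cong[OF Lc(1) fg_V PA_lin[OF PA_mult_cl[OF h g]] PA_mult_val v])
 also have "... = (\<Oplus>\<^bsub>Tp r (V m)\<^esub>s \<in> {..m}. Tpm r Lc (V m) (%x. S s (m - s) h (g s x)) v)"
  by (rule Tpm_finsum[OF Lc(1) fg_V _ l v]) simp_all
 also have "... = (\<Oplus>\<^bsub>V (r + m)\<^esub>s \<in> {..m}. S (r + s) (m - s) h (S r s g v))"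
  unfolding Tp_Tp
 proof (rule V.M.finsum_cong')
  show "(%s. S (r + s) (m - s) h (S r s g v)) \<in> {..m} -> el (V (r + m))"
  proof (rule Pi_I)
   fix s assume "s \<in> {..m}"
   then have "r + s + (m - s) = r + m" by simp
   then show "S (r + s) (m - s) h (S r s g v) .: (V (r + m))"
    using lin_cl[OF S_lin[OF h, of "r + s" "m - s"] lin_cl[OF S_lin[OF g] v]] by simp
  qed
 qed (use comp in simp_all)
 finally show ?thesis .
qed

lemma triangle_sum:
 assumes "abelian_group G" "!!k r. r \<le> k ==> k \<le> m ==> f k r .: G"
 shows "(\<Oplus>\<^bsub>G\<^esub>k \<in> {..m::nat}. \<Oplus>\<^bsub>G\<^esub>r \<in> {..k}. f k r) = (\<Oplus>\<^bsub>G\<^esub>r \<in> {..m}. \<Oplus>\<^bsub>G\<^esub>s \<in> {..m - r}. f (r + s) r)"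
proof -
 interpret G: abelian_group G by fact
 let ?f = "%k r. if r \<le> k then f k r else \<zero>\<^sub>G"
 have row: "(\<Oplus>\<^bsub>G\<^esub>r \<in> {..k}. f k r) = (\<Oplus>\<^bsub>G\<^esub>r \<in> {..m}. ?f k r)" if "k \<in> {..m}" for k
  by (rule G.add.finprod_mono_neutral_cong) (use that assms(2) in auto)
 have "(\<Oplus>\<^bsub>G\<^esub>k \<in> {..m}. \<Oplus>\<^bsub>G\<^esub>r \<in> {..k}. f k r) = (\<Oplus>\<^bsub>G\<^esub>k \<in> {..m}. \<Oplus>\<^bsub>G\<^esub>r \<in> {..m}. ?f k r)"
 proof (rule G.finsum_cong')
  show "(%k. \<Oplus>\<^bsub>G\<^esub>r \<in> {..m}. ?f k r) \<in> {..m} -> el G"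
   using assms(2) by (auto intro!: G.finsum_closed)
 qed (simp, rule row)
 also have "... = (\<Oplus>\<^bsub>G\<^esub>r \<in> {..m}. \<Oplus>\<^bsub>G\<^esub>k \<in> {..m}. ?f k r)"
  by (rule G.finsum_swap) (use assms(2) in auto)
 also have "... = (\<Oplus>\<^bsub>G\<^esub>r \<in> {..m}. \<Oplus>\<^bsub>G\<^esub>s \<in> {..m - r}. f (r + s) r)"
 proof (rule G.finsum_cong')
  fix r assume "r \<in> {..m}"
  then have r: "r \<le> m" by simp
  have "k \<in> (+) r ` {..m - r}" if "k \<in> {r..m}" for k
   by (rule image_eqI[of _ _ "k - r"]) (use that in auto)
  then have im: "(+) r ` {..m - r} = {r..m}" using r by auto
  have "(\<Oplus>\<^bsub>G\<^esub>k \<in> {..m}. ?f k r) = (\<Oplus>\<^bsub>G\<^esub>k \<in> {r..m}. f k r)"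
   by (rule G.add.finprod_mono_neutral_cong) (use assms(2) in auto)
  also have "... = (\<Oplus>\<^bsub>G\<^esub>s \<in> {..m - r}. f (r + s) r)"
   unfolding im[symmetric] by (rule G.finsum_reindex) (use assms(2) r in "auto simp: inj_on_def")
  finally show "(\<Oplus>\<^bsub>G\<^esub>k \<in> {..m}. ?f k r) = (\<Oplus>\<^bsub>G\<^esub>s \<in> {..m - r}. f (r + s) r)" .
 qed (use assms(2) in "auto intro!: G.finsum_closed")
 finally show ?thesis .
qed

lemma PA_mult_assoc:
 assumes h: "h .: PA" and g: "g .: PA" and f: "f .: PA"
 shows "(h \<otimes>\<^sub>PA g) \<otimes>\<^sub>PA f = h \<otimes>\<^sub>PA (g \<otimes>\<^sub>PA f)"
proof (rule PA_eqI)
 note hg = PA_mult_cl[OF h g] and gf = PA_mult_cl[OF g f]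
 show "h \<otimes>\<^sub>PA g \<otimes>\<^sub>PA f .: PA" by (rule PA_mult_cl[OF hg f])
 show "h \<otimes>\<^sub>PA (g \<otimes>\<^sub>PA f) .: PA" by (rule PA_mult_cl[OF h gf])
 fix m
 interpret V: left_module A "V k" for k by (rule Vl)
 note fu = PA_val_cl[OF f]
 let ?f = "%k r. S k (m - k) h (S r (k - r) g (f r u))"
 have fc: "?f k r .: (V m)" if "r \<le> k" "k \<le> m" for k r
  by (rule lin_cl[OF S_lin'[OF h that(2)] lin_cl[OF S_lin'[OF g that(1)] fu]])
 have "(h \<otimes>\<^sub>PA (g \<otimes>\<^sub>PA f)) m u = (\<Oplus>\<^bsub>V m\<^esub>k \<in> {..m}. S k (m - k) h (\<Oplus>\<^bsub>V k\<^esub>r \<in> {..k}. S r (k - r) g (f r u)))"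
  unfolding PA_mult_val[OF u_closed] ..
 also have "... = (\<Oplus>\<^bsub>V m\<^esub>k \<in> {..m}. \<Oplus>\<^bsub>V m\<^esub>r \<in> {..k}. ?f k r)"
 proof (rule V.M.finsum_cong')
  fix k assume "k \<in> {..m}"
  then have k: "k \<le> m" by simp
  show "S k (m - k) h (\<Oplus>\<^bsub>V k\<^esub>r \<in> {..k}. S r (k - r) g (f r u)) = (\<Oplus>\<^bsub>V m\<^esub>r \<in> {..k}. ?f k r)"
   by (rule lin_finsum[OF V.ag V.ag S_lin'[OF h k]])
    (auto intro: lin_cl[OF S_lin'[OF g] fu])
 qed (use fc in "auto intro!: V.M.finsum_closed")
 also have "... = (\<Oplus>\<^bsub>V m\<^esub>r \<in> {..m}. \<Oplus>\<^bsub>V m\<^esub>s \<in> {..m - r}. ?f (r + s) r)"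
  by (rule triangle_sum[OF V.ag fc])
 also have "... = (\<Oplus>\<^bsub>V m\<^esub>r \<in> {..m}. S r (m - r) (h \<otimes>\<^sub>PA g) (f r u))"
 proof (rule V.M.finsum_cong')
  fix r assume "r \<in> {..m}"
  then have r: "r \<le> m" by simp
  show "(\<Oplus>\<^bsub>V m\<^esub>s \<in> {..m - r}. ?f (r + s) r) = S r (m - r) (h \<otimes>\<^sub>PA g) (f r u)"
   using S_mult[OF h g fu, of r "m - r"] r by simp
 qed (auto intro: lin_cl[OF S_lin'[OF hg] fu])
 also have "... = ((h \<otimes>\<^sub>PA g) \<otimes>\<^sub>PA f) m u" unfolding PA_mult_val[OF u_closed] ..
 finally show "(h \<otimes>\<^sub>PA g \<otimes>\<^sub>PA f) m u = (h \<otimes>\<^sub>PA (g \<otimes>\<^sub>PA f)) m u" ..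
qed

lemma PA_mult_lin_left:
 assumes f: "f .: PA" shows "lin F PA PA (%g. g \<otimes>\<^sub>PA f)"
proof (rule linI)
 interpret V: left_module A "V k" for k by (rule Vl)
 note fu = PA_val_cl[OF f]
 fix g assume g: "g .: PA"
 have Sc: "S r (m - r) g (f r u) .: (V m)" if "g .: PA" "r \<le> m" for g r m by (rule lin_cl[OF S_lin'[OF that] fu])
 show "g \<otimes>\<^sub>PA f .: PA" by (rule PA_mult_cl[OF g f])
 show "(g \<oplus>\<^sub>PA h) \<otimes>\<^sub>PA f = g \<otimes>\<^sub>PA f \<oplus>\<^sub>PA h \<otimes>\<^sub>PA f" if h: "h .: PA" for h
 proof (rule PA_eqI[OF PA_mult_cl[OF PA_add_closed[OF g h] f] PA_add_closed[OF PA_mult_cl[OF g f] PA_mult_cl[OF h f]]])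
  fix m
  have "((g \<oplus>\<^sub>PA h) \<otimes>\<^sub>PA f) m u = (\<Oplus>\<^bsub>V m\<^esub>r \<in> {..m}. S r (m - r) g (f r u) \<oplus>\<^sub>(V m) S r (m - r) h (f r u))"
   unfolding PA_mult_val[OF u_closed]
   using Sc[OF g] Sc[OF h] by (intro V.M.finsum_cong') (auto simp: S_add[OF g h fu])
  also have "... = (g \<otimes>\<^sub>PA f \<oplus>\<^sub>PA h \<otimes>\<^sub>PA f) m u"
   unfolding PA_val PA_mult_val[OF u_closed] using Sc[OF g] Sc[OF h] by (intro V.M.finsum_addf) auto
  finally show "((g \<oplus>\<^sub>PA h) \<otimes>\<^sub>PA f) m u = (g \<otimes>\<^sub>PA f \<oplus>\<^sub>PA h \<otimes>\<^sub>PA f) m u" .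
 qed
 show "(c \<odot>\<^sub>PA g) \<otimes>\<^sub>PA f = c \<odot>\<^sub>PA (g \<otimes>\<^sub>PA f)" if c: "c .: F" for c
 proof (rule PA_eqI[OF PA_mult_cl[OF PA_smult_closed[OF c g] f] PA_smult_closed[OF c PA_mult_cl[OF g f]]])
  fix m
  have "((c \<odot>\<^sub>PA g) \<otimes>\<^sub>PA f) m u = (\<Oplus>\<^bsub>V m\<^esub>r \<in> {..m}. sc c \<odot>\<^sub>(V m) S r (m - r) g (f r u))"
   unfolding PA_mult_val[OF u_closed]
   using Sc[OF g] scalar_closed[OF c] by (intro V.M.finsum_cong') (auto simp: S_scalar[OF g c fu])
  also have "... = sc c \<odot>\<^sub>(V m) (\<Oplus>\<^bsub>V m\<^esub>r \<in> {..m}. S r (m - r) g (f r u))"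
   using Sc[OF g] by (intro lin_finsum[OF V.ag V.ag lin_scalar[OF Vl c], symmetric]) auto
  finally show "((c \<odot>\<^sub>PA g) \<otimes>\<^sub>PA f) m u = (c \<odot>\<^sub>PA (g \<otimes>\<^sub>PA f)) m u"
   unfolding PA_val PA_mult_val[OF u_closed] .
 qed
qed

lemma PA_mult_lin_right:
 assumes g: "g .: PA" shows "lin F PA PA (%f. g \<otimes>\<^sub>PA f)"
proof (rule linI)
 interpret V: left_module A "V k" for k by (rule Vl)
 fix f assume f: "f .: PA"
 have Sc: "S r (m - r) g (f r u) .: (V m)" if "f .: PA" "r \<le> m" for f r m
  by (rule lin_cl[OF S_lin'[OF g that(2)] PA_val_cl[OF that(1)]])
 show "g \<otimes>\<^sub>PA f .: PA" by (rule PA_mult_cl[OF g f])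
 show "g \<otimes>\<^sub>PA (f \<oplus>\<^sub>PA h) = g \<otimes>\<^sub>PA f \<oplus>\<^sub>PA g \<otimes>\<^sub>PA h" if h: "h .: PA" for h
 proof (rule PA_eqI[OF PA_mult_cl[OF g PA_add_closed[OF f h]] PA_add_closed[OF PA_mult_cl[OF g f] PA_mult_cl[OF g h]]])
  fix m
  have "(g \<otimes>\<^sub>PA (f \<oplus>\<^sub>PA h)) m u = (\<Oplus>\<^bsub>V m\<^esub>r \<in> {..m}. S r (m - r) g (f r u) \<oplus>\<^sub>(V m) S r (m - r) g (h r u))"
   unfolding PA_mult_val[OF u_closed] PA_val
   using Sc[OF f] Sc[OF h] by (intro V.M.finsum_cong') (auto simp: lin_add[OF S_lin'[OF g] PA_val_cl[OF f] PA_val_cl[OF h]])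
  also have "... = (g \<otimes>\<^sub>PA f \<oplus>\<^sub>PA g \<otimes>\<^sub>PA h) m u"
   unfolding PA_val PA_mult_val[OF u_closed] using Sc[OF f] Sc[OF h] by (intro V.M.finsum_addf) auto
  finally show "(g \<otimes>\<^sub>PA (f \<oplus>\<^sub>PA h)) m u = (g \<otimes>\<^sub>PA f \<oplus>\<^sub>PA g \<otimes>\<^sub>PA h) m u" .
 qed
 show "g \<otimes>\<^sub>PA (c \<odot>\<^sub>PA f) = c \<odot>\<^sub>PA (g \<otimes>\<^sub>PA f)" if c: "c .: F" for c
 proof (rule PA_eqI[OF PA_mult_cl[OF g PA_smult_closed[OF c f]] PA_smult_closed[OF c PA_mult_cl[OF g f]]])
  fix m
  have "(g \<otimes>\<^sub>PA (c \<odot>\<^sub>PA f)) m u = (\<Oplus>\<^bsub>V m\<^esub>r \<in> {..m}. sc c \<odot>\<^sub>(V m) S r (m - r) g (f r u))"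
   unfolding PA_mult_val[OF u_closed] PA_val
   using Sc[OF f] scalar_closed[OF c] by (intro V.M.finsum_cong') (auto simp: lin_smult[OF S_lin'[OF g] scalar_closed[OF c] PA_val_cl[OF f]])
  also have "... = sc c \<odot>\<^sub>(V m) (\<Oplus>\<^bsub>V m\<^esub>r \<in> {..m}. S r (m - r) g (f r u))"
   using Sc[OF f] by (intro lin_finsum[OF V.ag V.ag lin_scalar[OF Vl c], symmetric]) auto
  finally show "(g \<otimes>\<^sub>PA (c \<odot>\<^sub>PA f)) m u = (c \<odot>\<^sub>PA (g \<otimes>\<^sub>PA f)) m u"
   unfolding PA_val PA_mult_val[OF u_closed] .
 qed
qed

lemma PA_mult_homog:
 assumes g: "g .: PA" and v: "v .: (V k)"
 shows "(g \<otimes>\<^sub>PA homog k v) m u = (if k \<le> m then S k (m - k) g v else \<zero>\<^sub>(V m))"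
proof -
 interpret V: left_module A "V l" for l by (rule Vl)
 have z: "S r (m - r) g \<zero>\<^sub>(V r) = \<zero>\<^sub>(V m)" if "r \<le> m" for r
  by (rule lin_zero[OF V.ag V.ag S_lin'[OF g that]])
 have "(g \<otimes>\<^sub>PA homog k v) m u = (\<Oplus>\<^bsub>V m\<^esub>r \<in> {..m}. if k = r then S r (m - r) g v else \<zero>\<^sub>(V m))"
  unfolding PA_mult_val[OF u_closed]
 proof (rule V.M.finsum_cong')
  show "(%r. if k = r then S r (m - r) g v else \<zero>\<^sub>(V m)) \<in> {..m} -> el (V m)"
  proof (rule Pi_I)
   fix r assume r: "r \<in> {..m}"
   show "(if k = r then S r (m - r) g v else \<zero>\<^sub>(V m)) .: (V m)"
   proof (cases "k = r")
    case True
    have "S r (m - r) g v .: (V m)"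
     by (rule lin_cl[OF S_lin'[OF g] v[unfolded True]]) (use r in simp)
    then show ?thesis using True by simp
   qed simp
  qed
  show "S r (m - r) g (homog k v r u) = (if k = r then S r (m - r) g v else \<zero>\<^sub>(V m))" if "r \<in> {..m}" for r
   using that z by (simp add: homog(2)[OF v])
 qed simp
 also have "... = (if k \<le> m then S k (m - k) g v else \<zero>\<^sub>(V m))"
 proof (cases "k \<le> m")
  case True
  have "(\<Oplus>\<^bsub>V m\<^esub>r \<in> {..m}. if k = r then S r (m - r) g v else \<zero>\<^sub>(V m)) =
    (\<Oplus>\<^bsub>V m\<^esub>r \<in> {..m}. if k = r then S k (m - k) g v else \<zero>\<^sub>(V m))"
   using lin_cl[OF S_lin'[OF g True] v] by (intro V.M.finsum_cong') auto
  also have "... = S k (m - k) g v"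
   by (rule V.M.finsum_singleton) (use True lin_cl[OF S_lin'[OF g True] v] in auto)
  finally show ?thesis using True by simp
 next
  case False
  then have "(\<Oplus>\<^bsub>V m\<^esub>r \<in> {..m}. if k = r then S r (m - r) g v else \<zero>\<^sub>(V m)) = (\<Oplus>\<^bsub>V m\<^esub>r \<in> {..m}. \<zero>\<^sub>(V m))"
   by (intro V.M.finsum_cong') auto
  then show ?thesis using False by simp
 qed
 finally show ?thesis .
qed

end

section \<open>The Frobenius form\<close>

lemma mod_homI:
 assumes "h \<in> el M \<rightarrow>\<^sub>E el N"
  "!!x y. x .: M ==> y .: M ==> h (x \<oplus>\<^sub>M y) = h x \<oplus>\<^sub>N h y"
  "!!a x. a .: R ==> x .: M ==> h (a \<odot>\<^sub>M x) = a \<odot>\<^sub>N h x"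
 shows "h \<in> mod_hom R M N"
 using assms by (simp add: mod_hom_def)

context basic_hereditary_algebra
begin

text \<open>The nonzero injective modules among the \<open>X r i\<close>.\<close>

definition inj_idx :: "(nat \<times> nat) set"
 where "inj_idx = {(r, i). r < R & i < n & injmod A (X r i) & el (X r i) ~= {\<zero>\<^sub>(X r i)}}"

definition soc :: "nat => nat => (nat => 'a) set => 'f"
 where "soc r i = (SOME ph. lin F (rs A (X r i)) (regular_module F) ph &
  (\<forall>U. submodule U A (X r i) --> (\<exists>u \<in> U. u ~= \<zero>\<^sub>(X r i)) --> (\<exists>u \<in> U. ph u ~= \<zero>\<^sub>F)))"

definition comp :: "nat => nat => (nat => (nat => 'a) set => (nat => 'a) set) => (nat => 'a) set"
 where "comp r i g = be r i (g r u)"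

definition \<Phi> :: "(nat => (nat => 'a) set => (nat => 'a) set) => 'f"
 where "\<Phi> g = (\<Oplus>\<^bsub>regular_module F\<^esub>sg \<in> inj_idx. soc (fst sg) (snd sg) (comp (fst sg) (snd sg) g))"

lemma finite_inj_idx: "finite inj_idx"
 by (rule finite_subset[of _ "{..<R} \<times> {..<n}"]) (auto simp: inj_idx_def)

lemma soc:
 assumes "(r, i) \<in> inj_idx"
 shows "lin F (rs A (X r i)) (regular_module F) (soc r i)"
  "!!U x. submodule U A (X r i) ==> x \<in> U ==> x ~= \<zero>\<^sub>(X r i) ==> \<exists>x \<in> U. soc r i x ~= \<zero>\<^sub>F"
proof -
 have i: "i < n" "injmod A (X r i)" "el (X r i) ~= {\<zero>\<^sub>(X r i)}" using assms by (auto simp: inj_idx_def)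
 note * = someI_ex[OF socle_functional[OF fg_X[OF i(1)] X_indecomposable[OF i(1,3)] i(2)], folded soc_def]
 show "lin F (rs A (X r i)) (regular_module F) (soc r i)" by (rule conjunct1[OF *])
 show "\<exists>x \<in> U. soc r i x ~= \<zero>\<^sub>F" if "submodule U A (X r i)" "x \<in> U" "x ~= \<zero>\<^sub>(X r i)" for U x
  using conjunct2[OF *, rule_format, OF that(1)] that(2,3) by blast
qed

lemma comp_lin: "i < n ==> lin F PA (rs A (X r i)) (comp r i)"
 unfolding comp_def by (rule lin_comp[OF PA_val_lin lin_rs[OF be_lin]])

lemma comp_closed: "i < n ==> g .: PA ==> comp r i g .: (X r i)"
 unfolding comp_def by (rule lin_cl[OF be_lin PA_val_cl])

lemma lm_RF: "lmod F (regular_module F)"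
 by (rule lm_regular[OF ringF])

lemma \<Phi>_lin: "lin F PA (regular_module F) \<Phi>"
 unfolding \<Phi>_def
proof (rule lin_finsum_pt[OF lm_PA lm_RF _ finite_inj_idx])
 fix sg assume s: "sg \<in> inj_idx"
 then have "(fst sg, snd sg) \<in> inj_idx" "snd sg < n" by (auto simp: inj_idx_def)
 then show "lin F PA (regular_module F) (%g. soc (fst sg) (snd sg) (comp (fst sg) (snd sg) g))"
  by (intro lin_comp[OF comp_lin soc(1)])
qed

lemma PA_nonzero_comp:
 assumes g: "g .: PA" "g ~= \<zero>\<^sub>PA"
 shows "\<exists>r i. r < R & i < n & comp r i g ~= \<zero>\<^sub>(X r i)"
proof (rule ccontr)
 assume z: "~ ?thesis"
 have "g r u = \<zero>\<^sub>PA r u" for r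
 proof (cases "r < R")
  case True
  then show ?thesis unfolding PA_val using z be_zero_imp_zero[OF PA_val_cl[OF g(1)], of r] by (auto simp: comp_def)
 next
  case False
  then show ?thesis unfolding PA_val using V_zero[OF _ PA_val_cl[OF g(1)], of r] by simp
 qed
 then show False using PA_eqI[OF g(1) PA_zero_closed] g(2) by blast
qed

definition Rad :: "(nat => (nat => 'a) set => (nat => 'a) set) set"
 where "Rad = {g \<in> el PA. \<forall>f \<in> el PA. \<Phi> (g \<otimes>\<^sub>PA f) = \<zero>\<^sub>F}"

lemma Rad_mult: "g \<in> Rad ==> f .: PA ==> g \<otimes>\<^sub>PA f \<in> Rad"
 by (simp add: Rad_def PA_mult_cl PA_mult_assoc)

text \<open>By \<open>mult_degree_one\<close> this says that \<open>g\<close> is annihilated by the elements of degree one.\<close>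

definition killed :: "(nat => (nat => 'a) set => (nat => 'a) set) => bool"
 where "killed g <-> (\<forall>m. \<forall>e \<in> el E. pure (V m) e (g m u) = \<zero>\<^bsub>T (V m)\<^esub>)"

text \<open>Right multiplication by an element of degree one shifts the values and tensors them with \<open>e\<close>.\<close>

lemma mult_degree_one:
 assumes g: "g .: PA" and e: "e .: E"
 shows "(g \<otimes>\<^sub>PA homog 1 (pure Lc e u)) (Suc m) u = pure (V m) e (g m u)"
  "(g \<otimes>\<^sub>PA homog 1 (pure Lc e u)) 0 u = \<zero>\<^sub>(V 0)"
proof -
 have v: "pure Lc e u .: (V 1)" using pure_closed[OF Lc(1) e u_closed] by simp
 show "(g \<otimes>\<^sub>PA homog 1 (pure Lc e u)) (Suc m) u = pure (V m) e (g m u)"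
  unfolding PA_mult_homog[OF g v] using Tm_pure[OF Lc(1) fg_V PA_lin[OF g] e u_closed] by simp
 show "(g \<otimes>\<^sub>PA homog 1 (pure Lc e u)) 0 u = \<zero>\<^sub>(V 0)"
  unfolding PA_mult_homog[OF g v] by simp
qed

text \<open>Take \<open>g\<close> whose lowest nonzero degree is as large as possible; multiplying by an element of degree one raises that degree, so the product is zero.\<close>

lemma Rad_killed:
 assumes g: "g \<in> Rad" "g ~= \<zero>\<^sub>PA"
 shows "\<exists>g \<in> Rad. g ~= \<zero>\<^sub>PA & killed g"
proof -
 define P where "P k <-> (\<exists>g \<in> Rad. g ~= \<zero>\<^sub>PA & (\<forall>m<k. g m u = \<zero>\<^sub>(V m)))" for k
 have RadPA: "g .: PA" if "g \<in> Rad" for g using that by (simp add: Rad_def)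
 have P0: "P 0" unfolding P_def using g by (intro bexI[of _ g]) simp_all
 have bound: "\<forall>k. P k --> k < Suc R"
 proof (intro allI impI, rule ccontr)
  fix k assume Pk: "P k" and k: "~ k < Suc R"
  obtain g where g: "g \<in> Rad" "g ~= \<zero>\<^sub>PA" "\<forall>m<k. g m u = \<zero>\<^sub>(V m)" using Pk unfolding P_def by blast
  have "g m u = \<zero>\<^sub>PA m u" for m
   unfolding PA_val using g(3) k V_zero[OF _ PA_val_cl[OF RadPA[OF g(1)]], of m] by (cases "m < k") auto
  then show False using PA_eqI[OF RadPA[OF g(1)] PA_zero_closed] g(2) by blast
 qed
 \<comment> \<open>Degrees are bounded by \<open>R\<close>, so a maximal \<open>k\<close> exists.\<close>
 from ex_has_greatest_nat[of P 0 "%k. k", OF P0 bound]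
 obtain k where k: "P k" "\<forall>l. P l --> l \<le> k" by (elim exE conjE)
 obtain g where g: "g \<in> Rad" "g ~= \<zero>\<^sub>PA" "\<forall>m<k. g m u = \<zero>\<^sub>(V m)" using k(1) unfolding P_def by blast
 note gP = RadPA[OF g(1)]
 have "pure (V m) e (g m u) = \<zero>\<^bsub>T (V m)\<^esub>" if e: "e .: E" for m e
 proof -
  let ?f = "homog 1 (pure Lc e u)"
  have f: "?f .: PA" by (rule homog(1)) (use pure_closed[OF Lc(1) e u_closed] in simp)
  have "(g \<otimes>\<^sub>PA ?f) m u = \<zero>\<^sub>(V m)" if m: "m < Suc k" for m
  proof (cases m)
   case 0
   then show ?thesis using mult_degree_one(2)[OF gP e] by simp
  next
   case (Suc l)
   then show ?thesis using mult_degree_one(1)[OF gP e, of l] g(3) m pure_zero_right[OF fg_V e] by simp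
  qed
  then have "g \<otimes>\<^sub>PA ?f ~= \<zero>\<^sub>PA ==> P (Suc k)"
   unfolding P_def using Rad_mult[OF g(1) f] by (intro bexI[of _ "g \<otimes>\<^sub>PA ?f"]) simp_all
  then have "g \<otimes>\<^sub>PA ?f = \<zero>\<^sub>PA" using k(2)[rule_format, of "Suc k"] by fastforce
  then show ?thesis using mult_degree_one(1)[OF gP e, of m] PA_val(2)[of "Suc m"] by simp
 qed
 then show ?thesis using g(1,2) by (auto simp: killed_def)
qed

lemma mult_degree_zero:
 assumes g: "g .: PA" and c: "c .: A"
 shows "(g \<otimes>\<^sub>PA homog 0 (c \<odot>\<^sub>Lc u)) m u = c \<odot>\<^sub>(V m) g m u"
proof -
 interpret Lc: left_module A Lc by (rule fgD(1)[OF Lc(1)])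
 have v: "c \<odot>\<^sub>Lc u .: (V 0)" using c u_closed by simp
 show ?thesis unfolding PA_mult_homog[OF g v] using lin_smult[OF PA_lin[OF g] c u_closed] by simp
qed

lemma degree_zero_closed: "c .: A ==> homog 0 (c \<odot>\<^sub>Lc u) .: PA"
 by (rule homog(1)) (simp add: left_module.smult_closed[OF fgD(1)[OF Lc(1)]] u_closed)

lemma comp_degree_zero:
 assumes g: "g .: PA" and c: "c .: A" and i: "i < n"
 shows "comp r i (g \<otimes>\<^sub>PA homog 0 (c \<odot>\<^sub>Lc u)) = c \<odot>\<^sub>(X r i) comp r i g"
 unfolding comp_def mult_degree_zero[OF g c] by (rule lin_smult[OF be_lin[OF i] c PA_val_cl[OF g]])

lemma killed_degree_zero:
 assumes g: "g .: PA" "killed g" and c: "c .: A"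
 shows "killed (g \<otimes>\<^sub>PA homog 0 (c \<odot>\<^sub>Lc u))"
 unfolding killed_def mult_degree_zero[OF g(1) c]
proof (intro allI ballI)
 fix m e assume e: "e .: E"
 have "pure (V m) e (c \<odot>\<^sub>(V m) g m u) = pure (V m) (rsmult E e c) (g m u)"
  by (rule pure_balanced[OF fg_V e c PA_val_cl[OF g(1)], symmetric])
 then show "pure (V m) e (c \<odot>\<^sub>(V m) g m u) = \<zero>\<^bsub>T (V m)\<^esub>"
  using g(2) bimodD(2)[OF bimod_E e c] by (simp add: killed_def)
qed

lemma killed_comp_idx:
 assumes g: "g .: PA" "killed g" and ri: "r < R" "i < n" and nz: "comp r i g ~= \<zero>\<^sub>(X r i)"
 shows "(r, i) \<in> inj_idx"
proof -
 interpret TV: left_module A "T (V r)" by (rule fgD(1)[OF fg_T[OF fg_V]])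
 interpret TX: left_module A "T (X r i)" by (rule fgD(1)[OF fg_T[OF fg_X[OF ri(2)]]])
 note c = comp_closed[OF ri(2) g(1), of r]
 have X0: "el (X r i) ~= {\<zero>\<^sub>(X r i)}" using c nz by auto
 have "pure (X r i) e (comp r i g) = \<zero>\<^bsub>T (X r i)\<^esub>" if e: "e .: E" for e
 proof -
  have "pure (X r i) e (comp r i g) = Tm (V r) (X r i) (be r i) (pure (V r) e (g r u))"
   unfolding comp_def by (rule Tm_pure[OF fg_V fg_X[OF ri(2)] be_lin[OF ri(2)] e PA_val_cl[OF g(1)], symmetric])
  also have "pure (V r) e (g r u) = \<zero>\<^bsub>T (V r)\<^esub>" using g(2) e by (simp add: killed_def)
  also have "Tm (V r) (X r i) (be r i) \<zero>\<^bsub>T (V r)\<^esub> = \<zero>\<^bsub>T (X r i)\<^esub>"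
   by (rule lin_zero[OF TV.ag TX.ag Tm_lin[OF fg_V fg_X[OF ri(2)] be_lin[OF ri(2)]]])
  finally show ?thesis .
 qed
 then have "injmod A (X r i)"
  by (rule pure_zero_imp_injective[OF fg_X[OF ri(2)] X_indecomposable[OF ri(2) X0] c nz])
 then show ?thesis using ri X0 by (simp add: inj_idx_def)
qed

text \<open>Take \<open>g\<close> with the fewest nonzero components.  If \<open>c\<close> annihilates one of them, then \<open>g c\<close> has fewer, so it is zero and \<open>c\<close> annihilates all of them.\<close>

theorem Rad_zero:
 assumes "g \<in> Rad" shows "g = \<zero>\<^sub>PA"
proof (rule ccontr)
 assume "g ~= \<zero>\<^sub>PA"
 from Rad_killed[OF assms this]
 have ex: "\<exists>g. g \<in> Rad & g ~= \<zero>\<^sub>PA & killed g" by blast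
 define supp where "supp g = {(r, i). r < R & i < n & comp r i g ~= \<zero>\<^sub>(X r i)}" for g
 have fin: "finite (supp g)" for g
  by (rule finite_subset[of _ "{..<R} \<times> {..<n}"]) (auto simp: supp_def)
 obtain g where g: "g \<in> Rad" "g ~= \<zero>\<^sub>PA" "killed g"
  and least: "!!h. h \<in> Rad ==> h ~= \<zero>\<^sub>PA ==> killed h ==> card (supp g) \<le> card (supp h)"
  using ex_has_least_nat[of "%g. g \<in> Rad & g ~= \<zero>\<^sub>PA & killed g" _ "%g. card (supp g)"] ex by metis
 have gP: "g .: PA" using g(1) by (simp add: Rad_def)
 obtain r i where ri: "r < R" "i < n" "comp r i g ~= \<zero>\<^sub>(X r i)" using PA_nonzero_comp[OF gP g(2)] by blast
 note idx = killed_comp_idx[OF gP g(3)]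
 have ann: "c \<odot>\<^sub>(X s j) comp s j g = \<zero>\<^sub>(X s j)"
  if c: "c .: A" and rs: "(r, i) \<in> supp g" "(s, j) \<in> supp g" and z: "c \<odot>\<^sub>(X r i) comp r i g = \<zero>\<^sub>(X r i)"
  for c r i s j
 proof -
  let ?g = "g \<otimes>\<^sub>PA homog 0 (c \<odot>\<^sub>Lc u)"
  have ij: "i < n" "j < n" using rs by (auto simp: supp_def)
  have sub: "supp ?g <= supp g"
  proof
   fix sg assume "sg \<in> supp ?g"
   then obtain r' i' where s: "sg = (r', i')" "r' < R" "i' < n" "comp r' i' ?g ~= \<zero>\<^sub>(X r' i')" by (auto simp: supp_def)
   have "comp r' i' g ~= \<zero>\<^sub>(X r' i')"
   proof
    assume "comp r' i' g = \<zero>\<^sub>(X r' i')"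
    then show False
     using s(4) comp_degree_zero[OF gP c s(3), of r'] left_module.smult_r_null[OF Xl[OF s(3), of r'] c] by simp
   qed
   then show "sg \<in> supp g" using s by (simp add: supp_def)
  qed
  moreover have "(r, i) \<notin> supp ?g" using z comp_degree_zero[OF gP c ij(1), of r] by (simp add: supp_def)
  ultimately have "supp ?g \<subset> supp g" using rs(1) by blast
  then have "card (supp ?g) < card (supp g)" by (rule psubset_card_mono[OF fin])
  then have "?g = \<zero>\<^sub>PA"
   using least[OF Rad_mult[OF g(1) degree_zero_closed[OF c]] _ killed_degree_zero[OF gP g(3) c]] by fastforce
  then have "comp s j ?g = \<zero>\<^sub>(X s j)"
   using lin_zero[OF left_module.axioms(2)[OF lm_PA] left_module.axioms(2)[OF lm_rs[OF Xl[OF ij(2)]]] comp_lin[OF ij(2)]]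
   by (simp add: rs_def)
  then show ?thesis unfolding comp_degree_zero[OF gP c ij(2)] .
 qed
 have risupp: "(r, i) \<in> supp g" using ri by (simp add: supp_def)
 have single: "(s, j) = (r, i)" if sj: "(s, j) \<in> supp g" for s j
 proof -
  have s: "s < R" "j < n" "comp s j g ~= \<zero>\<^sub>(X s j)" using sj by (auto simp: supp_def)
  have I: "(r, i) \<in> inj_idx" "(s, j) \<in> inj_idx" using idx ri s by blast+
  then have X: "injmod A (X r i)" "el (X r i) ~= {\<zero>\<^sub>(X r i)}" "injmod A (X s j)" "el (X s j) ~= {\<zero>\<^sub>(X s j)}"
   by (auto simp: inj_idx_def)
  have "isomorphic A (X r i) (X s j)"
   by (rule injective_isomorphic_of_cyclic[OF fg_X[OF ri(2)] X_indecomposable[OF ri(2) X(2)] X(1) fg_X[OF s(2)]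
      X_indecomposable[OF s(2) X(4)] X(3) comp_closed[OF ri(2) gP] ri(3) comp_closed[OF s(2) gP]])
    (use ann[OF _ risupp sj] ann[OF _ sj risupp] in blast)
  from X_isomorphic_imp_eq[OF ri(2) s(2) X(2) this] show ?thesis by simp
 qed
 have riI: "(r, i) \<in> inj_idx" using idx ri by blast
 interpret X: left_module A "X r i" by (rule Xl[OF ri(2)])
 note c = comp_closed[OF ri(2) gP, of r]
 let ?U = "act (X r i) (comp r i g) ` el L"
 have U: "submodule ?U A (X r i)"
  by (rule submodule_image[OF lm_L Xl[OF ri(2)] act_lin[OF Xl[OF ri(2)] c] submodule_carrier[OF lm_L]])
 have "comp r i g \<in> ?U"
  by (rule image_eqI[of _ _ "\<one>\<^sub>A"]) (simp_all add: act_def X.smult_one[OF c])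
 from soc(2)[OF riI U this ri(3)]
 obtain a where a: "a .: A" "soc r i (a \<odot>\<^sub>(X r i) comp r i g) ~= \<zero>\<^sub>F" by (auto simp: act_def)
 let ?f = "homog 0 (a \<odot>\<^sub>Lc u)"
 interpret RF: left_module F "regular_module F" by (rule lm_RF)
 have summand: "soc s j (comp s j (g \<otimes>\<^sub>PA ?f)) = (if (r, i) = (s, j) then soc r i (a \<odot>\<^sub>(X r i) comp r i g) else \<zero>\<^sub>F)"
  if sj: "(s, j) \<in> inj_idx" for s j
 proof -
  have s: "s < R" "j < n" using sj by (auto simp: inj_idx_def)
  show ?thesis
  proof (cases "(r, i) = (s, j)")
   case True
   then show ?thesis using comp_degree_zero[OF gP a(1) ri(2), of r] by auto
  next
   case False
   then have "comp s j g = \<zero>\<^sub>(X s j)" using single s by (auto simp: supp_def)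
   then have "comp s j (g \<otimes>\<^sub>PA ?f) = \<zero>\<^sub>(X s j)"
    using comp_degree_zero[OF gP a(1) s(2), of s] left_module.smult_r_null[OF Xl[OF s(2), of s] a(1)] by simp
   then have "soc s j (comp s j (g \<otimes>\<^sub>PA ?f)) = \<zero>\<^sub>F"
    using lin_zero[OF left_module.axioms(2)[OF lm_rs[OF Xl[OF s(2)]]] RF.ag soc(1)[OF sj]]
    by (simp add: rs_def)
   then show ?thesis by (simp only: False if_False)
  qed
 qed
 have ac: "soc r i (a \<odot>\<^sub>(X r i) comp r i g) .: F"
  using lin_cl[OF soc(1)[OF riI], of "a \<odot>\<^sub>(X r i) comp r i g"] X.smult_closed[OF a(1) c] by (simp add: rs_def)
 have "\<Phi> (g \<otimes>\<^sub>PA ?f) = (\<Oplus>\<^bsub>regular_module F\<^esub>sg \<in> inj_idx. if (r, i) = sg then soc r i (a \<odot>\<^sub>(X r i) comp r i g) else \<zero>\<^sub>(regular_module F))"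
  unfolding \<Phi>_def
 proof (rule RF.M.finsum_cong')
  fix sg assume "sg \<in> inj_idx"
  then show "soc (fst sg) (snd sg) (comp (fst sg) (snd sg) (g \<otimes>\<^sub>PA ?f)) =
    (if (r, i) = sg then soc r i (a \<odot>\<^sub>(X r i) comp r i g) else \<zero>\<^sub>(regular_module F))"
   using summand[of "fst sg" "snd sg"] by simp
 qed (use ac in auto)
 also have "... = soc r i (a \<odot>\<^sub>(X r i) comp r i g)"
  by (rule RF.M.finsum_singleton[OF riI finite_inj_idx]) (use ac in auto)
 finally show False using a(2) g(1) degree_zero_closed[OF a(1)] by (simp add: Rad_def)
qed

text \<open>One application of representability turns nondegeneracy on the left into nondegeneracy on the right, a second one makes \<open>H\<close> surjective.\<close>

theorem frobenius: "frobenius_algebra F PA"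
proof -
 let ?F = "regular_module F"
 interpret PA: left_module F PA by (rule lm_PA)
 interpret RF: left_module F ?F by (rule lm_RF)
 define B where "B x y = \<Phi> (x \<otimes>\<^sub>PA y)" for x y
 have B1: "lin F PA ?F (%x. B x y)" if "y .: PA" for y
  unfolding B_def by (rule lin_comp[OF PA_mult_lin_left[OF that] \<Phi>_lin])
 have B2: "lin F PA ?F (B x)" if "x .: PA" for x
  unfolding B_def by (rule lin_comp[OF PA_mult_lin_right[OF that] \<Phi>_lin])
 note rep = nondegenerate_form_represents[OF fieldF lm_PA fin_gen_PA]
 have left: "\<exists>x \<in> el PA. \<forall>y \<in> el PA. B x y = l y" if "lin F PA ?F l" for l
  by (rule rep[OF B1 B2 _ that]) (use Rad_zero in "auto simp: Rad_def B_def")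
 have nd: "y = \<zero>\<^sub>PA" if y: "y .: PA" and z: "!!x. x .: PA ==> B x y = \<zero>\<^sub>F" for y
 proof (rule functionals_separate[OF fieldF lm_PA fin_gen_PA y])
  fix l assume "lin F PA ?F l"
  from left[OF this] show "l y = \<zero>\<^sub>F" using z y by force
 qed
 have right: "\<exists>y \<in> el PA. \<forall>x \<in> el PA. B x y = l x" if "lin F PA ?F l" for l
  by (rule rep[of "%y x. B x y", OF B2 B1 nd that])
 define H where "H = (\<lambda>y \<in> el PA. \<lambda>x \<in> el PA. B x y)"
 have D: "el (dual_module F PA) = mod_hom F PA ?F"
  "add (dual_module F PA) = (%ph ps. \<lambda>x \<in> el PA. ph x \<oplus>\<^sub>F ps x)"
  "smult (dual_module F PA) = (%a ph. \<lambda>x \<in> el PA. ph (x \<otimes>\<^sub>PA a))"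
  by (simp_all add: dual_module_def)
 have reg: "el (regular_module PA) = el PA" "add (regular_module PA) = add PA" "smult (regular_module PA) = monoid.mult PA"
  by (simp_all add: regular_module_def)
 have Hc: "H y \<in> mod_hom F PA ?F" if "y .: PA" for y
  using restrict_mod_hom[OF lm_PA B1[OF that]] that by (simp add: H_def)
 have "H \<in> mod_hom PA (regular_module PA) (dual_module F PA)"
 proof (rule mod_homI)
  show "H \<in> el (regular_module PA) \<rightarrow>\<^sub>E el (dual_module F PA)" unfolding reg D using Hc by (auto simp: H_def)
 next
  fix y z assume "y .: (regular_module PA)" "z .: (regular_module PA)"
  then have y: "y .: PA" and z: "z .: PA" by (simp_all add: reg)
  show "H (y \<oplus>\<^sub>(regular_module PA) z) = H y \<oplus>\<^sub>(dual_module F PA) H z"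
   unfolding reg D using lin_add[OF B2 y z] y z PA_add_closed[OF y z] by (auto simp: H_def intro!: restrict_ext)
 next
  fix y z assume "y .: PA" "z .: (regular_module PA)"
  then have y: "y .: PA" and z: "z .: PA" by (simp_all add: reg)
  show "H (y \<odot>\<^sub>(regular_module PA) z) = y \<odot>\<^sub>(dual_module F PA) H z"
   unfolding reg D using y z PA_mult_cl by (auto simp: H_def B_def PA_mult_assoc intro!: restrict_ext)
 qed
 moreover have "bij_betw H (el (regular_module PA)) (el (dual_module F PA))"
  unfolding reg D bij_betw_def
 proof
  show "inj_on H (el PA)"
  proof (rule inj_onI)
   fix y z assume y: "y .: PA" and z: "z .: PA" and eq: "H y = H z"
   have "y \<ominus>\<^sub>PA z = \<zero>\<^sub>PA"
   proof (rule nd[OF PA.M.minus_closed[OF y z]])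
    fix x assume x: "x .: PA"
    have "B x y = B x z" using fun_cong[OF eq, of x] x y z by (simp add: H_def)
    then show "B x (y \<ominus>\<^sub>PA z) = \<zero>\<^sub>F"
     using lin_diff[OF PA.ag RF.ag B2[OF x] y z]
      RF.M.diff_eq_zero lin_cl[OF B2[OF x] z] by simp
   qed
   then show "y = z" using PA.M.diff_eq_zero[OF y z] by simp
  qed
  show "H ` el PA = mod_hom F PA ?F"
  proof
   show "H ` el PA <= mod_hom F PA ?F" using Hc by blast
   show "mod_hom F PA ?F <= H ` el PA"
   proof
    fix l assume l: "l \<in> mod_hom F PA ?F"
    obtain y where y: "y .: PA" "\<forall>x \<in> el PA. B x y = l x" using right[OF mod_hom_lin[OF l]] by blast
    have "l = H y"
     by (rule extensionalityI[of _ "el PA"]) (use l y in "auto simp: H_def mod_hom_iff")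
    then show "l \<in> H ` el PA" using y(1) by blast
   qed
  qed
 qed
 ultimately show ?thesis unfolding frobenius_algebra_def isomorphic_def mod_iso_def by blast
qed

end

theorem theorem3p1:
  fixes F :: "'f ring" and \<Lambda> :: "('f, 'a) module"
  assumes "fin_dim_algebra F \<Lambda>"
    and "hereditary \<Lambda>"
    and "basic_ring \<Lambda>"
    and "rep_finite \<Lambda>"
  shows "frobenius_algebra F (preprojective_algebra F \<Lambda>)"
proof -
  interpret hereditary_algebra F \<Lambda>
    by (rule hereditary_algebra.intro[OF assms(1)]) (unfold_locales, rule assms(2))
  obtain n Q a b where "basic_hereditary_algebra F \<Lambda> n Q a b" by (rule basic_decomposition[OF assms(3,4)])
  then show ?thesis by (rule basic_hereditary_algebra.frobenius)
qed

end
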